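(* Let $L$ and $\{i<j<k\}$ be disjoint subsets of $[n]$. (1) $\dim\operatorname{ext}^1(M_{Lj},M_{Lik})=1$. (2) There are short exact sequences $$0\to M_{Lik}\to M_{Li}\oplus M_{Ljk}\to M_{Lj}\to0,\qquad 0\to M_{Lj}\to M_{Lij}\oplus M_{Lk}\to M_{Lik}\to0.$$ (3) Let $\mathsf J\subseteq[n-1]$ be an interval. For any cluster tilting object $T_{\mathcal S}$ in $\mathcal F_\Delta(\mathsf J)$ that has $M_{Li},M_{Lk},M_{Lij},M_{Ljk}$ and one of $M_{Lj},M_{Lik}$ as summands, the sequences in (2) are the mutation sequences for the pair $M_{Lj}$ and $M_{Lik}$.
   Context: Fix an integer $n>1$; $[m]=\{1,\dots,m\}$. $Lx=L\cup\{x\}$, $Lxy=L\cup\{x,y\}$. All modules are finite dimensional left modules. $D$ is the Auslander algebra of $\mathbb C[t]/(t^n)$: the path algebra over $\mathbb C$ of the quiver with vertices $0,\dots,n-1$ and arrows $b_i\colon i-1\to i$, $a_i\colon i\to i-1$ ($1\le i\le n-1$), with relations $b_{n-1}a_{n-1}=0$ (first $a_{n-1}$, then $b_{n-1}$) and $a_ib_i=b_{i-1}a_{i-1}$ for $2\le i\le n-1$. $e_i$ is the trivial path at $i$, $D_i=De_i$. The standard module $\Delta_i$ ($1\le i\le n$) is one-dimensional at vertices $0,\dots,i-1$ and zero elsewhere, with $a_1,\dots,a_{i-1}$ acting as isomorphisms and all $b_j$ as zero. $\mathcal F_\Delta\subseteq\operatorname{mod}D$ is the full subcategory of modules with a filtration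 by standard modules; the $\Delta$-support of such a module is the set of $i$ with $\Delta_i$ occurring in the filtration. For $I\subseteq[n]$, $M_I$ is the unique submodule of $D_0$ with $\Delta$-support $I$. $\mathbb T_i=M_{[i]}$; $\eta M=De_0M$ for $M\in\mathcal F_\Delta$ (the trace of $\bigoplus_{i=1}^n\mathbb T_i$). $\mathcal E$ denotes the exact structure of short exact sequences of objects of $\mathcal F_\Delta$ that stay exact under $\eta$, and $\operatorname{ext}^1$ the corresponding extension groups. For $\mathsf J\subseteq[n-1]$, $\mathcal F_\Delta(\mathsf J)$ is the full subcategory of $M\in\mathcal F_\Delta$ with $\eta M\in\operatorname{add}\bigoplus_{j\in\mathsf J}\mathbb T_j$, with exact structure $\mathcal E$; it is Frobenius stably 2-Calabi–Yau with a cluster structure. A basic object $T\in\mathcal F_\Delta(\mathsf J)$ is cluster tilting if it is rigid and $\operatorname{ext}^1(T,M)=0$ implies $M\in\operatorname{add}T$. For a non-projective indecomposable summand $T_l$, the mutation sequences for the pair $T_l,T_l^*$ are the sequences $0\to T_l^*\to E_l\xrightarrow{f}T_l\to0$ and $0\to T_l\xrightarrow{g}F_l\to T_l^*\to0$ in $\mathcal E$ with $f,g$ minimal $\operatorname{add}(T\setminus T_l)$-approximations and $T_l^*$ indecomposable. For a maximal weakly separated collection $\mathcal S$ of $\mathsf J$-sets (subsets $I\subseteq[n]$ with $|I|\in\mathsf J$), $T_{\mathcal S}=\bigoplus_{I\in\mathcal S}M_I$. Here $I,J$ are weakly separated if (i) $|I|\ge|J|$ and $J\setminus I$ is a disjoint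 union $J'\cup J''$ with $J'<(I\setminus J)<J''$ or (ii) $|J|\ge|I|$ and $I\setminus J$ is a disjoint union $I'\cup I''$ with $I'<(J\setminus I)<I''$, where $A<B$ means $a<b$ for all $a\in A,b\in B$. *)

theory Defs
  imports "Jordan_Normal_Form.VS_Connect"
begin

section \<open>Modules over the Auslander algebra of C[t]/(t^n)\<close>

text \<open>
  A finite dimensional left \<open>D\<close>-module is given as a representation of the bound quiver: vertex
  \<open>i < n\<close> carries the space \<open>carrier_vec (vdim X i)\<close>, and for \<open>1 \<le> i < n\<close> the arrow
  \<open>a_i : i \<rightarrow> i - 1\<close> acts by \<open>amap X i\<close>, the arrow \<open>b_i : i - 1 \<rightarrow> i\<close> by \<open>bmap X i\<close>.
  Values outside these index ranges are junk and are never inspected; in particular two families of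
  matrices represent the same morphism as soon as they agree at the vertices \<open>i < n\<close>.
\<close>

record rep =
  vdim :: "nat \<Rightarrow> nat"
  amap :: "nat \<Rightarrow> complex mat"
  bmap :: "nat \<Rightarrow> complex mat"

type_synonym rmor = "nat \<Rightarrow> complex mat"

definition is_rep :: "nat \<Rightarrow> rep \<Rightarrow> bool" where
  "is_rep n X \<longleftrightarrow>
     (\<forall>i\<in>{1..<n}. amap X i \<in> carrier_mat (vdim X (i - 1)) (vdim X i)
               \<and> bmap X i \<in> carrier_mat (vdim X i) (vdim X (i - 1))) \<and>
     (n > 1 \<longrightarrow> bmap X (n - 1) * amap X (n - 1) = 0\<^sub>m (vdim X (n - 1)) (vdim X (n - 1))) \<and>
     (\<forall>i\<in>{2..<n}. amap X i * bmap X i = bmap X (i - 1) * amap X (i - 1))"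

definition rep_hom :: "nat \<Rightarrow> rep \<Rightarrow> rep \<Rightarrow> rmor \<Rightarrow> bool" where
  "rep_hom n X Y f \<longleftrightarrow>
     (\<forall>i<n. f i \<in> carrier_mat (vdim Y i) (vdim X i)) \<and>
     (\<forall>i\<in>{1..<n}. f (i - 1) * amap X i = amap Y i * f i \<and>
                f i * bmap X i = bmap Y i * f (i - 1))"

definition mor_eq :: "nat \<Rightarrow> rmor \<Rightarrow> rmor \<Rightarrow> bool" where
  "mor_eq n f g \<longleftrightarrow> (\<forall>i<n. f i = g i)"

definition mor_comp :: "rmor \<Rightarrow> rmor \<Rightarrow> rmor" (infixl "\<circ>\<^sub>R" 70) where
  "(g \<circ>\<^sub>R f) i = g i * f i"

definition mor_id :: "rep \<Rightarrow> rmor" where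
  "mor_id X i = 1\<^sub>m (vdim X i)"

definition mor_smult :: "complex \<Rightarrow> rmor \<Rightarrow> rmor" where
  "mor_smult c f i = c \<cdot>\<^sub>m f i"

definition mono_mor :: "nat \<Rightarrow> rep \<Rightarrow> rmor \<Rightarrow> bool" where
  "mono_mor n X f \<longleftrightarrow> (\<forall>i<n. inj_on (\<lambda>v. f i *\<^sub>v v) (carrier_vec (vdim X i)))"

definition iso_mor :: "nat \<Rightarrow> rep \<Rightarrow> rep \<Rightarrow> rmor \<Rightarrow> bool" where
  "iso_mor n X Y f \<longleftrightarrow> rep_hom n X Y f \<and>
     (\<exists>g. rep_hom n Y X g \<and> mor_eq n (g \<circ>\<^sub>R f) (mor_id X) \<and> mor_eq n (f \<circ>\<^sub>R g) (mor_id Y))"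

definition rep_iso :: "nat \<Rightarrow> rep \<Rightarrow> rep \<Rightarrow> bool" where
  "rep_iso n X Y \<longleftrightarrow> (\<exists>f. iso_mor n X Y f)"

definition is_zero_rep :: "nat \<Rightarrow> rep \<Rightarrow> bool" where
  "is_zero_rep n X \<longleftrightarrow> (\<forall>i<n. vdim X i = 0)"


section \<open>Direct sums\<close>

definition block_diag :: "complex mat \<Rightarrow> complex mat \<Rightarrow> complex mat" where
  "block_diag A B = four_block_mat A (0\<^sub>m (dim_row A) (dim_col B)) (0\<^sub>m (dim_row B) (dim_col A)) B"

definition dsum :: "rep \<Rightarrow> rep \<Rightarrow> rep" (infixr "\<oplus>\<^sub>R" 65) where
  "X \<oplus>\<^sub>R Y = \<lparr> vdim = (\<lambda>i. vdim X i + vdim Y i),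
               amap = (\<lambda>i. block_diag (amap X i) (amap Y i)),
               bmap = (\<lambda>i. block_diag (bmap X i) (bmap Y i)) \<rparr>"

definition mor_dsum :: "rmor \<Rightarrow> rmor \<Rightarrow> rmor" where
  "mor_dsum f g i = block_diag (f i) (g i)"

definition mor_diag :: "rep \<Rightarrow> rmor" where
  "mor_diag X i = 1\<^sub>m (vdim X i) @\<^sub>r 1\<^sub>m (vdim X i)"

text \<open>The codiagonal \<open>X \<oplus>\<^sub>R X \<rightarrow> X\<close> has the transposed matrices of the diagonal.\<close>

definition mor_codiag :: "rep \<Rightarrow> rmor" where
  "mor_codiag X i = transpose_mat (1\<^sub>m (vdim X i) @\<^sub>r 1\<^sub>m (vdim X i))"

definition zero_rep :: rep where
  "zero_rep = \<lparr> vdim = (\<lambda>_. 0), amap = (\<lambda>_. 0\<^sub>m 0 0), bmap = (\<lambda>_. 0\<^sub>m 0 0) \<rparr>"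

definition dsum_list :: "rep list \<Rightarrow> rep" where
  "dsum_list Xs = foldr (\<oplus>\<^sub>R) Xs zero_rep"

text \<open>Direct sum over a finite set, in some enumeration of it.\<close>

definition dsum_set :: "('a \<Rightarrow> rep) \<Rightarrow> 'a set \<Rightarrow> rep" where
  "dsum_set F S = dsum_list (map F (SOME xs. distinct xs \<and> set xs = S))"

definition is_summand :: "nat \<Rightarrow> rep \<Rightarrow> rep \<Rightarrow> bool" where
  "is_summand n X T \<longleftrightarrow> is_rep n X \<and> (\<exists>Y. is_rep n Y \<and> rep_iso n T (X \<oplus>\<^sub>R Y))"

definition in_add :: "nat \<Rightarrow> rep \<Rightarrow> rep \<Rightarrow> bool" where
  "in_add n T X \<longleftrightarrow> (\<exists>m. is_summand n X (dsum_list (replicate m T)))"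

definition indecomposable :: "nat \<Rightarrow> rep \<Rightarrow> bool" where
  "indecomposable n X \<longleftrightarrow> is_rep n X \<and> \<not> is_zero_rep n X \<and>
     (\<forall>A B. is_rep n A \<and> is_rep n B \<and> rep_iso n X (A \<oplus>\<^sub>R B) \<longrightarrow> is_zero_rep n A \<or> is_zero_rep n B)"

definition basic :: "nat \<Rightarrow> rep \<Rightarrow> bool" where
  "basic n T \<longleftrightarrow> is_rep n T \<and> (\<forall>X. is_summand n (X \<oplus>\<^sub>R X) T \<and> is_rep n X \<longrightarrow> is_zero_rep n X)"


section \<open>Short exact sequences\<close>

text \<open>
  Exactness of \<open>0 \<rightarrow> U \<rightarrow> V \<rightarrow> W \<rightarrow> 0\<close> at all vertices, where \<open>U\<close>, \<open>V\<close>, \<open>W\<close> are families of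
  subspaces of the vertex spaces and the maps are the restrictions of \<open>f\<close> and \<open>g\<close>.
\<close>

definition exact_on ::
  "nat \<Rightarrow> rmor \<Rightarrow> rmor \<Rightarrow> (nat \<Rightarrow> complex vec set) \<Rightarrow> (nat \<Rightarrow> complex vec set) \<Rightarrow>
   (nat \<Rightarrow> complex vec set) \<Rightarrow> bool" where
  "exact_on n f g U V W \<longleftrightarrow>
     (\<forall>i<n. inj_on (\<lambda>v. f i *\<^sub>v v) (U i) \<and>
            (\<lambda>v. f i *\<^sub>v v) ` U i = {w \<in> V i. g i *\<^sub>v w = 0\<^sub>v (dim_row (g i))} \<and>
            (\<lambda>w. g i *\<^sub>v w) ` V i = W i)"

definition vspace :: "rep \<Rightarrow> nat \<Rightarrow> complex vec set" where
  "vspace X i = carrier_vec (vdim X i)"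

definition short_exact :: "nat \<Rightarrow> rep \<Rightarrow> rep \<Rightarrow> rep \<Rightarrow> rmor \<Rightarrow> rmor \<Rightarrow> bool" where
  "short_exact n X Y Z f g \<longleftrightarrow>
     is_rep n X \<and> is_rep n Y \<and> is_rep n Z \<and> rep_hom n X Y f \<and> rep_hom n Y Z g \<and>
     exact_on n f g (vspace X) (vspace Y) (vspace Z)"


section \<open>Standard modules and the projective \<open>D\<^sub>0\<close>\<close>

definition Delta :: "nat \<Rightarrow> rep" where
  "Delta i = (let d = (\<lambda>v. if v < i then 1 else 0 :: nat) in
     \<lparr> vdim = d,
       amap = (\<lambda>j. mat (d (j - 1)) (d j) (\<lambda>_. 1)),
       bmap = (\<lambda>j. 0\<^sub>m (d j) (d (j - 1))) \<rparr>)"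

text \<open>\<open>delta_filtered n X S\<close>: \<open>X\<close> has a filtration by standard modules in which exactly the
  \<open>Delta i\<close> with \<open>i \<in> S\<close> occur; so \<open>S\<close> is the Delta-support of \<open>X\<close>.\<close>

inductive delta_filtered :: "nat \<Rightarrow> rep \<Rightarrow> nat set \<Rightarrow> bool" for n where
  zero: "is_rep n X \<Longrightarrow> is_zero_rep n X \<Longrightarrow> delta_filtered n X {}"
| step: "delta_filtered n X S \<Longrightarrow> i \<in> {1..n} \<Longrightarrow> short_exact n X Y (Delta i) f g \<Longrightarrow>
         delta_filtered n Y (insert i S)"

definition F_Delta :: "nat \<Rightarrow> rep \<Rightarrow> bool" where
  "F_Delta n X \<longleftrightarrow> (\<exists>S. delta_filtered n X S)"

text \<open>
  \<open>D\<^sub>0 = De\<^sub>0\<close>. The relations move every \<open>a\<close> past every \<open>b\<close>, so that \<open>e\<^sub>iDe\<^sub>0\<close> has the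
  basis of residue classes of the paths \<open>b_i \<dots> b_1 (a_1 b_1)^k\<close>, \<open>k < n - i\<close>; this is the
  ordered basis of the space at vertex \<open>i\<close>. Left multiplication by \<open>b_i\<close> fixes the exponent \<open>k\<close>
  (and kills the path with \<open>k = n - i\<close>), left multiplication by \<open>a_i\<close> raises it by one. The
  lemmas \<open>D0_universal\<close> and \<open>D0_unique\<close> below confirm that this is \<open>De\<^sub>0\<close>: it represents
  \<open>X \<mapsto> e\<^sub>0X\<close>, with universal element \<open>e\<^sub>0\<close>, the first basis vector at vertex \<open>0\<close>.
\<close>

definition D0 :: "nat \<Rightarrow> rep" where
  "D0 n = \<lparr> vdim = (\<lambda>i. n - i),
            amap = (\<lambda>i. mat (n - (i - 1)) (n - i) (\<lambda>(r, c). if r = Suc c then 1 else 0)),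
            bmap = (\<lambda>i. mat (n - i) (n - (i - 1)) (\<lambda>(r, c). if r = c then 1 else 0)) \<rparr>"

text \<open>The action of the path \<open>b_i \<dots> b_1 (a_1 b_1)^k\<close> on a vector at vertex \<open>0\<close>.\<close>

fun path_act :: "rep \<Rightarrow> complex vec \<Rightarrow> nat \<Rightarrow> nat \<Rightarrow> complex vec" where
  "path_act X v 0 0 = v"
| "path_act X v 0 (Suc k) = amap X 1 *\<^sub>v (bmap X 1 *\<^sub>v path_act X v 0 k)"
| "path_act X v (Suc i) k = bmap X (Suc i) *\<^sub>v path_act X v i k"

lemma is_rep_carrier:
  assumes "is_rep n X" "Suc i < n"
  shows "amap X (Suc i) \<in> carrier_mat (vdim X i) (vdim X (Suc i))"
    "bmap X (Suc i) \<in> carrier_mat (vdim X (Suc i)) (vdim X i)"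
proof -
  have "Suc i \<in> {1..<n}" using assms(2) by simp
  then show "amap X (Suc i) \<in> carrier_mat (vdim X i) (vdim X (Suc i))"
    "bmap X (Suc i) \<in> carrier_mat (vdim X (Suc i)) (vdim X i)"
    using assms(1) unfolding is_rep_def by (metis diff_Suc_1)+
qed

lemma is_rep_comm:
  assumes "is_rep n X" "Suc (Suc i) < n"
  shows "amap X (Suc (Suc i)) * bmap X (Suc (Suc i)) = bmap X (Suc i) * amap X (Suc i)"
proof -
  have "Suc (Suc i) \<in> {2..<n}" using assms(2) by simp
  then show ?thesis using assms(1) unfolding is_rep_def by (metis diff_Suc_1)
qed

lemma path_act_carrier:
  assumes X: "is_rep n X" and v: "v \<in> carrier_vec (vdim X 0)" and n: "n > 1" and i: "i < n"
  shows "path_act X v i k \<in> carrier_vec (vdim X i)"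
proof -
  have 0: "path_act X v 0 k \<in> carrier_vec (vdim X 0)"
    using is_rep_carrier[OF X, of 0] n v by (induction k) (auto intro!: mult_mat_vec_carrier)
  show ?thesis using i
    by (induction i) (use 0 is_rep_carrier[OF X] in \<open>auto intro!: mult_mat_vec_carrier\<close>)
qed

lemma path_act_a:
  assumes X: "is_rep n X" and v: "v \<in> carrier_vec (vdim X 0)" and n: "n > 1" and i: "Suc i < n"
  shows "amap X (Suc i) *\<^sub>v path_act X v (Suc i) k = path_act X v i (Suc k)"
  using i
proof (induction i)
  case 0
  then show ?case by simp
next
  case (Suc i)
  let ?w = "path_act X v (Suc i) k"
  have w: "?w \<in> carrier_vec (vdim X (Suc i))"
    by (rule path_act_carrier[OF X v n Suc_lessD[OF Suc.prems]])
  note c = is_rep_carrier[OF X Suc.prems] is_rep_carrier[OF X Suc_lessD[OF Suc.prems]]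
  have "amap X (Suc (Suc i)) *\<^sub>v path_act X v (Suc (Suc i)) k =
      (amap X (Suc (Suc i)) * bmap X (Suc (Suc i))) *\<^sub>v ?w"
    using assoc_mult_mat_vec[OF c(1,2) w] by simp
  also have "\<dots> = bmap X (Suc i) *\<^sub>v (amap X (Suc i) *\<^sub>v ?w)"
    unfolding is_rep_comm[OF X Suc.prems] using assoc_mult_mat_vec[OF c(4,3) w] .
  also have "\<dots> = path_act X v (Suc i) (Suc k)"
    using Suc by simp
  finally show ?case .
qed

lemma zero_mv: "w \<in> carrier_vec c \<Longrightarrow> 0\<^sub>m r c *\<^sub>v w = (0\<^sub>v r :: complex vec)"
  by (intro eq_vecI) auto

lemma path_act_zero:
  assumes X: "is_rep n X" and v: "v \<in> carrier_vec (vdim X 0)" and n: "n > 1"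
  shows "Suc i < n \<Longrightarrow> path_act X v (Suc i) (n - Suc i) = 0\<^sub>v (vdim X (Suc i))"
proof (induction "n - Suc (Suc i)" arbitrary: i)
  case 0
  then have ni: "n = Suc (Suc i)" by simp
  note c = is_rep_carrier[OF X "0.prems"]
  have w: "path_act X v (Suc i) 0 \<in> carrier_vec (vdim X (Suc i))"
    by (rule path_act_carrier[OF X v n "0.prems"])
  have r: "bmap X (Suc i) * amap X (Suc i) = 0\<^sub>m (vdim X (Suc i)) (vdim X (Suc i))"
    using X n unfolding is_rep_def ni by simp
  have "path_act X v (Suc i) (Suc 0) = bmap X (Suc i) *\<^sub>v (amap X (Suc i) *\<^sub>v path_act X v (Suc i) 0)"
    using path_act_a[OF X v n "0.prems", of 0] by simp
  also have "\<dots> = 0\<^sub>v (vdim X (Suc i))"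
    using assoc_mult_mat_vec[OF c(2,1) w] zero_mv[OF w, of "vdim X (Suc i)"] unfolding r
    by (simp del: path_act.simps)
  finally show ?case using ni by simp
next
  case (Suc m)
  then have l: "Suc (Suc i) < n" by simp
  have e: "n - Suc i = Suc (n - Suc (Suc i))" using l by simp
  have "path_act X v (Suc i) (n - Suc i) = amap X (Suc (Suc i)) *\<^sub>v path_act X v (Suc (Suc i)) (n - Suc (Suc i))"
    unfolding e using path_act_a[OF X v n l] by simp
  also have "path_act X v (Suc (Suc i)) (n - Suc (Suc i)) = 0\<^sub>v (vdim X (Suc (Suc i)))"
    using Suc.hyps(1)[of "Suc i"] Suc.hyps(2) l by simp
  also have "amap X (Suc (Suc i)) *\<^sub>v 0\<^sub>v (vdim X (Suc (Suc i))) = 0\<^sub>v (vdim X (Suc i))"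
    using is_rep_carrier(1)[OF X l] by (intro eq_vecI) auto
  finally show ?case .
qed

lemma mult_unit_vec:
  fixes A :: "complex mat"
  assumes "A \<in> carrier_mat r c" "k < c"
  shows "A *\<^sub>v unit_vec c k = col A k"
  using assms by (intro eq_vecI) auto

lemma D0_b: "Suc i < n \<Longrightarrow> c < n - i \<Longrightarrow>
    col (bmap (D0 n) (Suc i)) c = (if c < n - Suc i then unit_vec (n - Suc i) c else 0\<^sub>v (n - Suc i))"
  by (intro eq_vecI) (auto simp: D0_def unit_vec_def)

lemma D0_a: "Suc i < n \<Longrightarrow> c < n - Suc i \<Longrightarrow>
    col (amap (D0 n) (Suc i)) c = unit_vec (n - i) (Suc c)"
  by (intro eq_vecI) (auto simp: D0_def unit_vec_def)

lemma mat_col_eqI: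
  fixes A B :: "complex mat"
  assumes "A \<in> carrier_mat r c" "B \<in> carrier_mat r c" "\<And>j. j < c \<Longrightarrow> col A j = col B j"
  shows "A = B"
  using assms by (intro mat_col_eqI) auto

lemma D0_rep: 
  assumes "n > 1"
  shows "is_rep n (D0 n)"
proof -
  have c: "amap (D0 n) i \<in> carrier_mat (n - (i - 1)) (n - i)"
    "bmap (D0 n) i \<in> carrier_mat (n - i) (n - (i - 1))" "vdim (D0 n) i = n - i" for i
    by (auto simp: D0_def)
  have 1: "bmap (D0 n) (n - 1) * amap (D0 n) (n - 1) = 0\<^sub>m 1 1"
  proof (rule mat_col_eqI[of _ 1 1])
    define m where "m = n - 2"
    have m: "n = Suc (Suc m)" using assms by (simp add: m_def)
    fix j :: nat assume j: "j < 1"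
    have "col (bmap (D0 n) (Suc m) * amap (D0 n) (Suc m)) 0 =
          bmap (D0 n) (Suc m) *\<^sub>v unit_vec 2 1"
      using c[of "Suc m"] D0_a[of m n 0] m by (subst col_mult2[of _ 1 2 _ 1]) auto
    also have "\<dots> = 0\<^sub>v 1"
      using c[of "Suc m"] D0_b[of m n 1] m by (subst mult_unit_vec[of _ 1]) auto
    finally show "col (bmap (D0 n) (n - 1) * amap (D0 n) (n - 1)) j = col (0\<^sub>m 1 1) j"
      using j m by auto
  qed (use c[of "n - 1"] assms in auto)
  have 2: "amap (D0 n) (Suc (Suc i)) * bmap (D0 n) (Suc (Suc i)) = bmap (D0 n) (Suc i) * amap (D0 n) (Suc i)"
    if i: "Suc (Suc i) < n" for i
  proof (rule mat_col_eqI[of _ "n - Suc i" "n - Suc i"])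
    note ca = c[of "Suc i"] c[of "Suc (Suc i)"]
    fix j assume j: "j < n - Suc i"
    have "col (amap (D0 n) (Suc (Suc i)) * bmap (D0 n) (Suc (Suc i))) j =
       amap (D0 n) (Suc (Suc i)) *\<^sub>v (if j < n - Suc (Suc i) then unit_vec (n - Suc (Suc i)) j else 0\<^sub>v (n - Suc (Suc i)))"
      using ca j D0_b[OF i j] by (subst col_mult2[of _ "n - Suc i" "n - Suc (Suc i)" _ "n - Suc i"]) auto
    also have "\<dots> = (if j < n - Suc (Suc i) then unit_vec (n - Suc i) (Suc j) else 0\<^sub>v (n - Suc i))"
    proof (cases "j < n - Suc (Suc i)")
      case True
      then show ?thesis using ca D0_a[OF i True] by (simp add: mult_unit_vec[of _ "n - Suc i"])
    next
      case False
      then show ?thesis using ca by (auto intro!: eq_vecI)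
    qed
    also have "\<dots> = bmap (D0 n) (Suc i) *\<^sub>v unit_vec (n - i) (Suc j)"
      using ca D0_b[of i n "Suc j"] i j by (subst mult_unit_vec[of _ "n - Suc i"]) auto
    also have "\<dots> = col (bmap (D0 n) (Suc i) * amap (D0 n) (Suc i)) j"
      using ca D0_a[of i n j] i j by (subst col_mult2[of _ "n - Suc i" "n - i" _ "n - Suc i"]) auto
    finally show "col (amap (D0 n) (Suc (Suc i)) * bmap (D0 n) (Suc (Suc i))) j =
      col (bmap (D0 n) (Suc i) * amap (D0 n) (Suc i)) j" .
  qed (use c[of "Suc i"] c[of "Suc (Suc i)"] in auto)
  show ?thesis
    unfolding is_rep_def
  proof (intro conjI impI ballI)
    fix i assume "i \<in> {2..<n}"
    moreover define m where "m = i - 2"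
    ultimately have "i = Suc (Suc m)" "Suc (Suc m) < n" by auto
    then show "amap (D0 n) i * bmap (D0 n) i = bmap (D0 n) (i - 1) * amap (D0 n) (i - 1)"
      using 2[of m] by simp
  qed (use 1 assms in \<open>simp_all add: D0_def\<close>)
qed

lemma D0_universal:
  assumes X: "is_rep n X" and v: "v \<in> carrier_vec (vdim X 0)" and n: "n > 1"
  shows "\<exists>h. rep_hom n (D0 n) X h \<and> h 0 *\<^sub>v unit_vec n 0 = v"
proof -
  define h where "h i = mat (vdim X i) (n - i) (\<lambda>(r, c). path_act X v i c $ r)" for i
  have hc: "h i \<in> carrier_mat (vdim X i) (n - i)" for i by (simp add: h_def)
  have col: "col (h i) k = path_act X v i k" if "i < n" "k < n - i" for i k
    using that path_act_carrier[OF X v n \<open>i < n\<close>, of k] by (auto intro!: eq_vecI simp: h_def)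
  have c: "amap (D0 n) i \<in> carrier_mat (n - (i - 1)) (n - i)"
    "bmap (D0 n) i \<in> carrier_mat (n - i) (n - (i - 1))" "vdim (D0 n) i = n - i" for i
    by (auto simp: D0_def)
  have a: "h i * amap (D0 n) (Suc i) = amap X (Suc i) * h (Suc i)" if i: "Suc i < n" for i
  proof (rule mat_col_eqI[of _ "vdim X i" "n - Suc i"])
    note ca = is_rep_carrier[OF X i] hc[of i] hc[of "Suc i"] c[of "Suc i"]
    fix j assume j: "j < n - Suc i"
    have "col (h i * amap (D0 n) (Suc i)) j = h i *\<^sub>v unit_vec (n - i) (Suc j)"
      using ca D0_a[OF i j] j by (subst col_mult2[of _ "vdim X i" "n - i" _ "n - Suc i"]) auto
    also have "\<dots> = path_act X v i (Suc j)"
      using ca i j col[of i "Suc j"] by (subst mult_unit_vec[of _ "vdim X i"]) auto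
    also have "\<dots> = amap X (Suc i) *\<^sub>v path_act X v (Suc i) j"
      using path_act_a[OF X v n i] by simp
    also have "\<dots> = col (amap X (Suc i) * h (Suc i)) j"
      using ca col[OF i j] j by (subst col_mult2[of _ "vdim X i" "vdim X (Suc i)" _ "n - Suc i"]) auto
    finally show "col (h i * amap (D0 n) (Suc i)) j = col (amap X (Suc i) * h (Suc i)) j" .
  qed (use is_rep_carrier[OF X i] hc[of i] hc[of "Suc i"] c[of "Suc i"] in auto)
  have b: "h (Suc i) * bmap (D0 n) (Suc i) = bmap X (Suc i) * h i" if i: "Suc i < n" for i
  proof (rule mat_col_eqI[of _ "vdim X (Suc i)" "n - i"])
    note ca = is_rep_carrier[OF X i] hc[of i] hc[of "Suc i"] c[of "Suc i"]
    fix j assume j: "j < n - i"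
    have "col (h (Suc i) * bmap (D0 n) (Suc i)) j =
      h (Suc i) *\<^sub>v (if j < n - Suc i then unit_vec (n - Suc i) j else 0\<^sub>v (n - Suc i))"
      using ca D0_b[OF i j] j by (subst col_mult2[of _ "vdim X (Suc i)" "n - Suc i" _ "n - i"]) auto
    also have "\<dots> = path_act X v (Suc i) j"
    proof (cases "j < n - Suc i")
      case True
      then show ?thesis using ca i col[OF i True] by (simp only: if_True mult_unit_vec[OF ca(4) True])
    next
      case False
      then have "j = n - Suc i" using j by simp
      then have "path_act X v (Suc i) j = 0\<^sub>v (vdim X (Suc i))"
        using path_act_zero[OF X v n i] by simp
      then show ?thesis using False ca by (auto intro!: eq_vecI)
    qed
    also have "\<dots> = col (bmap X (Suc i) * h i) j"
      using ca col[of i j] i j by (subst col_mult2[of _ "vdim X (Suc i)" "vdim X i" _ "n - i"]) auto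
    finally show "col (h (Suc i) * bmap (D0 n) (Suc i)) j = col (bmap X (Suc i) * h i) j" .
  qed (use is_rep_carrier[OF X i] hc[of i] hc[of "Suc i"] c[of "Suc i"] in auto)
  have "rep_hom n (D0 n) X h"
    unfolding rep_hom_def
  proof (intro conjI allI ballI impI)
    fix i assume "i \<in> {1..<n}"
    then obtain m where m: "i = Suc m" "Suc m < n" by (cases i) auto
    then show "h (i - 1) * amap (D0 n) i = amap X i * h i"
      "h i * bmap (D0 n) i = bmap X i * h (i - 1)" using a[of m] b[of m] by simp_all
  qed (use hc c in simp)
  moreover have "h 0 *\<^sub>v unit_vec n 0 = v"
    using mult_unit_vec[of "h 0" "vdim X 0" n 0] hc[of 0] col[of 0 0] n by simp
  ultimately show ?thesis by blast
qed

lemma D0_unique: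
  assumes X: "is_rep n X" and n: "n > 1" and h: "rep_hom n (D0 n) X h"
    and h': "rep_hom n (D0 n) X h'" and eq: "h 0 *\<^sub>v unit_vec n 0 = h' 0 *\<^sub>v unit_vec n 0"
  shows "mor_eq n h h'"
proof -
  define v where "v = h 0 *\<^sub>v unit_vec n 0"
  have c: "amap (D0 n) i \<in> carrier_mat (n - (i - 1)) (n - i)"
    "bmap (D0 n) i \<in> carrier_mat (n - i) (n - (i - 1))" "vdim (D0 n) i = n - i" for i
    by (auto simp: D0_def)
  have D: "is_rep n (D0 n)" using D0_rep[OF n] .
  have main: "h i *\<^sub>v unit_vec (n - i) k = path_act X v i k"
    if h: "rep_hom n (D0 n) X h" and v: "v = h 0 *\<^sub>v unit_vec n 0" and "i < n" "k < n - i" for h i k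
  proof -
    have hc: "h i \<in> carrier_mat (vdim X i) (n - i)" if "i < n" for i
      using h that c unfolding rep_hom_def by simp
    have ha: "h i * amap (D0 n) (Suc i) = amap X (Suc i) * h (Suc i)" 
      and hb: "h (Suc i) * bmap (D0 n) (Suc i) = bmap X (Suc i) * h i" if "Suc i < n" for i
      using h that unfolding rep_hom_def by (metis diff_Suc_1 atLeastLessThan_iff le_add1 plus_1_eq_Suc)+
    have b1: "h (Suc i) *\<^sub>v unit_vec (n - Suc i) k = bmap X (Suc i) *\<^sub>v (h i *\<^sub>v unit_vec (n - i) k)"
      if i: "Suc i < n" and k: "k < n - Suc i" for i k
    proof -
      have u: "unit_vec (n - i) k \<in> carrier_vec (n - i)" by simp
      have b': "bmap (D0 n) (Suc i) \<in> carrier_mat (n - Suc i) (n - i)" using c(2)[of "Suc i"] by simp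
      have "unit_vec (n - Suc i) k = bmap (D0 n) (Suc i) *\<^sub>v unit_vec (n - i) k"
        using D0_b[of i n k] i k by (subst mult_unit_vec[OF b']) auto
      then have "h (Suc i) *\<^sub>v unit_vec (n - Suc i) k = (h (Suc i) * bmap (D0 n) (Suc i)) *\<^sub>v unit_vec (n - i) k"
        using assoc_mult_mat_vec[OF hc[OF i] b' u] by simp
      then show ?thesis
        unfolding hb[OF i] using assoc_mult_mat_vec[OF is_rep_carrier(2)[OF X i] hc u] i by simp
    qed
    have a1: "h i *\<^sub>v unit_vec (n - i) (Suc k) = amap X (Suc i) *\<^sub>v (h (Suc i) *\<^sub>v unit_vec (n - Suc i) k)"
      if i: "Suc i < n" and k: "k < n - Suc i" for i k
    proof -
      have u: "unit_vec (n - Suc i) k \<in> carrier_vec (n - Suc i)" by simp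
      have a': "amap (D0 n) (Suc i) \<in> carrier_mat (n - i) (n - Suc i)" using c(1)[of "Suc i"] by simp
      have "unit_vec (n - i) (Suc k) = amap (D0 n) (Suc i) *\<^sub>v unit_vec (n - Suc i) k"
        using D0_a[of i n k] i k by (subst mult_unit_vec[OF a']) auto
      then have "h i *\<^sub>v unit_vec (n - i) (Suc k) = (h i * amap (D0 n) (Suc i)) *\<^sub>v unit_vec (n - Suc i) k"
        using assoc_mult_mat_vec[OF hc a' u] i by simp
      then show ?thesis
        unfolding ha[OF i] using assoc_mult_mat_vec[OF is_rep_carrier(1)[OF X i] hc[OF i] u] by simp
    qed
    have 0: "k < n \<Longrightarrow> h 0 *\<^sub>v unit_vec n k = path_act X v 0 k" for k
    proof (induction k)
      case (Suc k)
      then show ?case using a1[of 0 k] b1[of 0 k] by simp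
    qed (use v in simp)
    show ?thesis
      using that(3,4)
    proof (induction i)
      case (Suc i)
      then show ?case using b1[of i k] by simp
    qed (use 0 in simp)
  qed
  show ?thesis
    unfolding mor_eq_def
  proof (intro allI impI)
    fix i assume i: "i < n"
    have hc: "h i \<in> carrier_mat (vdim X i) (n - i)" "h' i \<in> carrier_mat (vdim X i) (n - i)"
      using h h' i c unfolding rep_hom_def by simp_all
    show "h i = h' i"
    proof (rule mat_col_eqI[OF hc])
      fix k assume k: "k < n - i"
      show "col (h i) k = col (h' i) k"
        using main[OF h v_def i k] main[OF h' _ i k] eq v_def
          mult_unit_vec[OF hc(1) k] mult_unit_vec[OF hc(2) k] by simp
    qed
  qed
qed

text \<open>Submodules are rendered as subobjects, so \<open>M_mod n I\<close> is fixed up to isomorphism.\<close>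

definition M_mod :: "nat \<Rightarrow> nat set \<Rightarrow> rep" where
  "M_mod n I = (SOME X. delta_filtered n X I \<and> (\<exists>f. rep_hom n X (D0 n) f \<and> mono_mor n X f))"

definition T_mod :: "nat \<Rightarrow> nat \<Rightarrow> rep" where
  "T_mod n i = M_mod n {1..i}"


section \<open>The submodule \<open>\<eta>X = De\<^sub>0X\<close> and the exact structure\<close>

text \<open>\<open>eta n X i\<close> is the space at vertex \<open>i\<close> of the submodule generated by \<open>e\<^sub>0X\<close>.\<close>

inductive in_eta :: "nat \<Rightarrow> rep \<Rightarrow> nat \<Rightarrow> complex vec \<Rightarrow> bool" for n X where
  gen: "v \<in> carrier_vec (vdim X 0) \<Longrightarrow> in_eta n X 0 v"
| add: "in_eta n X i v \<Longrightarrow> in_eta n X i w \<Longrightarrow> in_eta n X i (v + w)"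
| smult: "in_eta n X i v \<Longrightarrow> in_eta n X i (c \<cdot>\<^sub>v v)"
| act_a: "in_eta n X i v \<Longrightarrow> i \<in> {1..<n} \<Longrightarrow> in_eta n X (i - 1) (amap X i *\<^sub>v v)"
| act_b: "in_eta n X (i - 1) v \<Longrightarrow> i \<in> {1..<n} \<Longrightarrow> in_eta n X i (bmap X i *\<^sub>v v)"

definition eta :: "nat \<Rightarrow> rep \<Rightarrow> nat \<Rightarrow> complex vec set" where
  "eta n X i = {v. in_eta n X i v}"

definition E_exact :: "nat \<Rightarrow> rep \<Rightarrow> rep \<Rightarrow> rep \<Rightarrow> rmor \<Rightarrow> rmor \<Rightarrow> bool" where
  "E_exact n X Y Z f g \<longleftrightarrow>
     F_Delta n X \<and> F_Delta n Y \<and> F_Delta n Z \<and> short_exact n X Y Z f g \<and>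
     exact_on n f g (eta n X) (eta n Y) (eta n Z)"

text \<open>The category \<open>F\<^sub>\<Delta>(J)\<close>; \<open>X'\<close> is \<open>\<eta>X\<close> regarded as a module in its own right.\<close>

definition F_DeltaJ :: "nat \<Rightarrow> nat set \<Rightarrow> rep \<Rightarrow> bool" where
  "F_DeltaJ n J X \<longleftrightarrow> F_Delta n X \<and>
     (\<exists>X' f. is_rep n X' \<and> rep_hom n X' X f \<and> mono_mor n X' f \<and>
             (\<forall>i<n. (\<lambda>v. f i *\<^sub>v v) ` vspace X' i = eta n X i) \<and>
             in_add n (dsum_set (T_mod n) J) X')"


section \<open>The extension groups\<close>

text \<open>
  \<open>ext\<^sup>1(M, N)\<close> is the Yoneda extension group of the exact structure: equivalence classes of
  sequences \<open>0 \<rightarrow> N \<rightarrow> E \<rightarrow> M \<rightarrow> 0\<close>, stored as \<open>(E, f, g)\<close>, with the Baer sum.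
\<close>

type_synonym extn = "rep \<times> rmor \<times> rmor"

definition extns :: "nat \<Rightarrow> rep \<Rightarrow> rep \<Rightarrow> extn set" where
  "extns n M N = {(E, f, g). E_exact n N E M f g}"

text \<open>There is a morphism of sequences from \<open>\<xi>\<close> to \<open>\<xi>'\<close> with \<open>h\<close> on the left end and \<open>k\<close> on the
  right end. For \<open>k\<close> an identity this says that \<open>\<xi>'\<close> is the pushout of \<open>\<xi>\<close> along \<open>h\<close>; for
  \<open>h\<close> an identity, that \<open>\<xi>\<close> is the pullback of \<open>\<xi>'\<close> along \<open>k\<close>.\<close>

definition ext_mor :: "nat \<Rightarrow> extn \<Rightarrow> extn \<Rightarrow> rmor \<Rightarrow> rmor \<Rightarrow> bool" where
  "ext_mor n \<xi> \<xi>' h k \<longleftrightarrow>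
     (case (\<xi>, \<xi>') of ((E, f, g), (E', f', g')) \<Rightarrow>
        \<exists>u. rep_hom n E E' u \<and> mor_eq n (u \<circ>\<^sub>R f) (f' \<circ>\<^sub>R h) \<and> mor_eq n (g' \<circ>\<^sub>R u) (k \<circ>\<^sub>R g))"

definition ext_rel :: "nat \<Rightarrow> rep \<Rightarrow> rep \<Rightarrow> (extn \<times> extn) set" where
  "ext_rel n M N =
     {(\<xi>, \<xi>') \<in> extns n M N \<times> extns n M N. ext_mor n \<xi> \<xi>' (mor_id N) (mor_id M)}"

definition extn_dsum :: "extn \<Rightarrow> extn \<Rightarrow> extn" where
  "extn_dsum \<xi> \<xi>' = (case (\<xi>, \<xi>') of ((E, f, g), (E', f', g')) \<Rightarrow>
     (E \<oplus>\<^sub>R E', mor_dsum f f', mor_dsum g g'))"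

text \<open>\<open>\<xi>\<close> is the pullback along the diagonal of \<open>M\<close> of the pushout along the codiagonal of \<open>N\<close> of
  \<open>\<xi>\<^sub>1 \<oplus> \<xi>\<^sub>2\<close>.\<close>

definition baer_sum :: "nat \<Rightarrow> rep \<Rightarrow> rep \<Rightarrow> extn \<Rightarrow> extn \<Rightarrow> extn \<Rightarrow> bool" where
  "baer_sum n M N \<xi>\<^sub>1 \<xi>\<^sub>2 \<xi> \<longleftrightarrow>
     (\<exists>\<zeta> \<in> extns n (M \<oplus>\<^sub>R M) N.
        ext_mor n (extn_dsum \<xi>\<^sub>1 \<xi>\<^sub>2) \<zeta> (mor_codiag N) (mor_id (M \<oplus>\<^sub>R M)) \<and>
        ext_mor n \<xi> \<zeta> (mor_id N) (mor_diag M))"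

definition split_extns :: "nat \<Rightarrow> rep \<Rightarrow> rep \<Rightarrow> extn set" where
  "split_extns n M N =
     {(E, f, g) \<in> extns n M N. \<exists>s. rep_hom n M E s \<and> mor_eq n (g \<circ>\<^sub>R s) (mor_id M)}"

text \<open>As a complex vector space; the ring multiplication of the record type is meaningless here.
  The scalar \<open>c\<close> acts by pushout along \<open>c \<cdot> id\<close> on \<open>N\<close>.\<close>

definition ext1 :: "nat \<Rightarrow> rep \<Rightarrow> rep \<Rightarrow> (complex, extn set) module" where
  "ext1 n M N =
     \<lparr> carrier = extns n M N // ext_rel n M N,
       mult = undefined, one = undefined,
       zero = split_extns n M N,
       add = (\<lambda>A B. {\<xi> \<in> extns n M N. \<exists>\<xi>\<^sub>1\<in>A. \<exists>\<xi>\<^sub>2\<in>B. baer_sum n M N \<xi>\<^sub>1 \<xi>\<^sub>2 \<xi>}),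
       smult = (\<lambda>c A. {\<xi> \<in> extns n M N. \<exists>\<xi>\<^sub>1\<in>A.
                   ext_mor n \<xi>\<^sub>1 \<xi> (mor_smult c (mor_id N)) (mor_id M)}) \<rparr>"

definition has_dim :: "(complex, 'a) module \<Rightarrow> nat \<Rightarrow> bool" where
  "has_dim V d \<longleftrightarrow>
     vectorspace class_ring V \<and> vectorspace.fin_dim class_ring V \<and> vectorspace.dim class_ring V = d"

definition ext1_vanishes :: "nat \<Rightarrow> rep \<Rightarrow> rep \<Rightarrow> bool" where
  "ext1_vanishes n M N \<longleftrightarrow> carrier (ext1 n M N) = {\<zero>\<^bsub>ext1 n M N\<^esub>}"


section \<open>Cluster tilting objects and mutation\<close>

definition cluster_tilting :: "nat \<Rightarrow> nat set \<Rightarrow> rep \<Rightarrow> bool" where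
  "cluster_tilting n J T \<longleftrightarrow>
     basic n T \<and> F_DeltaJ n J T \<and> ext1_vanishes n T T \<and>
     (\<forall>M. F_DeltaJ n J M \<and> ext1_vanishes n T M \<longrightarrow> in_add n T M)"

text \<open>Projectivity in the exact category \<open>F\<^sub>\<Delta>(J)\<close>, not in \<open>mod D\<close>.\<close>

definition projectiveJ :: "nat \<Rightarrow> nat set \<Rightarrow> rep \<Rightarrow> bool" where
  "projectiveJ n J P \<longleftrightarrow> F_DeltaJ n J P \<and>
     (\<forall>X Y Z f g h. F_DeltaJ n J X \<and> F_DeltaJ n J Y \<and> F_DeltaJ n J Z \<and> E_exact n X Y Z f g \<and>
        rep_hom n P Z h \<longrightarrow> (\<exists>u. rep_hom n P Y u \<and> mor_eq n (g \<circ>\<^sub>R u) h))"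

definition right_min_approx :: "nat \<Rightarrow> rep \<Rightarrow> rep \<Rightarrow> rep \<Rightarrow> rmor \<Rightarrow> bool" where
  "right_min_approx n U E X f \<longleftrightarrow>
     in_add n U E \<and> rep_hom n E X f \<and>
     (\<forall>Y h. in_add n U Y \<and> rep_hom n Y X h \<longrightarrow> (\<exists>u. rep_hom n Y E u \<and> mor_eq n (f \<circ>\<^sub>R u) h)) \<and>
     (\<forall>h. rep_hom n E E h \<and> mor_eq n (f \<circ>\<^sub>R h) f \<longrightarrow> iso_mor n E E h)"

definition left_min_approx :: "nat \<Rightarrow> rep \<Rightarrow> rep \<Rightarrow> rep \<Rightarrow> rmor \<Rightarrow> bool" where
  "left_min_approx n U F X g \<longleftrightarrow>
     in_add n U F \<and> rep_hom n X F g \<and>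
     (\<forall>Y h. in_add n U Y \<and> rep_hom n X Y h \<longrightarrow> (\<exists>u. rep_hom n F Y u \<and> mor_eq n (u \<circ>\<^sub>R g) h)) \<and>
     (\<forall>h. rep_hom n F F h \<and> mor_eq n (h \<circ>\<^sub>R g) g \<longrightarrow> iso_mor n F F h)"

text \<open>
  The sequences \<open>0 \<rightarrow> T\<^sub>l\<^sup>* \<rightarrow> E \<rightarrow> T\<^sub>l \<rightarrow> 0\<close> (maps \<open>f'\<close>, \<open>f\<close>) and \<open>0 \<rightarrow> T\<^sub>l \<rightarrow> F \<rightarrow> T\<^sub>l\<^sup>* \<rightarrow> 0\<close>
  (maps \<open>g\<close>, \<open>g'\<close>) are the mutation sequences for the summand \<open>Tl\<close> of \<open>T\<close> and \<open>Ts\<close> \<open>= T\<^sub>l\<^sup>*\<close>.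
  \<open>U\<close> is the complement of \<open>Tl\<close> in the basic object \<open>T\<close>, unique up to isomorphism by Krull-Schmidt.
\<close>

definition mutation_sequences ::
  "nat \<Rightarrow> nat set \<Rightarrow> rep \<Rightarrow> rep \<Rightarrow> rep \<Rightarrow> rep \<Rightarrow> rmor \<Rightarrow> rmor \<Rightarrow> rep \<Rightarrow> rmor \<Rightarrow> rmor \<Rightarrow> bool" where
  "mutation_sequences n J T Tl Ts E f' f F g g' \<longleftrightarrow>
     cluster_tilting n J T \<and> indecomposable n Tl \<and> \<not> projectiveJ n J Tl \<and>
     F_DeltaJ n J Ts \<and> indecomposable n Ts \<and>
     E_exact n Ts E Tl f' f \<and> E_exact n Tl F Ts g g' \<and>
     (\<exists>U. is_rep n U \<and> rep_iso n T (Tl \<oplus>\<^sub>R U) \<and>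
          right_min_approx n U E Tl f \<and> left_min_approx n U F Tl g)"


section \<open>Weak separation\<close>

definition surrounds :: "nat set \<Rightarrow> nat set \<Rightarrow> bool" where
  "surrounds B A \<longleftrightarrow>
     (\<exists>B' B''. B = B' \<union> B'' \<and> B' \<inter> B'' = {} \<and>
        (\<forall>x\<in>B'. \<forall>y\<in>A. x < y) \<and> (\<forall>x\<in>A. \<forall>y\<in>B''. x < y))"

definition weakly_separated :: "nat set \<Rightarrow> nat set \<Rightarrow> bool" where
  "weakly_separated I J \<longleftrightarrow>
     card I \<ge> card J \<and> surrounds (J - I) (I - J) \<or>
     card J \<ge> card I \<and> surrounds (I - J) (J - I)"

definition ws_collection :: "nat \<Rightarrow> nat set \<Rightarrow> nat set set \<Rightarrow> bool" where
  "ws_collection n J S \<longleftrightarrow>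
     (\<forall>I\<in>S. I \<subseteq> {1..n} \<and> card I \<in> J) \<and> (\<forall>I\<in>S. \<forall>I'\<in>S. weakly_separated I I')"

definition max_ws_collection :: "nat \<Rightarrow> nat set \<Rightarrow> nat set set \<Rightarrow> bool" where
  "max_ws_collection n J S \<longleftrightarrow>
     ws_collection n J S \<and> (\<forall>S'. ws_collection n J S' \<and> S \<subseteq> S' \<longrightarrow> S' = S)"

definition T_coll :: "nat \<Rightarrow> nat set set \<Rightarrow> rep" where
  "T_coll n S = dsum_set (M_mod n) S"

end

theory Submission
  imports Defs
begin

text \<open>
  A module is studied through its space at vertex 0, on which \<open>t = a_1 b_1\<close> acts.
  In a module filtered by standard modules the arrows \<open>a\<close> act injectively, so that the maps
  \<open>inc X v = a_1 \<dots> a_v\<close> turn the other vertex spaces into a flag of subspaces of the one at vertex 0, and \<open>t\<close>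
  maps the subspace of vertex \<open>v\<close> into the one of \<open>v + 1\<close>. Morphisms are the \<open>t\<close>-linear maps at vertex
  0 that respect the flags (\<open>hom_extend\<close>). For a submodule \<open>M_I\<close> of \<open>D_0\<close> the space at vertex 0 is uniserial,
  of the form \<open>C[t]/(t^|I|)\<close>, and the subspace of vertex \<open>v\<close> is its socle layer of dimension \<open>dd I v\<close>, the
  number of elements of \<open>I\<close> above \<open>v\<close> (\<open>submodule_unique\<close>). A morphism \<open>M_I \<rightarrow> M_J\<close> is therefore a power
  series in \<open>t\<close>, with \<open>t^s\<close> allowed iff \<open>dd I v \<le> dd J v + s\<close> for all \<open>v\<close> (\<open>hom_coef\<close>), and every question
  about the modules \<open>M_I\<close> becomes one about these inequalities.

  The exchange sequences have the components \<open>t^s\<close> and \<open>1\<close> (locale \<open>exchange\<close>; \<open>s\<close> is 1 in the first sequence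
  and 0 in the second). A morphism from \<open>M_K\<close> to the right hand term lifts to the middle term if each
  power of \<open>t\<close> in it factors through one of the two summands (\<open>factor_right\<close>, dually \<open>factor_left\<close>). For \<open>K\<close>
  weakly separated from the sets involved this is a statement on the maxima of \<open>dd K - dd Lj\<close>
  (\<open>no_double_max\<close>, \<open>no_double_min\<close>), and the case of \<open>Lik\<close> follows by passing to complements. The approximations
  are minimal because their components lie in the radical.

  An extension of \<open>M = M_Lj\<close> by \<open>N = M_Lik\<close> that stays exact under \<open>\<eta>\<close> splits at vertex 0 compatibly with \<open>t\<close>,
  and the flag of its middle term then deviates from the direct sum of the flags by a multiple \<open>c\<close> of one fixed map, at
  the vertices from \<open>i\<close> to \<open>j - 1\<close> only (\<open>normal_form\<close>). The scalar \<open>c\<close> is intrinsic, being the connecting map induced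
  by a power of \<open>t\<close>. An explicit cocycle has \<open>c = 1\<close> (\<open>coc_exists\<close>), its pullbacks along scalars of \<open>M\<close> realize all
  values, and extensions with equal scalars are equivalent since each receives a morphism from such a pullback
  (\<open>pbk_to_ext\<close>). Baer sums add the scalars (\<open>baer_inv\<close>) and pushouts multiply them, so the group is a line.

  For the mutation statement it remains to see that the complement of a summand \<open>M_I\<close> of \<open>T_S\<close> is the sum of
  the other \<open>M_K\<close>, with \<open>K\<close> in \<open>S\<close>, that approximation properties pass from them to all of \<open>add\<close>, and that all terms
  lie in \<open>F_\<Delta>(J)\<close>; there \<open>M_I\<close> is not projective, as the exchange sequence does not split.
\<close>

notation mult_mat_vec (infixl "*v" 70)
notation smult_vec (infixl "*s" 70)
notation append_vec (infixr "@v" 65)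
notation zero_vec ("0v")
notation dsum (infixr "+R" 65)
notation mor_comp (infixl "oR" 70)

abbreviation cvec :: "nat \<Rightarrow> complex vec set" where "cvec \<equiv> carrier_vec"
abbreviation Sp :: "rep \<Rightarrow> nat \<Rightarrow> complex vec set" where "Sp X v \<equiv> cvec (vdim X v)"



section \<open>Linear maps between coordinate spaces\<close>

text \<open>
Maps on coordinate spaces that are not yet matrices: sections and lifts are obtained as functions and turned
into matrices by \<open>mat_of_fun\<close> only when they become components of a morphism.
\<close>

definition linmap :: "nat => nat => (complex vec => complex vec) => bool" where
 "linmap q p F \<longleftrightarrow> (\<forall>x\<in>cvec q. F x \<in> cvec p) \<and>
   (\<forall>x\<in>cvec q. \<forall>y\<in>cvec q. F (x + y) = F x + F y) \<and>
   (\<forall>c. \<forall>x\<in>cvec q. F (c *s x) = c *s F x)"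

definition mat_of_fun :: "nat => nat => (complex vec => complex vec) => complex mat" where
 "mat_of_fun q p F = mat p q (\<lambda>(i, j). F (unit_vec q j) $ i)"

lemma linD:
 assumes "linmap q p F"
 shows "x \<in> cvec q ==> F x \<in> cvec p"
  "x \<in> cvec q ==> y \<in> cvec q ==> F (x + y) = F x + F y"
  "x \<in> cvec q ==> F (c *s x) = c *s F x"
 using assms unfolding linmap_def by auto

lemma lin0:
 assumes "linmap q p F" shows "F (0v q) = 0v p"
proof -
 have "F (0 *s 0v q) = 0 *s F (0v q)" by (rule linD(3)[OF assms]) simp
 moreover have "(0::complex) *s 0v q = 0v q" by auto
 moreover have "0 *s F (0v q) = 0v p" using linD(1)[OF assms, of "0v q"] by auto
 ultimately show ?thesis by simp
qed

lemma linmap_mat: "A \<in> carrier_mat p q ==> linmap q p (\<lambda>x. A *v x)"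
 unfolding linmap_def by (auto simp: mult_add_distrib_mat_vec mult_mat_vec)

lemma linmap_eqI:
 assumes F: "linmap q p F" and G: "linmap q p G"
  and eq: "!!j. j < q ==> F (unit_vec q j) = G (unit_vec q j)" and x: "x \<in> cvec q"
 shows "F x = G x"
proof -
 define t where "t k = vec q (\<lambda>i. if i < k then x $ i else 0)" for k
 have tc: "t k \<in> cvec q" for k by (simp add: t_def)
 have "k \<le> q ==> F (t k) = G (t k)" for k
 proof (induction k)
  case 0
  have "t 0 = 0v q" by (auto simp: t_def)
  thus ?case using lin0[OF F] lin0[OF G] by simp
 next
  case (Suc k)
  have s: "t (Suc k) = t k + x $ k *s unit_vec q k"
   using Suc.prems by (auto simp: t_def less_Suc_eq unit_vec_def)
  have u: "x $ k *s unit_vec q k \<in> cvec q" by simp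
  show ?case
   unfolding s linD(2)[OF F tc u] linD(2)[OF G tc u]
   using linD(3)[OF F, of "unit_vec q k"] linD(3)[OF G, of "unit_vec q k"] eq[of k] Suc by simp
 qed
 moreover have "t q = x" using x by (auto simp: t_def)
 ultimately show ?thesis by (metis order_refl)
qed

lemma mat_of_fun_carrier [simp]: "mat_of_fun q p F \<in> carrier_mat p q"
 by (simp add: mat_of_fun_def)

lemma mat_of_fun_mult:
 assumes F: "linmap q p F" and x: "x \<in> cvec q"
 shows "mat_of_fun q p F *v x = F x"
proof (rule linmap_eqI[OF linmap_mat[OF mat_of_fun_carrier] F _ x])
 fix j assume j: "j < q"
 show "mat_of_fun q p F *v unit_vec q j = F (unit_vec q j)"
  using mult_unit_vec[OF mat_of_fun_carrier j, of p F] j linD(1)[OF F, of "unit_vec q j"]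
  by (auto simp: mat_of_fun_def intro!: eq_vecI)
qed

lemma mat_eq_vecI:
 assumes A: "(A :: complex mat) \<in> carrier_mat p q" and B: "B \<in> carrier_mat p q"
  and eq: "!!x. x \<in> cvec q ==> A *v x = B *v x"
 shows "A = B"
proof (rule mat_col_eqI[OF A B])
 fix j assume "j < q"
 thus "col A j = col B j"
  using mult_unit_vec[OF A] mult_unit_vec[OF B] eq[of "unit_vec q j"] by simp
qed

lemma lin_comp: "linmap q p F ==> linmap p r G ==> linmap q r (\<lambda>x. G (F x))"
 unfolding linmap_def by auto

lemma linmap_add:
 assumes F: "linmap q p F" and G: "linmap q p G"
 shows "linmap q p (\<lambda>x. F x + G x)"
 unfolding linmap_def
proof (intro conjI ballI allI)
 fix x y :: "complex vec" and c :: complex assume x: "x \<in> cvec q" and y: "y \<in> cvec q"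
 note c = linD(1)[OF F x] linD(1)[OF F y] linD(1)[OF G x] linD(1)[OF G y]
 show "F x + G x \<in> cvec p" using c by simp
 show "F (x + y) + G (x + y) = F x + G x + (F y + G y)"
  unfolding linD(2)[OF F x y] linD(2)[OF G x y] using c by (intro eq_vecI) auto
 show "F (c *s x) + G (c *s x) = c *s (F x + G x)"
  unfolding linD(3)[OF F x] linD(3)[OF G x] using c by (simp add: smult_add_distrib_vec)
qed

lemma linmap_smult:
 assumes F: "linmap q p F"
 shows "linmap q p (\<lambda>x. c *s F x)"
 unfolding linmap_def
proof (intro conjI ballI allI)
 fix x y :: "complex vec" and d :: complex assume x: "x \<in> cvec q" and y: "y \<in> cvec q"
 note c = linD(1)[OF F x] linD(1)[OF F y]
 show "c *s F x \<in> cvec p" using c by simp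
 show "c *s F (x + y) = c *s F x + c *s F y"
  unfolding linD(2)[OF F x y] using c by (simp add: smult_add_distrib_vec)
 show "c *s F (d *s x) = d *s (c *s F x)"
  unfolding linD(3)[OF F x] by (simp add: smult_smult_assoc mult.commute)
qed

lemma linmap_id: "linmap q q (\<lambda>x. x)"
 unfolding linmap_def by auto

text \<open>By injectivity the preimages are unique, so they depend linearly on the argument.\<close>

lemma linmap_lift:
 assumes I: "linmap p r I" and inj: "!!x. x \<in> cvec p ==> I x = 0v r ==> x = 0v p"
  and F: "linmap q r F" and im: "!!x. x \<in> cvec q ==> \<exists>y\<in>cvec p. I y = F x"
 obtains G where "linmap q p G" "!!x. x \<in> cvec q ==> I (G x) = F x"
proof -
 have uniq: "y = z" if "y \<in> cvec p" "z \<in> cvec p" "I y = I z" for y z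
 proof -
  have mz: "(-1) *s z \<in> cvec p" using that by simp
  have "I (y + (-1) *s z) = I y + (-1) *s I z"
   using linD(2)[OF I that(1) mz] linD(3)[OF I that(2), of "-1"] by simp
  also have "\<dots> = 0v r" using that linD(1)[OF I that(2)] by auto
  finally have "y + (-1) *s z = 0v p" using inj that mz by simp
  hence "(y + (-1) *s z) $ i = 0" if "i < p" for i using that by simp
  thus "y = z" using that by (intro eq_vecI) auto
 qed
 from im have "\<forall>x\<in>cvec q. \<exists>y\<in>cvec p. I y = F x" by blast
 then obtain G where G: "!!x. x \<in> cvec q ==> G x \<in> cvec p \<and> I (G x) = F x"
  by metis
 have "linmap q p G"
  unfolding linmap_def
 proof (intro conjI ballI allI)
  fix x y :: "complex vec" and c :: complex assume x: "x \<in> cvec q" and y: "y \<in> cvec q"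
  have xy: "x + y \<in> cvec q" "c *s x \<in> cvec q" using x y by auto
  have gc: "G x + G y \<in> cvec p" "c *s G x \<in> cvec p" using G[OF x] G[OF y] by auto
  show "G x \<in> cvec p" using G[OF x] by simp
  show "G (x + y) = G x + G y"
  proof (rule uniq)
   show "G (x + y) \<in> cvec p" using G[OF xy(1)] by simp
   show "I (G (x + y)) = I (G x + G y)"
    using G[OF x] G[OF y] G[OF xy(1)] linD(2)[OF I, of "G x" "G y"] linD(2)[OF F x y] by simp
  qed (rule gc)
  show "G (c *s x) = c *s G x"
  proof (rule uniq)
   show "G (c *s x) \<in> cvec p" using G[OF xy(2)] by simp
   show "I (G (c *s x)) = I (c *s G x)"
    using G[OF x] G[OF xy(2)] linD(3)[OF I, of "G x"] linD(3)[OF F x] by simp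
  qed (rule gc)
 qed
 thus ?thesis using that G by blast
qed

lemma linmap_diff:
 assumes "linmap q p F" "x \<in> cvec q" "y \<in> cvec q"
 shows "F (x - y) = F x - F y"
proof -
 have e: "x - y = x + (-1) *s y" using assms(2,3) by auto
 have "F (x - y) = F x + (-1) *s F y"
  unfolding e using linD(2)[OF assms(1,2), of "(-1) *s y"] linD(3)[OF assms(1,3), of "-1"] assms(3)
  by simp
 also have "\<dots> = F x - F y" using linD(1)[OF assms(1,2)] linD(1)[OF assms(1,3)] by auto
 finally show ?thesis .
qed

lemma vec_diff_zero:
 assumes "(x :: complex vec) \<in> cvec p" "y \<in> cvec p" "x - y = 0v p"
 shows "x = y"
proof (rule eq_vecI)
 fix i assume "i < dim_vec y"
 hence "i < p" using assms by simp
 hence "x $ i - y $ i = 0v p $ i" using assms(1,2) unfolding assms(3)[symmetric] by simp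
 thus "x $ i = y $ i" using \<open>i < p\<close> by simp
qed (use assms in auto)

lemma linmap_inj_on:
 assumes I: "linmap p r I" and inj: "!!x. x \<in> cvec p ==> I x = 0v r ==> x = 0v p"
  and "x \<in> cvec p" "y \<in> cvec p" "I x = I y"
 shows "x = y"
proof (rule vec_diff_zero[OF assms(3,4)])
 have "I (x - y) = 0v r"
  using linmap_diff[OF I assms(3,4)] linD(1)[OF I assms(4)] assms(5) by simp
 thus "x - y = 0v p" using inj[of "x - y"] assms(3,4) by simp
qed

definition inj_mat :: "complex mat => bool" where
 "inj_mat A \<longleftrightarrow> (\<forall>x\<in>cvec (dim_col A). A *v x = 0v (dim_row A) --> x = 0v (dim_col A))"

lemma inj_mat_iff:
 assumes A: "A \<in> carrier_mat p q"
 shows "inj_mat A \<longleftrightarrow> inj_on (\<lambda>x. A *v x) (cvec q)"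
proof
 assume "inj_mat A"
 thus "inj_on (\<lambda>x. A *v x) (cvec q)"
  using linmap_inj_on[OF linmap_mat[OF A]] A unfolding inj_on_def inj_mat_def by auto
next
 assume i: "inj_on (\<lambda>x. A *v x) (cvec q)"
 show "inj_mat A"
  unfolding inj_mat_def
 proof (intro ballI impI)
  fix x assume "x \<in> cvec (dim_col A)" "A *v x = 0v (dim_row A)"
  thus "x = 0v (dim_col A)"
   using i lin0[OF linmap_mat[OF A]] A unfolding inj_on_def by auto
 qed
qed

lemma inj_square_inverse:
 assumes A: "(A :: complex mat) \<in> carrier_mat n n" and inj: "inj_mat A"
 obtains B where "B \<in> carrier_mat n n" "A * B = 1\<^sub>m n" "B * A = 1\<^sub>m n"
proof -
 have "det A \<noteq> 0"
  using inj A unfolding det_0_iff_vec_prod_zero[OF A] inj_mat_def by auto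
 from det_non_zero_imp_unit[OF A this, of "()"]
 obtain B where "B \<in> carrier_mat n n" "B * A = 1\<^sub>m n" "A * B = 1\<^sub>m n"
  unfolding Units_def by (auto simp: ring_mat_def)
 thus ?thesis using that by blast
qed

lemma inj_dim_le:
 assumes A: "(A :: complex mat) \<in> carrier_mat p q" and inj: "inj_mat A"
 shows "q \<le> p"
proof (rule ccontr)
 assume "\<not> q \<le> p"
 hence pq: "p < q" by simp
 define A' where "A' = mat q q (\<lambda>(i, j). if i < p then A $$ (i, j) else 0)"
 have A': "A' \<in> carrier_mat q q" by (simp add: A'_def)
 have "inj_mat A'"
  unfolding inj_mat_def
 proof (intro ballI impI)
  fix x assume x: "x \<in> cvec (dim_col A')" and z: "A' *v x = 0v (dim_row A')"
  have "A *v x = 0v p"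
  proof (rule eq_vecI)
   fix i assume i: "i < dim_vec (0v p :: complex vec)"
   have "(A *v x) $ i = (A' *v x) $ i"
    using i pq A x by (auto simp: A'_def scalar_prod_def intro!: sum.cong)
   thus "(A *v x) $ i = 0v p $ i" using z i pq A' by simp
  qed (use A in auto)
  thus "x = 0v (dim_col A')" using inj A x A' unfolding inj_mat_def by auto
 qed
 from inj_square_inverse[OF A' this] obtain B where B: "B \<in> carrier_mat q q" "A' * B = 1\<^sub>m q"
  by metis
 have "(A' * B) $$ (p, p) = 0"
  using pq B(1) by (simp add: A'_def scalar_prod_def)
 thus False using B(2) pq by simp
qed

lemma inj_square_surj:
 assumes A: "(A :: complex mat) \<in> carrier_mat n n" and inj: "inj_mat A" and y: "y \<in> cvec n"
 obtains x where "x \<in> cvec n" "A *v x = y"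
proof -
 from inj_square_inverse[OF A inj] obtain B where B: "B \<in> carrier_mat n n" "A * B = 1\<^sub>m n" by metis
 have "A *v (B *v y) = y" using assoc_mult_mat_vec[OF A B(1) y] B(2) y by simp
 thus ?thesis using that[of "B *v y"] B(1) y by simp
qed

text \<open>Preimages of the unit vectors are the columns of a section.\<close>

lemma linear_section:
 assumes A: "(A :: complex mat) \<in> carrier_mat p q"
  and surj: "!!y. y \<in> cvec p ==> \<exists>x\<in>cvec q. A *v x = y"
 obtains B where "B \<in> carrier_mat q p" "A * B = 1\<^sub>m p"
proof -
 have "\<forall>j. \<exists>x\<in>cvec q. j < p --> A *v x = unit_vec p j"
  using surj[of "unit_vec p _"] by (metis unit_vec_carrier)
 then obtain s where s: "!!j. s j \<in> cvec q" "!!j. j < p ==> A *v s j = unit_vec p j"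
  by metis
 define B where "B = mat q p (\<lambda>(i, j). s j $ i)"
 have B: "B \<in> carrier_mat q p" by (simp add: B_def)
 have "A * B = 1\<^sub>m p"
 proof (rule mat_col_eqI[of _ p p])
  fix j assume j: "j < p"
  have "col B j = s j" using j s(1)[of j] by (auto simp: B_def)
  thus "col (A * B) j = col (1\<^sub>m p) j"
   using col_mult2[OF A B j] s(2)[OF j] j by simp
 qed (use A B in auto)
 thus ?thesis using that B by blast
qed

section \<open>Toeplitz matrices\<close>

text \<open>
The action of the power series \<open>\<Sum>s. c s t^s\<close> from \<open>C[t]/(t^q)\<close> to
\<open>C[t]/(t^p)\<close>, where \<open>t\<close> lowers the index of a basis vector by one. Both spaces are
aligned at their socles, spanned by the vector of index 0.
\<close>

definition toep :: "nat => nat => (nat => complex) => complex mat" where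
 "toep p q c = mat p q (\<lambda>(a, b). if a \<le> b then c (b - a) else 0)"

definition delta :: "nat => nat => complex" where
 "delta k s = (if s = k then 1 else 0)"

definition conv :: "(nat => complex) => (nat => complex) => nat => complex" where
 "conv c c' s = (\<Sum>x\<le>s. c x * c' (s - x))"

lemma toep_carrier [simp]: "toep p q c \<in> carrier_mat p q"
 and toep_dim [simp]: "dim_row (toep p q c) = p" "dim_col (toep p q c) = q"
 by (simp_all add: toep_def)

lemma conv_commute: "conv c c' = conv c' c"
proof
 fix s
 show "conv c c' s = conv c' c s"
  unfolding conv_def
  by (rule sum.reindex_bij_witness[of _ "\<lambda>x. s - x" "\<lambda>x. s - x"]) (auto simp: mult.commute)
qed

lemma conv_delta: "conv (delta k) c s = (if k \<le> s then c (s - k) else 0)"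
proof -
 have "conv (delta k) c s = (\<Sum>x\<le>s. if x = k then c (s - k) else 0)"
  unfolding conv_def by (intro sum.cong) (auto simp: delta_def)
 thus ?thesis by (simp add: sum.delta)
qed

lemma conv_delta0: "conv (delta 0) c = c"
 by (auto simp: conv_delta)

text \<open>The hypothesis says that truncation at the middle dimension loses nothing.\<close>

lemma toep_mult:
 assumes "!!s. c' s \<noteq> 0 ==> r \<le> q + s"
 shows "toep p q c * toep q r c' = toep p r (conv c c')"
proof (rule eq_matI)
 fix a b assume a: "a < dim_row (toep p r (conv c c'))" and b: "b < dim_col (toep p r (conv c c'))"
 hence a: "a < p" and b: "b < r" by auto
 have "(toep p q c * toep q r c') $$ (a, b) =
   (\<Sum>x<q. (if a \<le> x then c (x - a) else 0) * (if x \<le> b then c' (b - x) else 0))"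
  using a b by (auto simp: toep_def scalar_prod_def atLeast0LessThan intro!: sum.cong)
 also have "\<dots> = (\<Sum>x\<in>{a..b} \<inter> {..<q}. c (x - a) * c' (b - x))"
  by (rule sum.mono_neutral_cong_right) auto
 also have "\<dots> = (\<Sum>x\<in>{a..b}. c (x - a) * c' (b - x))"
 proof (rule sum.mono_neutral_left)
  show "\<forall>x\<in>{a..b} - {a..b} \<inter> {..<q}. c (x - a) * c' (b - x) = 0"
   using assms b by force
 qed auto
 also have "\<dots> = toep p r (conv c c') $$ (a, b)"
 proof (cases "a \<le> b")
  case True
  have "(\<Sum>x\<in>{a..b}. c (x - a) * c' (b - x)) = (\<Sum>x\<le>b - a. c x * c' (b - a - x))"
   using True by (intro sum.reindex_bij_witness[of _ "\<lambda>x. x + a" "\<lambda>x. x - a"]) auto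
  thus ?thesis using True a b by (simp add: toep_def conv_def)
 qed (use a b in \<open>simp add: toep_def\<close>)
 finally show "(toep p q c * toep q r c') $$ (a, b) = toep p r (conv c c') $$ (a, b)" .
qed auto

lemma toep_vec:
 assumes "x \<in> cvec q" "a < p"
 shows "(toep p q c *v x) $ a = (\<Sum>b\<in>{a..<q}. c (b - a) * x $ b)"
proof -
 have "(toep p q c *v x) $ a = (\<Sum>b\<in>{0..<q}. (if a \<le> b then c (b - a) else 0) * x $ b)"
  using assms by (auto simp: toep_def scalar_prod_def intro!: sum.cong)
 also have "\<dots> = (\<Sum>b\<in>{a..<q}. c (b - a) * x $ b)"
  by (rule sum.mono_neutral_cong_right) auto
 finally show ?thesis .
qed

lemma toep_delta_vec:
 assumes "x \<in> cvec q" "a < p"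
 shows "(toep p q (delta k) *v x) $ a = (if a + k < q then x $ (a + k) else 0)"
proof -
 have "(toep p q (delta k) *v x) $ a = (\<Sum>b\<in>{a..<q}. if b = a + k then x $ (a + k) else 0)"
  unfolding toep_vec[OF assms] by (intro sum.cong) (auto simp: delta_def)
 thus ?thesis by (simp add: sum.delta)
qed

lemma toep_id: "toep p p (delta 0) = 1\<^sub>m p"
 by (auto simp: toep_def delta_def)

text \<open>The matrix is triangular with \<open>c 0\<close> on the diagonal; look at the last nonzero coordinate.\<close>

lemma toep_inj:
 assumes "q \<le> p" "c 0 \<noteq> 0"
 shows "inj_mat (toep p q c)"
 unfolding inj_mat_def toep_dim
proof (intro ballI impI, rule ccontr)
 fix x assume x: "x \<in> cvec q" and z: "toep p q c *v x = 0v p" and "x \<noteq> 0v q"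
 hence ex: "\<exists>i. i < q \<and> x $ i \<noteq> 0" by (metis carrier_vecD eq_vecI index_zero_vec)
 define R where "R = {i. i < q \<and> x $ i \<noteq> 0}"
 define r where "r = Max R"
 have R: "finite R" "R \<noteq> {}" using ex by (auto simp: R_def)
 have r: "r < q" "x $ r \<noteq> 0" using Max_in[OF R] by (auto simp: R_def r_def)
 have top: "x $ i = 0" if "r < i" "i < q" for i
  using Max_ge[OF R(1), of i] that unfolding r_def R_def by fastforce
 have "(toep p q c *v x) $ r = (\<Sum>b\<in>{r..<q}. if b = r then c 0 * x $ r else 0)"
  unfolding toep_vec[OF x less_le_trans[OF r(1) assms(1)]] using top by (intro sum.cong) auto
 also have "\<dots> = c 0 * x $ r" using r by (simp add: sum.delta)
 finally show False using z r assms by simp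
qed

lemma toep_delta_surj:
 assumes "p + k = q" "y \<in> cvec p"
 shows "\<exists>x\<in>cvec q. toep p q (delta k) *v x = y"
proof (intro bexI)
 show "vec q (\<lambda>i. if i < k then 0 else y $ (i - k)) \<in> cvec q" by simp
 show "toep p q (delta k) *v vec q (\<lambda>i. if i < k then 0 else y $ (i - k)) = y"
  using assms by (intro eq_vecI) (auto simp: toep_delta_vec simp del: index_mult_mat_vec)
qed



section \<open>Modules seen from vertex 0\<close>

text \<open>The composite \<open>a_1 \<dots> a_v\<close> from vertex \<open>v\<close> to vertex 0.\<close>

fun inc :: "rep => nat => complex vec => complex vec" where
 "inc X 0 w = w"
| "inc X (Suc v) w = inc X v (amap X (Suc v) *v w)"

definition tt :: "rep => complex vec => complex vec" where
 "tt X x = amap X (Suc 0) *v (bmap X (Suc 0) *v x)"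

definition a_mono :: "nat => rep => bool" where
 "a_mono n X \<longleftrightarrow> (\<forall>v. Suc v < n --> inj_mat (amap X (Suc v)))"

lemma rep_act:
 assumes "is_rep n X" "Suc v < n"
 shows "w \<in> Sp X (Suc v) ==> amap X (Suc v) *v w \<in> Sp X v"
  "w \<in> Sp X v ==> bmap X (Suc v) *v w \<in> Sp X (Suc v)"
 using is_rep_carrier[OF assms] by auto

lemma hom_mat: "rep_hom n X Y f ==> v < n ==> f v \<in> carrier_mat (vdim Y v) (vdim X v)"
 unfolding rep_hom_def by simp

lemma hom_lin: "rep_hom n X Y f ==> v < n ==> linmap (vdim X v) (vdim Y v) (\<lambda>x. f v *v x)"
 by (rule linmap_mat[OF hom_mat])

lemma hom_vec:
 "rep_hom n X Y f ==> v < n ==> x \<in> Sp X v ==> f v *v x \<in> Sp Y v"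
 using hom_mat[of n X Y f v] by auto

lemma rep_hom_a:
 assumes X: "is_rep n X" and Y: "is_rep n Y" and f: "rep_hom n X Y f" and v: "Suc v < n"
  and w: "w \<in> Sp X (Suc v)"
 shows "f v *v (amap X (Suc v) *v w) = amap Y (Suc v) *v (f (Suc v) *v w)"
proof -
 have "Suc v \<in> {1..<n}" using v by simp
 hence e: "f v * amap X (Suc v) = amap Y (Suc v) * f (Suc v)"
  using f unfolding rep_hom_def by (metis diff_Suc_1)
 note c = hom_mat[OF f Suc_lessD[OF v]] hom_mat[OF f v]
  is_rep_carrier(1)[OF X v] is_rep_carrier(1)[OF Y v]
 show ?thesis
  using assoc_mult_mat_vec[OF c(1,3) w] assoc_mult_mat_vec[OF c(4,2) w] e by simp
qed

lemma rep_hom_b: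
 assumes X: "is_rep n X" and Y: "is_rep n Y" and f: "rep_hom n X Y f" and v: "Suc v < n"
  and w: "w \<in> Sp X v"
 shows "f (Suc v) *v (bmap X (Suc v) *v w) = bmap Y (Suc v) *v (f v *v w)"
proof -
 have "Suc v \<in> {1..<n}" using v by simp
 hence e: "f (Suc v) * bmap X (Suc v) = bmap Y (Suc v) * f v"
  using f unfolding rep_hom_def by (metis diff_Suc_1)
 note c = hom_mat[OF f Suc_lessD[OF v]] hom_mat[OF f v]
  is_rep_carrier(2)[OF X v] is_rep_carrier(2)[OF Y v]
 show ?thesis
  using assoc_mult_mat_vec[OF c(2,3) w] assoc_mult_mat_vec[OF c(4,1) w] e by simp
qed

lemma rep_homI:
 assumes X: "is_rep n X" and Y: "is_rep n Y"
  and c: "!!v. v < n ==> f v \<in> carrier_mat (vdim Y v) (vdim X v)"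
  and a: "!!v (w :: complex vec). Suc v < n ==> w \<in> Sp X (Suc v) ==>
   f v *v (amap X (Suc v) *v w) = amap Y (Suc v) *v (f (Suc v) *v w)"
  and b: "!!v (w :: complex vec). Suc v < n ==> w \<in> Sp X v ==>
   f (Suc v) *v (bmap X (Suc v) *v w) = bmap Y (Suc v) *v (f v *v w)"
 shows "rep_hom n X Y f"
 unfolding rep_hom_def
proof (intro conjI allI ballI impI)
 fix i assume "i \<in> {1..<n}"
 then obtain v where iv: "i = Suc v" and v: "Suc v < n" by (cases i) auto
 note cc = c[OF v] c[OF Suc_lessD[OF v]] is_rep_carrier[OF X v] is_rep_carrier[OF Y v]
 show "f (i - 1) * amap X i = amap Y i * f i"
  unfolding iv diff_Suc_1
 proof (rule mat_eq_vecI)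
  fix w :: "complex vec" assume w: "w \<in> Sp X (Suc v)"
  show "f v * amap X (Suc v) *v w = amap Y (Suc v) * f (Suc v) *v w"
   using a[OF v w] assoc_mult_mat_vec[OF cc(2,3) w] assoc_mult_mat_vec[OF cc(5,1) w] by simp
 qed (use cc in auto)
 show "f i * bmap X i = bmap Y i * f (i - 1)"
  unfolding iv diff_Suc_1
 proof (rule mat_eq_vecI)
  fix w :: "complex vec" assume w: "w \<in> Sp X v"
  show "f (Suc v) * bmap X (Suc v) *v w = bmap Y (Suc v) * f v *v w"
   using b[OF v w] assoc_mult_mat_vec[OF cc(1,4) w] assoc_mult_mat_vec[OF cc(6,2) w] by simp
 qed (use cc in auto)
qed (use c in simp)

lemma is_repI:
 assumes n: "1 < n"
  and ca: "!!v. Suc v < n ==> amap X (Suc v) \<in> carrier_mat (vdim X v) (vdim X (Suc v))"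
  and cb: "!!v. Suc v < n ==> bmap X (Suc v) \<in> carrier_mat (vdim X (Suc v)) (vdim X v)"
  and top: "!!v (w :: complex vec). n = Suc (Suc v) ==> w \<in> Sp X (Suc v) ==>
    bmap X (Suc v) *v (amap X (Suc v) *v w) = 0v (vdim X (Suc v))"
  and comm: "!!v (w :: complex vec). Suc (Suc v) < n ==> w \<in> Sp X (Suc v) ==>
    amap X (Suc (Suc v)) *v (bmap X (Suc (Suc v)) *v w) = bmap X (Suc v) *v (amap X (Suc v) *v w)"
 shows "is_rep n X"
 unfolding is_rep_def
proof (intro conjI ballI impI)
 fix i assume "i \<in> {1..<n}"
 then obtain v where "i = Suc v" "Suc v < n" by (cases i) auto
 thus "amap X i \<in> carrier_mat (vdim X (i - 1)) (vdim X i)"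
  "bmap X i \<in> carrier_mat (vdim X i) (vdim X (i - 1))" using ca[of v] cb[of v] by auto
next
 fix i assume "i \<in> {2..<n}"
 moreover define v where "v = i - 2"
 ultimately have iv: "i = Suc (Suc v)" and v: "Suc (Suc v) < n" by auto
 note cc = ca[OF v] cb[OF v] ca[OF Suc_lessD[OF v]] cb[OF Suc_lessD[OF v]]
 have "amap X (Suc (Suc v)) * bmap X (Suc (Suc v)) = bmap X (Suc v) * amap X (Suc v)"
 proof (rule mat_eq_vecI)
  fix w :: "complex vec" assume w: "w \<in> Sp X (Suc v)"
  show "amap X (Suc (Suc v)) * bmap X (Suc (Suc v)) *v w = bmap X (Suc v) * amap X (Suc v) *v w"
   using comm[OF v w] assoc_mult_mat_vec[OF cc(1,2) w] assoc_mult_mat_vec[OF cc(4,3) w] by simp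
 qed (use cc in auto)
 thus "amap X i * bmap X i = bmap X (i - 1) * amap X (i - 1)" by (simp add: iv)
next
 define v where "v = n - 2"
 have nv: "n = Suc (Suc v)" using n by (simp add: v_def)
 have v: "Suc v < n" by (simp add: nv)
 have "bmap X (Suc v) * amap X (Suc v) = 0\<^sub>m (vdim X (Suc v)) (vdim X (Suc v))"
 proof (rule mat_eq_vecI)
  fix w :: "complex vec" assume w: "w \<in> Sp X (Suc v)"
  show "bmap X (Suc v) * amap X (Suc v) *v w = 0\<^sub>m (vdim X (Suc v)) (vdim X (Suc v)) *v w"
   using top[OF nv w] assoc_mult_mat_vec[OF cb[OF v] ca[OF v] w] zero_mv[OF w] by simp
 qed (use ca[OF v] cb[OF v] in auto)
 thus "bmap X (n - 1) * amap X (n - 1) = 0\<^sub>m (vdim X (n - 1)) (vdim X (n - 1))" by (simp add: nv)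
qed

lemma rep_comm_vec:
 assumes X: "is_rep n X" and v: "Suc (Suc v) < n" and w: "w \<in> Sp X (Suc v)"
 shows "amap X (Suc (Suc v)) *v (bmap X (Suc (Suc v)) *v w) = bmap X (Suc v) *v (amap X (Suc v) *v w)"
proof -
 note c = is_rep_carrier[OF X v] is_rep_carrier[OF X Suc_lessD[OF v]]
 show ?thesis
  using is_rep_comm[OF X v] assoc_mult_mat_vec[OF c(1,2) w] assoc_mult_mat_vec[OF c(4,3) w] by simp
qed

lemma rep_top_vec:
 assumes X: "is_rep n X" and v: "n = Suc (Suc v)" and w: "w \<in> Sp X (Suc v)"
 shows "bmap X (Suc v) *v (amap X (Suc v) *v w) = 0v (vdim X (Suc v))"
proof -
 have v': "Suc v < n" using v by simp
 note c = is_rep_carrier[OF X v']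
 have "bmap X (Suc v) * amap X (Suc v) = 0\<^sub>m (vdim X (Suc v)) (vdim X (Suc v))"
  using X v unfolding is_rep_def by auto
 thus ?thesis using assoc_mult_mat_vec[OF c(2,1) w] zero_mv[OF w] by simp
qed

lemma linmap_act:
 assumes "is_rep n X" "Suc v < n"
 shows "linmap (vdim X (Suc v)) (vdim X v) (\<lambda>w. amap X (Suc v) *v w)"
  "linmap (vdim X v) (vdim X (Suc v)) (\<lambda>w. bmap X (Suc v) *v w)"
 using linmap_mat is_rep_carrier[OF assms] by blast+

lemma lin_inc:
 assumes X: "is_rep n X" and v: "v < n"
 shows "linmap (vdim X v) (vdim X 0) (inc X v)"
 using v
proof (induction v)
 case 0
 thus ?case using linmap_id by (simp add: linmap_def)
next
 case (Suc v)
 thus ?case using lin_comp[OF linmap_act(1)[OF X Suc.prems] Suc.IH] by simp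
qed

lemma lin_tt:
 assumes X: "is_rep n X" and n: "1 < n"
 shows "linmap (vdim X 0) (vdim X 0) (tt X)"
 unfolding tt_def using lin_comp[OF linmap_act(2)[OF X, of 0] linmap_act(1)[OF X, of 0]] n by simp

lemma linmap_funpow: "linmap q q F ==> linmap q q (F ^^ k)"
 by (induction k) (auto simp: linmap_def)

lemma inc_b:
 assumes X: "is_rep n X" and v: "Suc v < n" and w: "w \<in> Sp X v"
 shows "inc X (Suc v) (bmap X (Suc v) *v w) = tt X (inc X v w)"
 using v w
proof (induction v arbitrary: w)
 case 0
 thus ?case by (simp add: tt_def)
next
 case (Suc v)
 show ?case
  using rep_comm_vec[OF X Suc.prems] Suc.IH[OF Suc_lessD[OF Suc.prems(1)]
    rep_act(1)[OF X Suc_lessD[OF Suc.prems(1)] Suc.prems(2)]] by simp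
qed

text \<open>
By \<open>inc_b\<close>, \<open>t\<close> maps the image of vertex \<open>v\<close> into that of \<open>v +
1\<close>, hence into itself; at the last vertex the relation \<open>b a = 0\<close> makes it zero.
\<close>

lemma inc_tt:
 assumes X: "is_rep n X" and n: "1 < n" and v: "v < n" and w: "w \<in> Sp X v"
 shows "\<exists>w'\<in>Sp X v. inc X v w' = tt X (inc X v w)"
proof (cases v)
 case 0
 thus ?thesis using w linD(1)[OF lin_tt[OF X n] , of w] by auto
next
 case (Suc u)
 have u: "Suc u < n" using v Suc by simp
 have w1: "amap X (Suc u) *v w \<in> Sp X u" using rep_act(1)[OF X u] w Suc by simp
 thus ?thesis
  using inc_b[OF X u w1] rep_act(2)[OF X u w1] Suc by (intro bexI[of _ "bmap X (Suc u) *v (amap X (Suc u) *v w)"]) auto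
qed

lemma inc_tt_top:
 assumes X: "is_rep n X" and n: "1 < n" and w: "w \<in> cvec (vdim X (n - 1))"
 shows "tt X (inc X (n - 1) w) = 0v (vdim X 0)"
proof -
 define v where "v = n - 2"
 have nv: "n = Suc (Suc v)" using n by (simp add: v_def)
 have v: "Suc v < n" by (simp add: nv)
 have w': "w \<in> Sp X (Suc v)" using w by (simp add: nv)
 have "tt X (inc X (Suc v) w) = inc X (Suc v) (bmap X (Suc v) *v (amap X (Suc v) *v w))"
  using inc_b[OF X v rep_act(1)[OF X v w']] by simp
 also have "\<dots> = 0v (vdim X 0)"
  using rep_top_vec[OF X nv w'] lin0[OF lin_inc[OF X v]] by simp
 finally show ?thesis by (simp add: nv)
qed

lemma inc_inj:
 assumes X: "is_rep n X" and m: "a_mono n X" and v: "v < n" and w: "w \<in> Sp X v"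
  and z: "inc X v w = 0v (vdim X 0)"
 shows "w = 0v (vdim X v)"
 using v w z
proof (induction v arbitrary: w)
 case (Suc v)
 have "amap X (Suc v) *v w = 0v (vdim X v)"
  using Suc.IH[OF Suc_lessD[OF Suc.prems(1)] rep_act(1)[OF X Suc.prems(1,2)]] Suc.prems(3) by simp
 thus ?case
  using m Suc.prems is_rep_carrier(1)[OF X Suc.prems(1)] unfolding a_mono_def inj_mat_def by auto
qed simp

lemma inc_inject:
 assumes X: "is_rep n X" and m: "a_mono n X" and v: "v < n" and "w \<in> Sp X v"
  "w' \<in> Sp X v" "inc X v w = inc X v w'"
 shows "w = w'"
 by (rule linmap_inj_on[OF lin_inc[OF X v] inc_inj[OF X m v] assms(4-6)])

lemma hom_inc:
 assumes X: "is_rep n X" and Y: "is_rep n Y" and f: "rep_hom n X Y f" and v: "v < n"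
  and w: "w \<in> Sp X v"
 shows "inc Y v (f v *v w) = f 0 *v inc X v w"
 using v w
proof (induction v arbitrary: w)
 case (Suc v)
 thus ?case
  using rep_hom_a[OF X Y f Suc.prems] Suc.IH[OF Suc_lessD[OF Suc.prems(1)] rep_act(1)[OF X Suc.prems]]
  by simp
qed simp

lemma hom_tt:
 assumes X: "is_rep n X" and Y: "is_rep n Y" and n: "1 < n" and f: "rep_hom n X Y f"
  and w: "w \<in> Sp X 0"
 shows "tt Y (f 0 *v w) = f 0 *v tt X w"
 unfolding tt_def
 using rep_hom_a[OF X Y f _ rep_act(2)[OF X _ w]] rep_hom_b[OF X Y f _ w] n by simp

lemma hom_tt_pow:
 assumes X: "is_rep n X" and Y: "is_rep n Y" and n: "1 < n" and f: "rep_hom n X Y f"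
  and w: "w \<in> Sp X 0"
 shows "(tt Y ^^ k) (f 0 *v w) = f 0 *v (tt X ^^ k) w"
proof (induction k)
 case (Suc k)
 thus ?case
  using hom_tt[OF X Y n f linD(1)[OF linmap_funpow[OF lin_tt[OF X n]] w]] by simp
qed simp

lemma inc_path_act:
 assumes X: "is_rep n X" and n: "1 < n" and x: "x \<in> Sp X 0" and v: "v < n"
 shows "inc X v (path_act X x v 0) = (tt X ^^ v) x"
 using v
proof (induction v)
 case (Suc v)
 thus ?case
  using inc_b[OF X Suc.prems path_act_carrier[OF X x n Suc_lessD[OF Suc.prems]]] by simp
qed simp

lemma linmap_path_act:
 assumes X: "is_rep n X" and v: "v < n"
 shows "linmap (vdim X 0) (vdim X v) (\<lambda>x. path_act X x v 0)"
 using v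
proof (induction v)
 case 0
 thus ?case using linmap_id by simp
next
 case (Suc v)
 thus ?case using lin_comp[OF Suc.IH linmap_act(2)[OF X Suc.prems]] by simp
qed

lemma path_act_tt:
 assumes X: "is_rep n X" and n: "1 < n" and x: "x \<in> Sp X 0" and v: "v < n"
 shows "path_act X x v (Suc 0) = path_act X (tt X x) v 0"
 using v by (induction v) (auto simp: tt_def)

text \<open>
Commuting every \<open>a\<close> past every \<open>b\<close> leaves only the paths \<open>b_v \<dots>
b_1\<close> applied to \<open>t\<close>-multiples of vectors at vertex 0.
\<close>

lemma eta_iff:
 assumes X: "is_rep n X" and n: "1 < n"
 shows "v < n ==> w \<in> eta n X v \<longleftrightarrow> (\<exists>x\<in>Sp X 0. w = path_act X x v 0)"
proof -
 have *: "in_eta n X v w ==> v < n --> (\<exists>x\<in>Sp X 0. w = path_act X x v 0)" for v w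
 proof (induction rule: in_eta.induct)
  case (gen v)
  thus ?case by auto
 next
  case (add v w w')
  thus ?case using linD(2)[OF linmap_path_act[OF X]] by (metis add_carrier_vec)
 next
  case (smult v w c)
  thus ?case using linD(3)[OF linmap_path_act[OF X]] by (metis smult_carrier_vec)
 next
  case (act_a v w)
  show ?case
  proof
   assume "v - 1 < n"
   from act_a obtain u where u: "v = Suc u" "Suc u < n" by (cases v) auto
   from act_a u obtain x where x: "x \<in> Sp X 0" "w = path_act X x (Suc u) 0" by auto
   have "amap X v *v w = path_act X (tt X x) u 0"
    using path_act_a[OF X x(1) n u(2)] path_act_tt[OF X n x(1), of u] u x by simp
   thus "\<exists>x\<in>Sp X 0. amap X v *v w = path_act X x (v - 1) 0"
    using linD(1)[OF lin_tt[OF X n] x(1)] u by auto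
  qed
 next
  case (act_b v w)
  then obtain u where u: "v = Suc u" "Suc u < n" by (cases v) auto
  thus ?case using act_b by auto
 qed
 have **: "x \<in> Sp X 0 ==> v < n ==> in_eta n X v (path_act X x v 0)" for x v
 proof (induction v)
  case (Suc v)
  thus ?case using in_eta.act_b[of n X "Suc v"] by simp
 qed (auto intro: in_eta.gen)
 show "v < n ==> w \<in> eta n X v \<longleftrightarrow> (\<exists>x\<in>Sp X 0. w = path_act X x v 0)"
  using * ** unfolding eta_def by blast
qed

lemma hom_path_act:
 assumes X: "is_rep n X" and Y: "is_rep n Y" and n: "1 < n" and f: "rep_hom n X Y f" and v: "v < n"
  and x: "x \<in> Sp X 0"
 shows "f v *v path_act X x v 0 = path_act Y (f 0 *v x) v 0"
 using v
proof (induction v)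
 case (Suc v)
 thus ?case
  using rep_hom_b[OF X Y f Suc.prems path_act_carrier[OF X x n Suc_lessD[OF Suc.prems]]] by simp
qed simp

section \<open>Morphisms are determined at vertex 0\<close>

lemma hom_comp:
 assumes "is_rep n X" "is_rep n Y" "is_rep n Z" "rep_hom n X Y f" "rep_hom n Y Z g"
 shows "rep_hom n X Z (g oR f)"
proof (rule rep_homI[OF assms(1,3)])
 note cf = hom_mat[OF assms(4)] and cg = hom_mat[OF assms(5)]
 have as: "(g oR f) v *v w = g v *v (f v *v w)" if "v < n" "w \<in> Sp X v" for v w
  using assoc_mult_mat_vec[OF cg cf] that by (simp add: mor_comp_def)
 fix v
 show "v < n ==> (g oR f) v \<in> carrier_mat (vdim Z v) (vdim X v)"
  using cf[of v] cg[of v] by (simp add: mor_comp_def)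
 fix w assume v: "Suc v < n"
 show "(g oR f) v *v (amap X (Suc v) *v w) = amap Z (Suc v) *v ((g oR f) (Suc v) *v w)"
  if w: "w \<in> Sp X (Suc v)"
  using as[OF v w] as[OF Suc_lessD[OF v] rep_act(1)[OF assms(1) v w]]
   rep_hom_a[OF assms(1,2,4) v w] rep_hom_a[OF assms(2,3,5) v hom_vec[OF assms(4) v w]] by simp
 show "(g oR f) (Suc v) *v (bmap X (Suc v) *v w) = bmap Z (Suc v) *v ((g oR f) v *v w)"
  if w: "w \<in> Sp X v"
  using as[OF Suc_lessD[OF v] w] as[OF v rep_act(2)[OF assms(1) v w]]
   rep_hom_b[OF assms(1,2,4) v w] rep_hom_b[OF assms(2,3,5) v hom_vec[OF assms(4) Suc_lessD[OF v] w]]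
  by simp
qed

lemma comp_vec:
 assumes "rep_hom n X Y f" "rep_hom n Y Z g" "v < n" "w \<in> Sp X v"
 shows "(g oR f) v *v w = g v *v (f v *v w)"
 using assoc_mult_mat_vec[OF hom_mat[OF assms(2,3)] hom_mat[OF assms(1,3)] assms(4)]
 by (simp add: mor_comp_def)

lemma rep_hom_id: "is_rep n X ==> rep_hom n X X (mor_id X)"
 by (rule rep_homI) (auto simp: mor_id_def rep_act)

lemma mor_id_vec: "w \<in> Sp X v ==> mor_id X v *v w = w"
 by (simp add: mor_id_def)

lemma rep_hom_smult:
 assumes "is_rep n X" "is_rep n Y" "rep_hom n X Y f"
 shows "rep_hom n X Y (mor_smult c f)"
proof (rule rep_homI[OF assms(1,2)])
 note cf = hom_mat[OF assms(3)]
 have as: "mor_smult c f v *v w = c *s (f v *v w)" if "v < n" "w \<in> Sp X v" for v w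
  using cf[OF that(1)] that by (auto simp: mor_smult_def intro!: eq_vecI)
 fix v
 show "v < n ==> mor_smult c f v \<in> carrier_mat (vdim Y v) (vdim X v)"
  using cf[of v] by (simp add: mor_smult_def)
 fix w assume v: "Suc v < n"
 show "mor_smult c f v *v (amap X (Suc v) *v w) = amap Y (Suc v) *v (mor_smult c f (Suc v) *v w)"
  if w: "w \<in> Sp X (Suc v)"
  using as[OF v w] as[OF Suc_lessD[OF v] rep_act(1)[OF assms(1) v w]]
   rep_hom_a[OF assms v w] linD(3)[OF linmap_act(1)[OF assms(2) v] hom_vec[OF assms(3) v w]] by simp
 show "mor_smult c f (Suc v) *v (bmap X (Suc v) *v w) = bmap Y (Suc v) *v (mor_smult c f v *v w)"
  if w: "w \<in> Sp X v"
  using as[OF Suc_lessD[OF v] w] as[OF v rep_act(2)[OF assms(1) v w]]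
   rep_hom_b[OF assms v w] linD(3)[OF linmap_act(2)[OF assms(2) v] hom_vec[OF assms(3) Suc_lessD[OF v] w]] by simp
qed

lemma hom_eqI0:
 assumes X: "is_rep n X" and Y: "is_rep n Y" and m: "a_mono n Y"
  and f: "rep_hom n X Y f" and g: "rep_hom n X Y g"
  and eq: "!!x :: complex vec. x \<in> Sp X 0 ==> f 0 *v x = g 0 *v x"
 shows "mor_eq n f g"
 unfolding mor_eq_def
proof (intro allI impI)
 fix v assume v: "v < n"
 show "f v = g v"
 proof (rule mat_eq_vecI[OF hom_mat[OF f v] hom_mat[OF g v]])
  fix x :: "complex vec" assume x: "x \<in> Sp X v"
  show "f v *v x = g v *v x"
   using hom_inc[OF X Y f v x] hom_inc[OF X Y g v x] eq[OF linD(1)[OF lin_inc[OF X v] x]]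
   by (intro inc_inject[OF Y m v hom_vec[OF f v x] hom_vec[OF g v x]]) simp
 qed
qed

lemma eq_vec: "mor_eq n f g ==> v < n ==> f v *v x = g v *v x"
 by (simp add: mor_eq_def)

text \<open>
 A \<open>t\<close>-linear map of the spaces at vertex 0 that respects the subspaces \<open>inc v\<close> is a morphism:
 the maps at the other vertices are the unique lifts, and they commute with the arrows because
 they do so after the injection into vertex 0.
\<close>

lemma hom_extend:
 assumes X: "is_rep n X" and Y: "is_rep n Y" and m: "a_mono n Y" and n: "1 < n"
  and F: "linmap (vdim X 0) (vdim Y 0) F"
  and t: "!!x. x \<in> Sp X 0 ==> F (tt X x) = tt Y (F x)"
  and im: "!!v x. v < n ==> x \<in> Sp X v ==>
   \<exists>y\<in>Sp Y v. inc Y v y = F (inc X v x)"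
 obtains u where "rep_hom n X Y u" "!!x. x \<in> Sp X 0 ==> u 0 *v x = F x"
proof -
 have "\<forall>v. \<exists>G. v < n --> linmap (vdim X v) (vdim Y v) G \<and>
   (\<forall>x\<in>Sp X v. inc Y v (G x) = F (inc X v x))"
 proof (intro allI)
  fix v
  show "\<exists>G. v < n --> linmap (vdim X v) (vdim Y v) G \<and>
   (\<forall>x\<in>Sp X v. inc Y v (G x) = F (inc X v x))"
  proof (cases "v < n")
   case v: True
   show ?thesis
    by (rule linmap_lift[OF lin_inc[OF Y v] inc_inj[OF Y m v]
       lin_comp[OF lin_inc[OF X v] F] im[OF v]]) auto
  qed simp
 qed
 then obtain G where G: "!!v. v < n ==> linmap (vdim X v) (vdim Y v) (G v)"
  and GF: "!!v x. v < n ==> x \<in> Sp X v ==> inc Y v (G v x) = F (inc X v x)"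
  by metis
 define u where "u v = mat_of_fun (vdim X v) (vdim Y v) (G v)" for v
 have uG: "u v *v x = G v x" if "v < n" "x \<in> Sp X v" for v x
  using mat_of_fun_mult[OF G[OF that(1)] that(2)] by (simp add: u_def)
 have "rep_hom n X Y u"
 proof (rule rep_homI[OF X Y])
  fix v w assume v: "Suc v < n"
  note v' = Suc_lessD[OF v]
  show "u v *v (amap X (Suc v) *v w) = amap Y (Suc v) *v (u (Suc v) *v w)"
   if w: "w \<in> Sp X (Suc v)"
  proof (rule inc_inject[OF Y m v'])
   note wa = rep_act(1)[OF X v w] and Gw = linD(1)[OF G[OF v] w]
   show "inc Y v (u v *v (amap X (Suc v) *v w)) = inc Y v (amap Y (Suc v) *v (u (Suc v) *v w))"
    using uG[OF v w] uG[OF v' wa] GF[OF v w] GF[OF v' wa] by simp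
   show "u v *v (amap X (Suc v) *v w) \<in> Sp Y v"
    using uG[OF v' wa] linD(1)[OF G[OF v'] wa] by simp
   show "amap Y (Suc v) *v (u (Suc v) *v w) \<in> Sp Y v"
    using uG[OF v w] rep_act(1)[OF Y v Gw] by simp
  qed
  show "u (Suc v) *v (bmap X (Suc v) *v w) = bmap Y (Suc v) *v (u v *v w)"
   if w: "w \<in> Sp X v"
  proof (rule inc_inject[OF Y m v])
   note wb = rep_act(2)[OF X v w] and Gw = linD(1)[OF G[OF v'] w]
   show "inc Y (Suc v) (u (Suc v) *v (bmap X (Suc v) *v w)) = inc Y (Suc v) (bmap Y (Suc v) *v (u v *v w))"
    unfolding uG[OF v wb] uG[OF v' w] GF[OF v wb] inc_b[OF X v w] inc_b[OF Y v Gw] GF[OF v' w]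
    by (rule t[OF linD(1)[OF lin_inc[OF X v'] w]])
   show "u (Suc v) *v (bmap X (Suc v) *v w) \<in> Sp Y (Suc v)"
    using uG[OF v wb] linD(1)[OF G[OF v] wb] by simp
   show "bmap Y (Suc v) *v (u v *v w) \<in> Sp Y (Suc v)"
    using uG[OF v' w] rep_act(2)[OF Y v Gw] by simp
  qed
 qed (simp add: u_def)
 moreover have "u 0 *v x = F x" if "x \<in> Sp X 0" for x
  using uG[of 0 x] GF[of 0 x] that n by simp
 ultimately show ?thesis using that by blast
qed

section \<open>Isomorphisms\<close>

lemma iso_of_inj:
 assumes X: "is_rep n X" and Y: "is_rep n Y" and f: "rep_hom n X Y f"
  and d: "!!v. v < n ==> vdim X v = vdim Y v" and inj: "!!v. v < n ==> inj_mat (f v)"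
 shows "iso_mor n X Y f"
proof -
 have "\<forall>v. \<exists>B. v < n --> B \<in> carrier_mat (vdim X v) (vdim Y v) \<and> f v * B = 1\<^sub>m (vdim Y v) \<and> B * f v = 1\<^sub>m (vdim X v)"
  using inj_square_inverse[of "f _" "vdim X _"] hom_mat[OF f] d inj by metis
 then obtain g where g: "!!v. v < n ==> g v \<in> carrier_mat (vdim X v) (vdim Y v)"
  "!!v. v < n ==> f v * g v = 1\<^sub>m (vdim Y v)" "!!v. v < n ==> g v * f v = 1\<^sub>m (vdim X v)" by metis
 have fg: "f v *v (g v *v y) = y" if "v < n" "y \<in> Sp Y v" for v y
  using assoc_mult_mat_vec[OF hom_mat[OF f that(1)] g(1)[OF that(1)] that(2)] g(2)[OF that(1)] that by simp
 have gf: "g v *v (f v *v x) = x" if "v < n" "x \<in> Sp X v" for v x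
  using assoc_mult_mat_vec[OF g(1)[OF that(1)] hom_mat[OF f that(1)] that(2)] g(3)[OF that(1)] that by simp
 have gc: "g v *v y \<in> Sp X v" if "v < n" "y \<in> Sp Y v" for v y
  using g(1)[OF that(1)] that by auto
 have "rep_hom n Y X g"
 proof (rule rep_homI[OF Y X g(1)])
  fix v w assume v: "Suc v < n"
  note v' = Suc_lessD[OF v]
  show "g v *v (amap Y (Suc v) *v w) = amap X (Suc v) *v (g (Suc v) *v w)"
   if w: "w \<in> Sp Y (Suc v)"
   using rep_hom_a[OF X Y f v gc[OF v w]] fg[OF v w] gf[OF v' rep_act(1)[OF X v gc[OF v w]]] by simp
  show "g (Suc v) *v (bmap Y (Suc v) *v w) = bmap X (Suc v) *v (g v *v w)"
   if w: "w \<in> Sp Y v"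
   using rep_hom_b[OF X Y f v gc[OF v' w]] fg[OF v' w] gf[OF v rep_act(2)[OF X v gc[OF v' w]]] by simp
 qed
 thus ?thesis
  unfolding iso_mor_def using f g by (auto simp: mor_eq_def mor_comp_def mor_id_def)
qed

lemma inj_of_inj0:
 assumes X: "is_rep n X" and Y: "is_rep n Y" and m: "a_mono n X" and f: "rep_hom n X Y f"
  and i: "inj_mat (f 0)" and v: "v < n"
 shows "inj_mat (f v)"
 unfolding inj_mat_def
proof (intro ballI impI)
 have n: "0 < n" using v by simp
 fix x assume "x \<in> cvec (dim_col (f v))" and z: "f v *v x = 0v (dim_row (f v))"
 hence x: "x \<in> Sp X v" using hom_mat[OF f v] by auto
 have "f 0 *v inc X v x = 0v (vdim Y 0)"
  using hom_inc[OF X Y f v x] z lin0[OF lin_inc[OF Y v]] hom_mat[OF f v] by simp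
 hence "inc X v x = 0v (vdim X 0)"
  using i linD(1)[OF lin_inc[OF X v] x] hom_mat[OF f n] unfolding inj_mat_def by auto
 thus "x = 0v (dim_col (f v))"
  using inc_inj[OF X m v x] hom_mat[OF f v] by simp
qed

lemma iso_inverse:
 assumes "iso_mor n X Y f"
 obtains g where "iso_mor n Y X g" "!!v x. v < n ==> x \<in> Sp X v ==> g v *v (f v *v x) = x"
  "!!v y. v < n ==> y \<in> Sp Y v ==> f v *v (g v *v y) = y"
proof -
 from assms obtain g where f: "rep_hom n X Y f" and g: "rep_hom n Y X g"
  and gf: "mor_eq n (g oR f) (mor_id X)" and fg: "mor_eq n (f oR g) (mor_id Y)"
  unfolding iso_mor_def by auto
 have "iso_mor n Y X g" unfolding iso_mor_def using f g gf fg by auto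
 moreover have "g v *v (f v *v x) = x" if "v < n" "x \<in> Sp X v" for v x
  using comp_vec[OF f g that] eq_vec[OF gf that(1), of x] mor_id_vec[OF that(2)] by simp
 moreover have "f v *v (g v *v x) = x" if "v < n" "x \<in> Sp Y v" for v x
  using comp_vec[OF g f that] eq_vec[OF fg that(1), of x] mor_id_vec[OF that(2)] by simp
 ultimately show ?thesis using that by blast
qed

lemma iso_inj:
 assumes "iso_mor n X Y f" "v < n"
 shows "inj_mat (f v)"
proof -
 obtain g where g: "!!x. x \<in> Sp X v ==> g v *v (f v *v x) = x" and gi: "iso_mor n Y X g"
  using iso_inverse[OF assms(1)] assms(2) by metis
 have f: "f v \<in> carrier_mat (vdim Y v) (vdim X v)" and gc: "g v \<in> carrier_mat (vdim X v) (vdim Y v)"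
  using assms gi hom_mat unfolding iso_mor_def by auto
 show ?thesis
  unfolding inj_mat_def using f gc g lin0[OF linmap_mat[OF gc]] by (metis carrier_matD)
qed

lemma iso_hom: "iso_mor n X Y f ==> rep_hom n X Y f"
 by (simp add: iso_mor_def)

lemma iso_dim:
 assumes "iso_mor n X Y f" "v < n"
 shows "vdim X v = vdim Y v"
proof -
 obtain g where g: "iso_mor n Y X g" using iso_inverse[OF assms(1)] by metis
 show ?thesis
  using inj_dim_le[OF hom_mat[OF iso_hom[OF g] assms(2)] iso_inj[OF g assms(2)]]
   inj_dim_le[OF hom_mat[OF iso_hom[OF assms(1)] assms(2)] iso_inj[OF assms]] by simp
qed

lemma iso_comp:
 assumes X: "is_rep n X" and Y: "is_rep n Y" and Z: "is_rep n Z"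
  and f: "iso_mor n X Y f" and g: "iso_mor n Y Z g"
 shows "iso_mor n X Z (g oR f)"
proof (rule iso_of_inj[OF X Z hom_comp[OF X Y Z iso_hom[OF f] iso_hom[OF g]]])
 fix v assume v: "v < n"
 show "vdim X v = vdim Z v" using iso_dim[OF f v] iso_dim[OF g v] by simp
 note cf = hom_mat[OF iso_hom[OF f] v] and cg = hom_mat[OF iso_hom[OF g] v]
 show "inj_mat ((g oR f) v)"
  unfolding inj_mat_def
 proof (intro ballI impI)
  fix x assume "x \<in> cvec (dim_col ((g oR f) v))" and z: "(g oR f) v *v x = 0v (dim_row ((g oR f) v))"
  hence x: "x \<in> Sp X v" using cf by (simp add: mor_comp_def)
  have "g v *v (f v *v x) = 0v (vdim Z v)"
   using z comp_vec[OF iso_hom[OF f] iso_hom[OF g] v x] cg by (simp add: mor_comp_def)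
  hence "f v *v x = 0v (vdim Y v)"
   using iso_inj[OF g v] cg hom_vec[OF iso_hom[OF f] v x] unfolding inj_mat_def by auto
  thus "x = 0v (dim_col ((g oR f) v))"
   using iso_inj[OF f v] cf x unfolding inj_mat_def by (auto simp: mor_comp_def)
 qed
qed

lemma iso_id: "is_rep n X ==> iso_mor n X X (mor_id X)"
 unfolding iso_mor_def using rep_hom_id[of n X]
 by (intro conjI exI[of _ "mor_id X"]) (auto simp: mor_eq_def mor_comp_def mor_id_def)



section \<open>Block vectors\<close>

lemma vec_splitE:
 assumes "(x :: complex vec) \<in> cvec (p + q)"
 obtains a b where "a \<in> cvec p" "b \<in> cvec q" "x = a @v b"
 using assms vec_first_last_append[of x p q] vec_first_carrier vec_last_carrier by metis

lemma append_vec_zero_iff: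
 assumes "a \<in> cvec p" "b \<in> cvec q"
 shows "a @v b = 0v (p + q) \<longleftrightarrow> a = 0v p \<and> (b :: complex vec) = 0v q"
proof -
 have "0v (p + q) = 0v p @v (0v q :: complex vec)" by (intro eq_vecI) auto
 thus ?thesis using append_vec_eq[OF assms(1), of "0v p"] by auto
qed

lemma zero_append: "0v p @v (0v q :: complex vec) = 0v (p + q)"
 by (intro eq_vecI) auto

lemma append_add:
 assumes "a \<in> cvec p" "a' \<in> cvec p" "b \<in> cvec q" "b' \<in> cvec q"
 shows "(a @v b) + (a' @v b') = (a + a') @v ((b :: complex vec) + b')"
 using assms by (intro eq_vecI) auto

lemma append_smult: "c *s (a @v b) = (c *s a) @v (c *s (b :: complex vec))"
 by (intro eq_vecI) auto

lemma vec_first_append [simp]: "a \<in> cvec p ==> vec_first (a @v (b :: complex vec)) p = a"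
 by (intro eq_vecI) (auto simp: vec_first_def)

lemma vec_last_append [simp]:
 "b \<in> cvec q ==> vec_last ((a :: complex vec) @v b) q = b"
 by (intro eq_vecI) (auto simp: vec_last_def)

lemma linmap_first: "linmap (p + q) p (\<lambda>x. vec_first x p)"
 unfolding linmap_def by (auto intro!: eq_vecI simp: vec_first_def)

lemma linmap_last: "linmap (p + q) q (\<lambda>x. vec_last x q)"
 unfolding linmap_def by (auto intro!: eq_vecI simp: vec_last_def)

lemma linmap_append:
 assumes F: "linmap r p F" and G: "linmap r q G"
 shows "linmap r (p + q) (\<lambda>x. F x @v G x)"
 unfolding linmap_def
proof (intro conjI ballI allI)
 fix x y :: "complex vec" and c :: complex assume x: "x \<in> cvec r" and y: "y \<in> cvec r"
 note c = linD(1)[OF F x] linD(1)[OF F y] linD(1)[OF G x] linD(1)[OF G y]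
 show "F x @v G x \<in> cvec (p + q)" using c by simp
 show "F (x + y) @v G (x + y) = (F x @v G x) + (F y @v G y)"
  unfolding linD(2)[OF F x y] linD(2)[OF G x y] append_add[OF c] ..
 show "F (c *s x) @v G (c *s x) = c *s (F x @v G x)"
  unfolding linD(3)[OF F x] linD(3)[OF G x] append_smult ..
qed

lemma linmap_zero_fun: "linmap q p (\<lambda>_. 0v p)"
 unfolding linmap_def by auto

lemma block_diag_vec:
 assumes "A \<in> carrier_mat p q" "B \<in> carrier_mat p' q'" "a \<in> cvec q" "b \<in> cvec q'"
 shows "block_diag A B *v (a @v b) = (A *v a) @v (B *v b)"
proof -
 have e: "A *v a + 0v p = A *v a" "0v p' + B *v b = B *v b" using assms by auto
 show ?thesis
  unfolding block_diag_def
  using four_block_mat_mult_vec[OF assms(1) _ _ assms(2-4), of "0\<^sub>m p q'" "0\<^sub>m p' q"] assms e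
  by (simp add: zero_mv)
qed

lemma block_diag_carrier:
 "A \<in> carrier_mat p q ==> B \<in> carrier_mat p' q' ==> block_diag A B \<in> carrier_mat (p + p') (q + q')"
 unfolding block_diag_def by auto

section \<open>Extensions given by cocycles\<close>

text \<open>
 A short exact sequence \<open>0 \<rightarrow> N \<rightarrow> E \<rightarrow> M \<rightarrow> 0\<close> splits at each vertex, so \<open>E\<close> is \<open>N \<oplus> M\<close> with
 the arrows acting by upper triangular block matrices.
\<close>

definition cext :: "rep => rep => (nat => complex mat) => (nat => complex mat) => rep" where
 "cext N M al bt = \<lparr> vdim = (\<lambda>i. vdim N i + vdim M i),
   amap = (\<lambda>i. four_block_mat (amap N i) (al i) (0\<^sub>m (dim_row (amap M i)) (dim_col (amap N i))) (amap M i)),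
   bmap = (\<lambda>i. four_block_mat (bmap N i) (bt i) (0\<^sub>m (dim_row (bmap M i)) (dim_col (bmap N i))) (bmap M i)) \<rparr>"

definition cocycle :: "nat => rep => rep => (nat => complex mat) => (nat => complex mat) => bool" where
 "cocycle n N M al bt \<longleftrightarrow>
   (\<forall>v. Suc v < n --> al (Suc v) \<in> carrier_mat (vdim N v) (vdim M (Suc v)) \<and>
    bt (Suc v) \<in> carrier_mat (vdim N (Suc v)) (vdim M v)) \<and>
   (\<forall>v. \<forall>w\<in>Sp M (Suc v). n = Suc (Suc v) -->
    bmap N (Suc v) *v (al (Suc v) *v w) + bt (Suc v) *v (amap M (Suc v) *v w) = 0v (vdim N (Suc v))) \<and>
   (\<forall>v. \<forall>w\<in>Sp M (Suc v). Suc (Suc v) < n -->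
    amap N (Suc (Suc v)) *v (bt (Suc (Suc v)) *v w) + al (Suc (Suc v)) *v (bmap M (Suc (Suc v)) *v w) =
    bmap N (Suc v) *v (al (Suc v) *v w) + bt (Suc v) *v (amap M (Suc v) *v w))"

lemma cocycle_carrier:
 assumes "cocycle n N M al bt" "Suc v < n"
 shows "al (Suc v) \<in> carrier_mat (vdim N v) (vdim M (Suc v))"
  "bt (Suc v) \<in> carrier_mat (vdim N (Suc v)) (vdim M v)"
 using assms unfolding cocycle_def by auto

lemma vdim_cext [simp]: "vdim (cext N M al bt) v = vdim N v + vdim M v"
 by (simp add: cext_def)

lemma vdim_dsum [simp]: "vdim (X +R Y) v = vdim X v + vdim Y v"
 by (simp add: dsum_def)

lemma four_block_upper_vec:
 assumes "A \<in> carrier_mat p q" "B \<in> carrier_mat p q'" "D \<in> carrier_mat p' q'"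
  "a \<in> cvec q" "d \<in> cvec q'"
 shows "four_block_mat A B (0\<^sub>m (dim_row D) (dim_col A)) D *v (a @v d) =
  (A *v a + B *v d) @v ((D :: complex mat) *v d)"
proof -
 have e: "0v p' + D *v d = D *v d" using assms by auto
 show ?thesis
  using four_block_mat_mult_vec[OF assms(1,2) _ assms(3-5), of "0\<^sub>m p' q"] assms e by (simp add: zero_mv)
qed

lemma cext_a:
 assumes N: "is_rep n N" and M: "is_rep n M" and c: "cocycle n N M al bt" and v: "Suc v < n"
  and "x \<in> Sp N (Suc v)" "y \<in> Sp M (Suc v)"
 shows "amap (cext N M al bt) (Suc v) *v (x @v y) =
  (amap N (Suc v) *v x + al (Suc v) *v y) @v (amap M (Suc v) *v y)"
 unfolding cext_def
 using four_block_upper_vec[OF is_rep_carrier(1)[OF N v] cocycle_carrier(1)[OF c v] is_rep_carrier(1)[OF M v] assms(5,6)]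
 by simp

lemma cext_b:
 assumes N: "is_rep n N" and M: "is_rep n M" and c: "cocycle n N M al bt" and v: "Suc v < n"
  and "x \<in> Sp N v" "y \<in> Sp M v"
 shows "bmap (cext N M al bt) (Suc v) *v (x @v y) =
  (bmap N (Suc v) *v x + bt (Suc v) *v y) @v (bmap M (Suc v) *v y)"
 unfolding cext_def
 using four_block_upper_vec[OF is_rep_carrier(2)[OF N v] cocycle_carrier(2)[OF c v] is_rep_carrier(2)[OF M v] assms(5,6)]
 by simp

lemma cext_rep:
 assumes n: "1 < n" and N: "is_rep n N" and M: "is_rep n M" and c: "cocycle n N M al bt"
 shows "is_rep n (cext N M al bt)"
proof (rule is_repI[OF n])
 fix v assume v: "Suc v < n"
 note cc = is_rep_carrier[OF N v] is_rep_carrier[OF M v] cocycle_carrier[OF c v]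
 show "amap (cext N M al bt) (Suc v) \<in> carrier_mat (vdim (cext N M al bt) v) (vdim (cext N M al bt) (Suc v))"
  "bmap (cext N M al bt) (Suc v) \<in> carrier_mat (vdim (cext N M al bt) (Suc v)) (vdim (cext N M al bt) v)"
  using cc by (auto simp: cext_def)
next
 fix v and w :: "complex vec" assume nv: "n = Suc (Suc v)" and w: "w \<in> Sp (cext N M al bt) (Suc v)"
 hence v: "Suc v < n" by simp
 obtain x y where xy: "x \<in> Sp N (Suc v)" "y \<in> Sp M (Suc v)" "w = x @v y"
  by (rule vec_splitE[OF w[unfolded vdim_cext]])
 note ax = rep_act(1)[OF N v xy(1)] and ay = rep_act(1)[OF M v xy(2)]
 have aly: "al (Suc v) *v y \<in> Sp N v" and bty: "bt (Suc v) *v (amap M (Suc v) *v y) \<in> Sp N (Suc v)"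
  using cocycle_carrier[OF c v] xy ay by auto
 note bal = rep_act(2)[OF N v aly]
 have "bmap N (Suc v) *v (amap N (Suc v) *v x + al (Suc v) *v y) + bt (Suc v) *v (amap M (Suc v) *v y)
   = 0v (vdim N (Suc v)) + (bmap N (Suc v) *v (al (Suc v) *v y) + bt (Suc v) *v (amap M (Suc v) *v y))"
  using linD(2)[OF linmap_act(2)[OF N v] ax aly] rep_top_vec[OF N nv xy(1)] bal bty
  by (simp add: assoc_add_vec[of _ "vdim N (Suc v)"])
 also have "\<dots> = 0v (vdim N (Suc v))"
  using c nv xy(2) unfolding cocycle_def by simp
 finally show "bmap (cext N M al bt) (Suc v) *v (amap (cext N M al bt) (Suc v) *v w) = 0v (vdim (cext N M al bt) (Suc v))"
  unfolding xy(3) cext_a[OF N M c v xy(1,2)]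
  using cext_b[OF N M c v, of "amap N (Suc v) *v x + al (Suc v) *v y"] ax ay aly
   rep_top_vec[OF M nv xy(2)] by (simp add: zero_append)
next
 fix v and w :: "complex vec" assume v: "Suc (Suc v) < n" and w: "w \<in> Sp (cext N M al bt) (Suc v)"
 note v' = Suc_lessD[OF v]
 obtain x y where xy: "x \<in> Sp N (Suc v)" "y \<in> Sp M (Suc v)" "w = x @v y"
  by (rule vec_splitE[OF w[unfolded vdim_cext]])
 note ax = rep_act(1)[OF N v' xy(1)] and ay = rep_act(1)[OF M v' xy(2)]
 note bx = rep_act(2)[OF N v xy(1)] and bey = rep_act(2)[OF M v xy(2)]
 have aly: "al (Suc v) *v y \<in> Sp N v" and bty: "bt (Suc v) *v (amap M (Suc v) *v y) \<in> Sp N (Suc v)"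
  and bty2: "bt (Suc (Suc v)) *v y \<in> Sp N (Suc (Suc v))"
  and aly2: "al (Suc (Suc v)) *v (bmap M (Suc (Suc v)) *v y) \<in> Sp N (Suc v)"
  using cocycle_carrier[OF c v] cocycle_carrier[OF c v'] xy ay bey by auto
 note bal = rep_act(2)[OF N v' aly] and abt = rep_act(1)[OF N v bty2]
  and bax = rep_act(2)[OF N v' ax]
 have coc: "amap N (Suc (Suc v)) *v (bt (Suc (Suc v)) *v y) + al (Suc (Suc v)) *v (bmap M (Suc (Suc v)) *v y) =
    bmap N (Suc v) *v (al (Suc v) *v y) + bt (Suc v) *v (amap M (Suc v) *v y)"
  using c v xy(2) unfolding cocycle_def by blast
 have "amap N (Suc (Suc v)) *v (bmap N (Suc (Suc v)) *v x + bt (Suc (Suc v)) *v y) + al (Suc (Suc v)) *v (bmap M (Suc (Suc v)) *v y)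
  = bmap N (Suc v) *v (amap N (Suc v) *v x) + (bmap N (Suc v) *v (al (Suc v) *v y) + bt (Suc v) *v (amap M (Suc v) *v y))"
  unfolding coc[symmetric] linD(2)[OF linmap_act(1)[OF N v] bx bty2] rep_comm_vec[OF N v xy(1)]
  using bax abt aly2 by (simp add: assoc_add_vec[of _ "vdim N (Suc v)"])
 also have "\<dots> = bmap N (Suc v) *v (amap N (Suc v) *v x + al (Suc v) *v y) + bt (Suc v) *v (amap M (Suc v) *v y)"
  unfolding linD(2)[OF linmap_act(2)[OF N v'] ax aly]
  using bax bal bty by (simp add: assoc_add_vec[of _ "vdim N (Suc v)"])
 finally show "amap (cext N M al bt) (Suc (Suc v)) *v (bmap (cext N M al bt) (Suc (Suc v)) *v w) =
    bmap (cext N M al bt) (Suc v) *v (amap (cext N M al bt) (Suc v) *v w)"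
  unfolding xy(3) cext_a[OF N M c v' xy(1,2)] cext_b[OF N M c v xy(1,2)]
  using cext_b[OF N M c v', of "amap N (Suc v) *v x + al (Suc v) *v y"] ax ay aly bx bey bty2
   cext_a[OF N M c v, of "bmap N (Suc (Suc v)) *v x + bt (Suc (Suc v)) *v y"]
   rep_comm_vec[OF M v xy(2)] by simp
qed

definition zero_coc :: "(rep => nat => complex mat) => rep => rep => nat => complex mat" where
 "zero_coc act N M i = 0\<^sub>m (dim_row (act N i)) (dim_col (act M i))"

lemma dsum_cext: "N +R M = cext N M (zero_coc amap N M) (zero_coc bmap N M)"
 by (simp add: dsum_def cext_def block_diag_def zero_coc_def)

lemma cocycle_zero:
 assumes N: "is_rep n N" and M: "is_rep n M"
 shows "cocycle n N M (zero_coc amap N M) (zero_coc bmap N M)"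
proof -
 have z: "zero_coc amap N M (Suc v) = 0\<^sub>m (vdim N v) (vdim M (Suc v))"
  "zero_coc bmap N M (Suc v) = 0\<^sub>m (vdim N (Suc v)) (vdim M v)" if "Suc v < n" for v
  using is_rep_carrier[OF N that] is_rep_carrier[OF M that] by (auto simp: zero_coc_def)
 show ?thesis
  unfolding cocycle_def
 proof (intro conjI allI impI ballI)
  fix v and w :: "complex vec"
  show "bmap N (Suc v) *v (zero_coc amap N M (Suc v) *v w) +
    zero_coc bmap N M (Suc v) *v (amap M (Suc v) *v w) = 0v (vdim N (Suc v))"
   if w: "w \<in> Sp M (Suc v)" and nv: "n = Suc (Suc v)"
  proof -
   have v: "Suc v < n" using nv by simp
   show ?thesis
    using z[OF v] zero_mv[OF w] zero_mv[OF rep_act(1)[OF M v w]] lin0[OF linmap_act(2)[OF N v]] by simp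
  qed
  show "amap N (Suc (Suc v)) *v (zero_coc bmap N M (Suc (Suc v)) *v w) +
    zero_coc amap N M (Suc (Suc v)) *v (bmap M (Suc (Suc v)) *v w) =
    bmap N (Suc v) *v (zero_coc amap N M (Suc v) *v w) +
    zero_coc bmap N M (Suc v) *v (amap M (Suc v) *v w)"
   if w: "w \<in> Sp M (Suc v)" and v: "Suc (Suc v) < n"
  proof -
   note v' = Suc_lessD[OF v]
   show ?thesis
    using z[OF v'] z[OF v] zero_mv[OF w] zero_mv[OF rep_act(1)[OF M v' w]] zero_mv[OF rep_act(2)[OF M v w]]
     lin0[OF linmap_act(2)[OF N v']] lin0[OF linmap_act(1)[OF N v]] by simp
  qed
 qed (simp_all add: z)
qed

lemma dsum_rep: "1 < n ==> is_rep n N ==> is_rep n M ==> is_rep n (N +R M)"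
 unfolding dsum_cext using cext_rep cocycle_zero by blast

lemma dsum_a:
 assumes N: "is_rep n N" and M: "is_rep n M" and v: "Suc v < n"
  and "x \<in> Sp N (Suc v)" "y \<in> Sp M (Suc v)"
 shows "amap (N +R M) (Suc v) *v (x @v y) = (amap N (Suc v) *v x) @v (amap M (Suc v) *v y)"
 using block_diag_vec[OF is_rep_carrier(1)[OF N v] is_rep_carrier(1)[OF M v] assms(4,5)]
 by (simp add: dsum_def)

lemma dsum_b:
 assumes N: "is_rep n N" and M: "is_rep n M" and v: "Suc v < n"
  and "x \<in> Sp N v" "y \<in> Sp M v"
 shows "bmap (N +R M) (Suc v) *v (x @v y) = (bmap N (Suc v) *v x) @v (bmap M (Suc v) *v y)"
 using block_diag_vec[OF is_rep_carrier(2)[OF N v] is_rep_carrier(2)[OF M v] assms(4,5)]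
 by (simp add: dsum_def)

text \<open>
The morphisms \<open>in1\<close> and \<open>pr2\<close> serve all cocycle extensions at once, the direct sum
being the one with cocycle zero.
\<close>

definition in1 :: "rep => rep => rmor" where
 "in1 N M v = mat_of_fun (vdim N v) (vdim N v + vdim M v) (\<lambda>x. x @v 0v (vdim M v))"

definition pr2 :: "rep => rep => rmor" where
 "pr2 N M v = mat_of_fun (vdim N v + vdim M v) (vdim M v) (\<lambda>x. vec_last x (vdim M v))"

definition hpair :: "rep => rep => rep => rmor => rmor => rmor" where
 "hpair X Y Z f g v = mat_of_fun (vdim X v) (vdim Y v + vdim Z v) (\<lambda>x. (f v *v x) @v (g v *v x))"

definition hcopair :: "rep => rep => rep => rmor => rmor => rmor" where
 "hcopair X Y Z f g v = mat_of_fun (vdim X v + vdim Y v) (vdim Z v)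
   (\<lambda>w. f v *v vec_first w (vdim X v) + g v *v vec_last w (vdim Y v))"

lemma in1_vec: "x \<in> Sp N v ==> in1 N M v *v x = x @v 0v (vdim M v)"
 unfolding in1_def by (rule mat_of_fun_mult[OF linmap_append[OF linmap_id linmap_zero_fun]])

lemma pr2_vec:
 assumes "x \<in> Sp N v" "y \<in> Sp M v"
 shows "pr2 N M v *v (x @v y) = y"
 unfolding pr2_def using mat_of_fun_mult[OF linmap_last, of "x @v y"] assms by simp

lemma hpair_vec:
 assumes "f v \<in> carrier_mat (vdim Y v) (vdim X v)" "g v \<in> carrier_mat (vdim Z v) (vdim X v)"
  "x \<in> Sp X v"
 shows "hpair X Y Z f g v *v x = (f v *v x) @v (g v *v x)"
 unfolding hpair_def
 by (rule mat_of_fun_mult[OF linmap_append[OF linmap_mat[OF assms(1)] linmap_mat[OF assms(2)]] assms(3)])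

lemma hcopair_vec:
 assumes "f v \<in> carrier_mat (vdim Z v) (vdim X v)" "g v \<in> carrier_mat (vdim Z v) (vdim Y v)"
  "x \<in> Sp X v" "y \<in> Sp Y v"
 shows "hcopair X Y Z f g v *v (x @v y) = f v *v x + g v *v y"
 unfolding hcopair_def
 using mat_of_fun_mult[OF linmap_add[OF lin_comp[OF linmap_first linmap_mat[OF assms(1)]]
   lin_comp[OF linmap_last linmap_mat[OF assms(2)]]], of "x @v y"] assms by simp

lemma in1_hom:
 assumes n: "1 < n" and N: "is_rep n N" and M: "is_rep n M" and c: "cocycle n N M al bt"
 shows "rep_hom n N (cext N M al bt) (in1 N M)"
proof (rule rep_homI[OF N cext_rep[OF assms]])
 fix v and w :: "complex vec" assume v: "Suc v < n"
 note v' = Suc_lessD[OF v]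
 show "in1 N M v *v (amap N (Suc v) *v w) = amap (cext N M al bt) (Suc v) *v (in1 N M (Suc v) *v w)"
  if w: "w \<in> Sp N (Suc v)"
  using in1_vec[OF w] in1_vec[OF rep_act(1)[OF N v w]] cext_a[OF N M c v w, of "0v (vdim M (Suc v))"]
   lin0[OF linmap_act(1)[OF M v]] lin0[OF linmap_mat[OF cocycle_carrier(1)[OF c v]]]
   rep_act(1)[OF N v w] by simp
 show "in1 N M (Suc v) *v (bmap N (Suc v) *v w) = bmap (cext N M al bt) (Suc v) *v (in1 N M v *v w)"
  if w: "w \<in> Sp N v"
  using in1_vec[OF w] in1_vec[OF rep_act(2)[OF N v w]] cext_b[OF N M c v w, of "0v (vdim M v)"]
   lin0[OF linmap_act(2)[OF M v]] lin0[OF linmap_mat[OF cocycle_carrier(2)[OF c v]]]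
   rep_act(2)[OF N v w] by simp
qed (simp add: in1_def)

lemma pr2_hom:
 assumes n: "1 < n" and N: "is_rep n N" and M: "is_rep n M" and c: "cocycle n N M al bt"
 shows "rep_hom n (cext N M al bt) M (pr2 N M)"
proof (rule rep_homI[OF cext_rep[OF assms] M])
 fix v and w :: "complex vec" assume v: "Suc v < n"
 note v' = Suc_lessD[OF v]
 show "pr2 N M v *v (amap (cext N M al bt) (Suc v) *v w) = amap M (Suc v) *v (pr2 N M (Suc v) *v w)"
  if w: "w \<in> Sp (cext N M al bt) (Suc v)"
 proof -
  obtain x y where xy: "x \<in> Sp N (Suc v)" "y \<in> Sp M (Suc v)" "w = x @v y"
   by (rule vec_splitE[OF w[unfolded vdim_cext]])
  show ?thesis
   unfolding xy(3) cext_a[OF N M c v xy(1,2)] pr2_vec[OF xy(1,2)]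
   using cocycle_carrier(1)[OF c v] xy rep_act(1)[OF N v xy(1)] rep_act(1)[OF M v xy(2)] by (intro pr2_vec) auto
 qed
 show "pr2 N M (Suc v) *v (bmap (cext N M al bt) (Suc v) *v w) = bmap M (Suc v) *v (pr2 N M v *v w)"
  if w: "w \<in> Sp (cext N M al bt) v"
 proof -
  obtain x y where xy: "x \<in> Sp N v" "y \<in> Sp M v" "w = x @v y"
   by (rule vec_splitE[OF w[unfolded vdim_cext]])
  show ?thesis
   unfolding xy(3) cext_b[OF N M c v xy(1,2)] pr2_vec[OF xy(1,2)]
   using cocycle_carrier(2)[OF c v] xy rep_act(2)[OF N v xy(1)] rep_act(2)[OF M v xy(2)] by (intro pr2_vec) auto
 qed
qed (simp add: pr2_def)

lemma hpair_hom:
 assumes n: "1 < n" and X: "is_rep n X" and Y: "is_rep n Y" and Z: "is_rep n Z"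
  and f: "rep_hom n X Y f" and g: "rep_hom n X Z g"
 shows "rep_hom n X (Y +R Z) (hpair X Y Z f g)"
proof (rule rep_homI[OF X dsum_rep[OF n Y Z]])
 have hv: "hpair X Y Z f g v *v x = (f v *v x) @v (g v *v x)" if "v < n" "x \<in> Sp X v" for v x
  using hpair_vec that hom_mat[OF f that(1)] hom_mat[OF g that(1)] by blast
 fix v and w :: "complex vec" assume v: "Suc v < n"
 note v' = Suc_lessD[OF v]
 show "hpair X Y Z f g v *v (amap X (Suc v) *v w) = amap (Y +R Z) (Suc v) *v (hpair X Y Z f g (Suc v) *v w)"
  if w: "w \<in> Sp X (Suc v)"
  unfolding hv[OF v w] hv[OF v' rep_act(1)[OF X v w]] dsum_a[OF Y Z v hom_vec[OF f v w] hom_vec[OF g v w]]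
   rep_hom_a[OF X Y f v w] rep_hom_a[OF X Z g v w] ..
 show "hpair X Y Z f g (Suc v) *v (bmap X (Suc v) *v w) = bmap (Y +R Z) (Suc v) *v (hpair X Y Z f g v *v w)"
  if w: "w \<in> Sp X v"
  unfolding hv[OF v' w] hv[OF v rep_act(2)[OF X v w]] dsum_b[OF Y Z v hom_vec[OF f v' w] hom_vec[OF g v' w]]
   rep_hom_b[OF X Y f v w] rep_hom_b[OF X Z g v w] ..
qed (simp add: hpair_def)

lemma hcopair_hom:
 assumes n: "1 < n" and X: "is_rep n X" and Y: "is_rep n Y" and Z: "is_rep n Z"
  and f: "rep_hom n X Z f" and g: "rep_hom n Y Z g"
 shows "rep_hom n (X +R Y) Z (hcopair X Y Z f g)"
proof (rule rep_homI[OF dsum_rep[OF n X Y] Z])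
 have hv: "hcopair X Y Z f g v *v (x @v y) = f v *v x + g v *v y"
  if "v < n" "x \<in> Sp X v" "y \<in> Sp Y v" for v x y
  using hcopair_vec that hom_mat[OF f that(1)] hom_mat[OF g that(1)] by blast
 fix v and w :: "complex vec" assume v: "Suc v < n"
 note v' = Suc_lessD[OF v]
 show "hcopair X Y Z f g v *v (amap (X +R Y) (Suc v) *v w) = amap Z (Suc v) *v (hcopair X Y Z f g (Suc v) *v w)"
  if w: "w \<in> Sp (X +R Y) (Suc v)"
 proof -
  obtain x y where xy: "x \<in> Sp X (Suc v)" "y \<in> Sp Y (Suc v)" "w = x @v y"
   by (rule vec_splitE[OF w[unfolded vdim_dsum]])
  show ?thesis
   unfolding xy(3) dsum_a[OF X Y v xy(1,2)] hv[OF v xy(1,2)]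
    hv[OF v' rep_act(1)[OF X v xy(1)] rep_act(1)[OF Y v xy(2)]]
    rep_hom_a[OF X Z f v xy(1)] rep_hom_a[OF Y Z g v xy(2)]
    linD(2)[OF linmap_act(1)[OF Z v] hom_vec[OF f v xy(1)] hom_vec[OF g v xy(2)]] ..
 qed
 show "hcopair X Y Z f g (Suc v) *v (bmap (X +R Y) (Suc v) *v w) = bmap Z (Suc v) *v (hcopair X Y Z f g v *v w)"
  if w: "w \<in> Sp (X +R Y) v"
 proof -
  obtain x y where xy: "x \<in> Sp X v" "y \<in> Sp Y v" "w = x @v y"
   by (rule vec_splitE[OF w[unfolded vdim_dsum]])
  show ?thesis
   unfolding xy(3) dsum_b[OF X Y v xy(1,2)] hv[OF v' xy(1,2)]
    hv[OF v rep_act(2)[OF X v xy(1)] rep_act(2)[OF Y v xy(2)]]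
    rep_hom_b[OF X Z f v xy(1)] rep_hom_b[OF Y Z g v xy(2)]
    linD(2)[OF linmap_act(2)[OF Z v] hom_vec[OF f v' xy(1)] hom_vec[OF g v' xy(2)]] ..
 qed
qed (simp add: hcopair_def)

lemma inc_dsum:
 assumes X: "is_rep n X" and Y: "is_rep n Y" and v: "v < n"
  and "x \<in> Sp X v" "y \<in> Sp Y v"
 shows "inc (X +R Y) v (x @v y) = inc X v x @v inc Y v y"
 using v assms(4,5)
proof (induction v arbitrary: x y)
 case (Suc v)
 thus ?case
  using dsum_a[OF X Y Suc.prems] Suc.IH[OF Suc_lessD[OF Suc.prems(1)] rep_act(1)[OF X Suc.prems(1,2)]
    rep_act(1)[OF Y Suc.prems(1,3)]] by simp
qed simp

lemma tt_dsum:
 assumes X: "is_rep n X" and Y: "is_rep n Y" and n: "1 < n"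
  and "x \<in> Sp X 0" "y \<in> Sp Y 0"
 shows "tt (X +R Y) (x @v y) = tt X x @v tt Y y"
 unfolding tt_def using dsum_b[OF X Y _ assms(4,5)] n
  dsum_a[OF X Y _ rep_act(2)[OF X _ assms(4)] rep_act(2)[OF Y _ assms(5)]] by simp

lemma tt_dsum_pow:
 assumes X: "is_rep n X" and Y: "is_rep n Y" and n: "1 < n"
  and "x \<in> Sp X 0" "y \<in> Sp Y 0"
 shows "(tt (X +R Y) ^^ k) (x @v y) = (tt X ^^ k) x @v (tt Y ^^ k) y"
 using tt_dsum[OF X Y n linD(1)[OF linmap_funpow[OF lin_tt[OF X n]] assms(4)]
   linD(1)[OF linmap_funpow[OF lin_tt[OF Y n]] assms(5)]]
 by (induction k) auto



section \<open>Short exact sequences\<close>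

lemma short_exactI:
 assumes X: "is_rep n X" and Y: "is_rep n Y" and Z: "is_rep n Z"
  and f: "rep_hom n X Y f" and g: "rep_hom n Y Z g"
  and inj: "!!v x. v < n ==> x \<in> Sp X v ==> f v *v x = 0v (vdim Y v) ==> x = 0v (vdim X v)"
  and gf: "!!v x. v < n ==> x \<in> Sp X v ==> g v *v (f v *v x) = 0v (vdim Z v)"
  and ker: "!!v y. v < n ==> y \<in> Sp Y v ==> g v *v y = 0v (vdim Z v) ==>
   \<exists>x\<in>Sp X v. y = f v *v x"
  and surj: "!!v z. v < n ==> z \<in> Sp Z v ==> \<exists>y\<in>Sp Y v. g v *v y = z"
 shows "short_exact n X Y Z f g"
 unfolding short_exact_def exact_on_def vspace_def
proof (intro conjI X Y Z f g allI impI)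
 fix v assume v: "v < n"
 note cf = hom_mat[OF f v] and cg = hom_mat[OF g v]
 have "inj_mat (f v)" unfolding inj_mat_def using inj[OF v] cf by auto
 thus "inj_on ((*v) (f v)) (Sp X v)"
  using inj_mat_iff[OF cf] by simp
 show "(*v) (f v) ` Sp X v = {w \<in> Sp Y v. g v *v w = 0v (dim_row (g v))}"
  using ker[OF v] gf[OF v] hom_vec[OF f v] cg by auto
 show "(*v) (g v) ` Sp Y v = Sp Z v"
  using surj[OF v] hom_vec[OF g v] by (fastforce simp: image_iff)
qed

lemma seqD:
 assumes "short_exact n X Y Z f g"
 shows "is_rep n X" "is_rep n Y" "is_rep n Z" "rep_hom n X Y f" "rep_hom n Y Z g"
  "!!v x. v < n ==> x \<in> Sp X v ==> f v *v x = 0v (vdim Y v) ==> x = 0v (vdim X v)"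
  "!!v x. v < n ==> x \<in> Sp X v ==> g v *v (f v *v x) = 0v (vdim Z v)"
  "!!v y. v < n ==> y \<in> Sp Y v ==> g v *v y = 0v (vdim Z v) ==>
   \<exists>x\<in>Sp X v. y = f v *v x"
  "!!v z. v < n ==> z \<in> Sp Z v ==> \<exists>y\<in>Sp Y v. g v *v y = z"
  "!!v. v < n ==> inj_mat (f v)"
proof -
 show h: "is_rep n X" "is_rep n Y" "is_rep n Z" "rep_hom n X Y f" "rep_hom n Y Z g"
  using assms unfolding short_exact_def by auto
 have ex: "inj_on ((*v) (f v)) (Sp X v)"
  "(*v) (f v) ` Sp X v = {w \<in> Sp Y v. g v *v w = 0v (dim_row (g v))}"
  "(*v) (g v) ` Sp Y v = Sp Z v" if "v < n" for v
  using assms that unfolding short_exact_def exact_on_def vspace_def by auto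
 fix v assume v: "v < n"
 note cf = hom_mat[OF h(4) v] and cg = hom_mat[OF h(5) v]
 show i: "inj_mat (f v)" using inj_mat_iff[OF cf] ex(1)[OF v] by simp
 show "x \<in> Sp X v ==> f v *v x = 0v (vdim Y v) ==> x = 0v (vdim X v)" for x
  using i cf unfolding inj_mat_def by auto
 show "x \<in> Sp X v ==> g v *v (f v *v x) = 0v (vdim Z v)" for x
  using ex(2)[OF v] cg by auto
 show "y \<in> Sp Y v ==> g v *v y = 0v (vdim Z v) ==> \<exists>x\<in>Sp X v. y = f v *v x" for y
 proof -
  assume "y \<in> Sp Y v" "g v *v y = 0v (vdim Z v)"
  hence "y \<in> (*v) (f v) ` Sp X v" unfolding ex(2)[OF v] using cg by simp
  thus ?thesis by auto
 qed
 show "z \<in> Sp Z v ==> \<exists>y\<in>Sp Y v. g v *v y = z" for z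
  unfolding ex(3)[OF v, symmetric] by auto
qed

text \<open>The vector \<open>y - s (g y)\<close> lies in the kernel of \<open>g\<close>.\<close>

lemma section_decomp:
 assumes e: "short_exact n X Y Z f g" and v: "v < n" and s: "linmap (vdim Z v) (vdim Y v) s"
  and gs: "!!z. z \<in> Sp Z v ==> g v *v s z = z" and y: "y \<in> Sp Y v"
 obtains x where "x \<in> Sp X v" "y = f v *v x + s (g v *v y)"
proof -
 note E = seqD[OF e]
 have gy: "g v *v y \<in> Sp Z v" by (rule hom_vec[OF E(5) v y])
 note sg = linD(1)[OF s gy]
 have "g v *v (y - s (g v *v y)) = 0v (vdim Z v)"
  using linmap_diff[OF hom_lin[OF E(5) v] y sg] gs[OF gy] gy by simp
 then obtain x where x: "x \<in> Sp X v" "y - s (g v *v y) = f v *v x"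
  using E(8)[OF v, of "y - s (g v *v y)"] y sg by auto
 have "y = (y - s (g v *v y)) + s (g v *v y)" using y sg by auto
 thus ?thesis using that x by simp
qed

lemma section_exists:
 assumes e: "short_exact n X Y Z f g" and v: "v < n"
 obtains s where "linmap (vdim Z v) (vdim Y v) s" "!!z. z \<in> Sp Z v ==> g v *v s z = z"
proof -
 note E = seqD[OF e]
 note cg = hom_mat[OF E(5) v]
 obtain B where B: "B \<in> carrier_mat (vdim Y v) (vdim Z v)" "g v * B = 1\<^sub>m (vdim Z v)"
  using linear_section[OF cg] E(9)[OF v] by metis
 show ?thesis
  using that[OF linmap_mat[OF B(1)]] assoc_mult_mat_vec[OF cg B(1)] B(2) by simp
qed

lemma short_exact_dim:
 assumes e: "short_exact n X Y Z f g" and v: "v < n"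
 shows "vdim Y v = vdim X v + vdim Z v"
proof -
 note E = seqD[OF e]
 obtain s where s: "linmap (vdim Z v) (vdim Y v) s" "!!z. z \<in> Sp Z v ==> g v *v s z = z"
  using section_exists[OF e v] by metis
 note cf = hom_mat[OF E(4) v] and cg = hom_mat[OF E(5) v]
 let ?F = "\<lambda>w. f v *v vec_first w (vdim X v) + s (vec_last w (vdim Z v))"
 have F: "linmap (vdim X v + vdim Z v) (vdim Y v) ?F"
  by (rule linmap_add[OF lin_comp[OF linmap_first linmap_mat[OF cf]] lin_comp[OF linmap_last s(1)]])
 define A where "A = mat_of_fun (vdim X v + vdim Z v) (vdim Y v) ?F"
 have A: "A \<in> carrier_mat (vdim Y v) (vdim X v + vdim Z v)" by (simp add: A_def)
 have Av: "A *v (x @v z) = f v *v x + s z" if "x \<in> Sp X v" "z \<in> Sp Z v" for x z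
  using mat_of_fun_mult[OF F, of "x @v z"] that by (simp add: A_def)
 have "inj_mat A"
  unfolding inj_mat_def
 proof (intro ballI impI)
  fix w assume w: "w \<in> cvec (dim_col A)" and z: "A *v w = 0v (dim_row A)"
  have w': "w \<in> cvec (vdim X v + vdim Z v)" using w A by simp
  obtain a b where ab: "a \<in> Sp X v" "b \<in> Sp Z v" "w = a @v b"
   by (rule vec_splitE[OF w'])
  have fs: "f v *v a + s b = 0v (vdim Y v)" using Av[OF ab(1,2)] z ab(3) A by simp
  have fa: "f v *v a \<in> Sp Y v" by (rule hom_vec[OF E(4) v ab(1)])
  have "g v *v (f v *v a + s b) = b"
   using linD(2)[OF linmap_mat[OF cg] fa linD(1)[OF s(1) ab(2)]] E(7)[OF v ab(1)] s(2)[OF ab(2)] ab(2) by simp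
  hence b: "b = 0v (vdim Z v)" unfolding fs using lin0[OF linmap_mat[OF cg]] by simp
  have "f v *v a = 0v (vdim Y v)" using fs lin0[OF s(1)] fa unfolding b by simp
  hence "a = 0v (vdim X v)" by (rule E(6)[OF v ab(1)])
  thus "w = 0v (dim_col A)" using ab(3) b A by (simp add: zero_append)
 qed
 from inj_dim_le[OF A this] have 1: "vdim X v + vdim Z v \<le> vdim Y v" .
 have "\<exists>w\<in>cvec (vdim X v + vdim Z v). A *v w = y" if y: "y \<in> Sp Y v" for y
 proof -
  obtain x where x: "x \<in> Sp X v" "y = f v *v x + s (g v *v y)"
   using section_decomp[OF e v s y] by metis
  show ?thesis
   using Av[OF x(1) hom_vec[OF E(5) v y]] x hom_vec[OF E(5) v y]
   by (intro bexI[of _ "x @v (g v *v y)"]) auto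
 qed
 from linear_section[OF A this] obtain B where
  B: "B \<in> carrier_mat (vdim X v + vdim Z v) (vdim Y v)" "A * B = 1\<^sub>m (vdim Y v)" by metis
 have "inj_mat B"
  unfolding inj_mat_def
 proof (intro ballI impI)
  fix y assume "y \<in> cvec (dim_col B)" and z: "B *v y = 0v (dim_row B)"
  hence y: "y \<in> Sp Y v" using B by simp
  have "y = A *v (B *v y)" using assoc_mult_mat_vec[OF A B(1) y] B(2) y by simp
  also have "\<dots> = 0v (vdim Y v)" unfolding z using B lin0[OF linmap_mat[OF A]] by simp
  finally show "y = 0v (dim_col B)" using B by simp
 qed
 from inj_dim_le[OF B(1) this] 1 show ?thesis by simp
qed

text \<open>
 If the sequence splits at vertex 0 compatibly with \<open>t\<close>, then \<open>\<eta>\<close> preserves its exactness: an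
 element \<open>b_v \<dots> b_1 y\<close> of \<open>\<eta>Y\<close> that dies in \<open>Z\<close> only depends on the \<open>X\<close>-component of \<open>y\<close>.
\<close>

lemma eta_exactI:
 assumes n: "1 < n" and e: "short_exact n X Y Z f g" and m: "a_mono n Y"
  and s: "linmap (vdim Z 0) (vdim Y 0) s"
  and gs: "!!z. z \<in> Sp Z 0 ==> g 0 *v s z = z"
  and st: "!!z. z \<in> Sp Z 0 ==> s (tt Z z) = tt Y (s z)"
 shows "exact_on n f g (eta n X) (eta n Y) (eta n Z)"
 unfolding exact_on_def
proof (intro conjI allI impI)
 note E = seqD[OF e]
 have stp: "s ((tt Z ^^ k) z) = (tt Y ^^ k) (s z)" if z: "z \<in> Sp Z 0" for k z
  using st[OF linD(1)[OF linmap_funpow[OF lin_tt[OF E(3) n]] z]] by (induction k) auto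
 have n0: "0 < n" using n by simp
 fix v assume v: "v < n"
 note cf = hom_mat[OF E(4) v] and cg = hom_mat[OF E(5) v]
 note px = path_act_carrier[OF E(1) _ n v, of _ 0] and py = path_act_carrier[OF E(2) _ n v, of _ 0]
 have sub: "eta n X v \<subseteq> Sp X v" using eta_iff[OF E(1) n v] px by auto
 show "inj_on ((*v) (f v)) (eta n X v)"
  by (rule inj_on_subset[OF _ sub]) (use inj_mat_iff[OF cf] E(10)[OF v] in simp)
 show "(*v) (f v) ` eta n X v = {w \<in> eta n Y v. g v *v w = 0v (dim_row (g v))}"
 proof (intro equalityI subsetI)
  fix w assume "w \<in> (*v) (f v) ` eta n X v"
  then obtain x where x: "x \<in> Sp X 0" "w = f v *v path_act X x v 0"
   using eta_iff[OF E(1) n v] by auto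
  thus "w \<in> {w \<in> eta n Y v. g v *v w = 0v (dim_row (g v))}"
   using hom_path_act[OF E(1,2) n E(4) v x(1)] hom_vec[OF E(4) n0 x(1)] E(7)[OF v px[OF x(1)]] cg
   by (auto simp: eta_iff[OF E(2) n v])
 next
  fix w assume "w \<in> {w \<in> eta n Y v. g v *v w = 0v (dim_row (g v))}"
  then obtain y where y: "y \<in> Sp Y 0" "w = path_act Y y v 0"
   and gw: "g v *v path_act Y y v 0 = 0v (vdim Z v)"
   using cg eta_iff[OF E(2) n v] by auto
  obtain x where x: "x \<in> Sp X 0" "y = f 0 *v x + s (g 0 *v y)"
   using section_decomp[OF e n0 s gs y(1)] by metis
  have gy: "g 0 *v y \<in> Sp Z 0" by (rule hom_vec[OF E(5) n0 y(1)])
  note sgy = linD(1)[OF s gy]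
  have "path_act Z (g 0 *v y) v 0 = 0v (vdim Z v)"
   using gw hom_path_act[OF E(2,3) n E(5) v y(1)] by simp
  hence "(tt Z ^^ v) (g 0 *v y) = 0v (vdim Z 0)"
   using inc_path_act[OF E(3) n gy v] lin0[OF lin_inc[OF E(3) v]] by simp
  hence "inc Y v (path_act Y (s (g 0 *v y)) v 0) = 0v (vdim Y 0)"
   using inc_path_act[OF E(2) n sgy v] stp[OF gy, of v] lin0[OF s] by simp
  hence z: "path_act Y (s (g 0 *v y)) v 0 = 0v (vdim Y v)"
   by (rule inc_inj[OF E(2) m v py[OF sgy]])
  have fx: "f 0 *v x \<in> Sp Y 0" by (rule hom_vec[OF E(4) n0 x(1)])
  have "path_act Y y v 0 = path_act Y (f 0 *v x) v 0 + path_act Y (s (g 0 *v y)) v 0"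
   using linD(2)[OF linmap_path_act[OF E(2) v] fx sgy] x(2) by simp
  also have "\<dots> = f v *v path_act X x v 0"
   unfolding z hom_path_act[OF E(1,2) n E(4) v x(1)] using py[OF fx] by simp
  finally show "w \<in> (*v) (f v) ` eta n X v"
   using y(2) x(1) eta_iff[OF E(1) n v] by auto
 qed
 show "(*v) (g v) ` eta n Y v = eta n Z v"
 proof (intro equalityI subsetI)
  fix w assume "w \<in> (*v) (g v) ` eta n Y v"
  then obtain y where y: "y \<in> Sp Y 0" "w = g v *v path_act Y y v 0"
   using eta_iff[OF E(2) n v] by auto
  thus "w \<in> eta n Z v"
   using hom_path_act[OF E(2,3) n E(5) v y(1)] hom_vec[OF E(5) n0 y(1)] eta_iff[OF E(3) n v] by auto
 next
  fix w assume "w \<in> eta n Z v"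
  then obtain z where z: "z \<in> Sp Z 0" "w = path_act Z z v 0"
   using eta_iff[OF E(3) n v] by auto
  have "w = g v *v path_act Y (s z) v 0"
   using hom_path_act[OF E(2,3) n E(5) v linD(1)[OF s z(1)]] gs[OF z(1)] z(2) by simp
  thus "w \<in> (*v) (g v) ` eta n Y v"
   using linD(1)[OF s z(1)] eta_iff[OF E(2) n v] by auto
 qed
qed

section \<open>Modules filtered by standard modules\<close>

lemma Delta_vdim: "vdim (Delta i) v = (if v < i then 1 else 0)"
 by (simp add: Delta_def Let_def)

lemma Delta_a: "amap (Delta i) (Suc v) = mat (if v < i then 1 else 0) (if Suc v < i then 1 else 0) (\<lambda>_. 1)"
 by (simp add: Delta_def Let_def)

lemma Delta_b: "bmap (Delta i) (Suc v) = 0\<^sub>m (if Suc v < i then 1 else 0) (if v < i then 1 else 0)"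
 by (simp add: Delta_def Let_def)

lemma Delta_rep:
 assumes n: "1 < n"
 shows "is_rep n (Delta i)"
proof (rule is_repI[OF n])
 fix v and w :: "complex vec" assume w: "w \<in> Sp (Delta i) (Suc v)"
 have aw: "amap (Delta i) (Suc v) *v w \<in> cvec (if v < i then 1 else 0)"
  using w by (auto simp: Delta_a Delta_vdim intro!: carrier_vecI)
 show "bmap (Delta i) (Suc v) *v (amap (Delta i) (Suc v) *v w) = 0v (vdim (Delta i) (Suc v))"
  unfolding Delta_b using zero_mv[OF aw] by (simp add: Delta_vdim)
 show "amap (Delta i) (Suc (Suc v)) *v (bmap (Delta i) (Suc (Suc v)) *v w) =
   bmap (Delta i) (Suc v) *v (amap (Delta i) (Suc v) *v w)"
  unfolding Delta_b zero_mv[OF aw] using zero_mv[OF w] by (auto simp: Delta_vdim Delta_a intro!: eq_vecI)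
qed (auto simp: Delta_a Delta_b Delta_vdim)

lemma Delta_mono: "a_mono n (Delta i)"
 unfolding a_mono_def
proof (intro allI impI)
 fix v
 show "inj_mat (amap (Delta i) (Suc v))"
 proof (cases "Suc v < i")
  case True
  hence "amap (Delta i) (Suc v) = 1\<^sub>m 1" by (auto simp: Delta_a intro!: eq_matI)
  thus ?thesis by (simp add: inj_mat_def)
 next
  case False
  thus ?thesis by (auto simp: inj_mat_def Delta_a intro!: eq_vecI)
 qed
qed

lemma a_mono_zero:
 assumes "is_rep n X" "is_zero_rep n X"
 shows "a_mono n X"
 unfolding a_mono_def inj_mat_def
proof (intro allI impI ballI)
 fix v and x :: "complex vec" assume v: "Suc v < n" and x: "x \<in> cvec (dim_col (amap X (Suc v)))"
 have "dim_col (amap X (Suc v)) = 0"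
  using is_rep_carrier(1)[OF assms(1) v] assms(2) v unfolding is_zero_rep_def by auto
 thus "x = 0v (dim_col (amap X (Suc v)))" using x by (intro eq_vecI) auto
qed

lemma a_mono_ext:
 assumes e: "short_exact n X Y Z f g" and mX: "a_mono n X" and mZ: "a_mono n Z"
 shows "a_mono n Y"
 unfolding a_mono_def inj_mat_def
proof (intro allI impI ballI)
 note E = seqD[OF e]
 fix v y assume v: "Suc v < n" and "y \<in> cvec (dim_col (amap Y (Suc v)))"
  and "amap Y (Suc v) *v y = 0v (dim_row (amap Y (Suc v)))"
 note v' = Suc_lessD[OF v]
 hence y: "y \<in> Sp Y (Suc v)" and ay: "amap Y (Suc v) *v y = 0v (vdim Y v)"
  using is_rep_carrier(1)[OF E(2) v] \<open>y \<in> _\<close> \<open>amap Y (Suc v) *v y = _\<close> by auto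
 have "amap Z (Suc v) *v (g (Suc v) *v y) = 0v (vdim Z v)"
  using rep_hom_a[OF E(2,3,5) v y] ay lin0[OF hom_lin[OF E(5) v']] by simp
 hence "g (Suc v) *v y = 0v (vdim Z (Suc v))"
  using mZ v hom_vec[OF E(5) v y] is_rep_carrier(1)[OF E(3) v] unfolding a_mono_def inj_mat_def by auto
 then obtain x where x: "x \<in> Sp X (Suc v)" "y = f (Suc v) *v x"
  using E(8)[OF v y] by auto
 have "f v *v (amap X (Suc v) *v x) = 0v (vdim Y v)"
  using rep_hom_a[OF E(1,2,4) v x(1)] ay x(2) by simp
 hence "amap X (Suc v) *v x = 0v (vdim X v)"
  by (rule E(6)[OF v' rep_act(1)[OF E(1) v x(1)]])
 hence "x = 0v (vdim X (Suc v))"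
  using mX v x is_rep_carrier(1)[OF E(1) v] unfolding a_mono_def inj_mat_def by auto
 thus "y = 0v (dim_col (amap Y (Suc v)))"
  using x(2) lin0[OF hom_lin[OF E(4) v]] is_rep_carrier(1)[OF E(2) v] by simp
qed

lemma delta_filtered_rep:
 assumes "delta_filtered n X S"
 shows "is_rep n X \<and> a_mono n X"
 using assms
proof (induction rule: delta_filtered.induct)
 case (zero X)
 thus ?case using a_mono_zero by blast
next
 case (step X S i Y f g)
 thus ?case using seqD(2)[OF step.hyps(3)] a_mono_ext[OF step.hyps(3) _ Delta_mono] by simp
qed

lemma F_Delta_rep: "F_Delta n X ==> is_rep n X"
 and F_Delta_mono: "F_Delta n X ==> a_mono n X"
 using delta_filtered_rep unfolding F_Delta_def by blast+

text \<open>The function \<open>m\<close> counts how often each standard module occurs.\<close>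

lemma delta_filtered_dim:
 assumes "delta_filtered n X S"
 shows "\<exists>m :: nat => nat. S = {i \<in> {1..n}. m i > 0} \<and> (\<forall>v<n. vdim X v = (\<Sum>i\<in>{Suc v..n}. m i))"
 using assms
proof (induction rule: delta_filtered.induct)
 case (zero X)
 thus ?case by (intro exI[of _ "\<lambda>_. 0"]) (auto simp: is_zero_rep_def)
next
 case (step X S i Y f g)
 then obtain m where m: "S = {i \<in> {1..n}. m i > 0}" "!!v. v < n ==> vdim X v = (\<Sum>i\<in>{Suc v..n}. m i)" by blast
 have "vdim Y v = (\<Sum>j\<in>{Suc v..n}. (m(i := Suc (m i))) j)" if v: "v < n" for v
 proof -
  have "(\<Sum>j\<in>{Suc v..n}. (m(i := Suc (m i))) j) = (\<Sum>j\<in>{Suc v..n}. m j + (if j = i then 1 else 0))"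
   by (intro sum.cong) auto
  also have "\<dots> = (\<Sum>j\<in>{Suc v..n}. m j) + (if v < i then 1 else 0)"
   using step.hyps(2) by (simp add: sum.distrib Suc_le_eq)
  finally show ?thesis using short_exact_dim[OF step.hyps(3) v] m(2)[OF v] by (simp add: Delta_vdim)
 qed
 moreover have "insert i S = {j \<in> {1..n}. (m(i := Suc (m i))) j > 0}" using step.hyps(2) m(1) by auto
 ultimately show ?case by (intro exI[of _ "m(i := Suc (m i))"]) simp
qed

lemma delta_filtered_iso:
 assumes d: "delta_filtered n X S" and i: "iso_mor n X Y h" and Y: "is_rep n Y"
 shows "delta_filtered n Y S"
 using d
proof (cases rule: delta_filtered.cases)
 case zero
 thus ?thesis using delta_filtered.zero[OF Y] iso_dim[OF i] by (auto simp: is_zero_rep_def)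
next
 case (step X0 S0 k f g)
 note E = seqD[OF step(4)]
 obtain h' where h': "iso_mor n Y X h'" "!!v x. v < n ==> x \<in> Sp X v ==> h' v *v (h v *v x) = x"
  "!!v y. v < n ==> y \<in> Sp Y v ==> h v *v (h' v *v y) = y"
  using iso_inverse[OF i] by metis
 note hh = iso_hom[OF i] and hh' = iso_hom[OF h'(1)]
 have "short_exact n X0 Y (Delta k) (h oR f) (g oR h')"
 proof (rule short_exactI[OF E(1) Y E(3) hom_comp[OF E(1,2) Y E(4) hh] hom_comp[OF Y E(2,3) hh' E(5)]])
  fix v assume v: "v < n"
  note hv = comp_vec[OF E(4) hh v] and gv = comp_vec[OF hh' E(5) v]
  fix x :: "complex vec"
  show "x = 0v (vdim X0 v)" if x: "x \<in> Sp X0 v" and z: "(h oR f) v *v x = 0v (vdim Y v)"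
   using h'(2)[OF v hom_vec[OF E(4) v x]] z hv[OF x] lin0[OF hom_lin[OF hh' v]]
   by (intro E(6)[OF v x]) simp
  show "(g oR h') v *v ((h oR f) v *v x) = 0v (vdim (Delta k) v)" if x: "x \<in> Sp X0 v"
   using gv[OF hom_vec[OF hh v hom_vec[OF E(4) v x]]] hv[OF x] h'(2)[OF v hom_vec[OF E(4) v x]] E(7)[OF v x] by simp
  show "\<exists>y\<in>Sp X0 v. x = (h oR f) v *v y"
   if x: "x \<in> Sp Y v" and z: "(g oR h') v *v x = 0v (vdim (Delta k) v)"
  proof -
   obtain y where y: "y \<in> Sp X0 v" "h' v *v x = f v *v y"
    using E(8)[OF v hom_vec[OF hh' v x]] z gv[OF x] by auto
   thus ?thesis using hv[OF y(1)] h'(3)[OF v x] by (intro bexI[of _ y]) auto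
  qed
  show "\<exists>y\<in>Sp Y v. (g oR h') v *v y = x" if x: "x \<in> Sp (Delta k) v"
  proof -
   obtain y where y: "y \<in> Sp X v" "g v *v y = x" using E(9)[OF v x] by auto
   thus ?thesis
    using gv[OF hom_vec[OF hh v y(1)]] h'(2)[OF v y(1)] hom_vec[OF hh v y(1)]
    by (intro bexI[of _ "h v *v y"]) auto
  qed
 qed
 thus ?thesis unfolding step(1) by (rule delta_filtered.step[OF step(2,3)])
qed

lemma F_Delta_iso: "F_Delta n X ==> iso_mor n X Y h ==> is_rep n Y ==> F_Delta n Y"
 unfolding F_Delta_def using delta_filtered_iso by blast

text \<open>
The offset \<open>s\<close> makes one definition cover both parts of a cocycle: \<open>al v\<close> starts
at vertex \<open>v\<close> and \<open>bt v\<close> at \<open>v - 1\<close>.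
\<close>

definition coc_comp :: "nat => (nat => complex mat) => rmor => nat => complex mat" where
 "coc_comp s al h v = al v * h (v - s)"

abbreviation "coc_a \<equiv> coc_comp 0"
abbreviation "coc_b \<equiv> coc_comp 1"

lemma coc_vec:
 assumes c: "cocycle n N M al bt" and h: "rep_hom n X M h" and v: "Suc v < n"
 shows "x \<in> Sp X (Suc v) ==> coc_a al h (Suc v) *v x = al (Suc v) *v (h (Suc v) *v x)"
  "x \<in> Sp X v ==> coc_b bt h (Suc v) *v x = bt (Suc v) *v (h v *v x)"
 using assoc_mult_mat_vec[OF cocycle_carrier(1)[OF c v] hom_mat[OF h v]]
  assoc_mult_mat_vec[OF cocycle_carrier(2)[OF c v] hom_mat[OF h Suc_lessD[OF v]]]
 by (auto simp: coc_comp_def)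

lemma cocycle_comp:
 assumes c: "cocycle n N M al bt" and X: "is_rep n X" and M: "is_rep n M" and h: "rep_hom n X M h"
 shows "cocycle n N X (coc_a al h) (coc_b bt h)"
 unfolding cocycle_def
proof (intro conjI allI impI ballI)
 fix v
 show "Suc v < n ==> coc_a al h (Suc v) \<in> carrier_mat (vdim N v) (vdim X (Suc v))"
  "Suc v < n ==> coc_b bt h (Suc v) \<in> carrier_mat (vdim N (Suc v)) (vdim X v)"
  using cocycle_carrier[OF c, of v] hom_mat[OF h, of v] hom_mat[OF h, of "Suc v"]
  by (auto simp: coc_comp_def)
 fix w :: "complex vec" assume w: "w \<in> Sp X (Suc v)"
 show "bmap N (Suc v) *v (coc_a al h (Suc v) *v w) + coc_b bt h (Suc v) *v (amap X (Suc v) *v w) = 0v (vdim N (Suc v))"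
  if nv: "n = Suc (Suc v)"
 proof -
  have v: "Suc v < n" using nv by simp
  show ?thesis
   using coc_vec[OF c h v] w rep_act(1)[OF X v w] rep_hom_a[OF X M h v w] c nv hom_vec[OF h v w]
   unfolding cocycle_def by simp
 qed
 show "amap N (Suc (Suc v)) *v (coc_b bt h (Suc (Suc v)) *v w) + coc_a al h (Suc (Suc v)) *v (bmap X (Suc (Suc v)) *v w) =
   bmap N (Suc v) *v (coc_a al h (Suc v) *v w) + coc_b bt h (Suc v) *v (amap X (Suc v) *v w)"
  if v: "Suc (Suc v) < n"
 proof -
  note v' = Suc_lessD[OF v]
  have "\<forall>w\<in>Sp M (Suc v). amap N (Suc (Suc v)) *v (bt (Suc (Suc v)) *v w) + al (Suc (Suc v)) *v (bmap M (Suc (Suc v)) *v w) =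
    bmap N (Suc v) *v (al (Suc v) *v w) + bt (Suc v) *v (amap M (Suc v) *v w)"
   using c v unfolding cocycle_def by blast
  note * = this[rule_format, OF hom_vec[OF h v' w]]
  show ?thesis
   unfolding coc_vec(2)[OF c h v w] coc_vec(1)[OF c h v rep_act(2)[OF X v w]] coc_vec(1)[OF c h v' w]
    coc_vec(2)[OF c h v' rep_act(1)[OF X v' w]] rep_hom_a[OF X M h v' w] rep_hom_b[OF X M h v w]
   by (rule *)
 qed
qed

lemma cext_map_hom:
 assumes n: "1 < n" and N: "is_rep n N" and X: "is_rep n X" and M: "is_rep n M"
  and c: "cocycle n N M al bt" and h: "rep_hom n X M h"
 shows "rep_hom n (cext N X (coc_a al h) (coc_b bt h)) (cext N M al bt) (mor_dsum (mor_id N) h)"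
  and "!!v x y. v < n ==> x \<in> Sp N v ==> y \<in> Sp X v ==>
   mor_dsum (mor_id N) h v *v (x @v y) = x @v (h v *v y)"
proof -
 note c' = cocycle_comp[OF c X M h]
 show *: "!!v x y. v < n ==> x \<in> Sp N v ==> y \<in> Sp X v ==>
   mor_dsum (mor_id N) h v *v (x @v y) = x @v (h v *v y)"
  using block_diag_vec[OF one_carrier_mat hom_mat[OF h]] by (simp add: mor_dsum_def mor_id_def)
 show "rep_hom n (cext N X (coc_a al h) (coc_b bt h)) (cext N M al bt) (mor_dsum (mor_id N) h)"
 proof (rule rep_homI[OF cext_rep[OF n N X c'] cext_rep[OF n N M c]])
  fix v
  show "v < n ==> mor_dsum (mor_id N) h v \<in> carrier_mat (vdim (cext N M al bt) v) (vdim (cext N X (coc_a al h) (coc_b bt h)) v)"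
   using block_diag_carrier[OF _ hom_mat[OF h], of "mor_id N v"] by (simp add: mor_dsum_def mor_id_def)
  fix w :: "complex vec" assume v: "Suc v < n"
  note v' = Suc_lessD[OF v]
  show "mor_dsum (mor_id N) h v *v (amap (cext N X (coc_a al h) (coc_b bt h)) (Suc v) *v w) =
   amap (cext N M al bt) (Suc v) *v (mor_dsum (mor_id N) h (Suc v) *v w)"
   if w: "w \<in> cvec (vdim (cext N X (coc_a al h) (coc_b bt h)) (Suc v))"
  proof -
   obtain x y where xy: "x \<in> Sp N (Suc v)" "y \<in> Sp X (Suc v)" "w = x @v y"
    by (rule vec_splitE[OF w[unfolded vdim_cext]])
   have "al (Suc v) *v (h (Suc v) *v y) \<in> Sp N v"
    using cocycle_carrier[OF c v] hom_vec[OF h v xy(2)] by simp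
   thus ?thesis
    unfolding xy(3) cext_a[OF N X c' v xy(1,2)] *[OF v xy(1,2)] coc_vec(1)[OF c h v xy(2)]
     cext_a[OF N M c v xy(1) hom_vec[OF h v xy(2)]]
    using *[OF v' _ rep_act(1)[OF X v xy(2)], of "amap N (Suc v) *v x + al (Suc v) *v (h (Suc v) *v y)"]
     rep_act(1)[OF N v xy(1)] rep_hom_a[OF X M h v xy(2)] by simp
  qed
  show "mor_dsum (mor_id N) h (Suc v) *v (bmap (cext N X (coc_a al h) (coc_b bt h)) (Suc v) *v w) =
   bmap (cext N M al bt) (Suc v) *v (mor_dsum (mor_id N) h v *v w)"
   if w: "w \<in> cvec (vdim (cext N X (coc_a al h) (coc_b bt h)) v)"
  proof -
   obtain x y where xy: "x \<in> Sp N v" "y \<in> Sp X v" "w = x @v y"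
    by (rule vec_splitE[OF w[unfolded vdim_cext]])
   have "bt (Suc v) *v (h v *v y) \<in> Sp N (Suc v)"
    using cocycle_carrier[OF c v] hom_vec[OF h v' xy(2)] by simp
   thus ?thesis
    unfolding xy(3) cext_b[OF N X c' v xy(1,2)] *[OF v' xy(1,2)] coc_vec(2)[OF c h v xy(2)]
     cext_b[OF N M c v xy(1) hom_vec[OF h v' xy(2)]]
    using *[OF v _ rep_act(2)[OF X v xy(2)], of "bmap N (Suc v) *v x + bt (Suc v) *v (h v *v y)"]
     rep_act(2)[OF N v xy(1)] rep_hom_b[OF X M h v xy(2)] by simp
  qed
 qed
qed

lemma cext_short_exact:
 assumes n: "1 < n" and N: "is_rep n N" and M: "is_rep n M" and c: "cocycle n N M al bt"
 shows "short_exact n N (cext N M al bt) M (in1 N M) (pr2 N M)"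
proof (rule short_exactI[OF N cext_rep[OF assms] M in1_hom[OF assms] pr2_hom[OF assms]])
 fix v and x :: "complex vec" assume v: "v < n"
 show "x \<in> Sp N v ==> in1 N M v *v x = 0v (vdim (cext N M al bt) v) ==> x = 0v (vdim N v)"
  using append_vec_zero_iff[of x "vdim N v" "0v (vdim M v)" "vdim M v"] by (simp add: in1_vec)
 show "x \<in> Sp N v ==> pr2 N M v *v (in1 N M v *v x) = 0v (vdim M v)"
  by (simp add: in1_vec pr2_vec)
 show "\<exists>y\<in>Sp N v. x = in1 N M v *v y"
  if x: "x \<in> Sp (cext N M al bt) v" and z: "pr2 N M v *v x = 0v (vdim M v)"
 proof -
  obtain a b where ab: "a \<in> Sp N v" "b \<in> Sp M v" "x = a @v b"
   by (rule vec_splitE[OF x[unfolded vdim_cext]])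
  thus ?thesis using z pr2_vec[OF ab(1,2)] in1_vec[OF ab(1)] by (intro bexI[of _ a]) auto
 qed
 show "\<exists>y\<in>Sp (cext N M al bt) v. pr2 N M v *v y = x" if x: "x \<in> Sp M v"
  using pr2_vec[OF zero_carrier_vec x] x by (intro bexI[of _ "0v (vdim N v) @v x"]) auto
qed

text \<open>
Induction on the filtration of the right hand end: the preimage in the extension of a step of that filtration is
the pullback of the cocycle.
\<close>

lemma cext_F_Delta:
 assumes n: "1 < n" and N: "F_Delta n N" and "delta_filtered n M S" "cocycle n N M al bt"
 shows "F_Delta n (cext N M al bt)"
 using assms(3,4)
proof (induction arbitrary: al bt rule: delta_filtered.induct)
 case (zero M)
 note Nr = F_Delta_rep[OF N]
 note h = in1_hom[OF n Nr zero(1) zero(3)] and E = cext_short_exact[OF n Nr zero(1) zero(3)]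
 have "iso_mor n N (cext N M al bt) (in1 N M)"
  using zero(2) seqD(10)[OF E]
  by (intro iso_of_inj[OF Nr cext_rep[OF n Nr zero(1) zero(3)] h]) (auto simp: is_zero_rep_def)
 thus ?case using F_Delta_iso[OF N _ cext_rep[OF n Nr zero(1) zero(3)]] by blast
next
 case (step X S i Y f g)
 note Nr = F_Delta_rep[OF N]
 note E = seqD[OF step.hyps(3)] and c = step.prems
 note c' = cocycle_comp[OF c E(1,2,4)]
 obtain T where T: "delta_filtered n (cext N X (coc_a al f) (coc_b bt f)) T"
  using step.IH[OF c'] unfolding F_Delta_def by blast
 note rX = cext_rep[OF n Nr E(1) c'] and rY = cext_rep[OF n Nr E(2) c]
 note u = cext_map_hom[OF n Nr E(1,2) c E(4)] and p = pr2_hom[OF n Nr E(2) c]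
 note q = comp_vec[OF p E(5)]
 have "short_exact n (cext N X (coc_a al f) (coc_b bt f)) (cext N Y al bt) (Delta i)
   (mor_dsum (mor_id N) f) (g oR pr2 N Y)"
 proof (rule short_exactI[OF rX rY E(3) u(1) hom_comp[OF rY E(2,3) p E(5)]])
  fix v and w :: "complex vec" assume v: "v < n"
  show "w = 0v (vdim (cext N X (coc_a al f) (coc_b bt f)) v)"
   if w: "w \<in> cvec (vdim (cext N X (coc_a al f) (coc_b bt f)) v)"
    and z: "mor_dsum (mor_id N) f v *v w = 0v (vdim (cext N Y al bt) v)"
  proof -
   obtain a b where ab: "a \<in> Sp N v" "b \<in> Sp X v" "w = a @v b"
    by (rule vec_splitE[OF w[unfolded vdim_cext]])
   thus ?thesis
    using z u(2)[OF v ab(1,2)] append_vec_zero_iff[OF ab(1) hom_vec[OF E(4) v ab(2)]] E(6)[OF v ab(2)]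
    by (simp add: zero_append)
  qed
  show "(g oR pr2 N Y) v *v (mor_dsum (mor_id N) f v *v w) = 0v (vdim (Delta i) v)"
   if w: "w \<in> cvec (vdim (cext N X (coc_a al f) (coc_b bt f)) v)"
  proof -
   obtain a b where ab: "a \<in> Sp N v" "b \<in> Sp X v" "w = a @v b"
    by (rule vec_splitE[OF w[unfolded vdim_cext]])
   thus ?thesis
    using u(2)[OF v ab(1,2)] q[OF v, of "a @v (f v *v b)"] hom_vec[OF E(4) v ab(2)]
     pr2_vec[OF ab(1) hom_vec[OF E(4) v ab(2)]] E(7)[OF v ab(2)] by simp
  qed
  show "\<exists>x\<in>cvec (vdim (cext N X (coc_a al f) (coc_b bt f)) v). w = mor_dsum (mor_id N) f v *v x"
   if w: "w \<in> Sp (cext N Y al bt) v" and z: "(g oR pr2 N Y) v *v w = 0v (vdim (Delta i) v)"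
  proof -
   obtain a b where ab: "a \<in> Sp N v" "b \<in> Sp Y v" "w = a @v b"
    by (rule vec_splitE[OF w[unfolded vdim_cext]])
   obtain x where x: "x \<in> Sp X v" "b = f v *v x"
    using E(8)[OF v ab(2)] z q[OF v w] pr2_vec[OF ab(1,2)] ab(3) by auto
   thus ?thesis using u(2)[OF v ab(1) x(1)] ab by (intro bexI[of _ "a @v x"]) auto
  qed
  show "\<exists>y\<in>Sp (cext N Y al bt) v. (g oR pr2 N Y) v *v y = w" if w: "w \<in> Sp (Delta i) v"
  proof -
   obtain y where y: "y \<in> Sp Y v" "g v *v y = w" using E(9)[OF v w] by auto
   thus ?thesis
    using q[OF v, of "0v (vdim N v) @v y"] pr2_vec[OF zero_carrier_vec y(1)]
    by (intro bexI[of _ "0v (vdim N v) @v y"]) auto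
  qed
 qed
 thus ?case unfolding F_Delta_def using delta_filtered.step[OF T step.hyps(2)] by blast
qed

lemma F_Delta_cext:
 "1 < n ==> F_Delta n N ==> F_Delta n M ==> cocycle n N M al bt ==> F_Delta n (cext N M al bt)"
 using cext_F_Delta F_Delta_def by blast

lemma F_Delta_dsum: "1 < n ==> F_Delta n N ==> F_Delta n M ==> F_Delta n (N +R M)"
 unfolding dsum_cext using F_Delta_cext cocycle_zero F_Delta_rep by blast

section \<open>The exact structure\<close>

lemma E_exactD:
 assumes "E_exact n X Y Z f g"
 shows "F_Delta n X" "F_Delta n Y" "F_Delta n Z" "short_exact n X Y Z f g"
  "exact_on n f g (eta n X) (eta n Y) (eta n Z)"
 using assms unfolding E_exact_def by auto

text \<open>
Injectivity, vanishing of the composite and the choice of a \<open>t\<close>-equivariant section need checking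
at vertex 0 only; exactness in the middle follows from the dimensions.
\<close>

lemma E_exactI:
 assumes n: "1 < n" and X: "F_Delta n X" and Y: "F_Delta n Y" and Z: "F_Delta n Z"
  and f: "rep_hom n X Y f" and g: "rep_hom n Y Z g" and i: "inj_mat (f 0)"
  and gf: "!!x. x \<in> Sp X 0 ==> g 0 *v (f 0 *v x) = 0v (vdim Z 0)"
  and surj: "!!v z. v < n ==> z \<in> Sp Z v ==> \<exists>y\<in>Sp Y v. g v *v y = z"
  and dim: "!!v. v < n ==> vdim Y v = vdim X v + vdim Z v"
  and s: "linmap (vdim Z 0) (vdim Y 0) s"
  and gs: "!!z. z \<in> Sp Z 0 ==> g 0 *v s z = z"
  and st: "!!z. z \<in> Sp Z 0 ==> s (tt Z z) = tt Y (s z)"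
 shows "E_exact n X Y Z f g"
proof -
 note r = F_Delta_rep[OF X] F_Delta_rep[OF Y] F_Delta_rep[OF Z]
 have fi: "x = 0v (vdim X v)" if "v < n" "x \<in> Sp X v" "f v *v x = 0v (vdim Y v)" for v x
  using inj_of_inj0[OF r(1,2) F_Delta_mono[OF X] f i that(1)] that hom_mat[OF f that(1)]
  unfolding inj_mat_def by auto
 have gfv: "g v *v (f v *v x) = 0v (vdim Z v)" if v: "v < n" and x: "x \<in> Sp X v" for v x
  using hom_inc[OF r(2,3) g v hom_vec[OF f v x]] hom_inc[OF r(1,2) f v x]
   gf[OF linD(1)[OF lin_inc[OF r(1) v] x]]
  by (intro inc_inj[OF r(3) F_Delta_mono[OF Z] v hom_vec[OF g v hom_vec[OF f v x]]]) simp
 have "short_exact n X Y Z f g"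
 proof (rule short_exactI[OF r f g fi gfv _ surj])
  fix v y assume v: "v < n" and y: "y \<in> Sp Y v" and gy: "g v *v y = 0v (vdim Z v)"
  note cg = hom_mat[OF g v] and cf = hom_mat[OF f v]
  obtain B where B: "B \<in> carrier_mat (vdim Y v) (vdim Z v)" "g v * B = 1\<^sub>m (vdim Z v)"
   using linear_section[OF cg] surj[OF v] by metis
  have gB: "g v *v (B *v z) = z" if "z \<in> Sp Z v" for z
   using assoc_mult_mat_vec[OF cg B(1) that] B(2) that by simp
  let ?F = "\<lambda>w. f v *v vec_first w (vdim X v) + B *v (vec_last w (vdim Z v))"
  have F: "linmap (vdim X v + vdim Z v) (vdim Y v) ?F"
   by (rule linmap_add[OF lin_comp[OF linmap_first linmap_mat[OF cf]] lin_comp[OF linmap_last linmap_mat[OF B(1)]]])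
  define A where "A = mat_of_fun (vdim X v + vdim Z v) (vdim Y v) ?F"
  have A: "A \<in> carrier_mat (vdim Y v) (vdim Y v)" using dim[OF v] mat_of_fun_carrier unfolding A_def by metis
  have Av: "A *v (x @v z) = f v *v x + B *v z" if "x \<in> Sp X v" "z \<in> Sp Z v" for x z
   using mat_of_fun_mult[OF F, of "x @v z"] that by (simp add: A_def)
  have gfB: "g v *v (f v *v a + B *v b) = b" if "a \<in> Sp X v" "b \<in> Sp Z v" for a b
   using linD(2)[OF linmap_mat[OF cg] hom_vec[OF f v that(1)], of "B *v b"] gfv[OF v that(1)] gB[OF that(2)] that B(1) by simp
  have "inj_mat A"
   unfolding inj_mat_def
  proof (intro ballI impI)
   fix w assume "w \<in> cvec (dim_col A)" and z: "A *v w = 0v (dim_row A)"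
   hence w': "w \<in> cvec (vdim X v + vdim Z v)" using A dim[OF v] by simp
   obtain a b where ab: "a \<in> Sp X v" "b \<in> Sp Z v" "w = a @v b"
    by (rule vec_splitE[OF w'])
   have fs: "f v *v a + B *v b = 0v (vdim Y v)" using Av[OF ab(1,2)] z ab(3) A by simp
   have b: "b = 0v (vdim Z v)" using gfB[OF ab(1,2)] unfolding fs using lin0[OF linmap_mat[OF cg]] by simp
   have "f v *v a = 0v (vdim Y v)"
    using fs lin0[OF linmap_mat[OF B(1)]] hom_vec[OF f v ab(1)] unfolding b by simp
   thus "w = 0v (dim_col A)" using fi[OF v ab(1)] ab(3) b A dim[OF v] by (simp add: zero_append)
  qed
  from inj_square_surj[OF A this y] obtain w where w: "w \<in> cvec (vdim X v + vdim Z v)" "A *v w = y"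
   using dim[OF v] by metis
  obtain a b where ab: "a \<in> Sp X v" "b \<in> Sp Z v" "w = a @v b"
   by (rule vec_splitE[OF w(1)])
  have y': "y = f v *v a + B *v b" using Av[OF ab(1,2)] w(2) ab(3) by simp
  have "b = 0v (vdim Z v)" using gfB[OF ab(1,2)] gy y' by simp
  hence "y = f v *v a" using y' lin0[OF linmap_mat[OF B(1)]] hom_vec[OF f v ab(1)] by simp
  thus "\<exists>x\<in>Sp X v. y = f v *v x" using ab(1) by blast
 qed
 thus ?thesis
  unfolding E_exact_def
  by (intro conjI X Y Z eta_exactI[where s = s] n F_Delta_mono[OF Y] s gs st)
qed

lemma cext_E_exact:
 assumes n: "1 < n" and N: "F_Delta n N" and M: "F_Delta n M" and c: "cocycle n N M al bt"
  and c0: "!!w. w \<in> Sp M 0 ==>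
   amap N (Suc 0) *v (bt (Suc 0) *v w) + al (Suc 0) *v (bmap M (Suc 0) *v w) = 0v (vdim N 0)"
 shows "E_exact n N (cext N M al bt) M (in1 N M) (pr2 N M)"
proof -
 note Nr = F_Delta_rep[OF N] and Mr = F_Delta_rep[OF M]
 have n1: "Suc 0 < n" using n by simp
 note F = F_Delta_cext[OF n N M c] and e = cext_short_exact[OF n Nr Mr c]
 have "exact_on n (in1 N M) (pr2 N M) (eta n N) (eta n (cext N M al bt)) (eta n M)"
 proof (rule eta_exactI[OF n e F_Delta_mono[OF F]])
  show "linmap (vdim M 0) (vdim (cext N M al bt) 0) (\<lambda>z. 0v (vdim N 0) @v z)"
   using linmap_append[OF linmap_zero_fun linmap_id] by simp
  fix z :: "complex vec" assume z: "z \<in> Sp M 0"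
  show "pr2 N M 0 *v (0v (vdim N 0) @v z) = z" using pr2_vec[OF zero_carrier_vec z] .
  have b: "bt (Suc 0) *v z \<in> Sp N (Suc 0)" using cocycle_carrier(2)[OF c n1] z by simp
  have "bmap (cext N M al bt) (Suc 0) *v (0v (vdim N 0) @v z) = (bt (Suc 0) *v z) @v (bmap M (Suc 0) *v z)"
   using cext_b[OF Nr Mr c n1 zero_carrier_vec z] lin0[OF linmap_act(2)[OF Nr n1]] b by simp
  thus "0v (vdim N 0) @v tt M z = tt (cext N M al bt) (0v (vdim N 0) @v z)"
   unfolding tt_def using cext_a[OF Nr Mr c n1 b rep_act(2)[OF Mr n1 z]] c0[OF z] by simp
 qed
 thus ?thesis unfolding E_exact_def using N F M e by simp
qed



section \<open>Submodules of the projective module in socle coordinates\<close>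

text \<open>
The dimension of \<open>M_I\<close> at vertex \<open>v\<close>: one for each \<open>x \<in> I\<close> whose
standard module lives at \<open>v\<close>.
\<close>

definition dd :: "nat set => nat => nat" where
 "dd I v = card {x \<in> I. v < x}"

lemma dd_Suc: "finite I ==> dd I v = dd I (Suc v) + (if Suc v \<in> I then 1 else 0)"
proof -
 assume f: "finite I"
 have "{x \<in> I. v < x} = (if Suc v \<in> I then insert (Suc v) {x \<in> I. Suc v < x} else {x \<in> I. Suc v < x})"
  by (auto intro: Suc_lessI)
 thus ?thesis using f by (simp add: dd_def)
qed

lemma dd_le_Suc: "finite I ==> dd I v \<le> Suc (dd I (Suc v))"
 and dd_Suc_le: "finite I ==> dd I (Suc v) \<le> dd I v"
 using dd_Suc[of I v] by auto

lemma dd_antimono: "finite I ==> v \<le> w ==> dd I w \<le> dd I v"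
 unfolding dd_def by (intro card_mono) auto

lemma dd_bound:
 assumes "I \<subseteq> {1..n}" shows "dd I v \<le> n - v"
proof -
 have "{x \<in> I. v < x} \<subseteq> {Suc v..n}" using assms by auto
 hence "card {x \<in> I. v < x} \<le> card {Suc v..n}" by (intro card_mono) auto
 thus ?thesis by (simp add: dd_def)
qed

lemma dd_0: "I \<subseteq> {1..n} ==> dd I 0 = card I"
 unfolding dd_def by (intro arg_cong[where f = card]) auto

text \<open>
The model of \<open>M_I\<close> in coordinates adapted to the socle: \<open>a\<close> is the inclusion of the
first coordinates and \<open>b\<close> is \<open>t\<close>.
\<close>

definition Nmod :: "nat set => rep" where
 "Nmod I = \<lparr> vdim = dd I,
   amap = (\<lambda>v. toep (dd I (v - 1)) (dd I v) (delta 0)),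
   bmap = (\<lambda>v. toep (dd I v) (dd I (v - 1)) (delta 1)) \<rparr>"

lemma Nmod_vdim [simp]: "vdim (Nmod I) v = dd I v"
 by (simp add: Nmod_def)

lemma Nmod_a:
 assumes "w \<in> cvec (dd I (Suc v))" "a < dd I v"
 shows "(amap (Nmod I) (Suc v) *v w) $ a = (if a < dd I (Suc v) then w $ a else 0)"
 using toep_delta_vec[OF assms, of 0] by (simp add: Nmod_def del: index_mult_mat_vec)

lemma Nmod_b:
 assumes "w \<in> cvec (dd I v)" "a < dd I (Suc v)"
 shows "(bmap (Nmod I) (Suc v) *v w) $ a = (if Suc a < dd I v then w $ Suc a else 0)"
 using toep_delta_vec[OF assms, of 1] by (simp add: Nmod_def del: index_mult_mat_vec)

lemma Nmod_rep:
 assumes n: "1 < n" and I: "I \<subseteq> {1..n}"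
 shows "is_rep n (Nmod I)"
proof (rule is_repI[OF n])
 have f: "finite I" using I finite_subset by blast
 fix v
 show a: "amap (Nmod I) (Suc v) \<in> carrier_mat (vdim (Nmod I) v) (vdim (Nmod I) (Suc v))"
  and b: "bmap (Nmod I) (Suc v) \<in> carrier_mat (vdim (Nmod I) (Suc v)) (vdim (Nmod I) v)" for v
  by (simp_all add: Nmod_def)
 fix w :: "complex vec" assume w: "w \<in> Sp (Nmod I) (Suc v)"
 have aw: "amap (Nmod I) (Suc v) *v w \<in> cvec (dd I v)" using w a[of v] by auto
 have bw: "bmap (Nmod I) (Suc (Suc v)) *v w \<in> cvec (dd I (Suc (Suc v)))" using w b[of "Suc v"] by auto
 have ba: "(bmap (Nmod I) (Suc v) *v (amap (Nmod I) (Suc v) *v w)) $ r =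
   (if Suc r < dd I (Suc v) then w $ Suc r else 0)" if "r < dd I (Suc v)" for r
  using Nmod_b[OF aw that] Nmod_a[of w I v "Suc r"] w dd_Suc_le[OF f, of v] by (auto simp del: index_mult_mat_vec)
 have dba: "dim_vec (bmap (Nmod I) (Suc v) *v (amap (Nmod I) (Suc v) *v w)) = dd I (Suc v)"
  using b[of v] by simp
 show "bmap (Nmod I) (Suc v) *v (amap (Nmod I) (Suc v) *v w) = 0v (vdim (Nmod I) (Suc v))"
  if "n = Suc (Suc v)"
 proof (rule eq_vecI)
  fix r assume "r < dim_vec (0v (vdim (Nmod I) (Suc v)) :: complex vec)"
  thus "(bmap (Nmod I) (Suc v) *v (amap (Nmod I) (Suc v) *v w)) $ r = 0v (vdim (Nmod I) (Suc v)) $ r"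
   using ba[of r] dd_bound[OF I, of "Suc v"] that by (simp del: index_mult_mat_vec)
 qed (use dba in simp)
 show "amap (Nmod I) (Suc (Suc v)) *v (bmap (Nmod I) (Suc (Suc v)) *v w) =
    bmap (Nmod I) (Suc v) *v (amap (Nmod I) (Suc v) *v w)"
 proof (rule eq_vecI)
  fix r assume "r < dim_vec (bmap (Nmod I) (Suc v) *v (amap (Nmod I) (Suc v) *v w))"
  hence r: "r < dd I (Suc v)" using dba by simp
  thus "(amap (Nmod I) (Suc (Suc v)) *v (bmap (Nmod I) (Suc (Suc v)) *v w)) $ r =
    (bmap (Nmod I) (Suc v) *v (amap (Nmod I) (Suc v) *v w)) $ r"
   unfolding ba[OF r] Nmod_a[OF bw r]
   using Nmod_b[of w I "Suc v" r] w dd_le_Suc[OF f, of "Suc v"] by (auto simp del: index_mult_mat_vec)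
 qed (use dba a[of "Suc v"] in simp)
qed

lemma Nmod_mono: "finite I ==> a_mono n (Nmod I)"
 unfolding a_mono_def using toep_inj[of "dd I (Suc _)" "dd I _" "delta 0"] dd_Suc_le[of I]
 by (simp add: Nmod_def delta_def)

lemma Nmod_inc:
 assumes n: "1 < n" and I: "I \<subseteq> {1..n}"
 shows "v < n ==> w \<in> cvec (dd I v) ==> a < dd I 0 ==>
  inc (Nmod I) v w $ a = (if a < dd I v then w $ a else 0)"
proof (induction v arbitrary: w)
 case (Suc v)
 have f: "finite I" using I finite_subset by blast
 have "amap (Nmod I) (Suc v) *v w \<in> cvec (dd I v)"
  using rep_act(1)[OF Nmod_rep[OF n I] Suc.prems(1)] Suc.prems(2) by simp
 thus ?case
  using Suc.IH[of "amap (Nmod I) (Suc v) *v w"] Suc.prems Nmod_a[OF Suc.prems(2), of a] dd_Suc_le[OF f, of v]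
  by (auto simp del: index_mult_mat_vec)
qed simp

lemma Nmod_tt:
 assumes n: "1 < n" and I: "I \<subseteq> {1..n}" and w: "w \<in> cvec (dd I 0)" and a: "a < dd I 0"
 shows "tt (Nmod I) w $ a = (if Suc a < dd I 0 then w $ Suc a else 0)"
proof -
 have f: "finite I" using I finite_subset by blast
 have b: "bmap (Nmod I) (Suc 0) *v w \<in> cvec (dd I (Suc 0))"
  using rep_act(2)[OF Nmod_rep[OF n I], of 0] n w by simp
 show ?thesis
  unfolding tt_def using Nmod_a[OF b a] Nmod_b[OF w, of a] dd_le_Suc[OF f, of 0]
  by (auto simp del: index_mult_mat_vec)
qed

lemma Nmod_tt_carrier:
 assumes n: "1 < n" and I: "I \<subseteq> {1..n}" and w: "w \<in> cvec (dd I 0)"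
 shows "(tt (Nmod I) ^^ k) w \<in> cvec (dd I 0)"
 using linD(1)[OF linmap_funpow[OF lin_tt[OF Nmod_rep[OF n I] n]], of w k] w by simp

lemma Nmod_tt_pow:
 assumes n: "1 < n" and I: "I \<subseteq> {1..n}" and w: "w \<in> cvec (dd I 0)"
 shows "a < dd I 0 ==> (tt (Nmod I) ^^ k) w $ a = (if a + k < dd I 0 then w $ (a + k) else 0)"
proof (induction k arbitrary: a)
 case (Suc k)
 thus ?case
  using Nmod_tt[OF n I Nmod_tt_carrier[OF n I w, of k], of a] Suc.IH[of "Suc a"] by auto
qed simp

lemma Nmod_inc_carrier:
 assumes "1 < n" "I \<subseteq> {1..n}" "v < n" "w \<in> cvec (dd I v)"
 shows "inc (Nmod I) v w \<in> cvec (dd I 0)"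
 using linD(1)[OF lin_inc[OF Nmod_rep[OF assms(1,2)] assms(3)], of w] assms(4) by simp

lemma Nmod_inc_image:
 assumes n: "1 < n" and I: "I \<subseteq> {1..n}" and v: "v < n" and q: "q \<in> cvec (dd I 0)"
 shows "(\<exists>w\<in>cvec (dd I v). inc (Nmod I) v w = q) \<longleftrightarrow> (\<forall>r<dd I 0. dd I v \<le> r --> q $ r = 0)"
proof
 assume "\<exists>w\<in>cvec (dd I v). inc (Nmod I) v w = q"
 thus "\<forall>r<dd I 0. dd I v \<le> r --> q $ r = 0" using Nmod_inc[OF n I v] by auto
next
 have f: "finite I" using I finite_subset by blast
 assume z: "\<forall>r<dd I 0. dd I v \<le> r --> q $ r = 0"
 have w: "vec (dd I v) (\<lambda>r. q $ r) \<in> cvec (dd I v)" by simp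
 have "inc (Nmod I) v (vec (dd I v) (\<lambda>r. q $ r)) = q"
  using Nmod_inc[OF n I v w] z q Nmod_inc_carrier[OF n I v w] by (intro eq_vecI) auto
 thus "\<exists>w\<in>cvec (dd I v). inc (Nmod I) v w = q" using w by blast
qed

text \<open>
The inequality says that \<open>t^s\<close> maps the subspace of \<open>Nmod I\<close> of vertex
\<open>v\<close> into that of \<open>Nmod J\<close>.
\<close>

lemma toep_hom:
 assumes n: "1 < n" and I: "I \<subseteq> {1..n}" and J: "J \<subseteq> {1..n}"
  and c: "!!s v. c s \<noteq> 0 ==> v < n ==> dd I v \<le> dd J v + s"
 shows "rep_hom n (Nmod I) (Nmod J) (\<lambda>v. toep (dd J v) (dd I v) c)"
 unfolding rep_hom_def
proof (intro conjI allI impI ballI)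
 have f: "finite I" "finite J" using I J finite_subset by blast+
 fix i assume "i \<in> {1..<n}"
 then obtain v where i: "i = Suc v" and v: "Suc v < n" by (cases i) auto
 have e: "conv c (delta 0) = c" "conv (delta (Suc 0)) c = conv c (delta (Suc 0))"
  using conv_delta0 conv_commute by metis+
 have "toep (dd J v) (dd I v) c * toep (dd I v) (dd I (Suc v)) (delta 0) = toep (dd J v) (dd I (Suc v)) (conv c (delta 0))"
  by (rule toep_mult) (use dd_Suc_le[OF f(1), of v] in \<open>auto simp: delta_def split: if_splits\<close>)
 moreover have "toep (dd J v) (dd J (Suc v)) (delta 0) * toep (dd J (Suc v)) (dd I (Suc v)) c = toep (dd J v) (dd I (Suc v)) (conv (delta 0) c)"
  by (rule toep_mult) (use c[OF _ v] in auto)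
 ultimately show "toep (dd J (i - 1)) (dd I (i - 1)) c * amap (Nmod I) i = amap (Nmod J) i * toep (dd J i) (dd I i) c"
  by (simp add: Nmod_def i e conv_delta0)
 have "toep (dd J (Suc v)) (dd I (Suc v)) c * toep (dd I (Suc v)) (dd I v) (delta 1) = toep (dd J (Suc v)) (dd I v) (conv c (delta 1))"
  by (rule toep_mult) (use dd_le_Suc[OF f(1), of v] in \<open>auto simp: delta_def split: if_splits\<close>)
 moreover have "toep (dd J (Suc v)) (dd J v) (delta 1) * toep (dd J v) (dd I v) c = toep (dd J (Suc v)) (dd I v) (conv (delta 1) c)"
  by (rule toep_mult) (use c[OF _ Suc_lessD[OF v]] in auto)
 ultimately show "toep (dd J i) (dd I i) c * bmap (Nmod I) i = bmap (Nmod J) i * toep (dd J (i - 1)) (dd I (i - 1)) c"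
  by (simp add: Nmod_def i e)
qed simp

text \<open>
Induction on \<open>I\<close> by removing its least element. The quotient of \<open>Nmod I\<close> by
\<open>Nmod (I - {min I})\<close> is standard: the largest coordinate survives exactly at the vertices below
\<open>min I\<close>.
\<close>

lemma Nmod_filtered:
 assumes n: "1 < n"
 shows "I \<subseteq> {1..n} ==> delta_filtered n (Nmod I) I"
proof (induction "card I" arbitrary: I)
 case 0
 hence "I = {}" using finite_subset by fastforce
 thus ?case using delta_filtered.zero[OF Nmod_rep[OF n 0(2)]] by (auto simp: is_zero_rep_def dd_def)
next
 case (Suc d)
 have f: "finite I" and ne: "I \<noteq> {}" using Suc.prems Suc.hyps(2) finite_subset by fastforce+
 define i where "i = Min I"
 define I' where "I' = I - {i}"
 have iI: "i \<in> I" and imin: "!!x. x \<in> I ==> i \<le> x" using f ne by (auto simp: i_def)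
 have i1: "i \<in> {1..n}" using iI Suc.prems by auto
 have I': "I' \<subseteq> {1..n}" "card I' = d" using Suc.prems Suc.hyps(2) iI f by (auto simp: I'_def)
 have IH: "delta_filtered n (Nmod I') I'" using Suc.hyps(1)[OF I'(2)[symmetric] I'(1)] .
 have ddI: "dd I v = dd I' v + (if v < i then 1 else 0)" for v
 proof -
  have "{x \<in> I. v < x} = (if v < i then insert i {x \<in> I'. v < x} else {x \<in> I'. v < x})"
   using iI by (auto simp: I'_def)
  moreover have "finite I'" using f by (simp add: I'_def)
  ultimately show ?thesis by (simp add: dd_def I'_def)
 qed
 have dlow: "dd I (Suc v) = dd I v" if "Suc v < i" for v
  using dd_Suc[OF f, of v] imin[of "Suc v"] that by auto
 have di: "dd I' v = dd I' (Suc v)" if "v < i" for v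
  using dd_Suc[of I' v] f imin[of "Suc v"] that by (auto simp: I'_def)
 let ?f = "\<lambda>v. toep (dd I v) (dd I' v) (delta 0)"
 let ?g = "\<lambda>v. mat (if v < i then 1 else 0) (dd I v) (\<lambda>(a, b). if Suc b = dd I v then 1 else 0) :: complex mat"
 have fh: "rep_hom n (Nmod I') (Nmod I) ?f"
  by (rule toep_hom[OF n I'(1) Suc.prems]) (auto simp: delta_def ddI split: if_splits)
 have gv: "?g v *v w = (if v < i then vec 1 (\<lambda>_. w $ dd I' v) else 0v 0)" if w: "w \<in> cvec (dd I v)" for v w
 proof (rule eq_vecI)
  fix a assume a: "a < dim_vec (if v < i then vec 1 (\<lambda>_. w $ dd I' v) else 0v 0)"
  hence vi: "v < i" by (auto split: if_splits)
  have "(?g v *v w) $ a = (\<Sum>b\<in>{0..<dd I v}. if b = dd I' v then w $ dd I' v else 0)"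
   using a vi w ddI[of v] by (auto simp: scalar_prod_def intro!: sum.cong)
  also have "\<dots> = w $ dd I' v" using vi ddI[of v] by (simp add: sum.delta)
  finally show "(?g v *v w) $ a = (if v < i then vec 1 (\<lambda>_. w $ dd I' v) else 0v 0) $ a" using vi a by simp
 qed auto
 note rI = Nmod_rep[OF n Suc.prems]
 have gh: "rep_hom n (Nmod I) (Delta i) ?g"
 proof (rule rep_homI[OF rI Delta_rep[OF n]])
  fix v and w :: "complex vec" assume v: "Suc v < n"
  show "?g v *v (amap (Nmod I) (Suc v) *v w) = amap (Delta i) (Suc v) *v (?g (Suc v) *v w)"
   if "w \<in> Sp (Nmod I) (Suc v)"
  proof -
   have w: "w \<in> cvec (dd I (Suc v))" using that by simp
   have aw: "amap (Nmod I) (Suc v) *v w \<in> cvec (dd I v)" using rep_act(1)[OF rI v, of w] w by simp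
   show ?thesis
    unfolding gv[OF w] gv[OF aw] Delta_a
    using Nmod_a[OF w, of "dd I' v"] ddI[of v] ddI[of "Suc v"] di[of v]
    by (intro eq_vecI) (auto simp: scalar_prod_def simp del: index_mult_mat_vec simp add: index_mult_mat_vec[where A = "mat _ _ _"])
  qed
  show "?g (Suc v) *v (bmap (Nmod I) (Suc v) *v w) = bmap (Delta i) (Suc v) *v (?g v *v w)"
   if "w \<in> Sp (Nmod I) v"
  proof -
   have w: "w \<in> cvec (dd I v)" using that by simp
   have bw: "bmap (Nmod I) (Suc v) *v w \<in> cvec (dd I (Suc v))" using rep_act(2)[OF rI v, of w] w by simp
   have cw: "?g v *v w \<in> cvec (if v < i then 1 else 0)" by (auto intro!: carrier_vecI)
   show ?thesis
    unfolding gv[OF bw] Delta_b zero_mv[OF cw]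
    using Nmod_b[OF w, of "dd I' (Suc v)"] ddI[of v] ddI[of "Suc v"] di[of v] dlow[of v]
    by (intro eq_vecI) (auto simp del: index_mult_mat_vec)
  qed
 qed (simp add: Delta_vdim)
 have fv: "(?f v *v x) $ a = (if a < dd I' v then x $ a else 0)" if "x \<in> cvec (dd I' v)" "a < dd I v" for v x a
  using toep_delta_vec[OF that, of 0] by (simp del: index_mult_mat_vec)
 have "short_exact n (Nmod I') (Nmod I) (Delta i) ?f ?g"
 proof (rule short_exactI[OF Nmod_rep[OF n I'(1)] rI Delta_rep[OF n] fh gh])
  fix v and x :: "complex vec" assume v: "v < n"
  have "inj_mat (?f v)" by (rule toep_inj) (auto simp: ddI delta_def)
  thus "x \<in> Sp (Nmod I') v ==> ?f v *v x = 0v (vdim (Nmod I) v) ==> x = 0v (vdim (Nmod I') v)"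
   unfolding inj_mat_def by simp
  show "?g v *v (?f v *v x) = 0v (vdim (Delta i) v)" if x: "x \<in> Sp (Nmod I') v"
  proof -
   have c: "?f v *v x \<in> cvec (dd I v)" by (rule mult_mat_vec_carrier[OF toep_carrier]) (use x in simp)
   show ?thesis
    unfolding gv[OF c] using fv[of x v "dd I' v"] x ddI[of v]
    by (intro eq_vecI) (auto simp: Delta_vdim simp del: index_mult_mat_vec)
  qed
  show "\<exists>y\<in>Sp (Nmod I') v. x = ?f v *v y"
   if "x \<in> Sp (Nmod I) v" and z: "?g v *v x = 0v (vdim (Delta i) v)"
  proof -
   have x: "x \<in> cvec (dd I v)" using that by simp
   have top: "v < i ==> x $ dd I' v = 0" using z unfolding gv[OF x] by (auto simp: Delta_vdim dest: arg_cong[where f = "\<lambda>u. u $ 0"])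
   have y: "vec (dd I' v) (\<lambda>r. x $ r) \<in> cvec (dd I' v)" by simp
   have "x = ?f v *v vec (dd I' v) (\<lambda>r. x $ r)"
   proof (rule eq_vecI)
    fix a assume "a < dim_vec (?f v *v vec (dd I' v) (\<lambda>r. x $ r))"
    hence a: "a < dd I v" by simp
    show "x $ a = (?f v *v vec (dd I' v) (\<lambda>r. x $ r)) $ a"
     unfolding fv[OF y a] using a ddI[of v] top by (cases "a < dd I' v") (auto split: if_splits simp: less_Suc_eq)
   qed (use x in simp)
   thus ?thesis using y by (intro bexI[of _ "vec (dd I' v) (\<lambda>r. x $ r)"]) auto
  qed
  show "\<exists>y\<in>Sp (Nmod I) v. ?g v *v y = x" if x: "x \<in> Sp (Delta i) v"
  proof
   show y: "vec (dd I v) (\<lambda>_. x $ 0) \<in> Sp (Nmod I) v" by simp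
   hence y: "vec (dd I v) (\<lambda>_. x $ 0) \<in> cvec (dd I v)" by simp
   show "?g v *v vec (dd I v) (\<lambda>_. x $ 0) = x"
    unfolding gv[OF y] using x ddI[of v] by (intro eq_vecI) (auto simp: Delta_vdim split: if_splits)
  qed
 qed
 from delta_filtered.step[OF IH i1 this] show ?case using iI by (simp add: I'_def insert_absorb)
qed

text \<open>
In \<open>D0\<close> the exponent of \<open>t\<close> increases along the basis, away from the top; reversing
the basis gives socle coordinates and embeds \<open>Nmod I\<close>.
\<close>

definition rv :: "nat => nat set => rmor" where
 "rv n I v = mat (n - v) (dd I v) (\<lambda>(a, b). if a + b + 1 = n - v then 1 else 0)"

lemma rv_vec:
 assumes "w \<in> cvec (dd I v)" "a < n - v"
 shows "(rv n I v *v w) $ a = (if n - v - 1 - a < dd I v then w $ (n - v - 1 - a) else 0)"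
proof -
 have "(rv n I v *v w) $ a = (\<Sum>b\<in>{0..<dd I v}. (if a + b + 1 = n - v then 1 else 0) * w $ b)"
  using assms by (simp add: rv_def scalar_prod_def)
 also have "\<dots> = (\<Sum>b\<in>{0..<dd I v}. if b = n - v - 1 - a then w $ (n - v - 1 - a) else 0)"
  using assms(2) by (intro sum.cong) auto
 finally show ?thesis by (simp add: sum.delta)
qed

lemma rv_inj:
 assumes "I \<subseteq> {1..n}"
 shows "inj_mat (rv n I v)"
 unfolding inj_mat_def
proof (intro ballI impI)
 fix w assume "w \<in> cvec (dim_col (rv n I v))" and z: "rv n I v *v w = 0v (dim_row (rv n I v))"
 hence w: "w \<in> cvec (dd I v)" by (simp add: rv_def)
 show "w = 0v (dim_col (rv n I v))"
 proof (rule eq_vecI)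
  fix b assume "b < dim_vec (0v (dim_col (rv n I v)) :: complex vec)"
  hence b: "b < dd I v" by (simp add: rv_def)
  hence "b < n - v" using dd_bound[OF assms, of v] by simp
  hence "(rv n I v *v w) $ (n - v - 1 - b) = w $ b" using rv_vec[OF w, of "n - v - 1 - b" n] b by auto
  moreover have "n - v - 1 - b < dim_row (rv n I v)" using \<open>b < n - v\<close> by (simp add: rv_def)
  ultimately show "w $ b = 0v (dim_col (rv n I v)) $ b" using z b by (simp add: rv_def)
 qed (use w in \<open>simp add: rv_def\<close>)
qed

lemma D0_a_vec:
 assumes "u \<in> cvec (n - Suc v)" "a < n - v"
 shows "(amap (D0 n) (Suc v) *v u) $ a = (if a = 0 then 0 else u $ (a - 1))"
proof -
 have "(amap (D0 n) (Suc v) *v u) $ a = (\<Sum>b\<in>{0..<n - Suc v}. (if a = Suc b then 1 else 0) * u $ b)"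
  using assms by (simp add: D0_def scalar_prod_def)
 also have "\<dots> = (\<Sum>b\<in>{0..<n - Suc v}. if b = a - 1 then (if a = 0 then 0 else u $ (a - 1)) else 0)"
  by (intro sum.cong) auto
 finally show ?thesis using assms(2) by (auto simp: sum.delta)
qed

lemma D0_b_vec:
 assumes "u \<in> cvec (n - v)" "a < n - Suc v"
 shows "(bmap (D0 n) (Suc v) *v u) $ a = u $ a"
proof -
 have "(bmap (D0 n) (Suc v) *v u) $ a = (\<Sum>b\<in>{0..<n - v}. (if a = b then 1 else 0) * u $ b)"
  using assms by (simp add: D0_def scalar_prod_def)
 also have "\<dots> = (\<Sum>b\<in>{0..<n - v}. if b = a then u $ a else 0)"
  by (intro sum.cong) auto
 finally show ?thesis using assms(2) by (auto simp: sum.delta)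
qed

lemma rv_hom:
 assumes n: "1 < n" and I: "I \<subseteq> {1..n}"
 shows "rep_hom n (Nmod I) (D0 n) (rv n I)"
proof (rule rep_homI[OF Nmod_rep[OF assms] D0_rep[OF n]])
 have f: "finite I" using I finite_subset by blast
 fix v and w :: "complex vec" assume v: "Suc v < n"
 have b: "dd I v \<le> n - v" for v using dd_bound[OF I] .
 show "rv n I v *v (amap (Nmod I) (Suc v) *v w) = amap (D0 n) (Suc v) *v (rv n I (Suc v) *v w)"
  if "w \<in> Sp (Nmod I) (Suc v)"
 proof -
  have w: "w \<in> cvec (dd I (Suc v))" using that by simp
  have aw: "amap (Nmod I) (Suc v) *v w \<in> cvec (dd I v)" using rep_act(1)[OF Nmod_rep[OF assms] v, of w] w by simp
  have rw: "rv n I (Suc v) *v w \<in> cvec (n - Suc v)" by (auto simp: rv_def intro!: carrier_vecI)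
  show ?thesis
  proof (rule eq_vecI)
   fix a assume "a < dim_vec (amap (D0 n) (Suc v) *v (rv n I (Suc v) *v w))"
   hence a: "a < n - v" by (simp add: D0_def)
   show "(rv n I v *v (amap (Nmod I) (Suc v) *v w)) $ a = (amap (D0 n) (Suc v) *v (rv n I (Suc v) *v w)) $ a"
    using rv_vec[OF aw a] rv_vec[OF w, of "a - 1" n] D0_a_vec[OF rw a] a b[of "Suc v"] Nmod_a[OF w, of "n - v - 1 - a"] dd_Suc_le[OF f, of v]
    by (cases a) (auto simp del: index_mult_mat_vec)
  qed (simp add: D0_def rv_def)
 qed
 show "rv n I (Suc v) *v (bmap (Nmod I) (Suc v) *v w) = bmap (D0 n) (Suc v) *v (rv n I v *v w)"
  if "w \<in> Sp (Nmod I) v"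
 proof -
  have w: "w \<in> cvec (dd I v)" using that by simp
  have bw: "bmap (Nmod I) (Suc v) *v w \<in> cvec (dd I (Suc v))" using rep_act(2)[OF Nmod_rep[OF assms] v, of w] w by simp
  have rw: "rv n I v *v w \<in> cvec (n - v)" by (auto simp: rv_def intro!: carrier_vecI)
  show ?thesis
  proof (rule eq_vecI)
   fix a assume "a < dim_vec (bmap (D0 n) (Suc v) *v (rv n I v *v w))"
   hence a: "a < n - Suc v" by (simp add: D0_def)
   show "(rv n I (Suc v) *v (bmap (Nmod I) (Suc v) *v w)) $ a = (bmap (D0 n) (Suc v) *v (rv n I v *v w)) $ a"
    using rv_vec[OF bw a] rv_vec[OF w, of a n] D0_b_vec[OF rw a] a b[of v] Nmod_b[OF w, of "n - Suc v - 1 - a"] dd_le_Suc[OF f, of v]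
    by (auto simp del: index_mult_mat_vec simp: Suc_diff_Suc)
  qed (simp add: D0_def rv_def)
 qed
qed (simp add: rv_def D0_def)

lemma dd_full: "v \<le> n ==> dd {1..n} v = n - v"
proof -
 have "{x \<in> {1..n}. v < x} = {Suc v..n}" by auto
 thus "dd {1..n} v = n - v" by (simp add: dd_def)
qed

lemma D0_Nmod_iso:
 assumes n: "1 < n"
 obtains r where "iso_mor n (D0 n) (Nmod {1..n}) r"
proof -
 have "iso_mor n (Nmod {1..n}) (D0 n) (rv n {1..n})"
  by (rule iso_of_inj[OF Nmod_rep[OF n] D0_rep[OF n] rv_hom[OF n]])
   (use rv_inj[of "{1..n}" n] dd_full[of _ n] in \<open>auto simp: D0_def\<close>)
 thus ?thesis using iso_inverse that by metis
qed

text \<open>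
 The space of \<open>D0\<close> at vertex 0 is uniserial under \<open>t\<close>. Hence the image in it of \<open>e_vX\<close>, for a
 submodule \<open>X\<close>, is the span of the first \<open>vdim X v\<close> coordinates, and \<open>X\<close> is determined by its
 dimensions. Since \<open>t\<close> maps the image of \<open>e_vX\<close> into that of \<open>e_{v+1}X\<close>, consecutive dimensions
 differ by at most one, so that the standard modules occur at most once in a filtration of \<open>X\<close>.
\<close>

lemma submodule_unique:
 assumes n: "1 < n" and d: "delta_filtered n X I"
  and j: "rep_hom n X (D0 n) j" and mono: "mono_mor n X j"
 obtains u where "iso_mor n X (Nmod I) u"
proof -
 define F where "F = Nmod {1..n}"
 have X: "is_rep n X" and m: "a_mono n X" using delta_filtered_rep[OF d] by auto
 have F: "is_rep n F" using Nmod_rep[OF n] by (simp add: F_def)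
 have F0: "vdim F v = n - v" if "v < n" for v using that dd_full[of v n] by (simp add: F_def)
 have n0: "0 < n" using n by simp
 obtain r where r: "iso_mor n (D0 n) F r" using D0_Nmod_iso[OF n] unfolding F_def by metis
 define k where "k = r oR j"
 have k: "rep_hom n X F k" unfolding k_def by (rule hom_comp[OF X D0_rep[OF n] F j iso_hom[OF r]])
 have kz: "x = 0v (vdim X v)" if v: "v < n" and x: "x \<in> Sp X v" and z: "k v *v x = 0v (vdim F v)" for v x
 proof -
  have "r v *v (j v *v x) = 0v (vdim F v)" using z comp_vec[OF j iso_hom[OF r] v x] by (simp add: k_def)
  hence "j v *v x = 0v (vdim (D0 n) v)"
   using iso_inj[OF r v] hom_mat[OF iso_hom[OF r] v] hom_vec[OF j v x] unfolding inj_mat_def by auto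
  moreover have "inj_mat (j v)"
   using mono v inj_mat_iff[OF hom_mat[OF j v]] unfolding mono_mor_def by simp
  ultimately show ?thesis using hom_mat[OF j v] x unfolding inj_mat_def by auto
 qed
 define q where "q v x = k 0 *v inc X v x" for v x
 have lq: "linmap (vdim X v) n (q v)" if "v < n" for v
  unfolding q_def using lin_comp[OF lin_inc[OF X that] hom_lin[OF k n0]] F0[OF n0] by simp
 have qz: "x = 0v (vdim X v)" if v: "v < n" and x: "x \<in> Sp X v" and z: "q v x = 0v n" for v x
  using kz[OF n0 linD(1)[OF lin_inc[OF X v] x]] z F0[OF n0] inc_inj[OF X m v x] by (simp add: q_def)
 have qc: "q v x \<in> cvec n" if "v < n" "x \<in> Sp X v" for v x
  using linD(1)[OF lq[OF that(1)] that(2)] .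
 have ttF: "(tt F ^^ s) y $ a = (if a + s < n then y $ (a + s) else 0)" if "y \<in> cvec n" "a < n" for s y a
  using Nmod_tt_pow[OF n, of "{1..n}" y a s] that dd_full[of 0 n] by (simp add: F_def)
 have tq: "(tt F ^^ s) (q v x) \<in> q v ` Sp X v" if v: "v < n" and x: "x \<in> Sp X v" for s v x
 proof (induction s)
  case (Suc s)
  then obtain y where y: "y \<in> Sp X v" "(tt F ^^ s) (q v x) = q v y" by auto
  obtain y' where y': "y' \<in> Sp X v" "inc X v y' = tt X (inc X v y)"
   using inc_tt[OF X n v y(1)] by auto
  have "(tt F ^^ Suc s) (q v x) = q v y'"
   using y(2) y'(2) hom_tt[OF X F n k linD(1)[OF lin_inc[OF X v] y(1)]] by (simp add: q_def)
  thus ?case using y'(1) by auto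
 qed (use x in auto)
 have low: "q v x $ a = 0" if v: "v < n" and x: "x \<in> Sp X v" and a: "a < n" "vdim X v \<le> a" for v x a
 proof (rule ccontr)
  assume "q v x $ a \<noteq> 0"
  define R where "R = {i. i < n \<and> q v x $ i \<noteq> 0}"
  define t where "t = Max R"
  have R: "finite R" "R \<noteq> {}" using a(1) \<open>q v x $ a \<noteq> 0\<close> by (auto simp: R_def)
  have t: "t < n" "q v x $ t \<noteq> 0" using Max_in[OF R] by (auto simp: R_def t_def)
  have at: "a \<le> t" using Max_ge[OF R(1), of a] a(1) \<open>q v x $ a \<noteq> 0\<close> by (auto simp: R_def t_def)
  have top: "q v x $ i = 0" if "t < i" "i < n" for i
   using Max_ge[OF R(1), of i] that unfolding t_def R_def by fastforce
  have "\<forall>s. \<exists>w\<in>Sp X v. (tt F ^^ (t - s)) (q v x) = q v w" using tq[OF v x] by auto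
  then obtain w where w: "!!s. w s \<in> Sp X v" "!!s. (tt F ^^ (t - s)) (q v x) = q v (w s)" by metis
  define W where "W = mat (vdim X v) (Suc t) (\<lambda>(i, s). w s $ i)"
  have W: "W \<in> carrier_mat (vdim X v) (Suc t)" by (simp add: W_def)
  define c where "c s = q v x $ (t - s)" for s
  have "q v (W *v y) = toep n (Suc t) c *v y" if y: "y \<in> cvec (Suc t)" for y
  proof (rule linmap_eqI[OF lin_comp[OF linmap_mat[OF W] lq[OF v]] linmap_mat[OF toep_carrier] _ y])
   fix b assume b: "b < Suc t"
   have "W *v unit_vec (Suc t) b = w b"
    unfolding mult_unit_vec[OF W b] using b w(1)[of b] by (auto simp: W_def)
   moreover have "q v (w b) = col (toep n (Suc t) c) b"
   proof (rule eq_vecI)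
    fix i assume "i < dim_vec (col (toep n (Suc t) c) b)"
    hence i: "i < n" by simp
    have "q v (w b) $ i = (if i + (t - b) < n then q v x $ (i + (t - b)) else 0)"
     unfolding w(2)[symmetric] by (rule ttF[OF qc[OF v x] i])
    also have "\<dots> = (if i \<le> b then c (b - i) else 0)"
    proof (cases "i \<le> b")
     case True
     hence "i + (t - b) = t - (b - i)" using b by simp
     thus ?thesis using True t(1) by (simp add: c_def)
    next
     case False
     thus ?thesis using b top[of "i + (t - b)"] by simp
    qed
    finally show "q v (w b) $ i = col (toep n (Suc t) c) b $ i" using i b by (simp add: toep_def)
   qed (use qc[OF v w(1)[of b]] in simp)
   ultimately show "q v (W *v unit_vec (Suc t) b) = toep n (Suc t) c *v unit_vec (Suc t) b"
    unfolding mult_unit_vec[OF toep_carrier b] by simp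
  qed
  note Wt = this
  have ti: "inj_mat (toep n (Suc t) c)" by (rule toep_inj) (use t in \<open>auto simp: c_def\<close>)
  have "inj_mat W"
   unfolding inj_mat_def
  proof (intro ballI impI)
   fix y assume "y \<in> cvec (dim_col W)" and z: "W *v y = 0v (dim_row W)"
   hence y: "y \<in> cvec (Suc t)" using W by simp
   have "toep n (Suc t) c *v y = 0v n"
    unfolding Wt[OF y, symmetric] z using W lin0[OF lq[OF v]] by simp
   thus "y = 0v (dim_col W)" using ti y W unfolding inj_mat_def by simp
  qed
  from inj_dim_le[OF W this] show False using at a(2) by simp
 qed
 have xn: "vdim X v \<le> n" if v: "v < n" for v
 proof (rule inj_dim_le[OF mat_of_fun_carrier])
  show "inj_mat (mat_of_fun (vdim X v) n (q v))"
   unfolding inj_mat_def using mat_of_fun_mult[OF lq[OF v]] qz[OF v]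
   by (metis carrier_matD mat_of_fun_carrier)
 qed
 have full: "\<exists>x\<in>Sp X v. q v x = y"
  if v: "v < n" and y: "y \<in> cvec n" and sup: "!!a. a < n ==> vdim X v \<le> a ==> y $ a = 0" for v y
 proof -
  let ?d = "vdim X v"
  have G: "linmap ?d ?d (\<lambda>x. toep ?d n (delta 0) *v q v x)"
   by (rule lin_comp[OF lq[OF v] linmap_mat[OF toep_carrier]])
  have ge: "y' = q v x" if x: "x \<in> cvec ?d" and y': "y' \<in> cvec n"
   and sup': "!!a. a < n ==> ?d \<le> a ==> y' $ a = 0"
   and eq: "toep ?d n (delta 0) *v q v x = toep ?d n (delta 0) *v y'" for x y'
  proof (rule eq_vecI)
   fix a assume "a < dim_vec (q v x)"
   hence a: "a < n" using qc[OF v x] by simp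
   show "y' $ a = q v x $ a"
   proof (cases "a < ?d")
    case True
    hence "(toep ?d n (delta 0) *v q v x) $ a = (toep ?d n (delta 0) *v y') $ a" using eq by simp
    thus ?thesis
     unfolding toep_delta_vec[OF qc[OF v x] True] toep_delta_vec[OF y' True] using a by simp
   qed (use sup'[OF a] low[OF v x a] in simp)
  qed (use qc[OF v x] y' in simp)
  define A where "A = mat_of_fun ?d ?d (\<lambda>x. toep ?d n (delta 0) *v q v x)"
  have A: "A \<in> carrier_mat ?d ?d" by (simp add: A_def)
  have Av: "A *v x = toep ?d n (delta 0) *v q v x" if "x \<in> cvec ?d" for x
   using mat_of_fun_mult[OF G that] by (simp add: A_def)
  have "inj_mat A"
   unfolding inj_mat_def
  proof (intro ballI impI)
   fix x assume "x \<in> cvec (dim_col A)" and z: "A *v x = 0v (dim_row A)"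
   hence x: "x \<in> cvec ?d" using A by simp
   have "0v n = q v x"
    by (rule ge[OF x]) (use Av[OF x] z A lin0[OF linmap_mat[OF toep_carrier[of ?d n "delta 0"]]] in auto)
   thus "x = 0v (dim_col A)" using qz[OF v x] A by simp
  qed
  from inj_square_surj[OF A this, of "toep ?d n (delta 0) *v y"] obtain x where
   "x \<in> cvec ?d" "A *v x = toep ?d n (delta 0) *v y"
   using mult_mat_vec_carrier[OF toep_carrier y] by metis
  thus ?thesis using ge[of x y] Av y sup by auto
 qed
 have unitlow: "\<exists>x\<in>Sp X v. q v x = unit_vec n b" if "v < n" "b < vdim X v" for v b
  using full[OF that(1), of "unit_vec n b"] that xn[OF that(1)] by (auto simp: unit_vec_def)
 have step: "vdim X v \<le> Suc (vdim X (Suc v))" if v: "Suc v < n" for v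
 proof (rule ccontr)
  note v' = Suc_lessD[OF v]
  assume "\<not> vdim X v \<le> Suc (vdim X (Suc v))"
  hence big: "Suc (vdim X (Suc v)) < vdim X v" by simp
  define b where "b = Suc (vdim X (Suc v))"
  obtain x where x: "x \<in> Sp X v" "q v x = unit_vec n b"
   using unitlow[OF v', of b] big by (auto simp: b_def)
  have bn: "b < n" using big xn[OF v'] by (simp add: b_def)
  note bx = rep_act(2)[OF X v x(1)]
  have "q (Suc v) (bmap X (Suc v) *v x) = tt F (unit_vec n b)"
   using inc_b[OF X v x(1)] hom_tt[OF X F n k linD(1)[OF lin_inc[OF X v'] x(1)]] x(2) by (simp add: q_def)
  moreover have "tt F (unit_vec n b) $ vdim X (Suc v) = 1"
   using ttF[of "unit_vec n b" "vdim X (Suc v)" 1] bn by (simp add: b_def)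
  moreover have "vdim X (Suc v) < n" using bn by (simp add: b_def)
  ultimately show False using low[OF v bx, of "vdim X (Suc v)"] by simp
 qed
 have last: "vdim X (n - 1) \<le> 1"
 proof (rule ccontr)
  assume "\<not> vdim X (n - 1) \<le> 1"
  hence b: "1 < vdim X (n - 1)" by simp
  have v: "n - 1 < n" using n by simp
  obtain x where x: "x \<in> cvec (vdim X (n - 1))" "q (n - 1) x = unit_vec n 1"
   using unitlow[OF v b] by auto
  have "tt F (unit_vec n 1) = k 0 *v 0v (vdim X 0)"
   using hom_tt[OF X F n k linD(1)[OF lin_inc[OF X v] x(1)]] x(2) inc_tt_top[OF X n x(1)] by (simp add: q_def)
  hence "tt F (unit_vec n 1) = 0v n"
   using lin0[OF hom_lin[OF k n0]] F0[OF n0] by simp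
  moreover have "tt F (unit_vec n 1) $ 0 = 1" using ttF[of "unit_vec n 1" 0 1] n by simp
  ultimately show False using n by simp
 qed
 obtain mu where mu: "I = {i \<in> {1..n}. mu i > 0}" "!!v. v < n ==> vdim X v = (\<Sum>i\<in>{Suc v..n}. mu i)"
  using delta_filtered_dim[OF d] by metis
 have I: "I \<subseteq> {1..n}" using mu by auto
 have mu1: "mu i = (if i \<in> I then 1 else 0)" if i: "i \<in> {1..n}" for i
 proof -
  have "mu i \<le> 1"
  proof (cases "i = n")
   case True
   thus ?thesis using last mu(2)[of "n - 1"] n by simp
  next
   case False
   define v where "v = i - 1"
   have v: "i = Suc v" "Suc v < n" using i False by (auto simp: v_def)
   have "(\<Sum>i\<in>{Suc v..n}. mu i) = mu (Suc v) + (\<Sum>i\<in>{Suc (Suc v)..n}. mu i)"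
    using v by (intro sum.atLeast_Suc_atMost) simp
   thus ?thesis using step[OF v(2)] mu(2)[OF v(2)] mu(2)[OF Suc_lessD[OF v(2)]] v(1) by simp
  qed
  thus ?thesis using mu(1) i by auto
 qed
 have dim: "vdim X v = dd I v" if v: "v < n" for v
 proof -
  have "vdim X v = (\<Sum>i\<in>{Suc v..n}. if i \<in> I then 1 else 0)"
   unfolding mu(2)[OF v] by (intro sum.cong) (auto simp: mu1)
  also have "\<dots> = card ({Suc v..n} \<inter> I)" by (simp add: sum.If_cases)
  also have "{Suc v..n} \<inter> I = {x \<in> I. v < x}" using I by auto
  finally show ?thesis by (simp add: dd_def)
 qed
 note N = Nmod_rep[OF n I]
 have fin: "finite I" using I finite_subset by blast
 let ?d = "dd I 0"
 have dn: "?d \<le> n" using dd_bound[OF I, of 0] by simp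
 define G where "G x = toep ?d n (delta 0) *v (k 0 *v x)" for x
 have G: "linmap (vdim X 0) (vdim (Nmod I) 0) G"
  unfolding G_def using lin_comp[OF hom_lin[OF k n0] linmap_mat[OF toep_carrier]] F0[OF n0] by simp
 have kx: "k 0 *v x \<in> cvec n" if "x \<in> Sp X 0" for x
  using hom_vec[OF k n0 that] F0[OF n0] by simp
 have Gv: "G x $ a = (k 0 *v x) $ a" if "x \<in> Sp X 0" "a < ?d" for x a
  unfolding G_def using toep_delta_vec[OF kx[OF that(1)] that(2), of 0] that(2) dn by simp
 have Gc: "G x \<in> cvec ?d" if "x \<in> Sp X 0" for x using linD(1)[OF G that] by simp
 obtain u where u: "rep_hom n X (Nmod I) u" "!!x. x \<in> Sp X 0 ==> u 0 *v x = G x"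
 proof (rule hom_extend[OF X N Nmod_mono[OF fin] n G])
  fix x :: "complex vec" assume x: "x \<in> Sp X 0"
  note tx = linD(1)[OF lin_tt[OF X n] x]
  show "G (tt X x) = tt (Nmod I) (G x)"
  proof (rule eq_vecI)
   fix a assume "a < dim_vec (tt (Nmod I) (G x))"
   hence a: "a < ?d" using Nmod_tt_carrier[OF n I Gc[OF x], of 1] by simp
   have "G (tt X x) $ a = tt F (k 0 *v x) $ a"
    unfolding Gv[OF tx a] hom_tt[OF X F n k x] ..
   also have "\<dots> = (if a + 1 < n then (k 0 *v x) $ (a + 1) else 0)"
    using ttF[OF kx[OF x], of a 1] a dn by simp
   also have "\<dots> = tt (Nmod I) (G x) $ a"
    unfolding Nmod_tt[OF n I Gc[OF x] a]
    using Gv[OF x, of "Suc a"] low[OF n0 x, of "Suc a"] dim[OF n0] dn by (auto simp: q_def)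
   finally show "G (tt X x) $ a = tt (Nmod I) (G x) $ a" .
  qed (use Gc[OF tx] Nmod_tt_carrier[OF n I Gc[OF x], of 1] in simp)
 next
  fix v and x :: "complex vec" assume v: "v < n" and x: "x \<in> Sp X v"
  note ix = linD(1)[OF lin_inc[OF X v] x]
  have "\<forall>r<?d. dd I v \<le> r --> G (inc X v x) $ r = 0"
   using Gv[OF ix] low[OF v x] dim[OF v] dn by (simp add: q_def)
  thus "\<exists>y\<in>Sp (Nmod I) v. inc (Nmod I) v y = G (inc X v x)"
   using Nmod_inc_image[OF n I v Gc[OF ix]] by simp
 qed blast
 have "inj_mat (u 0)"
  unfolding inj_mat_def
 proof (intro ballI impI)
  fix x assume "x \<in> cvec (dim_col (u 0))" and z: "u 0 *v x = 0v (dim_row (u 0))"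
  hence x: "x \<in> Sp X 0" using hom_mat[OF u(1) n0] by simp
  have G0: "G x = 0v ?d" using z u(2)[OF x] hom_mat[OF u(1) n0] by simp
  have "q 0 x = 0v n"
  proof (rule eq_vecI)
   fix a assume "a < dim_vec (0v n :: complex vec)"
   thus "q 0 x $ a = 0v n $ a"
    using Gv[OF x, of a] low[OF n0 x, of a] dim[OF n0] G0 by (cases "a < ?d") (auto simp: q_def)
  qed (use qc[OF n0 x] in simp)
  thus "x = 0v (dim_col (u 0))" using qz[OF n0 x] hom_mat[OF u(1) n0] by simp
 qed
 hence "iso_mor n X (Nmod I) u"
  using inj_of_inj0[OF X N m u(1)] dim by (intro iso_of_inj[OF X N u(1)]) auto
 thus ?thesis using that by blast
qed

lemma
 assumes n: "1 < n" and I: "I \<subseteq> {1..n}"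
 shows M_mod_iso: "\<exists>u. iso_mor n (M_mod n I) (Nmod I) u"
  and M_mod_F_Delta: "F_Delta n (M_mod n I)"
proof -
 have "\<exists>X. delta_filtered n X I \<and> (\<exists>f. rep_hom n X (D0 n) f \<and> mono_mor n X f)"
  using Nmod_filtered[OF n I] rv_hom[OF n I] rv_inj[OF I] inj_mat_iff[OF hom_mat[OF rv_hom[OF n I]]]
  unfolding mono_mor_def by blast
 hence d: "delta_filtered n (M_mod n I) I \<and> (\<exists>f. rep_hom n (M_mod n I) (D0 n) f \<and> mono_mor n (M_mod n I) f)"
  unfolding M_mod_def by (rule someI_ex)
 thus "\<exists>u. iso_mor n (M_mod n I) (Nmod I) u" using submodule_unique[OF n] by metis
 show "F_Delta n (M_mod n I)" using d unfolding F_Delta_def by blast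
qed



section \<open>Morphisms between the modules M_I\<close>

text \<open>
The submodule \<open>M_I\<close> is only determined up to isomorphism. One isomorphism from the model is fixed,
and all morphisms are expressed through it.
\<close>

definition PP :: "nat => nat set => rmor" where
 "PP n I = (SOME P. iso_mor n (Nmod I) (M_mod n I) P)"

definition QQ :: "nat => nat set => rmor" where
 "QQ n I = (SOME Q. iso_mor n (M_mod n I) (Nmod I) Q \<and>
   (\<forall>v<n. (\<forall>x\<in>cvec (dd I v). Q v *v (PP n I v *v x) = x) \<and>
      (\<forall>y\<in>Sp (M_mod n I) v. PP n I v *v (Q v *v y) = y)))"

lemma
 assumes n: "1 < n" and I: "I \<subseteq> {1..n}"
 shows PP_iso: "iso_mor n (Nmod I) (M_mod n I) (PP n I)"
  and QQ_iso: "iso_mor n (M_mod n I) (Nmod I) (QQ n I)"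
  and QQ_PP: "v < n ==> x \<in> cvec (dd I v) ==> QQ n I v *v (PP n I v *v x) = x"
  and PP_QQ: "v < n ==> y \<in> Sp (M_mod n I) v ==> PP n I v *v (QQ n I v *v y) = y"
proof -
 obtain u where u: "iso_mor n (M_mod n I) (Nmod I) u" using M_mod_iso[OF n I] by blast
 obtain P where "iso_mor n (Nmod I) (M_mod n I) P" using iso_inverse[OF u] by metis
 thus P: "iso_mor n (Nmod I) (M_mod n I) (PP n I)" unfolding PP_def by (rule someI[of "iso_mor n (Nmod I) (M_mod n I)"])
 have "\<exists>Q. iso_mor n (M_mod n I) (Nmod I) Q \<and>
   (\<forall>v<n. (\<forall>x\<in>cvec (dd I v). Q v *v (PP n I v *v x) = x) \<and>
      (\<forall>y\<in>Sp (M_mod n I) v. PP n I v *v (Q v *v y) = y))"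
  using iso_inverse[OF P] by (metis Nmod_vdim)
 hence Q: "iso_mor n (M_mod n I) (Nmod I) (QQ n I) \<and>
   (\<forall>v<n. (\<forall>x\<in>cvec (dd I v). QQ n I v *v (PP n I v *v x) = x) \<and>
      (\<forall>y\<in>Sp (M_mod n I) v. PP n I v *v (QQ n I v *v y) = y))"
  unfolding QQ_def by (rule someI_ex)
 thus "iso_mor n (M_mod n I) (Nmod I) (QQ n I)"
  "v < n ==> x \<in> cvec (dd I v) ==> QQ n I v *v (PP n I v *v x) = x"
  "v < n ==> y \<in> Sp (M_mod n I) v ==> PP n I v *v (QQ n I v *v y) = y" by auto
qed

lemma M_vdim: "1 < n ==> I \<subseteq> {1..n} ==> v < n ==> vdim (M_mod n I) v = dd I v"
 using iso_dim[OF PP_iso, of n I v] by simp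

lemma M_rep: "1 < n ==> I \<subseteq> {1..n} ==> is_rep n (M_mod n I)"
 and M_mono: "1 < n ==> I \<subseteq> {1..n} ==> a_mono n (M_mod n I)"
 using M_mod_F_Delta F_Delta_rep F_Delta_mono by blast+

lemma PP_vec: "1 < n ==> I \<subseteq> {1..n} ==> v < n ==> x \<in> cvec (dd I v) ==>
  PP n I v *v x \<in> cvec (dd I v)"
 using hom_vec[OF iso_hom[OF PP_iso], of n I v x] M_vdim by simp

lemma QQ_vec: "1 < n ==> I \<subseteq> {1..n} ==> v < n ==> x \<in> cvec (dd I v) ==>
  QQ n I v *v x \<in> cvec (dd I v)"
 using hom_vec[OF iso_hom[OF QQ_iso], of n I v x] M_vdim by simp

lemma PP_carrier: "1 < n ==> I \<subseteq> {1..n} ==> v < n ==> PP n I v \<in> carrier_mat (dd I v) (dd I v)"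
 using hom_mat[OF iso_hom[OF PP_iso], of n I v] M_vdim by simp

lemma QQ_carrier: "1 < n ==> I \<subseteq> {1..n} ==> v < n ==> QQ n I v \<in> carrier_mat (dd I v) (dd I v)"
 using hom_mat[OF iso_hom[OF QQ_iso], of n I v] M_vdim by simp

text \<open>
The condition of \<open>toep_hom\<close> for the power series \<open>\<Sum>s. c s t^s\<close> to define a
morphism \<open>M_I \<rightarrow> M_J\<close>.
\<close>

definition okc :: "nat => nat set => nat set => (nat => complex) => bool" where
 "okc n I J c \<longleftrightarrow> (\<forall>s v. c s \<noteq> 0 --> v < n --> dd I v \<le> dd J v + s)"

definition hm :: "nat => nat set => nat set => (nat => complex) => rmor" where
 "hm n I J c = PP n J oR ((\<lambda>v. toep (dd J v) (dd I v) c) oR QQ n I)"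

lemma hm_hom:
 assumes n: "1 < n" and I: "I \<subseteq> {1..n}" and J: "J \<subseteq> {1..n}" and c: "okc n I J c"
 shows "rep_hom n (M_mod n I) (M_mod n J) (hm n I J c)"
proof -
 have t: "rep_hom n (Nmod I) (Nmod J) (\<lambda>v. toep (dd J v) (dd I v) c)"
  by (rule toep_hom[OF n I J]) (use c in \<open>auto simp: okc_def\<close>)
 note r = M_rep[OF n I] M_rep[OF n J] Nmod_rep[OF n I] Nmod_rep[OF n J]
 show ?thesis
  unfolding hm_def
  by (rule hom_comp[OF r(1,4,2) hom_comp[OF r(1,3,4) iso_hom[OF QQ_iso[OF n I]] t] iso_hom[OF PP_iso[OF n J]]])
qed

lemma hm_vec:
 assumes n: "1 < n" and I: "I \<subseteq> {1..n}" and J: "J \<subseteq> {1..n}" and v: "v < n" and x: "x \<in> cvec (dd I v)"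
 shows "hm n I J c v *v x = PP n J v *v (toep (dd J v) (dd I v) c *v (QQ n I v *v x))"
proof -
 note cq = QQ_carrier[OF n I v] and cp = PP_carrier[OF n J v]
 show ?thesis
  unfolding hm_def mor_comp_def
  using assoc_mult_mat_vec[OF cp mult_carrier_mat[OF toep_carrier cq] x] assoc_mult_mat_vec[OF toep_carrier cq x] by simp
qed

lemma hm_carrier:
 assumes n: "1 < n" and I: "I \<subseteq> {1..n}" and J: "J \<subseteq> {1..n}" and v: "v < n"
 shows "hm n I J c v \<in> carrier_mat (dd J v) (dd I v)"
 unfolding hm_def mor_comp_def using QQ_carrier[OF n I v] PP_carrier[OF n J v] by auto

lemma hm_comp:
 assumes n: "1 < n" and I: "I \<subseteq> {1..n}" and J: "J \<subseteq> {1..n}" and K: "K \<subseteq> {1..n}" and c': "okc n I J c'"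
  and v: "v < n" and x: "x \<in> cvec (dd I v)"
 shows "hm n J K c v *v (hm n I J c' v *v x) = hm n I K (conv c c') v *v x"
proof -
 have q: "QQ n I v *v x \<in> cvec (dd I v)" by (rule QQ_vec[OF n I v x])
 have y: "toep (dd J v) (dd I v) c' *v (QQ n I v *v x) \<in> cvec (dd J v)"
  by (rule mult_mat_vec_carrier[OF toep_carrier q])
 have "toep (dd K v) (dd J v) c * toep (dd J v) (dd I v) c' = toep (dd K v) (dd I v) (conv c c')"
  by (rule toep_mult) (use c' v in \<open>auto simp: okc_def\<close>)
 hence "toep (dd K v) (dd J v) c *v (toep (dd J v) (dd I v) c' *v (QQ n I v *v x)) =
   toep (dd K v) (dd I v) (conv c c') *v (QQ n I v *v x)"
  using assoc_mult_mat_vec[OF toep_carrier toep_carrier q] by metis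
 thus ?thesis
  unfolding hm_vec[OF n I J v x] hm_vec[OF n I K v x] hm_vec[OF n J K v PP_vec[OF n J v y]] QQ_PP[OF n J v y] by simp
qed

lemma hm_add:
 assumes n: "1 < n" and I: "I \<subseteq> {1..n}" and J: "J \<subseteq> {1..n}" and v: "v < n" and x: "x \<in> cvec (dd I v)"
 shows "hm n I J c v *v x + hm n I J c' v *v x = hm n I J (\<lambda>s. c s + c' s) v *v x"
proof -
 have q: "QQ n I v *v x \<in> cvec (dd I v)" by (rule QQ_vec[OF n I v x])
 have e: "toep (dd J v) (dd I v) (\<lambda>s. c s + c' s) = toep (dd J v) (dd I v) c + toep (dd J v) (dd I v) c'"
  by (auto simp: toep_def)
 have tc: "toep (dd J v) (dd I v) c *v (QQ n I v *v x) \<in> cvec (dd J v)" for c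
  by (rule mult_mat_vec_carrier[OF toep_carrier q])
 show ?thesis
  unfolding hm_vec[OF n I J v x] e add_mult_distrib_mat_vec[OF toep_carrier toep_carrier q]
  using linD(2)[OF linmap_mat[OF PP_carrier[OF n J v]] tc tc] by simp
qed

lemma hm_delta0_id:
 assumes n: "1 < n" and I: "I \<subseteq> {1..n}" and v: "v < n" and x: "x \<in> cvec (dd I v)"
 shows "hm n I I (delta 0) v *v x = x"
 unfolding hm_vec[OF n I I v x] toep_id
 using PP_QQ[OF n I v, of x] x QQ_vec[OF n I v x] M_vdim[OF n I v] by simp

lemma hm_coef_eq:
 assumes n: "1 < n" and I: "I \<subseteq> {1..n}" and J: "J \<subseteq> {1..n}"
  and eq: "!!x. x \<in> cvec (dd I 0) ==> hm n I J c 0 *v x = hm n I J c' 0 *v x"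
  and s: "s < dd I 0" and J0: "0 < dd J 0"
 shows "c s = c' s"
proof -
 have n0: "0 < n" using n by simp
 have u: "unit_vec (dd I 0) s \<in> cvec (dd I 0)" by simp
 have tc: "toep (dd J 0) (dd I 0) c *v unit_vec (dd I 0) s \<in> cvec (dd J 0)" for c
  by (rule mult_mat_vec_carrier[OF toep_carrier u])
 have h: "QQ n J 0 *v (hm n I J c 0 *v (PP n I 0 *v unit_vec (dd I 0) s)) = toep (dd J 0) (dd I 0) c *v unit_vec (dd I 0) s" for c
  unfolding hm_vec[OF n I J n0 PP_vec[OF n I n0 u]] QQ_PP[OF n I n0 u] QQ_PP[OF n J n0 tc] ..
 have "toep (dd J 0) (dd I 0) c *v unit_vec (dd I 0) s = toep (dd J 0) (dd I 0) c' *v unit_vec (dd I 0) s"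
  unfolding h[symmetric] using eq[OF PP_vec[OF n I n0 u]] by simp
 hence "col (toep (dd J 0) (dd I 0) c) s $ 0 = col (toep (dd J 0) (dd I 0) c') s $ 0"
  unfolding mult_unit_vec[OF toep_carrier s] by simp
 thus ?thesis using s J0 by (simp add: toep_def)
qed

text \<open>
 Conversely every morphism is of this form: it is determined by the image of the generator of the
 uniserial space at vertex 0.
\<close>

lemma Nmod_hom_coef:
 assumes n: "1 < n" and I: "I \<subseteq> {1..n}" and J: "J \<subseteq> {1..n}" and h: "rep_hom n (Nmod I) (Nmod J) h"
 obtains c where "okc n I J c" "h 0 = toep (dd J 0) (dd I 0) c"
proof -
 have n0: "0 < n" using n by simp
 define p where "p = dd I 0"
 define q where "q = dd J 0"
 have hc: "h 0 \<in> carrier_mat q p" using hom_mat[OF h n0] by (simp add: p_def q_def)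
 define y where "y = h 0 *v unit_vec p (p - 1)"
 have y: "y \<in> cvec q" using hc by (auto simp: y_def)
 define c where "c s = (if s < p \<and> p - 1 - s < q then y $ (p - 1 - s) else 0)" for s
 have he: "(h 0 *v unit_vec p r) $ a = (if a + (p - 1 - r) < q then y $ (a + (p - 1 - r)) else 0)"
  if r: "r < p" and a: "a < q" for r a
 proof -
  have "unit_vec p r = (tt (Nmod I) ^^ (p - 1 - r)) (unit_vec p (p - 1))"
  proof (rule eq_vecI)
   fix b assume "b < dim_vec ((tt (Nmod I) ^^ (p - 1 - r)) (unit_vec p (p - 1)))"
   hence b: "b < p" using Nmod_tt_carrier[OF n I, of "unit_vec p (p - 1)" "p - 1 - r"] by (simp add: p_def)
   show "unit_vec p r $ b = (tt (Nmod I) ^^ (p - 1 - r)) (unit_vec p (p - 1)) $ b"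
    using Nmod_tt_pow[OF n I, of "unit_vec p (p - 1)" b "p - 1 - r"] b r by (auto simp: p_def unit_vec_def)
  qed (use Nmod_tt_carrier[OF n I, of "unit_vec p (p - 1)" "p - 1 - r"] in \<open>simp add: p_def\<close>)
  hence "h 0 *v unit_vec p r = (tt (Nmod J) ^^ (p - 1 - r)) y"
   using hom_tt_pow[OF Nmod_rep[OF n I] Nmod_rep[OF n J] n h, of "unit_vec p (p - 1)" "p - 1 - r"]
   by (simp add: y_def p_def)
  thus ?thesis using Nmod_tt_pow[OF n J, of y a "p - 1 - r"] y a unfolding q_def by (simp del: diff_Suc_eq_diff_pred)
 qed
 have yz: "y $ b = 0" if b: "b < q" "p \<le> b" for b
 proof (cases "p = 0")
  case True
  hence "y = 0v q" using hc unfolding y_def by (intro eq_vecI) (auto simp: scalar_prod_def)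
  thus ?thesis using b by simp
 next
  case False
  have "(tt (Nmod I) ^^ p) (unit_vec p (p - 1)) = 0v p"
  proof (rule eq_vecI)
   fix a assume "a < dim_vec (0v p :: complex vec)"
   thus "(tt (Nmod I) ^^ p) (unit_vec p (p - 1)) $ a = 0v p $ a"
    using Nmod_tt_pow[OF n I, of "unit_vec p (p - 1)" a p] by (simp add: p_def)
  qed (use Nmod_tt_carrier[OF n I, of "unit_vec p (p - 1)" p] in \<open>simp add: p_def\<close>)
  hence "(tt (Nmod J) ^^ p) y = 0v q"
   using hom_tt_pow[OF Nmod_rep[OF n I] Nmod_rep[OF n J] n h, of "unit_vec p (p - 1)" p]
    lin0[OF linmap_mat[OF hc]] by (simp add: y_def p_def)
  thus ?thesis using Nmod_tt_pow[OF n J, of y "b - p" p] y b by (auto simp: q_def)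
 qed
 have "h 0 = toep q p c"
 proof (rule mat_col_eqI[OF hc toep_carrier])
  fix r assume r: "r < p"
  show "col (h 0) r = col (toep q p c) r"
  proof (rule eq_vecI)
   fix a assume "a < dim_vec (col (toep q p c) r)"
   hence a: "a < q" by simp
   have "col (h 0) r $ a = (if a + (p - 1 - r) < q then y $ (a + (p - 1 - r)) else 0)"
    using he[OF r a] mult_unit_vec[OF hc r] by simp
   also have "\<dots> = (if a \<le> r then c (r - a) else 0)"
   proof (cases "a \<le> r")
    case True
    hence "a + (p - 1 - r) = p - 1 - (r - a)" using r by simp
    thus ?thesis using True r by (simp add: c_def)
   next
    case False
    thus ?thesis using yz[of "a + (p - 1 - r)"] r by simp
   qed
   finally show "col (h 0) r $ a = col (toep q p c) r $ a" using r a by (simp add: toep_def)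
  qed (use hc in simp)
 qed
 moreover have "okc n I J c"
  unfolding okc_def
 proof (intro allI impI, rule ccontr)
  fix s v assume cs: "c s \<noteq> 0" and v: "v < n" and "\<not> dd I v \<le> dd J v + s"
  hence big: "dd J v + s < dd I v" by simp
  have f: "finite I" using I finite_subset by blast
  have s: "s < p" "p - 1 - s < q" "y $ (p - 1 - s) \<noteq> 0" using cs by (auto simp: c_def split: if_splits)
  define r where "r = dd I v - 1"
  have r: "r < p" "r < dd I v" "s \<le> r" using big dd_antimono[OF f, of 0 v] by (auto simp: r_def p_def)
  have "\<exists>w\<in>cvec (dd I v). inc (Nmod I) v w = unit_vec p r"
   using Nmod_inc_image[OF n I v, of "unit_vec p r"] r by (auto simp: p_def)
  then obtain w where w: "w \<in> cvec (dd I v)" "inc (Nmod I) v w = unit_vec p r" by auto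
  have "h v *v w \<in> cvec (dd J v)" using hom_vec[OF h v, of w] w by simp
  moreover have "inc (Nmod J) v (h v *v w) = h 0 *v unit_vec p r"
   using hom_inc[OF Nmod_rep[OF n I] Nmod_rep[OF n J] h v, of w] w by simp
  ultimately have "\<forall>a<q. dd J v \<le> a --> (h 0 *v unit_vec p r) $ a = 0"
   using Nmod_inc_image[OF n J v, of "h 0 *v unit_vec p r"] hc unfolding q_def by auto
  moreover have rs: "r - s < q" "dd J v \<le> r - s" using s r big by (auto simp: r_def)
  ultimately have "(h 0 *v unit_vec p r) $ (r - s) = 0" by blast
  moreover have "r - s + (p - 1 - r) = p - 1 - s" using r by simp
  ultimately show False using he[OF r(1) rs(1)] s by simp
 qed
 ultimately show ?thesis using that by (simp add: p_def q_def)
qed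

lemma hom_coef:
 assumes n: "1 < n" and I: "I \<subseteq> {1..n}" and J: "J \<subseteq> {1..n}" and h: "rep_hom n (M_mod n I) (M_mod n J) h"
 obtains c where "okc n I J c" "mor_eq n h (hm n I J c)"
proof -
 have n0: "0 < n" using n by simp
 note r = M_rep[OF n I] M_rep[OF n J] Nmod_rep[OF n I] Nmod_rep[OF n J]
 note P = iso_hom[OF PP_iso[OF n I]] and Q = iso_hom[OF QQ_iso[OF n J]]
 define k where "k = QQ n J oR (h oR PP n I)"
 have hp: "rep_hom n (Nmod I) (M_mod n J) (h oR PP n I)" by (rule hom_comp[OF r(3,1,2) P h])
 have k: "rep_hom n (Nmod I) (Nmod J) k" unfolding k_def by (rule hom_comp[OF r(3,2,4) hp Q])
 obtain c where c: "okc n I J c" "k 0 = toep (dd J 0) (dd I 0) c" by (rule Nmod_hom_coef[OF n I J k])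
 have "mor_eq n h (hm n I J c)"
 proof (rule hom_eqI0[OF r(1,2) M_mono[OF n J] h hm_hom[OF n I J c(1)]])
  fix x :: "complex vec" assume "x \<in> Sp (M_mod n I) 0"
  hence x: "x \<in> cvec (dd I 0)" using M_vdim[OF n I n0] by simp
  have x': "x \<in> Sp (M_mod n I) 0" using x M_vdim[OF n I n0] by simp
  note q = QQ_vec[OF n I n0 x]
  have q': "QQ n I 0 *v x \<in> Sp (Nmod I) 0" using q by simp
  have "k 0 *v (QQ n I 0 *v x) = QQ n J 0 *v (h 0 *v x)"
   unfolding k_def comp_vec[OF hp Q n0 q'] comp_vec[OF P h n0 q'] PP_QQ[OF n I n0 x'] ..
  thus "h 0 *v x = hm n I J c 0 *v x"
   unfolding hm_vec[OF n I J n0 x] c(2)[symmetric] using PP_QQ[OF n J n0 hom_vec[OF h n0 x']] by simp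
 qed
 thus ?thesis using that c(1) by blast
qed

section \<open>Socles\<close>

lemma tt_nilpotent:
 assumes X: "is_rep n X" and n: "1 < n" and x: "x \<in> Sp X 0"
 shows "(tt X ^^ n) x = 0v (vdim X 0)"
proof -
 have v: "n - 1 < n" using n by simp
 have "tt X ((tt X ^^ (n - 1)) x) = 0v (vdim X 0)"
  using inc_tt_top[OF X n path_act_carrier[OF X x n v, of 0]] inc_path_act[OF X n x v] by simp
 moreover have "n = Suc (n - 1)" using n by simp
 ultimately show ?thesis by (metis comp_apply funpow.simps(2))
qed

text \<open>The last nonzero vector among \<open>x, t x, t^2 x, \<dots>\<close>.\<close>

lemma socle_power:
 assumes X: "is_rep n X" and n: "1 < n" and x: "x \<in> Sp X 0" and nz: "x \<noteq> 0v (vdim X 0)"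
 obtains k where "(tt X ^^ k) x \<in> Sp X 0" "(tt X ^^ k) x \<noteq> 0v (vdim X 0)"
  "tt X ((tt X ^^ k) x) = 0v (vdim X 0)"
proof -
 define k where "k = (LEAST k. (tt X ^^ k) x = 0v (vdim X 0))"
 have z: "(tt X ^^ k) x = 0v (vdim X 0)"
  unfolding k_def by (rule LeastI[of "\<lambda>k. (tt X ^^ k) x = 0v (vdim X 0)", OF tt_nilpotent[OF X n x]])
 have "k \<noteq> 0" using z nz by auto
 then obtain l where l: "k = Suc l" by (cases k) auto
 have "(tt X ^^ l) x \<noteq> 0v (vdim X 0)" using not_less_Least[of l "\<lambda>k. (tt X ^^ k) x = 0v (vdim X 0)"] l by (simp add: k_def)
 thus ?thesis
  using that[of l] z l linD(1)[OF linmap_funpow[OF lin_tt[OF X n]] x, of l] by simp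
qed

lemma inj_of_socle:
 assumes X: "is_rep n X" and Y: "is_rep n Y" and n: "1 < n" and f: "rep_hom n X Y f"
  and s: "!!w. w \<in> Sp X 0 ==> tt X w = 0v (vdim X 0) ==> f 0 *v w = 0v (vdim Y 0) ==> w = 0v (vdim X 0)"
 shows "inj_mat (f 0)"
 unfolding inj_mat_def
proof (intro ballI impI, rule ccontr)
 have n0: "0 < n" using n by simp
 note cf = hom_mat[OF f n0]
 fix x assume "x \<in> cvec (dim_col (f 0))" "f 0 *v x = 0v (dim_row (f 0))" "x \<noteq> 0v (dim_col (f 0))"
 hence x: "x \<in> Sp X 0" "f 0 *v x = 0v (vdim Y 0)" "x \<noteq> 0v (vdim X 0)" using cf by auto
 obtain k where k: "(tt X ^^ k) x \<in> Sp X 0" "(tt X ^^ k) x \<noteq> 0v (vdim X 0)"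
  "tt X ((tt X ^^ k) x) = 0v (vdim X 0)" by (rule socle_power[OF X n x(1,3)])
 have "f 0 *v (tt X ^^ k) x = 0v (vdim Y 0)"
  using hom_tt_pow[OF X Y n f x(1), of k] x(2) lin0[OF linmap_funpow[OF lin_tt[OF Y n]], of k] by simp
 thus False using s k by blast
qed

text \<open>
A generator of the socle of \<open>M_I\<close> at vertex 0. Morphisms act on it by their constant coefficient,
which detects isomorphisms.
\<close>

definition es :: "nat => nat set => complex vec" where
 "es n I = PP n I 0 *v unit_vec (dd I 0) 0"

lemma es_carrier: "1 < n ==> I \<subseteq> {1..n} ==> es n I \<in> cvec (dd I 0)"
 unfolding es_def by (rule PP_vec) auto

lemma es_smult_zero:
 assumes n: "1 < n" and I: "I \<subseteq> {1..n}" and p: "0 < dd I 0" and z: "c *s es n I = 0v (dd I 0)"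
 shows "c = 0"
proof -
 have n0: "0 < n" using n by simp
 have u: "c *s unit_vec (dd I 0) 0 \<in> cvec (dd I 0)" by simp
 have "PP n I 0 *v (c *s unit_vec (dd I 0) 0) = 0v (dd I 0)"
  using z linD(3)[OF linmap_mat[OF PP_carrier[OF n I n0]], of "unit_vec (dd I 0) 0" c] by (simp add: es_def)
 hence "c *s unit_vec (dd I 0) 0 = 0v (dd I 0)"
  using QQ_PP[OF n I n0 u] lin0[OF linmap_mat[OF QQ_carrier[OF n I n0]]] by simp
 hence "(c *s unit_vec (dd I 0) 0) $ 0 = 0" using p by simp
 thus ?thesis using p by simp
qed

lemma socle_es:
 assumes n: "1 < n" and I: "I \<subseteq> {1..n}" and w: "w \<in> cvec (dd I 0)" and t: "tt (M_mod n I) w = 0v (dd I 0)"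
 obtains c where "w = c *s es n I"
proof -
 have n0: "0 < n" using n by simp
 define q where "q = QQ n I 0 *v w"
 have q: "q \<in> cvec (dd I 0)" unfolding q_def by (rule QQ_vec[OF n I n0 w])
 have w': "w \<in> Sp (M_mod n I) 0" using w M_vdim[OF n I n0] by simp
 have "tt (Nmod I) q = 0v (dd I 0)"
  using hom_tt[OF M_rep[OF n I] Nmod_rep[OF n I] n iso_hom[OF QQ_iso[OF n I]] w'] t
   lin0[OF linmap_mat[OF QQ_carrier[OF n I n0]]] by (simp add: q_def)
 hence z: "q $ Suc a = 0" if "Suc a < dd I 0" for a using Nmod_tt[OF n I q, of a] that by simp
 have "q = (q $ 0) *s unit_vec (dd I 0) 0"
 proof (rule eq_vecI)
  fix a assume "a < dim_vec ((q $ 0) *s unit_vec (dd I 0) 0)"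
  thus "q $ a = ((q $ 0) *s unit_vec (dd I 0) 0) $ a" using z[of "a - 1"] by (cases a) (auto simp: unit_vec_def)
 qed (use q in simp)
 hence "PP n I 0 *v q = (q $ 0) *s es n I"
  using linD(3)[OF linmap_mat[OF PP_carrier[OF n I n0]], of "unit_vec (dd I 0) 0" "q $ 0"] by (simp add: es_def)
 thus ?thesis using that PP_QQ[OF n I n0 w'] by (simp add: q_def)
qed

lemma hm_es:
 assumes n: "1 < n" and I: "I \<subseteq> {1..n}" and J: "J \<subseteq> {1..n}" and p: "0 < dd I 0" and q: "0 < dd J 0"
 shows "hm n I J c 0 *v es n I = c 0 *s es n J"
proof -
 have n0: "0 < n" using n by simp
 have u: "unit_vec (dd I 0) 0 \<in> cvec (dd I 0)" by simp
 have "toep (dd J 0) (dd I 0) c *v unit_vec (dd I 0) 0 = c 0 *s unit_vec (dd J 0) 0"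
  unfolding mult_unit_vec[OF toep_carrier p] using p q by (intro eq_vecI) (auto simp: toep_def unit_vec_def)
 thus ?thesis
  unfolding hm_vec[OF n I J n0 es_carrier[OF n I]]
  using QQ_PP[OF n I n0 u] linD(3)[OF linmap_mat[OF PP_carrier[OF n J n0]], of "unit_vec (dd J 0) 0" "c 0"]
  by (simp add: es_def)
qed

text \<open>The set is recovered as the places where \<open>dd\<close> drops.\<close>

lemma dd_determines:
 assumes I: "I \<subseteq> {1..n}" and J: "J \<subseteq> {1..n}" and e: "!!v. v < n ==> dd I v = dd J v"
 shows "I = J"
proof -
 have *: "v < n ==> Suc v \<in> I \<longleftrightarrow> Suc v \<in> J" for v
 proof -
  assume v: "v < n"
  have "dd I (Suc v) = dd J (Suc v)"
   using e[of "Suc v"] dd_bound[OF I, of "Suc v"] dd_bound[OF J, of "Suc v"] by (cases "Suc v < n") auto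
  moreover have "finite I" "finite J" using I J finite_subset by blast+
  ultimately show ?thesis using dd_Suc[of I v] dd_Suc[of J v] e[OF v] by (auto split: if_splits)
 qed
 show ?thesis
 proof (rule Set.set_eqI)
  fix x
  show "x \<in> I \<longleftrightarrow> x \<in> J"
  proof (cases "x \<in> {1..n}")
   case True
   thus ?thesis using *[of "x - 1"] by auto
  qed (use I J in auto)
 qed
qed

section \<open>Morphisms into and out of direct sums\<close>

definition zmor :: "rep => rep => rmor" where
 "zmor X Y v = 0\<^sub>m (vdim Y v) (vdim X v)"

lemma zmor_hom: "is_rep n X ==> is_rep n Y ==> rep_hom n X Y (zmor X Y)"
 by (rule rep_homI) (auto simp: zmor_def zero_mv rep_act lin0[OF linmap_act(1)] lin0[OF linmap_act(2)])

lemma hpair_vec':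
 assumes "rep_hom n X Y f" "rep_hom n X Z g" "v < n" "x \<in> Sp X v"
 shows "hpair X Y Z f g v *v x = (f v *v x) @v (g v *v x)"
 using hpair_vec hom_mat assms by metis

lemma hcopair_vec':
 assumes "rep_hom n X Z f" "rep_hom n Y Z g" "v < n" "x \<in> Sp X v" "y \<in> Sp Y v"
 shows "hcopair X Y Z f g v *v (x @v y) = f v *v x + g v *v y"
 using hcopair_vec hom_mat assms by metis

lemma dsum_in1: "1 < n ==> is_rep n X ==> is_rep n Y ==> rep_hom n X (X +R Y) (in1 X Y)"
 unfolding dsum_cext using in1_hom cocycle_zero by blast

lemma dsum_pr2: "1 < n ==> is_rep n X ==> is_rep n Y ==> rep_hom n (X +R Y) Y (pr2 X Y)"
 unfolding dsum_cext using pr2_hom cocycle_zero by blast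

definition in2 :: "rep => rep => rmor" where "in2 X Y = hpair Y X Y (zmor Y X) (mor_id Y)"

definition pr1 :: "rep => rep => rmor" where "pr1 X Y = hcopair X Y X (mor_id X) (zmor Y X)"

lemma dsum_in2: "1 < n ==> is_rep n X ==> is_rep n Y ==> rep_hom n Y (X +R Y) (in2 X Y)"
 unfolding in2_def by (intro hpair_hom zmor_hom rep_hom_id)

lemma dsum_pr1: "1 < n ==> is_rep n X ==> is_rep n Y ==> rep_hom n (X +R Y) X (pr1 X Y)"
 unfolding pr1_def by (intro hcopair_hom zmor_hom rep_hom_id)

lemma in2_vec: "y \<in> Sp Y v ==> in2 X Y v *v y = 0v (vdim X v) @v y"
 unfolding in2_def by (subst hpair_vec) (auto simp: zmor_def mor_id_def zero_mv)

lemma pr1_vec: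
 "x \<in> Sp X v ==> y \<in> Sp Y v ==> pr1 X Y v *v (x @v y) = x"
 unfolding pr1_def by (subst hcopair_vec) (auto simp: zmor_def mor_id_def zero_mv)

lemma dsum_hom_in:
 assumes n: "1 < n" and r: "is_rep n X" "is_rep n Y" "is_rep n Z" and h: "rep_hom n X (Y +R Z) h"
 obtains h1 h2 where "rep_hom n X Y h1" "rep_hom n X Z h2"
  "!!v x. v < n ==> x \<in> Sp X v ==> h v *v x = (h1 v *v x) @v (h2 v *v x)"
proof -
 note p1 = dsum_pr1[OF n r(2,3)] and p2 = dsum_pr2[OF n r(2,3)] and d = dsum_rep[OF n r(2,3)]
 have "h v *v x = ((pr1 Y Z oR h) v *v x) @v ((pr2 Y Z oR h) v *v x)"
  if v: "v < n" and x: "x \<in> Sp X v" for v x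
 proof -
  obtain a b where ab: "a \<in> Sp Y v" "b \<in> Sp Z v" "h v *v x = a @v b"
   by (rule vec_splitE[OF hom_vec[OF h v x, unfolded vdim_dsum]])
  show ?thesis
   unfolding comp_vec[OF h p1 v x] comp_vec[OF h p2 v x] ab(3) pr1_vec[OF ab(1,2)] pr2_vec[OF ab(1,2)] ..
 qed
 thus ?thesis using that[OF hom_comp[OF r(1) d r(2) h p1] hom_comp[OF r(1) d r(3) h p2]] by blast
qed

lemma dsum_hom_out:
 assumes n: "1 < n" and r: "is_rep n X" "is_rep n Y" "is_rep n Z" and h: "rep_hom n (X +R Y) Z h"
 obtains h1 h2 where "rep_hom n X Z h1" "rep_hom n Y Z h2"
  "!!v x y. v < n ==> x \<in> Sp X v ==> y \<in> Sp Y v ==>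
   h v *v (x @v y) = h1 v *v x + h2 v *v y"
proof -
 note i1 = dsum_in1[OF n r(1,2)] and i2 = dsum_in2[OF n r(1,2)] and d = dsum_rep[OF n r(1,2)]
 have "h v *v (x @v y) = (h oR in1 X Y) v *v x + (h oR in2 X Y) v *v y"
  if v: "v < n" and x: "x \<in> Sp X v" and y: "y \<in> Sp Y v" for v x y
 proof -
  have e: "x @v y = (x @v 0v (vdim Y v)) + (0v (vdim X v) @v y)"
   using append_add[OF x zero_carrier_vec zero_carrier_vec y] x y by simp
  have c: "x @v 0v (vdim Y v) \<in> Sp (X +R Y) v" "0v (vdim X v) @v y \<in> Sp (X +R Y) v"
   using x y by auto
  show ?thesis
   unfolding comp_vec[OF i1 h v x] comp_vec[OF i2 h v y] in1_vec[OF x] in2_vec[OF y]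
   using linD(2)[OF hom_lin[OF h v] c] e by simp
 qed
 thus ?thesis using that[OF hom_comp[OF r(1) d r(3) i1 h] hom_comp[OF r(2) d r(3) i2 h]] by blast
qed



section \<open>Exchange sequences\<close>

lemma conv_neg: "conv c (\<lambda>t. - c' t) = (\<lambda>t. - conv c c' t)"
 by (auto simp: conv_def sum_negf)

lemma conv_delta0_right: "conv c (delta 0) = c"
 using conv_commute conv_delta0 by metis

lemma conv_delta_right: "conv c (delta k) t = (if k \<le> t then c (t - k) else 0)"
 using conv_commute conv_delta by metis

lemma hm_zero:
 assumes n: "1 < n" and I: "I \<subseteq> {1..n}" and J: "J \<subseteq> {1..n}" and v: "v < n" and x: "x \<in> cvec (dd I v)"
 shows "hm n I J (\<lambda>_. 0) v *v x = 0v (dd J v)"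
proof -
 have "toep (dd J v) (dd I v) (\<lambda>_. 0) = 0\<^sub>m (dd J v) (dd I v)" by (auto simp: toep_def)
 thus ?thesis
  unfolding hm_vec[OF n I J v x]
  using zero_mv[OF QQ_vec[OF n I v x]] lin0[OF linmap_mat[OF PP_carrier[OF n J v]]] by simp
qed

lemma hm_surj:
 assumes n: "1 < n" and I: "I \<subseteq> {1..n}" and J: "J \<subseteq> {1..n}" and v: "v < n"
  and d: "dd I v = dd J v + k" and y: "y \<in> cvec (dd J v)"
 shows "\<exists>x\<in>cvec (dd I v). hm n I J (delta k) v *v x = y"
proof -
 obtain q where q: "q \<in> cvec (dd I v)" "toep (dd J v) (dd I v) (delta k) *v q = QQ n J v *v y"
  using toep_delta_surj[OF d[symmetric] QQ_vec[OF n J v y]] by auto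
 show ?thesis
  using PP_vec[OF n I v q(1)] hm_vec[OF n I J v PP_vec[OF n I v q(1)], of "delta k"] QQ_PP[OF n I v q(1)] q(2)
   PP_QQ[OF n J v, of y] M_vdim[OF n J v] y by (intro bexI[of _ "PP n I v *v q"]) auto
qed

text \<open>
Numerical data of a sequence \<open>0 \<rightarrow> M_A \<rightarrow> M_B \<oplus> M_C \<rightarrow> M_Z
\<rightarrow> 0\<close> with maps \<open>(t^s, -1)\<close> and \<open>(1, t^s)\<close>. The inequalities make
these maps morphisms, \<open>dims\<close> and \<open>onto\<close> make the sequence exact, and \<open>B0\<close>
provides the section over vertex 0 needed for exactness under \<open>\<eta>\<close>. The conditions
\<open>noXY\<close> exclude isomorphisms between the components; they are what minimality and non-splitting rest
on.
\<close>

locale exchange =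
 fixes n :: nat and A B C Z :: "nat set" and s :: nat
 assumes n: "1 < n"
  and A: "A \<subseteq> {1..n}" and B: "B \<subseteq> {1..n}" and C: "C \<subseteq> {1..n}" and Z: "Z \<subseteq> {1..n}"
  and AB: "!!v. v < n ==> dd A v \<le> dd B v + s" and AC: "!!v. v < n ==> dd A v \<le> dd C v"
  and BZ: "!!v. v < n ==> dd B v \<le> dd Z v" and CZ: "!!v. v < n ==> dd C v \<le> dd Z v + s"
  and dims: "!!v. v < n ==> dd A v + dd Z v = dd B v + dd C v"
  and onto: "!!v. v < n ==> dd B v = dd Z v \<or> dd C v = dd Z v + s"
  and B0: "dd B 0 = dd Z 0" and posA: "s < dd A 0" and posZ: "0 < dd Z 0"
  and noCB: "\<exists>v<n. dd B v + s < dd C v" and noBC: "s = 0 ==> \<exists>v<n. dd C v < dd B v"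
  and noZB: "\<exists>v<n. dd B v < dd Z v" and noZC: "s = 0 ==> \<exists>v<n. dd C v < dd Z v"
begin

abbreviation "MA \<equiv> M_mod n A"
abbreviation "MB \<equiv> M_mod n B"
abbreviation "MC \<equiv> M_mod n C"
abbreviation "MZ \<equiv> M_mod n Z"

definition ff :: rmor where "ff = hpair MA MB MC (hm n A B (delta s)) (hm n A C (\<lambda>t. - delta 0 t))"
definition gg :: rmor where "gg = hcopair MB MC MZ (hm n B Z (delta 0)) (hm n C Z (delta s))"

lemma n0: "0 < n" using n by simp

lemma posB: "0 < dd B 0" using B0 posZ by simp
lemma posC: "s < dd C 0" using dims[OF n0] B0 posA by simp

lemmas rA = M_rep[OF n A] and rB = M_rep[OF n B] and rC = M_rep[OF n C] and rZ = M_rep[OF n Z]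
lemmas rBC = dsum_rep[OF n rB rC]

lemma ok: "okc n A B (delta s)" "okc n A C (\<lambda>t. - delta 0 t)" "okc n B Z (delta 0)" "okc n C Z (delta s)"
 using AB AC BZ CZ by (auto simp: okc_def delta_def)

lemmas hAB = hm_hom[OF n A B ok(1)] and hAC = hm_hom[OF n A C ok(2)]
 and hBZ = hm_hom[OF n B Z ok(3)] and hCZ = hm_hom[OF n C Z ok(4)]

lemma ff_hom: "rep_hom n MA (MB +R MC) ff"
 unfolding ff_def by (rule hpair_hom[OF n rA rB rC hAB hAC])

lemma gg_hom: "rep_hom n (MB +R MC) MZ gg"
 unfolding gg_def by (rule hcopair_hom[OF n rB rC rZ hBZ hCZ])

lemma ff_vec: "v < n ==> x \<in> cvec (dd A v) ==>
  ff v *v x = (hm n A B (delta s) v *v x) @v (hm n A C (\<lambda>t. - delta 0 t) v *v x)"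
 unfolding ff_def using hpair_vec'[OF hAB hAC] M_vdim[OF n A] by simp

lemma gg_vec: "v < n ==> x \<in> cvec (dd B v) ==> y \<in> cvec (dd C v) ==>
  gg v *v (x @v y) = hm n B Z (delta 0) v *v x + hm n C Z (delta s) v *v y"
 unfolding gg_def using hcopair_vec'[OF hBZ hCZ] M_vdim[OF n B] M_vdim[OF n C] by simp

lemma hm_in: "I \<subseteq> {1..n} ==> J \<subseteq> {1..n} ==> v < n ==> x \<in> cvec (dd I v) ==>
  hm n I J c v *v x \<in> cvec (dd J v)"
 using hm_carrier[OF n, of I J v c] by auto

lemma exchange_exact: "E_exact n MA (MB +R MC) MZ ff gg"
proof (rule E_exactI[OF n M_mod_F_Delta[OF n A] F_Delta_dsum[OF n M_mod_F_Delta[OF n B] M_mod_F_Delta[OF n C]]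
   M_mod_F_Delta[OF n Z] ff_hom gg_hom])
 show "inj_mat (ff 0)"
 proof (rule inj_of_socle[OF rA rBC n ff_hom])
  fix w assume "w \<in> Sp MA 0" and t: "tt MA w = 0v (vdim MA 0)" and z: "ff 0 *v w = 0v (vdim (MB +R MC) 0)"
  hence w: "w \<in> cvec (dd A 0)" using M_vdim[OF n A n0] by simp
  obtain c where c: "w = c *s es n A" using socle_es[OF n A w] t M_vdim[OF n A n0] by auto
  have "hm n A C (\<lambda>t. - delta 0 t) 0 *v w = 0v (dd C 0)"
   using z unfolding ff_vec[OF n0 w]
   using append_vec_zero_iff[OF hm_in[OF A B n0 w] hm_in[OF A C n0 w]] M_vdim[OF n B n0] M_vdim[OF n C n0] by auto
  hence z': "(- c) *s es n C = 0v (dd C 0)"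
   unfolding c using linD(3)[OF linmap_mat[OF hm_carrier[OF n A C n0]] es_carrier[OF n A]]
    hm_es[OF n A C _ _, of "\<lambda>t. - delta 0 t"] posA posC by (simp add: smult_smult_assoc delta_def)
  have "- c = 0" by (rule es_smult_zero[OF n C _ z']) (use posC in simp)
  thus "w = 0v (vdim MA 0)" unfolding c using es_carrier[OF n A] M_vdim[OF n A n0] by auto
 qed
 show "gg 0 *v (ff 0 *v x) = 0v (vdim MZ 0)" if "x \<in> Sp MA 0" for x
 proof -
  have x: "x \<in> cvec (dd A 0)" using that M_vdim[OF n A n0] by simp
  have "gg 0 *v (ff 0 *v x) = hm n A Z (conv (delta 0) (delta s)) 0 *v x + hm n A Z (conv (delta s) (\<lambda>t. - delta 0 t)) 0 *v x"
   unfolding ff_vec[OF n0 x] gg_vec[OF n0 hm_in[OF A B n0 x] hm_in[OF A C n0 x]]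
    hm_comp[OF n A B Z ok(1) n0 x] hm_comp[OF n A C Z ok(2) n0 x] ..
  also have "\<dots> = hm n A Z (\<lambda>_. 0) 0 *v x"
   unfolding hm_add[OF n A Z n0 x] conv_neg conv_delta0 conv_delta0_right by simp
  finally show ?thesis using hm_zero[OF n A Z n0 x] M_vdim[OF n Z n0] by simp
 qed
 show "\<exists>y\<in>Sp (MB +R MC) v. gg v *v y = z" if v: "v < n" and "z \<in> Sp MZ v" for v z
 proof -
  have z: "z \<in> cvec (dd Z v)" using that M_vdim[OF n Z v] by simp
  note d = M_vdim[OF n B v] M_vdim[OF n C v]
  from onto[OF v] show ?thesis
  proof
   assume e: "dd B v = dd Z v"
   obtain x where x: "x \<in> cvec (dd B v)" "hm n B Z (delta 0) v *v x = z"
    using hm_surj[OF n B Z v _ z, of 0] e by auto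
   have "gg v *v (x @v 0v (dd C v)) = z"
    unfolding gg_vec[OF v x(1) zero_carrier_vec]
    using x(2) lin0[OF linmap_mat[OF hm_carrier[OF n C Z v]]] z by simp
   thus ?thesis using x(1) d by (intro bexI[of _ "x @v 0v (dd C v)"]) auto
  next
   assume e: "dd C v = dd Z v + s"
   obtain x where x: "x \<in> cvec (dd C v)" "hm n C Z (delta s) v *v x = z"
    using hm_surj[OF n C Z v e z] by auto
   have "gg v *v (0v (dd B v) @v x) = z"
    unfolding gg_vec[OF v zero_carrier_vec x(1)]
    using x(2) lin0[OF linmap_mat[OF hm_carrier[OF n B Z v]]] z by simp
   thus ?thesis using x(1) d by (intro bexI[of _ "0v (dd B v) @v x"]) auto
  qed
 qed
 show "vdim (MB +R MC) v = vdim MA v + vdim MZ v" if v: "v < n" for v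
  using dims[OF v] M_vdim[OF n A v] M_vdim[OF n B v] M_vdim[OF n C v] M_vdim[OF n Z v] by simp
 let ?s = "\<lambda>z. (PP n B 0 *v (QQ n Z 0 *v z)) @v 0v (dd C 0)"
 have lin: "linmap (dd Z 0) (dd B 0) (\<lambda>z. PP n B 0 *v (QQ n Z 0 *v z))"
  using lin_comp[OF linmap_mat[OF QQ_carrier[OF n Z n0]] linmap_mat[OF PP_carrier[OF n B n0, unfolded B0]]] by (simp add: B0)
 show "linmap (vdim MZ 0) (vdim (MB +R MC) 0) ?s"
  using linmap_append[OF lin linmap_zero_fun] M_vdim[OF n _ n0] B C Z by simp
 fix z :: "complex vec" assume "z \<in> Sp MZ 0"
 hence z': "z \<in> Sp MZ 0" and z: "z \<in> cvec (dd Z 0)" using M_vdim[OF n Z n0] by auto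
 define q where "q = QQ n Z 0 *v z"
 have q: "q \<in> cvec (dd Z 0)" unfolding q_def by (rule QQ_vec[OF n Z n0 z])
 have q': "q \<in> cvec (dd B 0)" using q B0 by simp
 note pq = PP_vec[OF n B n0 q']
 have "hm n B Z (delta 0) 0 *v (PP n B 0 *v q) = z"
  unfolding hm_vec[OF n B Z n0 pq] QQ_PP[OF n B n0 q'] B0 toep_id
  using q PP_QQ[OF n Z n0 z'] by (simp add: q_def)
 thus "gg 0 *v ?s z = z"
  unfolding q_def[symmetric] gg_vec[OF n0 pq zero_carrier_vec]
  using lin0[OF linmap_mat[OF hm_carrier[OF n C Z n0]]] z by simp
 have ttq: "tt (Nmod B) q = tt (Nmod Z) q"
 proof (rule eq_vecI)
  fix a assume "a < dim_vec (tt (Nmod Z) q)"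
  hence "a < dd Z 0" using Nmod_tt_carrier[OF n Z q, of 1] by simp
  thus "tt (Nmod B) q $ a = tt (Nmod Z) q $ a" using Nmod_tt[OF n B q', of a] Nmod_tt[OF n Z q, of a] B0 by simp
 qed (use Nmod_tt_carrier[OF n B q', of 1] Nmod_tt_carrier[OF n Z q, of 1] B0 in simp)
 have "QQ n Z 0 *v tt MZ z = tt (Nmod Z) q"
  using hom_tt[OF rZ Nmod_rep[OF n Z] n iso_hom[OF QQ_iso[OF n Z]] z'] by (simp add: q_def)
 moreover have "PP n B 0 *v tt (Nmod B) q = tt MB (PP n B 0 *v q)"
  using hom_tt[OF Nmod_rep[OF n B] rB n iso_hom[OF PP_iso[OF n B]], of q] q' by simp
 moreover have "tt (MB +R MC) ((PP n B 0 *v q) @v 0v (dd C 0)) = tt MB (PP n B 0 *v q) @v 0v (dd C 0)"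
  using tt_dsum[OF rB rC n, of "PP n B 0 *v q" "0v (dd C 0)"] pq lin0[OF lin_tt[OF rC n]]
   M_vdim[OF n B n0] M_vdim[OF n C n0] by simp
 ultimately show "?s (tt MZ z) = tt (MB +R MC) (?s z)"
  unfolding q_def[symmetric] using ttq by simp
qed

text \<open>
 An endomorphism of \<open>M_B \<oplus> M_C\<close> is a \<open>2 \<times> 2\<close> matrix of power series. If its constant terms form
 a lower unitriangular matrix, then it is injective on the socle, hence invertible.
\<close>

lemma endo_unitriangular_iso:
 assumes h: "rep_hom n (MB +R MC) (MB +R MC) h"
  and h0: "!!x y. x \<in> cvec (dd B 0) ==> y \<in> cvec (dd C 0) ==> h 0 *v (x @v y) =
   (hm n B B c11 0 *v x + hm n C B c12 0 *v y) @v (hm n B C c21 0 *v x + hm n C C c22 0 *v y)"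
  and c: "c11 0 = 1" "c12 0 = 0" "c22 0 = 1"
 shows "iso_mor n (MB +R MC) (MB +R MC) h"
proof -
 note dB = M_vdim[OF n B n0] and dC = M_vdim[OF n C n0]
 have pC: "0 < dd C 0" using posC by simp
 have "inj_mat (h 0)"
 proof (rule inj_of_socle[OF rBC rBC n h])
  fix w assume "w \<in> Sp (MB +R MC) 0" and t: "tt (MB +R MC) w = 0v (vdim (MB +R MC) 0)"
   and z: "h 0 *v w = 0v (vdim (MB +R MC) 0)"
  hence "w \<in> cvec (dd B 0 + dd C 0)" using dB dC by simp
  then obtain x y where xy: "x \<in> cvec (dd B 0)" "y \<in> cvec (dd C 0)" "w = x @v y" by (rule vec_splitE)
  have "tt MB x @v tt MC y = 0v (dd B 0 + dd C 0)"
   using t tt_dsum[OF rB rC n, of x y] xy dB dC by simp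
  hence "tt MB x = 0v (dd B 0)" "tt MC y = 0v (dd C 0)"
   using append_vec_zero_iff[of "tt MB x" "dd B 0" "tt MC y" "dd C 0"] linD(1)[OF lin_tt[OF rB n], of x]
    linD(1)[OF lin_tt[OF rC n], of y] xy dB dC by auto
  then obtain a b where ab: "x = a *s es n B" "y = b *s es n C"
   using socle_es[OF n B xy(1)] socle_es[OF n C xy(2)] by metis
  have hs: "hm n I J cc 0 *v (e *s es n I) = (e * cc 0) *s es n J"
   if I: "I \<subseteq> {1..n}" and J: "J \<subseteq> {1..n}" and p: "0 < dd I 0" and q: "0 < dd J 0" for I J cc e
   unfolding linD(3)[OF linmap_mat[OF hm_carrier[OF n I J n0]] es_carrier[OF n I]] hm_es[OF n I J p q]
   by (simp add: smult_smult_assoc)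
  note eB = es_carrier[OF n B] and eC = es_carrier[OF n C]
  have z0: "0 *s es n B = 0v (dd B 0)" "0 *s es n C = 0v (dd C 0)" using eB eC by auto
  have "(hm n B B c11 0 *v x + hm n C B c12 0 *v y) @v (hm n B C c21 0 *v x + hm n C C c22 0 *v y) = 0v (dd B 0 + dd C 0)"
   using z h0[OF xy(1,2)] xy(3) dB dC by simp
  hence zz: "hm n B B c11 0 *v x + hm n C B c12 0 *v y = 0v (dd B 0)" "hm n B C c21 0 *v x + hm n C C c22 0 *v y = 0v (dd C 0)"
   using append_vec_zero_iff[of "hm n B B c11 0 *v x + hm n C B c12 0 *v y" "dd B 0" "hm n B C c21 0 *v x + hm n C C c22 0 *v y" "dd C 0"]
    hm_in[OF B B n0 xy(1)] hm_in[OF C B n0 xy(2)] hm_in[OF B C n0 xy(1)] hm_in[OF C C n0 xy(2)] by auto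
  have "a *s es n B = 0v (dd B 0)"
   using zz(1) z0 hs[OF B B posB posB, of c11 a] hs[OF C B pC posB, of c12 b] eB unfolding ab by (simp add: c)
  hence a: "a = 0" by (rule es_smult_zero[OF n B posB])
  have "b *s es n C = 0v (dd C 0)"
   using zz(2) z0 hs[OF B C posB pC, of c21 a] hs[OF C C pC pC, of c22 b] eC unfolding ab by (simp add: c a)
  hence b: "b = 0" by (rule es_smult_zero[OF n C pC])
  have "x = 0v (dd B 0)" "y = 0v (dd C 0)" using ab a b eB eC by auto
  thus "w = 0v (vdim (MB +R MC) 0)" using xy(3) dB dC by (simp add: zero_append)
 qed
 moreover have "a_mono n (MB +R MC)"
  using F_Delta_mono[OF F_Delta_dsum[OF n M_mod_F_Delta[OF n B] M_mod_F_Delta[OF n C]]] .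
 ultimately show ?thesis
  using inj_of_inj0[OF rBC rBC _ h] by (intro iso_of_inj[OF rBC rBC h]) auto
qed

lemma endo_coef:
 assumes h: "rep_hom n (MB +R MC) (MB +R MC) h"
 obtains c11 c12 c21 c22 where "okc n B B c11" "okc n C B c12" "okc n B C c21" "okc n C C c22"
  "!!x y. x \<in> cvec (dd B 0) ==> y \<in> cvec (dd C 0) ==> h 0 *v (x @v y) =
   (hm n B B c11 0 *v x + hm n C B c12 0 *v y) @v (hm n B C c21 0 *v x + hm n C C c22 0 *v y)"
proof -
 note dB = M_vdim[OF n B n0] and dC = M_vdim[OF n C n0]
 obtain h1 h2 where hh: "rep_hom n (MB +R MC) MB h1" "rep_hom n (MB +R MC) MC h2"
  "!!v x. v < n ==> x \<in> Sp (MB +R MC) v ==> h v *v x = (h1 v *v x) @v (h2 v *v x)"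
  using dsum_hom_in[OF n rBC rB rC h] by blast
 obtain k11 k12 where k1: "rep_hom n MB MB k11" "rep_hom n MC MB k12"
  "!!v x y. v < n ==> x \<in> Sp MB v ==> y \<in> Sp MC v ==> h1 v *v (x @v y) = k11 v *v x + k12 v *v y"
  using dsum_hom_out[OF n rB rC rB hh(1)] by blast
 obtain k21 k22 where k2: "rep_hom n MB MC k21" "rep_hom n MC MC k22"
  "!!v x y. v < n ==> x \<in> Sp MB v ==> y \<in> Sp MC v ==> h2 v *v (x @v y) = k21 v *v x + k22 v *v y"
  using dsum_hom_out[OF n rB rC rC hh(2)] by blast
 obtain c11 where c11: "okc n B B c11" "mor_eq n k11 (hm n B B c11)" by (rule hom_coef[OF n B B k1(1)])
 obtain c12 where c12: "okc n C B c12" "mor_eq n k12 (hm n C B c12)" by (rule hom_coef[OF n C B k1(2)])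
 obtain c21 where c21: "okc n B C c21" "mor_eq n k21 (hm n B C c21)" by (rule hom_coef[OF n B C k2(1)])
 obtain c22 where c22: "okc n C C c22" "mor_eq n k22 (hm n C C c22)" by (rule hom_coef[OF n C C k2(2)])
 have e: "k11 0 = hm n B B c11 0" "k12 0 = hm n C B c12 0" "k21 0 = hm n B C c21 0" "k22 0 = hm n C C c22 0"
  using c11(2) c12(2) c21(2) c22(2) n0 unfolding mor_eq_def by auto
 show ?thesis
  by (rule that[OF c11(1) c12(1) c21(1) c22(1)]) (use hh(3)[OF n0] k1(3)[OF n0] k2(3)[OF n0] e dB dC in simp)
qed

lemma okCB: "okc n C B c ==> t \<le> s ==> c t = 0"
 using noCB unfolding okc_def by (metis add_le_mono le_refl not_less order_trans)

lemma okBC: "okc n B C c ==> s = 0 ==> c 0 = 0"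
 using noBC unfolding okc_def by (metis add.right_neutral not_less)

text \<open>
Comparing coefficients in \<open>gg h = gg\<close> at the socle forces the diagonal constant terms of
\<open>h\<close> to be 1, because \<open>noCB\<close> and \<open>noBC\<close> kill the constant terms off the
diagonal.
\<close>

lemma gg_right_minimal:
 assumes h: "rep_hom n (MB +R MC) (MB +R MC) h" and e: "mor_eq n (gg oR h) gg"
 shows "iso_mor n (MB +R MC) (MB +R MC) h"
proof -
 note dB = M_vdim[OF n B n0] and dC = M_vdim[OF n C n0]
 obtain c11 c12 c21 c22 where ok': "okc n B B c11" "okc n C B c12" "okc n B C c21" "okc n C C c22"
  "!!x y. x \<in> cvec (dd B 0) ==> y \<in> cvec (dd C 0) ==> h 0 *v (x @v y) =
   (hm n B B c11 0 *v x + hm n C B c12 0 *v y) @v (hm n B C c21 0 *v x + hm n C C c22 0 *v y)"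
  using endo_coef[OF h] by blast
 note h0 = ok'(5)
 have gh: "gg 0 *v (h 0 *v w) = gg 0 *v w" if "w \<in> Sp (MB +R MC) 0" for w
  using comp_vec[OF h gg_hom n0 that] eq_vec[OF e n0, of w] by simp
 have z: "hm n I J c 0 *v 0v (dd I 0) = 0v (dd J 0)" if "I \<subseteq> {1..n}" "J \<subseteq> {1..n}" for I J c
  by (rule lin0[OF linmap_mat[OF hm_carrier[OF n that n0]]])
 have 1: "hm n B Z (\<lambda>t. conv (delta 0) c11 t + conv (delta s) c21 t) 0 *v x = hm n B Z (delta 0) 0 *v x"
  if x: "x \<in> cvec (dd B 0)" for x
 proof -
  have "gg 0 *v (h 0 *v (x @v 0v (dd C 0))) = hm n B Z (delta 0) 0 *v (hm n B B c11 0 *v x) + hm n C Z (delta s) 0 *v (hm n B C c21 0 *v x)"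
   unfolding h0[OF x zero_carrier_vec] z[OF C B] z[OF C C]
   using gg_vec[OF n0 hm_in[OF B B n0 x] hm_in[OF B C n0 x]] hm_in[OF B B n0 x] hm_in[OF B C n0 x] by simp
  moreover have "gg 0 *v (x @v 0v (dd C 0)) = hm n B Z (delta 0) 0 *v x"
   unfolding gg_vec[OF n0 x zero_carrier_vec] z[OF C Z] using hm_in[OF B Z n0 x] by simp
  ultimately show ?thesis
   using gh[of "x @v 0v (dd C 0)"] x dB dC
   unfolding hm_comp[OF n B B Z ok'(1) n0 x] hm_comp[OF n B C Z ok'(3) n0 x] hm_add[OF n B Z n0 x] by simp
 qed
 have "conv (delta 0) c11 0 + conv (delta s) c21 0 = delta 0 0"
  by (rule hm_coef_eq[OF n B Z 1 posB posZ])
 hence c11: "c11 0 = 1" using okBC[OF ok'(3)] by (cases "s = 0") (auto simp: conv_delta delta_def)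
 have 2: "hm n C Z (\<lambda>t. conv (delta 0) c12 t + conv (delta s) c22 t) 0 *v x = hm n C Z (delta s) 0 *v x"
  if x: "x \<in> cvec (dd C 0)" for x
 proof -
  have "gg 0 *v (h 0 *v (0v (dd B 0) @v x)) = hm n B Z (delta 0) 0 *v (hm n C B c12 0 *v x) + hm n C Z (delta s) 0 *v (hm n C C c22 0 *v x)"
   unfolding h0[OF zero_carrier_vec x] z[OF B B] z[OF B C]
   using gg_vec[OF n0 hm_in[OF C B n0 x] hm_in[OF C C n0 x]] hm_in[OF C B n0 x] hm_in[OF C C n0 x] by simp
  moreover have "gg 0 *v (0v (dd B 0) @v x) = hm n C Z (delta s) 0 *v x"
   unfolding gg_vec[OF n0 zero_carrier_vec x] z[OF B Z] using hm_in[OF C Z n0 x] by simp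
  ultimately show ?thesis
   using gh[of "0v (dd B 0) @v x"] x dB dC
   unfolding hm_comp[OF n C B Z ok'(2) n0 x] hm_comp[OF n C C Z ok'(4) n0 x] hm_add[OF n C Z n0 x] by simp
 qed
 have "conv (delta 0) c12 s + conv (delta s) c22 s = delta s s"
  by (rule hm_coef_eq[OF n C Z 2 posC posZ])
 hence c22: "c22 0 = 1" using okCB[OF ok'(2)] by (auto simp: conv_delta delta_def)
 show ?thesis by (rule endo_unitriangular_iso[OF h h0 c11 okCB[OF ok'(2)] c22]) auto
qed

lemma ff_left_minimal:
 assumes h: "rep_hom n (MB +R MC) (MB +R MC) h" and e: "mor_eq n (h oR ff) ff"
 shows "iso_mor n (MB +R MC) (MB +R MC) h"
proof -
 note dA = M_vdim[OF n A n0]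
 obtain c11 c12 c21 c22 where ok': "okc n B B c11" "okc n C B c12" "okc n B C c21" "okc n C C c22"
  "!!x y. x \<in> cvec (dd B 0) ==> y \<in> cvec (dd C 0) ==> h 0 *v (x @v y) =
   (hm n B B c11 0 *v x + hm n C B c12 0 *v y) @v (hm n B C c21 0 *v x + hm n C C c22 0 *v y)"
  using endo_coef[OF h] by blast
 note h0 = ok'(5)
 have eq: "hm n A B (\<lambda>t. conv c11 (delta s) t + conv c12 (\<lambda>t. - delta 0 t) t) 0 *v x = hm n A B (delta s) 0 *v x \<and>
  hm n A C (\<lambda>t. conv c21 (delta s) t + conv c22 (\<lambda>t. - delta 0 t) t) 0 *v x = hm n A C (\<lambda>t. - delta 0 t) 0 *v x"
  if x: "x \<in> cvec (dd A 0)" for x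
 proof -
  have "h 0 *v (ff 0 *v x) = ff 0 *v x"
   using comp_vec[OF ff_hom h n0, of x] eq_vec[OF e n0, of x] x dA by simp
  thus ?thesis
   unfolding ff_vec[OF n0 x] h0[OF hm_in[OF A B n0 x] hm_in[OF A C n0 x]]
    hm_comp[OF n A B B ok(1) n0 x] hm_comp[OF n A C B ok(2) n0 x] hm_comp[OF n A B C ok(1) n0 x] hm_comp[OF n A C C ok(2) n0 x]
    hm_add[OF n A B n0 x] hm_add[OF n A C n0 x]
   using append_vec_eq[OF hm_in[OF A B n0 x] hm_in[OF A B n0 x]] by blast
 qed
 have "conv c11 (delta s) s + conv c12 (\<lambda>t. - delta 0 t) s = delta s s"
  by (rule hm_coef_eq[OF n A B conjunct1[OF eq] posA posB])
 hence c11: "c11 0 = 1"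
  using okCB[OF ok'(2)] unfolding conv_neg conv_delta0_right conv_delta_right by (simp add: delta_def)
 have "conv c21 (delta s) 0 + conv c22 (\<lambda>t. - delta 0 t) 0 = - delta 0 0"
  by (rule hm_coef_eq[OF n A C conjunct2[OF eq]]) (use posA posC in simp_all)
 hence c22: "c22 0 = 1"
  using okBC[OF ok'(3)] unfolding conv_neg conv_delta0_right conv_delta_right
  by (cases "s = 0") (simp_all add: delta_def)
 show ?thesis by (rule endo_unitriangular_iso[OF h h0 c11 okCB[OF ok'(2)] c22]) auto
qed

text \<open>
The constant coefficient of \<open>gg u\<close> vanishes: by \<open>noZB\<close> there is no invertible
component \<open>M_Z \<rightarrow> M_B\<close>, and the other summand contributes \<open>t^s\<close> times a
morphism that is not invertible for \<open>s = 0\<close>.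
\<close>

lemma nonsplit:
 assumes u: "rep_hom n MZ (MB +R MC) u"
 shows "\<not> mor_eq n (gg oR u) (mor_id MZ)"
proof
 assume e: "mor_eq n (gg oR u) (mor_id MZ)"
 note dZ = M_vdim[OF n Z n0]
 obtain u1 u2 where uu: "rep_hom n MZ MB u1" "rep_hom n MZ MC u2"
  "!!v x. v < n ==> x \<in> Sp MZ v ==> u v *v x = (u1 v *v x) @v (u2 v *v x)"
  using dsum_hom_in[OF n rZ rB rC u] by blast
 obtain c1 where c1: "okc n Z B c1" "mor_eq n u1 (hm n Z B c1)" by (rule hom_coef[OF n Z B uu(1)])
 obtain c2 where c2: "okc n Z C c2" "mor_eq n u2 (hm n Z C c2)" by (rule hom_coef[OF n Z C uu(2)])
 have "hm n Z Z (\<lambda>t. conv (delta 0) c1 t + conv (delta s) c2 t) 0 *v x = hm n Z Z (delta 0) 0 *v x"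
  if x: "x \<in> cvec (dd Z 0)" for x
 proof -
  have x': "x \<in> Sp MZ 0" using x dZ by simp
  have "gg 0 *v (u 0 *v x) = x"
   using comp_vec[OF u gg_hom n0 x'] eq_vec[OF e n0, of x] mor_id_vec[OF x'] by simp
  moreover have "u 0 *v x = (hm n Z B c1 0 *v x) @v (hm n Z C c2 0 *v x)"
   using uu(3)[OF n0 x'] eq_vec[OF c1(2) n0] eq_vec[OF c2(2) n0] by simp
  ultimately have "x = gg 0 *v ((hm n Z B c1 0 *v x) @v (hm n Z C c2 0 *v x))" by simp
  also have "\<dots> = hm n Z Z (\<lambda>t. conv (delta 0) c1 t + conv (delta s) c2 t) 0 *v x"
   unfolding gg_vec[OF n0 hm_in[OF Z B n0 x] hm_in[OF Z C n0 x]]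
    hm_comp[OF n Z B Z c1(1) n0 x] hm_comp[OF n Z C Z c2(1) n0 x] hm_add[OF n Z Z n0 x] ..
  finally show ?thesis unfolding hm_delta0_id[OF n Z n0 x] by (rule sym)
 qed
 hence "conv (delta 0) c1 0 + conv (delta s) c2 0 = delta 0 0"
  by (rule hm_coef_eq[OF n Z Z _ posZ posZ])
 moreover have "c1 0 = 0" using c1(1) noZB unfolding okc_def by (metis add.right_neutral not_less)
 moreover have "s = 0 ==> c2 0 = 0" using c2(1) noZC unfolding okc_def by (metis add.right_neutral not_less)
 ultimately show False by (cases "s = 0") (auto simp: conv_delta delta_def)
qed

text \<open>Split the coefficients of a morphism \<open>M_K \<rightarrow> M_Z\<close> into those that already define a morphism to
 \<open>M_B\<close> and the others, which define one to \<open>M_C\<close>.\<close>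

lemma factor_right:
 assumes K: "K \<subseteq> {1..n}"
  and cond: "!!t. (\<forall>v<n. dd K v \<le> dd Z v + t) ==>
    (\<forall>v<n. dd K v \<le> dd B v + t) \<or> (s \<le> t \<and> (\<forall>v<n. dd K v \<le> dd C v + (t - s)))"
  and h: "rep_hom n (M_mod n K) MZ h"
 obtains u where "rep_hom n (M_mod n K) (MB +R MC) u" "mor_eq n (gg oR u) h"
proof -
 note rK = M_rep[OF n K]
 obtain c where c: "okc n K Z c" "mor_eq n h (hm n K Z c)" by (rule hom_coef[OF n K Z h])
 define c1 where "c1 t = (if \<forall>v<n. dd K v \<le> dd B v + t then c t else 0)" for t
 define c2 where "c2 t = (if \<forall>v<n. dd K v \<le> dd B v + (t + s) then 0 else c (t + s))" for t
 have ok1: "okc n K B c1" unfolding okc_def c1_def by auto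
 have ok2: "okc n K C c2"
  unfolding okc_def
 proof (intro allI impI)
  fix t v assume "c2 t \<noteq> 0" and v: "v < n"
  hence "\<not> (\<forall>v<n. dd K v \<le> dd B v + (t + s))" "c (t + s) \<noteq> 0" unfolding c2_def by (auto split: if_splits)
  moreover hence "\<forall>v<n. dd K v \<le> dd Z v + (t + s)" using c(1) unfolding okc_def by blast
  ultimately have "\<forall>v<n. dd K v \<le> dd C v + (t + s - s)" using cond[of "t + s"] by blast
  thus "dd K v \<le> dd C v + t" using v by simp
 qed
 have split: "conv (delta 0) c1 t + conv (delta s) c2 t = c t" for t
 proof (cases "c t = 0")
  case True
  thus ?thesis by (auto simp: conv_delta c1_def c2_def)
 next
  case False
  hence "\<forall>v<n. dd K v \<le> dd Z v + t" using c(1) unfolding okc_def by blast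
  from cond[OF this] show ?thesis by (auto simp: conv_delta c1_def c2_def)
 qed
 note h1 = hm_hom[OF n K B ok1] and h2 = hm_hom[OF n K C ok2]
 define u where "u = hpair (M_mod n K) MB MC (hm n K B c1) (hm n K C c2)"
 have u: "rep_hom n (M_mod n K) (MB +R MC) u" unfolding u_def by (rule hpair_hom[OF n rK rB rC h1 h2])
 have "mor_eq n (gg oR u) h"
 proof (rule hom_eqI0[OF rK rZ M_mono[OF n Z] hom_comp[OF rK rBC rZ u gg_hom] h])
  fix x :: "complex vec" assume x': "x \<in> Sp (M_mod n K) 0"
  hence x: "x \<in> cvec (dd K 0)" using M_vdim[OF n K n0] by simp
  show "(gg oR u) 0 *v x = h 0 *v x"
   unfolding comp_vec[OF u gg_hom n0 x'] hpair_vec'[OF h1 h2 n0 x', folded u_def] gg_vec[OF n0 hm_in[OF K B n0 x] hm_in[OF K C n0 x]]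
    hm_comp[OF n K B Z ok1 n0 x] hm_comp[OF n K C Z ok2 n0 x] hm_add[OF n K Z n0 x] split eq_vec[OF c(2) n0] ..
 qed
 thus ?thesis using that u by blast
qed

lemma factor_left:
 assumes K: "K \<subseteq> {1..n}"
  and cond: "!!t. (\<forall>v<n. dd A v \<le> dd K v + t) ==>
    (\<forall>v<n. dd C v \<le> dd K v + t) \<or> (s \<le> t \<and> (\<forall>v<n. dd B v \<le> dd K v + (t - s)))"
  and h: "rep_hom n MA (M_mod n K) h"
 obtains u where "rep_hom n (MB +R MC) (M_mod n K) u" "mor_eq n (u oR ff) h"
proof -
 note rK = M_rep[OF n K]
 obtain c where c: "okc n A K c" "mor_eq n h (hm n A K c)" by (rule hom_coef[OF n A K h])
 define c2 where "c2 t = (if \<forall>v<n. dd C v \<le> dd K v + t then - c t else 0)" for t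
 define c1 where "c1 t = (if \<forall>v<n. dd C v \<le> dd K v + (t + s) then 0 else c (t + s))" for t
 have ok2: "okc n C K c2" unfolding okc_def c2_def by auto
 have ok1: "okc n B K c1"
  unfolding okc_def
 proof (intro allI impI)
  fix t v assume "c1 t \<noteq> 0" and v: "v < n"
  hence "\<not> (\<forall>v<n. dd C v \<le> dd K v + (t + s))" "c (t + s) \<noteq> 0" unfolding c1_def by (auto split: if_splits)
  moreover hence "\<forall>v<n. dd A v \<le> dd K v + (t + s)" using c(1) unfolding okc_def by blast
  ultimately have "\<forall>v<n. dd B v \<le> dd K v + (t + s - s)" using cond[of "t + s"] by blast
  thus "dd B v \<le> dd K v + t" using v by simp
 qed
 have split: "conv c1 (delta s) t + conv c2 (\<lambda>t. - delta 0 t) t = c t" for t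
 proof (cases "c t = 0")
  case True
  thus ?thesis by (auto simp: conv_delta_right conv_neg c1_def c2_def)
 next
  case False
  hence "\<forall>v<n. dd A v \<le> dd K v + t" using c(1) unfolding okc_def by blast
  from cond[OF this] show ?thesis by (auto simp: conv_delta_right conv_neg c1_def c2_def)
 qed
 note h1 = hm_hom[OF n B K ok1] and h2 = hm_hom[OF n C K ok2]
 define u where "u = hcopair MB MC (M_mod n K) (hm n B K c1) (hm n C K c2)"
 have u: "rep_hom n (MB +R MC) (M_mod n K) u" unfolding u_def by (rule hcopair_hom[OF n rB rC rK h1 h2])
 have "mor_eq n (u oR ff) h"
 proof (rule hom_eqI0[OF rA rK M_mono[OF n K] hom_comp[OF rA rBC rK ff_hom u] h])
  fix x :: "complex vec" assume x': "x \<in> Sp MA 0"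
  hence x: "x \<in> cvec (dd A 0)" using M_vdim[OF n A n0] by simp
  have hc: "hm n A B (delta s) 0 *v x \<in> Sp MB 0" "hm n A C (\<lambda>t. - delta 0 t) 0 *v x \<in> Sp MC 0"
   using hm_in[OF A B n0 x] hm_in[OF A C n0 x] M_vdim[OF n _ n0] B C by auto
  show "(u oR ff) 0 *v x = h 0 *v x"
   unfolding comp_vec[OF ff_hom u n0 x'] ff_vec[OF n0 x] hcopair_vec'[OF h1 h2 n0 hc, folded u_def]
    hm_comp[OF n A B K ok(1) n0 x] hm_comp[OF n A C K ok(2) n0 x] hm_add[OF n A K n0 x] split eq_vec[OF c(2) n0] ..
 qed
 thus ?thesis using that u by blast
qed

end



section \<open>Weak separation\<close>

lemma surrounds_between:
 "surrounds B A ==> a \<in> A ==> c \<in> A ==> b \<in> B ==> a < b ==> b < c ==> False"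
 unfolding surrounds_def by (metis Un_iff less_asym)

lemma weakly_separated_sym: "weakly_separated I J \<longleftrightarrow> weakly_separated J I"
 unfolding weakly_separated_def by auto

text \<open>
Weak separation says that on a circle no chord of \<open>I - J\<close> crosses one of \<open>J - I\<close>; an
alternating quadruple is such a crossing.
\<close>

lemma ws_no_alternation:
 assumes "weakly_separated I J" "a \<in> I - J" "b \<in> J - I" "c \<in> I - J" "d \<in> J - I" "a < b" "b < c" "c < d"
 shows False
 using assms surrounds_between[of "J - I" "I - J" a c b] surrounds_between[of "I - J" "J - I" b d c]
 unfolding weakly_separated_def by blast

text \<open>By definition the surrounding set is not the larger one.\<close>

lemma ws_card:
 assumes "weakly_separated I J" "a \<in> J - I" "b \<in> I - J" "c \<in> J - I" "a < b" "b < c"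
 shows "card J \<le> card I"
 using assms surrounds_between[of "I - J" "J - I" a c b] unfolding weakly_separated_def by blast

lemma ws_complement:
 assumes "I \<subseteq> {1..n}" "J \<subseteq> {1..n}" "weakly_separated I J"
 shows "weakly_separated ({1..n} - I) ({1..n} - J)"
proof -
 have e: "({1..n} - I) - ({1..n} - J) = J - I" "({1..n} - J) - ({1..n} - I) = I - J" using assms by auto
 have c: "card ({1..n} - I) = n - card I" "card ({1..n} - J) = n - card J" "card I \<le> n" "card J \<le> n"
  using card_Diff_subset[of I "{1..n}"] card_Diff_subset[of J "{1..n}"] card_mono[of "{1..n}" I] card_mono[of "{1..n}" J]
   assms(1,2) finite_subset[OF assms(1)] finite_subset[OF assms(2)] by auto
 show ?thesis using assms(3) c unfolding weakly_separated_def e by auto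
qed

text \<open>
The reversal of \<open>[n]\<close>, which preserves weak separation and turns minima of the dimension
differences into maxima.
\<close>

definition reflect :: "nat => nat set => nat set" where
 "reflect n I = (\<lambda>x. Suc n - x) ` I"

lemma reflect_inj: "inj_on (\<lambda>x. Suc n - x) {1..n}"
 by (auto simp: inj_on_def)

lemma reflect_sub: "I \<subseteq> {1..n} ==> reflect n I \<subseteq> {1..n}"
 unfolding reflect_def by (rule image_subsetI) (drule (1) subsetD, simp, linarith)

lemma reflect_diff: "I \<subseteq> {1..n} ==> J \<subseteq> {1..n} ==> reflect n I - reflect n J = reflect n (I - J)"
 unfolding reflect_def by (rule inj_on_image_set_diff[OF reflect_inj, symmetric]) auto

lemma reflect_card: "I \<subseteq> {1..n} ==> card (reflect n I) = card I"
 unfolding reflect_def by (rule card_image) (rule inj_on_subset[OF reflect_inj])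

lemma reflect_involution: "I \<subseteq> {1..n} ==> reflect n (reflect n I) = I"
 unfolding reflect_def image_image by (force simp: image_iff)

lemma surrounds_reflect:
 assumes "surrounds B A" "A \<subseteq> {1..n}" "B \<subseteq> {1..n}"
 shows "surrounds (reflect n B) (reflect n A)"
proof -
 obtain B' B'' where B: "B = B' \<union> B''" "B' \<inter> B'' = {}" "\<forall>x\<in>B'. \<forall>y\<in>A. x < y" "\<forall>x\<in>A. \<forall>y\<in>B''. x < y"
  using assms(1) unfolding surrounds_def by blast
 have sub: "B' \<subseteq> {1..n}" "B'' \<subseteq> {1..n}" using B(1) assms(3) by auto
 have lt: "\<forall>x\<in>reflect n Y. \<forall>y\<in>reflect n X. x < y" if h: "\<forall>x\<in>X. \<forall>y\<in>Y. x < y" "X \<subseteq> {1..n}" "Y \<subseteq> {1..n}" for X Y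
 proof (intro ballI)
  fix x y assume "x \<in> reflect n Y" "y \<in> reflect n X"
  then obtain x' y' where xy: "x' \<in> Y" "x = Suc n - x'" "y' \<in> X" "y = Suc n - y'" unfolding reflect_def by blast
  have "y' < x'" using h(1) xy by blast
  moreover have "x' \<le> n" using xy(1) h(3) by auto
  ultimately show "x < y" unfolding xy by simp
 qed
 have "reflect n B'' \<inter> reflect n B' = {}"
  using inj_on_image_Int[OF reflect_inj sub] B(2) unfolding reflect_def by (simp add: Int_commute)
 moreover have "reflect n B = reflect n B'' \<union> reflect n B'" unfolding B(1) reflect_def by auto
 moreover have "\<forall>x\<in>reflect n B''. \<forall>y\<in>reflect n A. x < y" "\<forall>x\<in>reflect n A. \<forall>y\<in>reflect n B'. x < y"
  using lt[OF B(4) assms(2) sub(2)] lt[OF B(3) sub(1) assms(2)] by blast+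
 ultimately show ?thesis unfolding surrounds_def by blast
qed

lemma ws_reflect:
 assumes I: "I \<subseteq> {1..n}" and J: "J \<subseteq> {1..n}" and w: "weakly_separated I J"
 shows "weakly_separated (reflect n I) (reflect n J)"
proof -
 have s: "I - J \<subseteq> {1..n}" "J - I \<subseteq> {1..n}" using I J by auto
 show ?thesis
  using w surrounds_reflect[OF _ s] surrounds_reflect[OF _ s(2,1)]
  unfolding weakly_separated_def reflect_diff[OF I J] reflect_diff[OF J I] reflect_card[OF I] reflect_card[OF J] by blast
qed

section \<open>Dimension differences\<close>

text \<open>
The power \<open>t^s\<close> defines a morphism \<open>M_K \<rightarrow> M_J\<close> iff \<open>s\<close> bounds
this difference. The places where the bound is attained decide through which other modules the morphism factors.
\<close>

definition dif :: "nat set => nat set => nat => int" where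
 "dif K J v = int (dd K v) - int (dd J v)"

lemma dif_step:
 "finite K ==> finite J ==> dif K J (Suc v) = dif K J v + (if Suc v \<in> J then 1 else 0) - (if Suc v \<in> K then 1 else 0)"
 using dd_Suc[of K v] dd_Suc[of J v] by (simp add: dif_def)

lemma dif_fall:
 assumes f: "finite K" "finite J"
 shows "a \<le> b ==> dif K J b < dif K J a ==> \<exists>x\<in>K - J. a < x \<and> x \<le> b"
proof (induction b rule: dec_induct)
 case (step b)
 show ?case
 proof (cases "dif K J b < dif K J a")
  case True
  then obtain x where "x \<in> K - J" "a < x" "x \<le> b" using step.IH by blast
  thus ?thesis by (intro bexI[of _ x]) auto
 next
  case False
  hence "Suc b \<in> K - J" using step.prems dif_step[OF f, of b] by (auto split: if_splits)
  thus ?thesis using step.hyps(1) by (intro bexI[of _ "Suc b"]) simp_all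
 qed
qed simp

lemma dif_rise:
 assumes f: "finite K" "finite J"
 shows "a \<le> b ==> dif K J a < dif K J b ==> \<exists>x\<in>J - K. a < x \<and> x \<le> b"
 using dif_fall[OF f(2,1), of a b] by (simp add: dif_def)

lemma dif_end: "K \<subseteq> {1..n} ==> J \<subseteq> {1..n} ==> dif K J n = 0"
 using dd_bound[of K n n] dd_bound[of J n n] by (simp add: dif_def)

lemma dif_start: "K \<subseteq> {1..n} ==> J \<subseteq> {1..n} ==> dif K J 0 = int (card K) - int (card J)"
 using dd_0 by (simp add: dif_def)

lemma dd_insert: "finite I ==> x \<notin> I ==> dd (insert x I) v = dd I v + (if v < x then 1 else 0)"
proof -
 assume "finite I" "x \<notin> I"
 moreover have "{y \<in> insert x I. v < y} = (if v < x then insert x {y \<in> I. v < y} else {y \<in> I. v < y})" by auto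
 ultimately show ?thesis by (simp add: dd_def)
qed

lemma dd_complement: "I \<subseteq> {1..n} ==> v \<le> n ==> dd I v + dd ({1..n} - I) v = n - v"
proof -
 assume I: "I \<subseteq> {1..n}" and v: "v \<le> n"
 have "{Suc v..n} = {x \<in> I. v < x} \<union> {x \<in> {1..n} - I. v < x}" using I by auto
 hence "n - v = card ({x \<in> I. v < x} \<union> {x \<in> {1..n} - I. v < x})" by (metis card_atLeastAtMost diff_Suc_Suc)
 also have "\<dots> = dd I v + dd ({1..n} - I) v"
  unfolding dd_def using finite_subset[OF I] by (intro card_Un_disjoint) auto
 finally show ?thesis by simp
qed

lemma dd_reflect: "I \<subseteq> {1..n} ==> v \<le> n ==> dd (reflect n I) v + dd I (n - v) = card I"
proof -
 assume I: "I \<subseteq> {1..n}" and v: "v \<le> n"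
 have "{y \<in> reflect n I. v < y} = (\<lambda>x. Suc n - x) ` {x \<in> I. x \<le> n - v}"
  unfolding reflect_def using I v by (auto simp: image_iff)
 moreover have "inj_on (\<lambda>x. Suc n - x) {x \<in> I. x \<le> n - v}"
  by (rule inj_on_subset[OF reflect_inj[of n]]) (use I in auto)
 ultimately have "dd (reflect n I) v = card {x \<in> I. x \<le> n - v}"
  unfolding dd_def by (metis card_image)
 moreover have "I = {x \<in> I. x \<le> n - v} \<union> {x \<in> I. n - v < x}" by auto
 hence "card I = card {x \<in> I. x \<le> n - v} + card {x \<in> I. n - v < x}"
  using finite_subset[OF I] by (subst \<open>I = _\<close>, subst card_Un_disjoint) auto
 ultimately show ?thesis by (simp add: dd_def)
qed

text \<open>
Going from left to right, the difference \<open>dif K (Lj)\<close> goes up at the elements of \<open>Lj -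
K\<close> and down at those of \<open>K - Lj\<close>. Suppose that it is maximal both between \<open>i\<close>
and \<open>j\<close> and after \<open>k\<close>. Either it varies in between, which produces elements violating
the weak separation of \<open>K\<close> from \<open>Lj\<close> or from \<open>Lij\<close>, or it is constant
there, and then \<open>K\<close> contains \<open>j\<close> but not \<open>k\<close> and is not weakly separated
from \<open>Lk\<close>.
\<close>

lemma no_double_max:
 fixes m :: int
 assumes K: "K \<subseteq> {1..n}" and L: "L \<subseteq> {1..n}" and ijk: "{i, j, k} \<subseteq> {1..n}" "i < j" "j < k" "L \<inter> {i, j, k} = {}"
  and w1: "weakly_separated K (L \<union> {j})" and w2: "weakly_separated K (L \<union> {i, j})" and w3: "weakly_separated K (L \<union> {k})"
  and ne: "K \<noteq> L \<union> {j}"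
  and max: "!!v. v \<le> n ==> dif K (L \<union> {j}) v \<le> m"
  and v1: "i \<le> v1" "v1 < j" "dif K (L \<union> {j}) v1 = m" and v2: "k \<le> v2" "v2 \<le> n" "dif K (L \<union> {j}) v2 = m"
 shows False
proof -
 let ?J = "L \<union> {j}"
 let ?D = "dif K ?J"
 have J: "?J \<subseteq> {1..n}" using L ijk by auto
 have f: "finite K" "finite ?J" "finite L" using K J finite_subset by (blast, blast, meson L finite_atLeastAtMost finite_subset)
 note fall = dif_fall[OF f(1,2)] and rise = dif_rise[OF f(1,2)] and step = dif_step[OF f(1,2)]
 have Dn: "?D n = 0" by (rule dif_end[OF K J])
 have D0: "?D 0 = int (card K) - int (card ?J)" by (rule dif_start[OF K J])
 have cJ: "card ?J = Suc (card L)" "card (L \<union> {i, j}) = Suc (Suc (card L))" "card (L \<union> {k}) = Suc (card L)"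
  using f(3) ijk by auto
 note ws1 = ws_no_alternation[OF w1] and ws1' = ws_no_alternation[OF w1[unfolded weakly_separated_sym[of K]]]
 note ws2 = ws_no_alternation[OF w2] and ws2' = ws_no_alternation[OF w2[unfolded weakly_separated_sym[of K]]]
 note ws3 = ws_no_alternation[OF w3] and ws3' = ws_no_alternation[OF w3[unfolded weakly_separated_sym[of K]]]
 show False
 proof (cases "\<exists>z. v1 < z \<and> z \<le> v2 \<and> (z \<in> K) \<noteq> (z \<in> ?J)")
  case True
  then obtain z where z: "v1 < z" "z \<le> v2" "(z \<in> K) \<noteq> (z \<in> ?J)" by blast
  obtain z' where z': "z = Suc z'" using z(1) by (cases z) auto
  have "\<exists>x y. x \<in> K - ?J \<and> y \<in> ?J - K \<and> v1 < x \<and> x < y \<and> y \<le> v2"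
  proof (cases "z \<in> K")
   case True
   hence "?D z = ?D z' - 1" using z(3) step[of z'] by (simp add: z')
   hence "?D z < ?D v2" using max[of z'] z(2) v2 by (simp add: z')
   then obtain y where "y \<in> ?J - K" "z < y" "y \<le> v2" using rise[OF z(2)] by blast
   thus ?thesis using True z by blast
  next
   case False
   hence "?D z = ?D z' + 1" using z(3) step[of z'] by (simp add: z')
   hence "?D z' < ?D v1" using max[of z] z(2) v1 v2 by simp
   moreover have "v1 \<le> z'" using z(1) by (simp add: z')
   ultimately obtain x where "x \<in> K - ?J" "v1 < x" "x \<le> z'" using fall by blast
   thus ?thesis using False z by (intro exI[of _ x] exI[of _ z]) (auto simp: z')
  qed
  then obtain x y where xy: "x \<in> K - ?J" "y \<in> ?J - K" "v1 < x" "x < y" "y \<le> v2" by blast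
  show False
  proof (cases "i \<in> K")
   case True
   have iKJ: "i \<in> K - ?J" using True ijk by auto
   obtain i' where i': "i = Suc i'" using ijk(1) by (cases i) auto
   have "?D i = ?D i' - 1" using iKJ step[of i'] by (simp add: i')
   hence "?D i < ?D v1" using max[of i'] v1 v2 ijk by (simp add: i')
   then obtain w where w: "w \<in> ?J - K" "i < w" "w \<le> v1" using rise[OF v1(1)] by blast
   show False by (rule ws1[OF iKJ w(1) xy(1,2)]) (use w xy in auto)
  next
   case False
   have a: "i \<in> (L \<union> {i, j}) - K" "x \<in> K - (L \<union> {i, j})" "y \<in> (L \<union> {i, j}) - K" using False xy by auto
   have "card (L \<union> {i, j}) \<le> card K" by (rule ws_card[OF w2 a]) (use v1 xy in auto)
   hence "?D 0 \<ge> 1" using D0 cJ by simp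
   hence "?D n < ?D v2" using max[of 0] Dn v2(3) by simp
   then obtain z where zz: "z \<in> K - ?J" "v2 < z" "z \<le> n" using fall[OF v2(2)] by blast
   have zK: "z \<in> K - (L \<union> {i, j})" using zz False by auto
   show False by (rule ws2'[OF a zK]) (use v1 xy zz in auto)
  qed
 next
  case False
  hence same: "z \<in> K \<longleftrightarrow> z \<in> ?J" if "v1 < z" "z \<le> v2" for z using that by blast
  have jk: "j \<in> K - (L \<union> {k})" "k \<in> (L \<union> {k}) - K" using same[of j] same[of k] v1 v2 ijk by auto
  have m0: "0 \<le> m" using max[of n] Dn by simp
  show False
  proof (cases "m = 0")
   case m: False
   hence "?D n < ?D v2" using m0 Dn v2(3) by simp
   then obtain z where z: "z \<in> K - ?J" "v2 < z" "z \<le> n" using fall[OF v2(2)] by blast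
   have zK: "z \<in> K - (L \<union> {k})" using z v2 by auto
   have "card K \<le> card (L \<union> {k})"
    by (rule ws_card[OF w3[unfolded weakly_separated_sym[of K]] jk zK]) (use z v2 ijk in auto)
   hence "?D 0 < ?D v1" using D0 cJ m m0 v1(3) by simp
   then obtain w where w: "w \<in> ?J - K" "w \<le> v1" using rise[of 0 v1] by blast
   have wL: "w \<in> (L \<union> {k}) - K" using w v1 by auto
   show False by (rule ws3'[OF wL jk zK]) (use w z v1 v2 ijk in auto)
  next
   case True
   note m = True
   have "\<exists>v\<le>n. ?D v \<noteq> 0"
   proof (rule ccontr)
    assume "\<not> (\<exists>v\<le>n. ?D v \<noteq> 0)"
    hence "K = ?J" using dd_determines[OF K J] by (auto simp: dif_def)
    thus False using ne by simp
   qed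
   then obtain v where v: "v \<le> n" "?D v < 0" using max m by (metis order_less_le)
   consider "v \<le> v1" | "v1 < v" "v \<le> v2" | "v2 < v" by linarith
   thus False
   proof cases
    case 1
    have "?D v < ?D v1" using v v1(3) m by simp
    then obtain w where w: "w \<in> ?J - K" "v < w" "w \<le> v1" using rise[OF 1] by blast
    have wL: "w \<in> (L \<union> {k}) - K" using w v1 by auto
    have "card (L \<union> {k}) \<le> card K" by (rule ws_card[OF w3 wL jk]) (use w v1 ijk in auto)
    hence "?D v < ?D 0" using D0 cJ v by simp
    then obtain z where z: "z \<in> K - ?J" "z \<le> v" using fall[of 0 v] by blast
    have zK: "z \<in> K - (L \<union> {k})" using z 1 v1 ijk by auto
    show False by (rule ws3[OF zK wL jk]) (use w z v1 ijk in auto)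
   next
    case 2
    have "?D v < ?D v1" using v v1(3) m by simp
    then obtain z where "z \<in> K - ?J" "v1 < z" "z \<le> v" using fall[of v1 v] 2 by auto
    thus False using same[of z] 2 by auto
   next
    case 3
    have "?D v < ?D v2" using v v2(3) m by simp
    then obtain z where z: "z \<in> K - ?J" "v2 < z" "z \<le> v" using fall[of v2 v] 3 by auto
    have "?D v < ?D n" using v Dn by simp
    then obtain w where w: "w \<in> ?J - K" "v < w" "w \<le> n" using rise[OF v(1)] by blast
    have zK: "z \<in> K - (L \<union> {k})" using z v2 by auto
    have wL: "w \<in> (L \<union> {k}) - K" using w 3 v2 ijk by auto
    show False by (rule ws3[OF jk zK wL]) (use w z v2 ijk in auto)
   qed
  qed
 qed
qed

text \<open>The reflection of \<open>no_double_max\<close>.\<close>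

lemma no_double_min:
 fixes m :: int
 assumes K: "K \<subseteq> {1..n}" and L: "L \<subseteq> {1..n}" and ijk: "{i, j, k} \<subseteq> {1..n}" "i < j" "j < k" "L \<inter> {i, j, k} = {}"
  and w1: "weakly_separated K (L \<union> {j})" and w2: "weakly_separated K (L \<union> {j, k})" and w3: "weakly_separated K (L \<union> {i})"
  and ne: "K \<noteq> L \<union> {j}"
  and max: "!!v. v \<le> n ==> dif (L \<union> {j}) K v \<le> m"
  and v1: "v1 < i" "dif (L \<union> {j}) K v1 = m" and v2: "j \<le> v2" "v2 < k" "dif (L \<union> {j}) K v2 = m"
 shows False
proof -
 let ?J = "L \<union> {j}"
 let ?r = "\<lambda>x. Suc n - x"
 have J: "?J \<subseteq> {1..n}" "L \<union> {j, k} \<subseteq> {1..n}" "L \<union> {i} \<subseteq> {1..n}" using L ijk by auto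
 have r: "reflect n (L \<union> X) = reflect n L \<union> ?r ` X" for X by (auto simp: reflect_def)
 have rdif: "dif (reflect n K) (reflect n ?J) v = int (card K) - int (card ?J) + dif ?J K (n - v)" if "v \<le> n" for v
  using dd_reflect[OF K that] dd_reflect[OF J(1) that] by (simp add: dif_def)
 have dis: "reflect n L \<inter> {?r k, ?r j, ?r i} = {}"
 proof -
  have "L \<inter> {k, j, i} = {}" using ijk by auto
  hence "?r ` L \<inter> ?r ` {k, j, i} = {}"
   using inj_on_image_Int[OF reflect_inj[of n], of L "{k, j, i}"] L ijk(1) by auto
  thus ?thesis by (simp add: reflect_def)
 qed
 show False
 proof (rule no_double_max[OF reflect_sub[OF K] reflect_sub[OF L] _ _ _ dis, where m = "int (card K) - int (card ?J) + m"
    and ?v1.0 = "n - v2" and ?v2.0 = "n - v1"])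
  show "weakly_separated (reflect n K) (reflect n L \<union> {?r j})"
   "weakly_separated (reflect n K) (reflect n L \<union> {?r k, ?r j})" "weakly_separated (reflect n K) (reflect n L \<union> {?r i})"
   using ws_reflect[OF K J(1) w1] ws_reflect[OF K J(2) w2] ws_reflect[OF K J(3) w3] r[of "{j}"] r[of "{j, k}"] r[of "{i}"]
   by (auto simp: insert_commute)
  have "reflect n K \<noteq> reflect n ?J" using ne reflect_involution[OF K] reflect_involution[OF J(1)] by metis
  thus "reflect n K \<noteq> reflect n L \<union> {?r j}" using r[of "{j}"] by simp
  show "dif (reflect n K) (reflect n L \<union> {?r j}) v \<le> int (card K) - int (card ?J) + m" if "v \<le> n" for v
   using rdif[OF that] max[of "n - v"] r[of "{j}"] by simp
  have n12: "n - (n - v2) = v2" "n - (n - v1) = v1" using v1 v2 ijk by auto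
  show "dif (reflect n K) (reflect n L \<union> {?r j}) (n - v2) = int (card K) - int (card ?J) + m"
   "dif (reflect n K) (reflect n L \<union> {?r j}) (n - v1) = int (card K) - int (card ?J) + m"
   using rdif[of "n - v2"] rdif[of "n - v1"] n12 v1 v2 r[of "{j}"] by simp_all
 qed (use v1 v2 ijk in auto)
qed

section \<open>The two exchange sequences and their approximation property\<close>

lemma dif_le: "dd K v \<le> dd J v + t \<longleftrightarrow> dif K J v \<le> int t"
 by (auto simp: dif_def)

context
 fixes n i j k :: nat and L :: "nat set"
 assumes n: "1 < n" and L: "L \<subseteq> {1..n}" and ijk: "{i, j, k} \<subseteq> {1..n}" "i < j" "j < k" "L \<inter> {i, j, k} = {}"
begin

abbreviation (input) "Li \<equiv> L \<union> {i}"
abbreviation (input) "Lj \<equiv> L \<union> {j}"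
abbreviation (input) "Lk \<equiv> L \<union> {k}"
abbreviation (input) "Lij \<equiv> L \<union> {i, j}"
abbreviation (input) "Lik \<equiv> L \<union> {i, k}"
abbreviation (input) "Ljk \<equiv> L \<union> {j, k}"

lemma fL: "finite L" using L finite_subset by blast

lemma dd_L:
 "dd Li v = dd L v + (if v < i then 1 else 0)" "dd Lj v = dd L v + (if v < j then 1 else 0)"
 "dd Lk v = dd L v + (if v < k then 1 else 0)"
 "dd Lij v = dd L v + (if v < i then 1 else 0) + (if v < j then 1 else 0)"
 "dd Lik v = dd L v + (if v < i then 1 else 0) + (if v < k then 1 else 0)"
 "dd Ljk v = dd L v + (if v < j then 1 else 0) + (if v < k then 1 else 0)"
 using dd_insert[OF fL] dd_insert[of "insert _ L"] fL ijk by (auto simp: insert_commute)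

lemma subs: "Li \<subseteq> {1..n}" "Lj \<subseteq> {1..n}" "Lk \<subseteq> {1..n}"
 "Lij \<subseteq> {1..n}" "Lik \<subseteq> {1..n}" "Ljk \<subseteq> {1..n}"
 using L ijk by auto

lemma exchange_j: "exchange n Lik Li Ljk Lj 1"
 by (unfold_locales; (rule n subs)?; unfold dd_L; use ijk in \<open>auto intro: exI[of _ i]\<close>)

lemma exchange_ik: "exchange n Lj Lij Lk Lik 0"
 by (unfold_locales; (rule n subs)?; unfold dd_L; use ijk n in \<open>auto intro: exI[of _ j] exI[of _ 0]\<close>)

context
 fixes K :: "nat set"
 assumes K: "K \<subseteq> {1..n}"
  and ws: "weakly_separated K Li" "weakly_separated K Lk" "weakly_separated K Lij"
   "weakly_separated K Ljk"
begin

text \<open>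
The difference to \<open>Li\<close> exceeds that to \<open>Lj\<close> by one between \<open>i\<close> and
\<open>j\<close>, and the difference to \<open>Ljk\<close> is smaller by one below \<open>k\<close> only. So the
power of exponent \<open>t\<close> factors through neither module only if the bound \<open>t\<close> is attained
between \<open>i\<close> and \<open>j\<close> and also after \<open>k\<close>.
\<close>

lemma right_cond_j:
 assumes wj: "weakly_separated K Lj" and ne: "K \<noteq> Lj" and t: "\<forall>v<n. dd K v \<le> dd Lj v + t"
 shows "(\<forall>v<n. dd K v \<le> dd Li v + t) \<or> (1 \<le> t \<and> (\<forall>v<n. dd K v \<le> dd Ljk v + (t - 1)))"
proof (rule ccontr)
 assume neg: "\<not> ?thesis"
 then obtain v1 where v1: "v1 < n" "dd Li v1 + t < dd K v1" by (auto simp: not_le)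
 have max: "dif K Lj v \<le> int t" if "v \<le> n" for v
  using t dif_end[OF K subs(2)] that by (cases "v < n") (auto simp: dif_le)
 have "\<exists>v2. k \<le> v2 \<and> v2 \<le> n \<and> dif K Lj v2 = int t"
 proof (cases "t = 0")
  case True
  thus ?thesis using dif_end[OF K subs(2)] ijk by (intro exI[of _ n]) auto
 next
  case False
  then obtain v2 where v2: "v2 < n" "dd Ljk v2 + (t - 1) < dd K v2" using neg by (auto simp: not_le)
  thus ?thesis using max[of v2] False unfolding dd_L dif_def
   by (intro exI[of _ v2]) (auto split: if_splits)
 qed
 then obtain v2 where v2: "k \<le> v2" "v2 \<le> n" "dif K Lj v2 = int t" by blast
 have "i \<le> v1 \<and> v1 < j \<and> dif K Lj v1 = int t"
  using v1 max[of v1] ijk unfolding dd_L dif_def by (auto split: if_splits)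
 thus False using no_double_max[OF K L ijk wj ws(3) ws(2) ne max] v2 by blast
qed

text \<open>As before, with the bound attained before \<open>i\<close> and between \<open>j\<close> and \<open>k\<close>.\<close>

lemma left_cond_j:
 assumes wj: "weakly_separated K Lj" and ne: "K \<noteq> Lj" and t: "\<forall>v<n. dd Lj v \<le> dd K v + t"
 shows "(\<forall>v<n. dd Lk v \<le> dd K v + t) \<or> (0 \<le> t \<and> (\<forall>v<n. dd Lij v \<le> dd K v + (t - 0)))"
proof (rule ccontr)
 assume neg: "\<not> ?thesis"
 then obtain v1 v2 where v: "v1 < n" "dd K v1 + t < dd Lij v1" "v2 < n" "dd K v2 + t < dd Lk v2"
  by (auto simp: not_le)
 have max: "dif Lj K v \<le> int t" if "v \<le> n" for v
  using t dif_end[OF subs(2) K] that by (cases "v < n") (auto simp: dif_le)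
 have "v1 < i \<and> dif Lj K v1 = int t" "j \<le> v2 \<and> v2 < k \<and> dif Lj K v2 = int t"
  using v max[of v1] max[of v2] ijk unfolding dd_L dif_def by (auto split: if_splits)
 thus False using no_double_min[OF K L ijk wj ws(4) ws(1) ne max] by blast
qed

text \<open>
Taking complements in \<open>[n]\<close> turns \<open>Lik\<close> into a set of the form \<open>L' \<union>
{j}\<close> and reverses differences.
\<close>

abbreviation (input) "cpl X \<equiv> {1..n} - X"

lemma complements:
 "cpl (L \<union> {i, j, k}) \<union> {j} = cpl Lik" "cpl (L \<union> {i, j, k}) \<union> {i} = cpl Ljk"
 "cpl (L \<union> {i, j, k}) \<union> {k} = cpl Lij" "cpl (L \<union> {i, j, k}) \<union> {j, k} = cpl Li"
 "cpl (L \<union> {i, j, k}) \<union> {i, j} = cpl Lk" "cpl (L \<union> {i, j, k}) \<inter> {i, j, k} = {}"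
 "cpl (L \<union> {i, j, k}) \<subseteq> {1..n}" "cpl K \<subseteq> {1..n}"
 using ijk by auto

lemma dif_complement: "v \<le> n ==> I \<subseteq> {1..n} ==> J \<subseteq> {1..n} ==> dif (cpl I) (cpl J) v = dif J I v"
 using dd_complement[of I n v] dd_complement[of J n v] by (simp add: dif_def)

lemma cpl_ne: "K \<noteq> Lik ==> cpl K \<noteq> cpl Lik"
 using K subs(5) by blast

lemma right_cond_ik:
 assumes wik: "weakly_separated K Lik" and ne: "K \<noteq> Lik" and t: "\<forall>v<n. dd K v \<le> dd Lik v + t"
 shows "(\<forall>v<n. dd K v \<le> dd Lij v + t) \<or> (0 \<le> t \<and> (\<forall>v<n. dd K v \<le> dd Lk v + (t - 0)))"
proof (rule ccontr)
 assume neg: "\<not> ?thesis"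
 then obtain v1 v2 where v: "v1 < n" "dd Lk v1 + t < dd K v1" "v2 < n" "dd Lij v2 + t < dd K v2"
  by (auto simp: not_le)
 have max: "dif K Lik v \<le> int t" if "v \<le> n" for v
  using t dif_end[OF K subs(5)] that by (cases "v < n") (auto simp: dif_le)
 have e: "v1 < i \<and> dif K Lik v1 = int t" "j \<le> v2 \<and> v2 < k \<and> dif K Lik v2 = int t"
  using v max[of v1] max[of v2] ijk unfolding dd_L dif_def by (auto split: if_splits)
 note d = dif_complement[OF _ subs(5) K]
 show False
 proof (rule no_double_min[OF complements(8,7) ijk(1-3) complements(6), unfolded complements])
  show "weakly_separated (cpl K) (cpl Lik)" "weakly_separated (cpl K) (cpl Li)"
   "weakly_separated (cpl K) (cpl Ljk)"
   using ws_complement[OF K] subs wik ws by auto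
  show "dif (cpl Lik) (cpl K) v \<le> int t" if "v \<le> n" for v using d max that by simp
  show "v1 < i" "dif (cpl Lik) (cpl K) v1 = int t" "j \<le> v2" "v2 < k"
   "dif (cpl Lik) (cpl K) v2 = int t" using d v e by auto
 qed (rule cpl_ne[OF ne])
qed

lemma left_cond_ik:
 assumes wik: "weakly_separated K Lik" and ne: "K \<noteq> Lik" and t: "\<forall>v<n. dd Lik v \<le> dd K v + t"
 shows "(\<forall>v<n. dd Ljk v \<le> dd K v + t) \<or> (1 \<le> t \<and> (\<forall>v<n. dd Li v \<le> dd K v + (t - 1)))"
proof (rule ccontr)
 assume neg: "\<not> ?thesis"
 then obtain v1 where v1: "v1 < n" "dd K v1 + t < dd Ljk v1" by (auto simp: not_le)
 have max: "dif Lik K v \<le> int t" if "v \<le> n" for v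
  using t dif_end[OF subs(5) K] that by (cases "v < n") (auto simp: dif_le)
 have "\<exists>v2. k \<le> v2 \<and> v2 \<le> n \<and> dif Lik K v2 = int t"
 proof (cases "t = 0")
  case True
  thus ?thesis using dif_end[OF subs(5) K] ijk by (intro exI[of _ n]) auto
 next
  case False
  then obtain v2 where v2: "v2 < n" "dd K v2 + (t - 1) < dd Li v2" using neg by (auto simp: not_le)
  thus ?thesis using max[of v2] False unfolding dd_L dif_def
   by (intro exI[of _ v2]) (auto split: if_splits)
 qed
 then obtain v2 where v2: "k \<le> v2" "v2 \<le> n" "dif Lik K v2 = int t" by blast
 have e: "i \<le> v1 \<and> v1 < j \<and> dif Lik K v1 = int t"
  using v1 max[of v1] ijk unfolding dd_L dif_def by (auto split: if_splits)
 note d = dif_complement[OF _ K subs(5)]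
 show False
 proof (rule no_double_max[OF complements(8,7) ijk(1-3) complements(6), unfolded complements])
  show "weakly_separated (cpl K) (cpl Lik)" "weakly_separated (cpl K) (cpl Lk)"
   "weakly_separated (cpl K) (cpl Lij)"
   using ws_complement[OF K] subs wik ws by auto
  show "dif (cpl K) (cpl Lik) v \<le> int t" if "v \<le> n" for v using d max that by simp
  show "i \<le> v1" "v1 < j" "dif (cpl K) (cpl Lik) v1 = int t" "k \<le> v2" "v2 \<le> n"
   "dif (cpl K) (cpl Lik) v2 = int t" using d v1 v2 e by auto
 qed (rule cpl_ne[OF ne])
qed

end

end



section \<open>Normal form of an extension\<close>

lemma smult_zero_vec' [simp]: "(c :: complex) *s 0v p = 0v p"
 by (intro eq_vecI) auto

text \<open>The image of \<open>e_v X\<close> in the space at vertex 0.\<close>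

definition isub :: "rep => nat => complex vec set" where
 "isub X v = inc X v ` Sp X v"

lemma isub_sub: "is_rep n X ==> v < n ==> isub X v \<subseteq> Sp X 0"
 unfolding isub_def using linD(1)[OF lin_inc] by blast

lemma isubI: "w \<in> Sp X v ==> x = inc X v w ==> x \<in> isub X v"
 unfolding isub_def by blast

lemma isubE: "x \<in> isub X v ==> (!!w. w \<in> Sp X v ==> x = inc X v w ==> P) ==> P"
 unfolding isub_def by blast

lemma isub_add:
 assumes "is_rep n X" "v < n" "x \<in> isub X v" "y \<in> isub X v" shows "x + y \<in> isub X v"
proof -
 obtain a where a: "a \<in> Sp X v" "x = inc X v a" using assms(3) by (rule isubE)
 obtain b where b: "b \<in> Sp X v" "y = inc X v b" using assms(4) by (rule isubE)
 show ?thesis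
  using a b linD(2)[OF lin_inc[OF assms(1,2)] a(1) b(1)] by (intro isubI[of "a + b"]) auto
qed

lemma isub_smult:
 assumes "is_rep n X" "v < n" "x \<in> isub X v" shows "c *s x \<in> isub X v"
proof -
 obtain a where a: "a \<in> Sp X v" "x = inc X v a" using assms(3) by (rule isubE)
 show ?thesis using a linD(3)[OF lin_inc[OF assms(1,2)] a(1)] by (intro isubI[of "c *s a"]) auto
qed

lemma isub_diff:
 assumes "is_rep n X" "v < n" "x \<in> isub X v" "y \<in> isub X v" shows "x - y \<in> isub X v"
proof -
 have "x - y = x + (-1) *s y" using isub_sub[OF assms(1,2)] assms(3,4) by (intro eq_vecI) auto
 thus ?thesis using isub_add[OF assms(1-3) isub_smult[OF assms(1,2,4)]] by simp
qed

lemma isub_Suc: "is_rep n X ==> Suc v < n ==> isub X (Suc v) \<subseteq> isub X v"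
 using rep_act(1) by (auto elim!: isubE intro!: isubI)

lemma isub_tt_Suc: "is_rep n X ==> Suc v < n ==> x \<in> isub X v ==> tt X x \<in> isub X (Suc v)"
 by (erule isubE) (rule isubI[OF rep_act(2)], auto simp: inc_b[symmetric] simp del: inc.simps)

lemma isub_tt: "is_rep n X ==> 1 < n ==> v < n ==> x \<in> isub X v ==> tt X x \<in> isub X v"
 by (erule isubE) (use inc_tt in \<open>metis isubI\<close>)

lemma isub_tt_pow: "is_rep n X ==> 1 < n ==> v < n ==> x \<in> isub X v ==> (tt X ^^ k) x \<in> isub X v"
 by (induction k) (auto intro: isub_tt)

lemma isub_0: "isub X 0 = Sp X 0"
 by (auto simp: isub_def)

lemma isub_hom:
 "is_rep n X ==> is_rep n Y ==> rep_hom n X Y f ==> v < n ==> x \<in> isub X v ==> f 0 *v x \<in> isub Y v"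
 by (erule isubE) (rule isubI[OF hom_vec], auto simp: hom_inc)

text \<open>
The preimage at vertex 0 lies in the flag of \<open>X\<close>, because the \<open>a\<close> act injectively on
\<open>Z\<close>.
\<close>

lemma isub_ker:
 assumes e: "short_exact n X Y Z f g" and mZ: "a_mono n Z" and v: "v < n" and y: "y \<in> isub Y v" and z: "g 0 *v y = 0v (vdim Z 0)"
 shows "\<exists>x\<in>isub X v. y = f 0 *v x"
proof -
 note E = seqD[OF e]
 obtain w where w: "w \<in> Sp Y v" "y = inc Y v w" using y unfolding isub_def by blast
 have "inc Z v (g v *v w) = 0v (vdim Z 0)" using hom_inc[OF E(2,3,5) v w(1)] z w(2) by simp
 hence "g v *v w = 0v (vdim Z v)" by (rule inc_inj[OF E(3) mZ v hom_vec[OF E(5) v w(1)]])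
 then obtain x where x: "x \<in> Sp X v" "w = f v *v x" using E(8)[OF v w(1)] by blast
 thus ?thesis using hom_inc[OF E(1,2,4) v x(1)] w(2) unfolding isub_def by auto
qed

text \<open>The basis of \<open>M_I\<close> at vertex 0 in which \<open>t\<close> lowers the index.\<close>

definition eb :: "nat => nat set => nat => complex vec" where
 "eb n I r = PP n I 0 *v unit_vec (dd I 0) r"

lemma eb_carrier: "1 < n ==> I \<subseteq> {1..n} ==> eb n I r \<in> cvec (dd I 0)"
 unfolding eb_def by (rule PP_vec) auto

lemma eb_tt:
 assumes n: "1 < n" and I: "I \<subseteq> {1..n}" and r: "r < dd I 0"
 shows "tt (M_mod n I) (eb n I r) = (if r = 0 then 0v (dd I 0) else eb n I (r - 1))"
proof -
 have n0: "0 < n" using n by simp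
 have "tt (Nmod I) (unit_vec (dd I 0) r) = (if r = 0 then 0v (dd I 0) else unit_vec (dd I 0) (r - 1))"
 proof (rule eq_vecI)
  fix a assume "a < dim_vec (if r = 0 then 0v (dd I 0) else unit_vec (dd I 0) (r - 1) :: complex vec)"
  hence a: "a < dd I 0" by (auto split: if_splits)
  show "tt (Nmod I) (unit_vec (dd I 0) r) $ a = (if r = 0 then 0v (dd I 0) else unit_vec (dd I 0) (r - 1)) $ a"
   using Nmod_tt[OF n I _ a, of "unit_vec (dd I 0) r"] a r by (auto simp: unit_vec_def)
 qed (use Nmod_tt_carrier[OF n I, of "unit_vec (dd I 0) r" 1] in auto)
 moreover have "tt (M_mod n I) (eb n I r) = PP n I 0 *v tt (Nmod I) (unit_vec (dd I 0) r)"
  unfolding eb_def by (rule hom_tt[OF Nmod_rep[OF n I] M_rep[OF n I] n iso_hom[OF PP_iso[OF n I]]]) simp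
 ultimately show ?thesis using lin0[OF linmap_mat[OF PP_carrier[OF n I n0]]] by (auto simp: eb_def)
qed

lemma eb_tt_pow:
 assumes n: "1 < n" and I: "I \<subseteq> {1..n}" and r: "r < dd I 0"
 shows "(tt (M_mod n I) ^^ q) (eb n I r) = (if q \<le> r then eb n I (r - q) else 0v (dd I 0))"
proof (induction q)
 case (Suc q)
 have z: "tt (M_mod n I) (0v (dd I 0)) = 0v (dd I 0)"
  using lin0[OF lin_tt[OF M_rep[OF n I] n]] M_vdim[OF n I] n by simp
 show ?case using Suc.IH eb_tt[OF n I, of "r - q"] r z by (auto simp: Suc_diff_Suc)
qed simp

text \<open>The socle layer of dimension \<open>q\<close>; these are the only \<open>t\<close>-stable subspaces at vertex 0.\<close>

definition low :: "nat => nat set => nat => complex vec set" where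
 "low n I q = {PP n I 0 *v u | u. u \<in> cvec (dd I 0) \<and> (\<forall>r<dd I 0. q \<le> r --> u $ r = 0)}"

lemma isub_low:
 assumes n: "1 < n" and I: "I \<subseteq> {1..n}" and v: "v < n"
 shows "isub (M_mod n I) v = low n I (dd I v)"
proof (rule Set.set_eqI)
 fix x
 have n0: "0 < n" using n by simp
 note P = iso_hom[OF PP_iso[OF n I]]
 show "x \<in> isub (M_mod n I) v \<longleftrightarrow> x \<in> low n I (dd I v)"
 proof
  assume "x \<in> isub (M_mod n I) v"
  then obtain w where w: "w \<in> Sp (M_mod n I) v" "x = inc (M_mod n I) v w" unfolding isub_def by blast
  have w': "w \<in> cvec (dd I v)" using w M_vdim[OF n I v] by simp
  note q = QQ_vec[OF n I v w']
  have "x = PP n I 0 *v inc (Nmod I) v (QQ n I v *v w)"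
   using hom_inc[OF Nmod_rep[OF n I] M_rep[OF n I] P v, of "QQ n I v *v w"] PP_QQ[OF n I v w(1)] w(2) q by simp
  thus "x \<in> low n I (dd I v)"
   unfolding low_def using Nmod_inc_image[OF n I v Nmod_inc_carrier[OF n I v q]] Nmod_inc_carrier[OF n I v q] q by blast
 next
  assume "x \<in> low n I (dd I v)"
  then obtain u where u: "u \<in> cvec (dd I 0)" "\<forall>r<dd I 0. dd I v \<le> r --> u $ r = 0" "x = PP n I 0 *v u"
   unfolding low_def by blast
  then obtain w where w: "w \<in> cvec (dd I v)" "inc (Nmod I) v w = u" using Nmod_inc_image[OF n I v u(1)] by blast
  hence "x = inc (M_mod n I) v (PP n I v *v w)"
   using hom_inc[OF Nmod_rep[OF n I] M_rep[OF n I] P v, of w] u(3) by simp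
  thus "x \<in> isub (M_mod n I) v" unfolding isub_def using PP_vec[OF n I v w(1)] M_vdim[OF n I v] by auto
 qed
qed

lemma eb_low: "1 < n ==> I \<subseteq> {1..n} ==> r < q ==> r < dd I 0 ==> eb n I r \<in> low n I q"
 unfolding low_def eb_def by (auto intro!: exI[of _ "unit_vec (dd I 0) r"])

lemma low_sub: "1 < n ==> I \<subseteq> {1..n} ==> low n I q \<subseteq> cvec (dd I 0)"
 unfolding low_def using PP_vec[of n I 0] by auto

lemma low_mono: "q \<le> q' ==> low n I q \<subseteq> low n I q'"
 unfolding low_def by fastforce

lemma low_0:
 assumes n: "1 < n" and I: "I \<subseteq> {1..n}" shows "low n I 0 = {0v (dd I 0)}"
proof -
 have "u \<in> cvec (dd I 0) \<and> (\<forall>r<dd I 0. u $ r = 0) \<longleftrightarrow> u = 0v (dd I 0)" for u :: "complex vec" by auto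
 thus ?thesis unfolding low_def using lin0[OF linmap_mat[OF PP_carrier[OF n I]]] n by auto
qed

lemma low_split:
 assumes n: "1 < n" and I: "I \<subseteq> {1..n}" and x: "x \<in> low n I (Suc q)" and q: "q < dd I 0"
 obtains c x' where "x' \<in> low n I q" "x = c *s eb n I q + x'"
proof -
 have n0: "0 < n" using n by simp
 obtain u where u: "u \<in> cvec (dd I 0)" "\<forall>r<dd I 0. Suc q \<le> r --> u $ r = 0" "x = PP n I 0 *v u"
  using x unfolding low_def by blast
 define u' where "u' = vec (dd I 0) (\<lambda>r. if r < q then u $ r else 0)"
 have u': "u' \<in> cvec (dd I 0)" by (simp add: u'_def)
 have cu: "(u $ q) *s unit_vec (dd I 0) q \<in> cvec (dd I 0)" by simp
 have "u = (u $ q) *s unit_vec (dd I 0) q + u'"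
  using u(1,2) by (intro eq_vecI) (auto simp: u'_def unit_vec_def not_less_iff_gr_or_eq)
 hence "x = (u $ q) *s eb n I q + PP n I 0 *v u'"
  using u(3) linD(2)[OF linmap_mat[OF PP_carrier[OF n I n0]] cu u']
   linD(3)[OF linmap_mat[OF PP_carrier[OF n I n0]], of "unit_vec (dd I 0) q" "u $ q"] by (simp add: eb_def)
 moreover have "PP n I 0 *v u' \<in> low n I q" unfolding low_def using u' by (auto simp: u'_def)
 ultimately show ?thesis using that by blast
qed

lemma tt_low:
 assumes n: "1 < n" and I: "I \<subseteq> {1..n}" and x: "x \<in> low n I q"
 shows "(tt (M_mod n I) ^^ q) x = 0v (dd I 0)"
proof -
 have n0: "0 < n" using n by simp
 obtain u where u: "u \<in> cvec (dd I 0)" "\<forall>r<dd I 0. q \<le> r --> u $ r = 0" "x = PP n I 0 *v u"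
  using x unfolding low_def by blast
 have "(tt (Nmod I) ^^ q) u = 0v (dd I 0)"
 proof (rule eq_vecI)
  fix a assume "a < dim_vec (0v (dd I 0) :: complex vec)"
  thus "(tt (Nmod I) ^^ q) u $ a = 0v (dd I 0) $ a" using Nmod_tt_pow[OF n I u(1), of a q] u(2) by auto
 qed (use Nmod_tt_carrier[OF n I u(1), of q] in auto)
 thus ?thesis
  using hom_tt_pow[OF Nmod_rep[OF n I] M_rep[OF n I] n iso_hom[OF PP_iso[OF n I]], of u q] u
   lin0[OF linmap_mat[OF PP_carrier[OF n I n0]]] by simp
qed

text \<open>
A right inverse of \<open>t\<close> up to the change of module: each basis vector of \<open>M_I\<close> goes to
the next one of \<open>M_J\<close>. It is \<open>t\<close>-linear only modulo the socle, which is where the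
extensions come from.
\<close>

definition Sh :: "nat => nat set => nat set => complex vec => complex vec" where
 "Sh n I J x = PP n J 0 *v (mat (dd J 0) (dd I 0) (\<lambda>(a, b). if a = Suc b then 1 else 0) *v (QQ n I 0 *v x))"

lemma Sh_linmap:
 assumes n: "1 < n" and I: "I \<subseteq> {1..n}" and J: "J \<subseteq> {1..n}"
 shows "linmap (dd I 0) (dd J 0) (Sh n I J)"
proof -
 have n0: "0 < n" using n by simp
 show ?thesis
  unfolding Sh_def
  using lin_comp[OF lin_comp[OF linmap_mat[OF QQ_carrier[OF n I n0]] linmap_mat[OF mat_carrier]] linmap_mat[OF PP_carrier[OF n J n0]]] .
qed

lemma Sh_eb:
 assumes n: "1 < n" and I: "I \<subseteq> {1..n}" and J: "J \<subseteq> {1..n}" and r: "r < dd I 0" "Suc r < dd J 0"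
 shows "Sh n I J (eb n I r) = eb n J (Suc r)"
proof -
 have n0: "0 < n" using n by simp
 have u: "unit_vec (dd I 0) r \<in> cvec (dd I 0)" by simp
 have "mat (dd J 0) (dd I 0) (\<lambda>(a, b). if a = Suc b then 1 else 0) *v unit_vec (dd I 0) r = (unit_vec (dd J 0) (Suc r) :: complex vec)"
  unfolding mult_unit_vec[OF mat_carrier r(1)] using r by (intro eq_vecI) (auto simp: unit_vec_def)
 thus ?thesis unfolding Sh_def eb_def QQ_PP[OF n I n0 u] by simp
qed

text \<open>
The pair \<open>I = Lj\<close>, \<open>J = Lik\<close> in terms of dimensions: \<open>J\<close> exceeds
\<open>I\<close> by one, except from \<open>i\<close> to \<open>j - 1\<close> and from \<open>k\<close> on,
where they agree. By the bound on \<open>dd I 0\<close> there is a vertex \<open>m = dd I 0\<close>, where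
\<open>\<eta>\<close> sees \<open>t^m\<close>.
\<close>

locale interlaced =
 fixes n i j k :: nat and I J :: "nat set"
 assumes n: "1 < n" and I: "I \<subseteq> {1..n}" and J: "J \<subseteq> {1..n}"
  and ijk: "0 < i" "i < j" "j < k" "k \<le> n"
  and dJ: "!!v. v < n ==> dd J v = dd I v + (if i \<le> v \<and> v < j \<or> k \<le> v then 0 else 1)"
  and m_n: "dd I 0 < n" and d_pos: "0 < dd I i"
begin

abbreviation "M \<equiv> M_mod n I"
abbreviation "N \<equiv> M_mod n J"
abbreviation "m \<equiv> dd I 0"

lemma n0: "0 < n" using n by simp
lemma i_n: "i < n" using ijk by simp
lemma fI: "finite I" using I finite_subset by blast
lemma dJ0: "dd J 0 = Suc m" using dJ[OF n0] ijk by simp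
lemma m_pos: "0 < m" using d_pos dd_antimono[OF fI, of 0 i] by simp
lemma d_le: "dd I v \<le> m" using dd_antimono[OF fI, of 0 v] by simp
lemmas rM = M_rep[OF n I] and rN = M_rep[OF n J] and mM = M_mono[OF n I] and mN = M_mono[OF n J]
lemmas FM = M_mod_F_Delta[OF n I] and FN = M_mod_F_Delta[OF n J]
lemmas vM = M_vdim[OF n I] and vN = M_vdim[OF n J]

definition topM :: "complex vec" where "topM = PP n I i *v unit_vec (dd I i) (dd I i - 1)"

lemma topM_carrier: "topM \<in> Sp M i"
 unfolding topM_def vM[OF i_n] by (rule PP_vec[OF n I i_n]) simp

lemma inc_topM: "inc M i topM = eb n I (dd I i - 1)"
proof -
 have "inc (Nmod I) i (unit_vec (dd I i) (dd I i - 1)) = unit_vec m (dd I i - 1)"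
 proof (rule eq_vecI)
  fix a assume "a < dim_vec (unit_vec m (dd I i - 1) :: complex vec)"
  thus "inc (Nmod I) i (unit_vec (dd I i) (dd I i - 1)) $ a = unit_vec m (dd I i - 1) $ a"
   using Nmod_inc[OF n I i_n, of "unit_vec (dd I i) (dd I i - 1)" a] d_le[of i] d_pos by (auto simp: unit_vec_def)
 qed (use Nmod_inc_carrier[OF n I i_n, of "unit_vec (dd I i) (dd I i - 1)"] in simp)
 thus ?thesis
  unfolding topM_def eb_def
  using hom_inc[OF Nmod_rep[OF n I] rM iso_hom[OF PP_iso[OF n I]] i_n, of "unit_vec (dd I i) (dd I i - 1)"] by simp
qed

text \<open>
As \<open>t^d\<close>, \<open>d = dd I i\<close>, kills the spaces of \<open>M\<close> and of \<open>N\<close>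
at vertex \<open>i\<close>, it induces a connecting map between them, which is determined by the image of the
generator. This image lies in the socle.
\<close>

definition ext_inv :: "extn => complex => bool" where
 "ext_inv \<xi> c \<longleftrightarrow> (case \<xi> of (E, f, g) => \<exists>z\<in>Sp E i. g i *v z = topM \<and>
   (tt E ^^ dd I i) (inc E i z) = c *s (f 0 *v eb n J 0))"

definition chi :: "nat => complex" where "chi v = (if i \<le> v \<and> v < j then 1 else 0)"

text \<open>
Exactness under \<open>\<eta>\<close> at the vertex \<open>m = dd I 0\<close> provides a lift \<open>y\<close>
of the generator of \<open>M\<close> with \<open>t^m y = 0\<close>, hence a \<open>t\<close>-linear section
\<open>s\<close> at vertex 0. At each vertex the flag of \<open>E\<close> contains a vector lifting the top of
the flag of \<open>M\<close>, and modulo the flag of \<open>N\<close> it equals its image under \<open>s\<close>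
plus a multiple of \<open>f (eb n J (dd I v))\<close>. The multiple can be moved to zero where \<open>dd J v =
dd I v + 1\<close>. It is constant from \<open>i\<close> to \<open>j - 1\<close>, and from \<open>k\<close> on
it is constant and vanishes at the last vertex, whose space is killed by \<open>t\<close>.
\<close>

lemma normal_form:
 assumes ee: "E_exact n N E M f g"
 obtains c s \<sigma> where "ext_inv (E, f, g) c" "linmap m (vdim E 0) s"
  "!!x. x \<in> cvec m ==> g 0 *v s x = x" "!!x. x \<in> cvec m ==> s (tt M x) = tt E (s x)"
  "!!v. v < n ==> linmap (vdim M v) (vdim E v) (\<sigma> v)"
  "!!v x. v < n ==> x \<in> Sp M v ==>
   inc E v (\<sigma> v x) = s (inc M v x) + (chi v * c) *s (f 0 *v Sh n I J (inc M v x))"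
proof -
 note X = E_exactD[OF ee]
 note S = seqD[OF X(4)]
 note rE = S(2) and hf = S(4) and hg = S(5)
 note mE = F_Delta_mono[OF X(2)]
 let ?T = "tt E"
 note lT = lin_tt[OF rE n]
 have lTp: "linmap (vdim E 0) (vdim E 0) (?T ^^ q)" for q by (rule linmap_funpow[OF lT])
 note cf = hom_mat[OF hf n0] and cg = hom_mat[OF hg n0]
 note lf = linmap_mat[OF cf, unfolded vN[OF n0]] and lg = linmap_mat[OF cg, unfolded vM[OF n0]]
 note ebJ = eb_carrier[OF n J] and ebI = eb_carrier[OF n I]
 \<comment> \<open>a lift \<open>y\<close> of the generator with \<open>t^m y = 0\<close>, by exactness of \<open>\<eta>\<close> at vertex \<open>m\<close>\<close>
 obtain y where y: "y \<in> Sp E 0" "g 0 *v y = eb n I (m - 1)" "(?T ^^ m) y = 0v (vdim E 0)"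
 proof -
  obtain y' where y': "y' \<in> Sp E 0" "g 0 *v y' = eb n I (m - 1)"
   using S(9)[OF n0, of "eb n I (m - 1)"] ebI[of "m - 1"] vM[OF n0] by auto
  have "\<not> m \<le> m - 1" using m_pos by linarith
  hence "(tt M ^^ m) (eb n I (m - 1)) = 0v m" using eb_tt_pow[OF n I, of "m - 1" m] m_pos by simp
  hence z: "path_act M (eb n I (m - 1)) m 0 = 0v (vdim M m)"
   using inc_path_act[OF rM n _ m_n, of "eb n I (m - 1)"] ebI[of "m - 1"] vM[OF n0] path_act_carrier[OF rM _ n m_n, of "eb n I (m - 1)" 0]
   by (intro inc_inj[OF rM mM m_n]) auto
  have "g m *v path_act E y' m 0 = 0v (vdim M m)"
   using hom_path_act[OF rE rM n hg m_n y'(1)] y'(2) z by simp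
  hence "path_act E y' m 0 \<in> {w \<in> eta n E m. g m *v w = 0v (dim_row (g m))}"
   using eta_iff[OF rE n m_n] y'(1) hom_mat[OF hg m_n] by auto
  hence "path_act E y' m 0 \<in> (\<lambda>v. f m *v v) ` eta n N m"
   using X(5) m_n unfolding exact_on_def by auto
  then obtain x where x: "x \<in> Sp N 0" "path_act E y' m 0 = f m *v path_act N x m 0"
   using eta_iff[OF rN n m_n] by auto
  have fx: "f 0 *v x \<in> Sp E 0" by (rule hom_vec[OF hf n0 x(1)])
  have "(?T ^^ m) y' = (?T ^^ m) (f 0 *v x)"
   using inc_path_act[OF rE n y'(1) m_n] inc_path_act[OF rE n fx m_n] x(2) hom_path_act[OF rN rE n hf m_n x(1)] by simp
  hence "(?T ^^ m) (y' - f 0 *v x) = 0v (vdim E 0)"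
   using linmap_diff[OF lTp y'(1) fx, of m] linD(1)[OF lTp fx, of m] by simp
  moreover have "g 0 *v (y' - f 0 *v x) = eb n I (m - 1)"
   using linmap_diff[OF linmap_mat[OF cg] y'(1) fx] S(7)[OF n0 x(1)] y'(2) ebI[of "m - 1"] vM[OF n0] by simp
  ultimately show ?thesis using that[of "y' - f 0 *v x"] y'(1) fx by simp
 qed
 define gy where "gy q = (?T ^^ (m - q)) y" for q
 define F where "F r = f 0 *v eb n J r" for r
 have gyc: "gy q \<in> Sp E 0" for q unfolding gy_def by (rule linD(1)[OF lTp y(1)])
 have Fc: "F r \<in> Sp E 0" for r unfolding F_def by (rule linD(1)[OF lf ebJ])
 have gy0: "gy 0 = 0v (vdim E 0)" using y(3) by (simp add: gy_def)
 have gyT: "?T (gy (Suc q)) = gy q" if "q < m" for q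
  using that unfolding gy_def by (simp add: Suc_diff_Suc[symmetric])
 have FT: "?T (F r) = (if r = 0 then 0v (vdim E 0) else F (r - 1))" if "r \<le> m" for r
  using hom_tt[OF rN rE n hf, of "eb n J r"] ebJ[of r] eb_tt[OF n J, of r] that dJ0 vN[OF n0] lin0[OF lf]
  by (auto simp: F_def)
 have ggy: "g 0 *v gy (Suc r) = eb n I r" if "r < m" for r
  unfolding gy_def using hom_tt_pow[OF rE rM n hg y(1), of "m - Suc r"] y(2) eb_tt_pow[OF n I, of "m - 1" "m - Suc r"] that by auto
 have gF: "g 0 *v F r = 0v m" for r
  unfolding F_def using S(7)[OF n0, of "eb n J r"] ebJ[of r] vN[OF n0] vM[OF n0] by simp
 have F0: "c = 0" if "c *s F 0 = 0v (vdim E 0)" for c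
 proof -
  have "f 0 *v (c *s eb n J 0) = 0v (vdim E 0)" using that linD(3)[OF lf ebJ, of c 0] by (simp add: F_def)
  hence "c *s eb n J 0 = 0v (dd J 0)" using S(6)[OF n0, of "c *s eb n J 0"] ebJ[of 0] vN[OF n0] by simp
  thus ?thesis using es_smult_zero[OF n J] dJ0 by (simp add: es_def eb_def)
 qed
 let ?W = "isub E"
 note Wadd = isub_add[OF rE] and Wsm = isub_smult[OF rE] and Wdiff = isub_diff[OF rE]
 have lowW: "f 0 *v x \<in> ?W v" if v: "v < n" and x: "x \<in> low n J q" "q \<le> dd J v" for v x q
  using isub_hom[OF rN rE hf v] low_mono[OF x(2), of n J] x(1) isub_low[OF n J v] by blast
 have kerW: "\<exists>x\<in>low n J (dd J v). w = f 0 *v x" if "v < n" "w \<in> ?W v" "g 0 *v w = 0v m" for v w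
  using isub_ker[OF X(4) mM that(1,2)] that(3) vM[OF n0] isub_low[OF n J that(1)] by simp
 define Q where "Q v c \<longleftrightarrow> gy (dd I v) + c *s F (dd I v) \<in> ?W v" for v c
 have QT: "?T (gy (Suc e) + c *s F (Suc e)) = gy e + c *s F e" if "e < m" for e c
  using linD(2)[OF lT gyc, of "c *s F (Suc e)"] linD(3)[OF lT Fc, of c] gyT[OF that] FT[of "Suc e"] that Fc by simp
 have step: "\<exists>c'. Q (Suc v) c' \<and> (dd J v = dd I v --> c' = c)" if v: "Suc v < n" and Qv: "Q v c" for v c
 proof (cases "Suc v \<in> I")
  case True
  hence e: "dd I v = Suc (dd I (Suc v))" using dd_Suc[OF fI, of v] by simp
  have "dd I (Suc v) < m" using e d_le[of v] by simp
  hence "Q (Suc v) c"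
   using isub_tt_Suc[OF rE v Qv[unfolded Q_def]] QT[of "dd I (Suc v)" c] by (simp add: Q_def e)
  thus ?thesis by blast
 next
  case False
  note v' = Suc_lessD[OF v]
  define e where "e = dd I (Suc v)"
  have e: "dd I v = e" using dd_Suc[OF fI, of v] False by (simp add: e_def)
  have em: "e \<le> m" unfolding e_def by (rule d_le)
  have eJ: "e \<le> dd J (Suc v)" "dd J v \<le> Suc e" using dJ[OF v] dJ[OF v'] e by (auto simp: e_def)
  have "\<exists>w\<in>?W (Suc v). g 0 *v w = g 0 *v gy e"
  proof (cases e)
   case 0
   have "0v (vdim E 0) \<in> ?W (Suc v)"
    unfolding isub_def using lin0[OF lin_inc[OF rE v]] by (intro image_eqI[of _ _ "0v (vdim E (Suc v))"]) auto
   thus ?thesis using 0 gy0 by auto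
  next
   case (Suc r)
   have "eb n I r \<in> isub M (Suc v)" unfolding isub_low[OF n I v] by (rule eb_low[OF n I]) (use Suc em in \<open>auto simp: e_def\<close>)
   then obtain x where x: "x \<in> Sp M (Suc v)" "eb n I r = inc M (Suc v) x" unfolding isub_def by blast
   obtain z where z: "z \<in> Sp E (Suc v)" "g (Suc v) *v z = x" using S(9)[OF v x(1)] by blast
   have "g 0 *v inc E (Suc v) z = eb n I r" using hom_inc[OF rE rM hg v z(1)] z(2) x(2) by simp
   thus ?thesis using ggy[of r] Suc em z(1) unfolding isub_def by (intro bexI[of _ "inc E (Suc v) z"]) auto
  qed
  then obtain w where w: "w \<in> ?W (Suc v)" "g 0 *v w = g 0 *v gy e" by blast
  have wc: "w \<in> Sp E 0" using w(1) isub_sub[OF rE v] by blast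
  define p where "p = gy e + c *s F e"
  have p: "p \<in> ?W v" "p \<in> Sp E 0" using Qv gyc Fc unfolding Q_def e p_def by auto
  have "g 0 *v p = g 0 *v gy e"
   using linD(2)[OF lg gyc, of "c *s F e"] linD(3)[OF lg Fc, of c] gF[of e] Fc linD(1)[OF lg gyc, of e] by (simp add: p_def)
  hence gz: "g 0 *v (w - p) = 0v m" using linmap_diff[OF lg wc p(2)] w(2) linD(1)[OF lg gyc, of e] by simp
  have "w - p \<in> ?W v" by (rule Wdiff[OF v' _ p(1)]) (use w(1) isub_Suc[OF rE v] in blast)
  from kerW[OF v' this gz] obtain x where x: "x \<in> low n J (dd J v)" "w - p = f 0 *v x" by blast
  have pw: "p = w - f 0 *v x" unfolding x(2)[symmetric] using wc p(2) by (intro eq_vecI) auto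
  have "\<exists>c' x'. x' \<in> low n J e \<and> x = c' *s eb n J e + x' \<and> (dd J v = dd I v --> c' = 0)"
  proof (cases "dd J v = dd I v")
   case True
   hence "x \<in> low n J e" using x(1) e by simp
   moreover have "x = 0 *s eb n J e + x" using subsetD[OF low_sub[OF n J] x(1)] ebJ[of e] by (intro eq_vecI) auto
   ultimately show ?thesis by blast
  next
   case False
   hence "dd J v = Suc e" using eJ dJ[OF v'] e by (auto split: if_splits)
   thus ?thesis using low_split[OF n J, of x e] x(1) False dJ0 em by (metis less_Suc_eq_le)
  qed
  then obtain c' x' where x': "x' \<in> low n J e" "x = c' *s eb n J e + x'" "dd J v = dd I v --> c' = 0" by blast
  have x'c: "x' \<in> cvec (dd J 0)" using low_sub[OF n J] x'(1) by blast
  have fx': "f 0 *v x' \<in> ?W (Suc v)" by (rule lowW[OF v x'(1) eJ(1)])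
  have fxc: "f 0 *v x' \<in> Sp E 0" by (rule linD(1)[OF lf x'c])
  have "f 0 *v x = c' *s F e + f 0 *v x'"
   unfolding x'(2) F_def using linD(2)[OF lf _ x'c, of "c' *s eb n J e"] linD(3)[OF lf ebJ, of c'] ebJ[of e] by simp
  hence "gy e + (c + c') *s F e = w - f 0 *v x'"
   using pw[unfolded p_def] wc fxc gyc[of e] Fc[of e]
   by (intro eq_vecI) (auto simp: vec_eq_iff algebra_simps)
  hence "Q (Suc v) (c + c')" unfolding Q_def e_def[symmetric] using Wdiff[OF v w(1) fx'] by simp
  thus ?thesis using x'(3) by (intro exI[of _ "c + c'"]) auto
 qed
 have ex: "v < n ==> \<exists>c. Q v c" for v
 proof (induction v)
  case 0
  show ?case unfolding Q_def isub_0 using gyc Fc by auto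
 next
  case (Suc v)
  thus ?case using step by (metis Suc_lessD)
 qed
 have any: "Q v c'" if v: "v < n" and Qv: "Q v c" and d: "dd J v = Suc (dd I v)" for v c c'
 proof -
  have "F (dd I v) \<in> ?W v"
   unfolding F_def by (rule lowW[OF v eb_low[OF n J]]) (use d dJ0 d_le[of v] in auto)
  hence "(gy (dd I v) + c *s F (dd I v)) + (c' - c) *s F (dd I v) \<in> ?W v"
   using Wadd[OF v Qv[unfolded Q_def] Wsm[OF v]] by blast
  moreover have "(gy (dd I v) + c *s F (dd I v)) + (c' - c) *s F (dd I v) = gy (dd I v) + c' *s F (dd I v)"
   using gyc[of "dd I v"] Fc[of "dd I v"] by (intro eq_vecI) (auto simp: algebra_simps)
  ultimately show ?thesis by (simp add: Q_def)
 qed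
 have persist: "Q v c" if "u \<le> v" "v < n" "Q u c" "!!w. u \<le> w ==> w < v ==> dd J w = dd I w" for u v c
  using that
 proof (induction v rule: dec_induct)
  case (step v)
  hence "Q v c" "dd J v = dd I v" by auto
  thus ?case using \<open>!!v c. Suc v < n ==> Q v c ==> \<exists>c'. Q (Suc v) c' \<and> (dd J v = dd I v --> c' = c)\<close>[of v c] step.prems by auto
 qed
 obtain c where c: "Q i c" using ex[OF i_n] by blast
 have Qchi: "Q v (chi v * c)" if v: "v < n" for v
 proof -
  consider "i \<le> v" "v < j" | "k \<le> v" | "v < i \<or> j \<le> v \<and> v < k" by linarith
  thus ?thesis
  proof cases
   case 1
   have "Q v c" by (rule persist[OF 1(1) v c]) (use dJ 1 v in auto)
   thus ?thesis using 1 by (simp add: chi_def)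
  next
   case 2
   hence kn: "k < n" using v by simp
   obtain c' where c': "Q k c'" using ex[OF kn] by blast
   have per: "Q u c'" if "k \<le> u" "u < n" for u by (rule persist[OF that c']) (use dJ that in auto)
   have l: "Q (n - 1) c'" and dl: "dd J (n - 1) = dd I (n - 1)" and n1: "n - 1 < n"
    using per[of "n - 1"] dJ[of "n - 1"] kn n by auto
   have "c' = 0"
   proof (cases "dd I (n - 1)")
    case 0
    hence "c' *s F 0 \<in> ?W (n - 1)" using l gy0 Fc[of 0] by (simp add: Q_def)
    moreover have "g 0 *v (c' *s F 0) = 0v m" using linD(3)[OF lg Fc, of c' 0] gF[of 0] by simp
    ultimately obtain x where "x \<in> low n J 0" "c' *s F 0 = f 0 *v x" using kerW[OF n1, of "c' *s F 0"] dl 0 by auto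
    thus ?thesis using F0 low_0[OF n J] lin0[OF lf] by simp
   next
    case (Suc e)
    hence e: "e = 0" using dd_bound[OF I, of "n - 1"] n by simp
    obtain z where "z \<in> cvec (vdim E (n - 1))" "gy (Suc 0) + c' *s F (Suc 0) = inc E (n - 1) z"
     using l Suc e unfolding Q_def isub_def by auto
    hence "?T (gy (Suc 0) + c' *s F (Suc 0)) = 0v (vdim E 0)" using inc_tt_top[OF rE n] by simp
    thus ?thesis using QT[OF m_pos, of c'] gy0 Fc[of 0] F0 by simp
   qed
   thus ?thesis using per[OF 2 v] 2 ijk by (simp add: chi_def)
  next
   case 3
   hence "dd J v = Suc (dd I v)" "chi v = 0" using dJ[OF v] ijk by (auto simp: chi_def)
   thus ?thesis using any[OF v] ex[OF v] by auto
  qed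
 qed
 have QT': "(?T ^^ q) (gy e + c *s F e) = gy (e - q) + c *s F (e - q)" if "q \<le> e" "e \<le> m" for q e c
  using that
 proof (induction q)
  case (Suc q)
  thus ?case using QT[of "e - Suc q" c] by (simp add: Suc_diff_Suc)
 qed simp
 \<comment> \<open>the section at vertex 0\<close>
 define G where "G = mat (vdim E 0) m (\<lambda>(a, r). gy (Suc r) $ a)"
 have G: "G \<in> carrier_mat (vdim E 0) m" by (simp add: G_def)
 define s where "s x = G *v (QQ n I 0 *v x)" for x
 have ls: "linmap m (vdim E 0) s"
  unfolding s_def using lin_comp[OF linmap_mat[OF QQ_carrier[OF n I n0]] linmap_mat[OF G]] .
 have s_eb: "s (eb n I r) = gy (Suc r)" if "r < m" for r
 proof -
  have u: "unit_vec m r \<in> cvec m" by simp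
  show ?thesis unfolding s_def eb_def QQ_PP[OF n I n0 u] mult_unit_vec[OF G that]
   using that gyc[of "Suc r"] by (intro eq_vecI) (auto simp: G_def)
 qed
 \<comment> \<open>linear maps on \<open>e_0 M\<close> are compared on the basis \<open>eb\<close>\<close>
 have eqI: "A x = B x" if A: "linmap m p A" and B: "linmap m p B" and e: "!!r. r < m ==> A (eb n I r) = B (eb n I r)"
  and x: "x \<in> cvec m" for A B p x
 proof -
  have "A (PP n I 0 *v q) = B (PP n I 0 *v q)" if q: "q \<in> cvec m" for q
   by (rule linmap_eqI[OF lin_comp[OF linmap_mat[OF PP_carrier[OF n I n0]] A] lin_comp[OF linmap_mat[OF PP_carrier[OF n I n0]] B] _ q])
    (use e in \<open>simp add: eb_def\<close>)
  from this[OF QQ_vec[OF n I n0 x]] show ?thesis using PP_QQ[OF n I n0, of x] x vM[OF n0] by simp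
 qed
 have gs: "g 0 *v s x = x" if "x \<in> cvec m" for x
  by (rule eqI[OF lin_comp[OF ls lg] linmap_id _ that]) (use s_eb ggy in simp)
 have ltM: "linmap m m (tt M)" using lin_tt[OF rM n] vM[OF n0] by simp
 have st: "s (tt M x) = ?T (s x)" if "x \<in> cvec m" for x
 proof (rule eqI[OF lin_comp[OF ltM ls] lin_comp[OF ls lT] _ that])
  fix r assume r: "r < m"
  show "s (tt M (eb n I r)) = ?T (s (eb n I r))"
   using eb_tt[OF n I r] s_eb[OF r] s_eb[of "r - 1"] r gyT[of r] gy0 lin0[OF ls] by (cases r) auto
 qed
 have inv: "ext_inv (E, f, g) c"
 proof -
  obtain z where z: "z \<in> Sp E i" "gy (dd I i) + c *s F (dd I i) = inc E i z"
   using c unfolding Q_def isub_def by auto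
  have "inc M i (g i *v z) = g 0 *v gy (dd I i)"
   unfolding hom_inc[OF rE rM hg i_n z(1)] z(2)[symmetric] using linD(2)[OF lg gyc, of "c *s F (dd I i)"] linD(3)[OF lg Fc, of c] gF[of "dd I i"]
    linD(1)[OF lg gyc, of "dd I i"] Fc by simp
  also have "\<dots> = inc M i topM" using ggy[of "dd I i - 1"] d_pos d_le[of i] inc_topM by simp
  finally have "g i *v z = topM" by (rule inc_inject[OF rM mM i_n hom_vec[OF hg i_n z(1)] topM_carrier])
  moreover have "(?T ^^ dd I i) (inc E i z) = c *s F 0"
   using QT'[OF order_refl d_le, of i c] z(2) gy0 Fc[of 0] by simp
  ultimately show ?thesis unfolding ext_inv_def using z(1) by (auto simp: F_def)
 qed
 have lSh: "linmap m (dd J 0) (Sh n I J)" by (rule Sh_linmap[OF n I J])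
 define A where "A v x = s x + (chi v * c) *s (f 0 *v Sh n I J x)" for v x
 have lA: "linmap m (vdim E 0) (A v)" for v
  unfolding A_def by (rule linmap_add[OF ls linmap_smult[OF lin_comp[OF lSh lf]]])
 have A_eb: "A v (eb n I r) = gy (Suc r) + (chi v * c) *s F (Suc r)" if "r < m" for v r
  unfolding A_def s_eb[OF that] F_def using Sh_eb[OF n I J that] dJ0 that by simp
 have memb: "A v (inc M v x) \<in> ?W v" if v: "v < n" and x: "x \<in> Sp M v" for v x
 proof -
  let ?d = "dd I v"
  have "\<forall>r. \<exists>w\<in>Sp E v. r < ?d --> inc E v w = A v (eb n I r)"
  proof
   fix r
   show "\<exists>w\<in>Sp E v. r < ?d --> inc E v w = A v (eb n I r)"
   proof (cases "r < ?d")
    case True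
    have "(?T ^^ (?d - Suc r)) (gy ?d + (chi v * c) *s F ?d) \<in> ?W v"
     by (rule isub_tt_pow[OF rE n v Qchi[OF v, unfolded Q_def]])
    thus ?thesis using QT'[OF _ d_le, of "?d - Suc r" v] True A_eb[of r v] d_le[of v] unfolding isub_def by auto
   qed (use zero_carrier_vec in blast)
  qed
  then obtain w where w: "!!r. w r \<in> Sp E v" "!!r. r < ?d ==> inc E v (w r) = A v (eb n I r)" by metis
  define B where "B = mat (vdim E v) ?d (\<lambda>(a, r). w r $ a)"
  have B: "B \<in> carrier_mat (vdim E v) ?d" by (simp add: B_def)
  have "inc E v (B *v q) = A v (PP n I 0 *v inc (Nmod I) v q)" if q: "q \<in> cvec ?d" for q
  proof (rule linmap_eqI[OF lin_comp[OF linmap_mat[OF B] lin_inc[OF rE v]]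
     lin_comp[OF lin_comp[OF lin_inc[OF Nmod_rep[OF n I] v, unfolded Nmod_vdim] linmap_mat[OF PP_carrier[OF n I n0]]] lA] _ q])
   fix r assume r: "r < ?d"
   have "B *v unit_vec ?d r = w r" unfolding mult_unit_vec[OF B r] using r w(1)[of r] by (auto simp: B_def)
   moreover have "inc (Nmod I) v (unit_vec ?d r) = unit_vec m r"
   proof (rule eq_vecI)
    fix a assume "a < dim_vec (unit_vec m r :: complex vec)"
    thus "inc (Nmod I) v (unit_vec ?d r) $ a = unit_vec m r $ a"
     using Nmod_inc[OF n I v, of "unit_vec ?d r" a] r d_le[of v] by (auto simp: unit_vec_def)
   qed (use Nmod_inc_carrier[OF n I v, of "unit_vec ?d r"] in simp)
   ultimately show "inc E v (B *v unit_vec ?d r) = A v (PP n I 0 *v inc (Nmod I) v (unit_vec ?d r))"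
    using w(2)[OF r] by (simp add: eb_def)
  qed
  note * = this
  have x': "x \<in> cvec ?d" using x vM[OF v] by simp
  note q = QQ_vec[OF n I v x']
  have "PP n I 0 *v inc (Nmod I) v (QQ n I v *v x) = inc M v x"
   using hom_inc[OF Nmod_rep[OF n I] rM iso_hom[OF PP_iso[OF n I]] v, of "QQ n I v *v x"] PP_QQ[OF n I v x] q by simp
  hence "A v (inc M v x) = inc E v (B *v (QQ n I v *v x))" using *[OF q] by simp
  thus ?thesis unfolding isub_def using B q by auto
 qed
 have "\<forall>v. \<exists>\<sigma>. v < n --> linmap (vdim M v) (vdim E v) \<sigma> \<and> (\<forall>x\<in>Sp M v. inc E v (\<sigma> x) = A v (inc M v x))"
 proof
  fix v
  show "\<exists>\<sigma>. v < n --> linmap (vdim M v) (vdim E v) \<sigma> \<and> (\<forall>x\<in>Sp M v. inc E v (\<sigma> x) = A v (inc M v x))"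
  proof (cases "v < n")
   case v: True
   have lMA: "linmap (vdim M v) (vdim E 0) (\<lambda>x. A v (inc M v x))"
    by (rule lin_comp[OF lin_inc[OF rM v, unfolded vM[OF n0]] lA])
   have im: "\<exists>y\<in>Sp E v. inc E v y = A v (inc M v x)" if "x \<in> Sp M v" for x
    using memb[OF v that] unfolding isub_def by auto
   obtain \<sigma> where "linmap (vdim M v) (vdim E v) \<sigma>" "!!x. x \<in> Sp M v ==> inc E v (\<sigma> x) = A v (inc M v x)"
    using linmap_lift[OF lin_inc[OF rE v] inc_inj[OF rE mE v] lMA im] by blast
   thus ?thesis by blast
  qed simp
 qed
 then obtain \<sigma> where \<sigma>: "!!v. v < n ==> linmap (vdim M v) (vdim E v) (\<sigma> v)"
  "!!v x. v < n ==> x \<in> Sp M v ==> inc E v (\<sigma> v x) = A v (inc M v x)" by metis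
 show ?thesis by (rule that[OF inv ls gs st \<sigma>(1) \<sigma>(2)[unfolded A_def]])
qed

end



section \<open>Morphisms of extensions at vertex 0\<close>

lemma vec_minus_self: "x \<in> cvec p ==> x + (-1) *s x = (0v p :: complex vec)"
 by (intro eq_vecI) auto

lemma vec_diff_cancel:
 "a \<in> cvec p ==> b \<in> cvec p ==> c \<in> cvec p ==> a + (b - c) + c = a + (b :: complex vec)"
 by (intro eq_vecI) auto

text \<open>
The part of an exact sequence that the notion of morphism of extensions refers to; unlike exactness in
\<open>\<E>\<close> it is immediate for direct sums of sequences.
\<close>

definition eseq :: "nat => rep => rep => rep => rmor => rmor => bool" where
 "eseq n N E M f g \<longleftrightarrow> is_rep n N \<and> is_rep n E \<and> is_rep n M \<and> rep_hom n N E f \<and> rep_hom n E M g \<and>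
   a_mono n E \<and> a_mono n M"

lemma eseqD:
 assumes "eseq n N E M f g"
 shows "is_rep n N" "is_rep n E" "is_rep n M" "rep_hom n N E f" "rep_hom n E M g" "a_mono n E" "a_mono n M"
 using assms unfolding eseq_def by auto

lemma exact_eseq: "E_exact n N E M f g ==> eseq n N E M f g"
 unfolding eseq_def by (intro conjI F_Delta_mono F_Delta_rep seqD(4,5) E_exactD(1-4))

text \<open>
Morphisms of extensions tested at vertex 0, with the maps on the ends given as functions. For modules with
injective \<open>a\<close> this is the same as \<open>ext_mor\<close>.
\<close>

definition em :: "nat => rep => rep => rmor => rmor => rep => rmor => rmor =>
  (complex vec => complex vec) => (complex vec => complex vec) => bool" where
 "em n N E f g E' f' g' h k \<longleftrightarrow> (\<exists>u. rep_hom n E E' u \<and>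
   (\<forall>x\<in>Sp N 0. u 0 *v (f 0 *v x) = f' 0 *v h x) \<and>
   (\<forall>w\<in>Sp E 0. g' 0 *v (u 0 *v w) = k (g 0 *v w)))"

lemma ext_mor_em:
 assumes n: "1 < n" and e: "eseq n N E M f g" and e': "eseq n N' E' M' f' g'" and h: "rep_hom n N N' h" and k: "rep_hom n M M' k"
 shows "ext_mor n (E, f, g) (E', f', g') h k \<longleftrightarrow> em n N E f g E' f' g' (\<lambda>x. h 0 *v x) (\<lambda>x. k 0 *v x)"
proof -
 note S = eseqD[OF e] and S' = eseqD[OF e']
 have n0: "0 < n" using n by simp
 have 1: "mor_eq n (u oR f) (f' oR h) \<longleftrightarrow> (\<forall>x\<in>Sp N 0. u 0 *v (f 0 *v x) = f' 0 *v (h 0 *v x))"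
  if u: "rep_hom n E E' u" for u
 proof
  assume m: "mor_eq n (u oR f) (f' oR h)"
  show "\<forall>x\<in>Sp N 0. u 0 *v (f 0 *v x) = f' 0 *v (h 0 *v x)"
   using comp_vec[OF S(4) u n0] comp_vec[OF h S'(4) n0] eq_vec[OF m n0] by simp
 next
  assume m: "\<forall>x\<in>Sp N 0. u 0 *v (f 0 *v x) = f' 0 *v (h 0 *v x)"
  show "mor_eq n (u oR f) (f' oR h)"
   by (rule hom_eqI0[OF S(1) S'(2,6) hom_comp[OF S(1,2) S'(2) S(4) u] hom_comp[OF S(1) S'(1,2) h S'(4)]])
    (use m comp_vec[OF S(4) u n0] comp_vec[OF h S'(4) n0] in simp)
 qed
 have 2: "mor_eq n (g' oR u) (k oR g) \<longleftrightarrow> (\<forall>w\<in>Sp E 0. g' 0 *v (u 0 *v w) = k 0 *v (g 0 *v w))"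
  if u: "rep_hom n E E' u" for u
 proof
  assume m: "mor_eq n (g' oR u) (k oR g)"
  show "\<forall>w\<in>Sp E 0. g' 0 *v (u 0 *v w) = k 0 *v (g 0 *v w)"
   using comp_vec[OF u S'(5) n0] comp_vec[OF S(5) k n0] eq_vec[OF m n0] by simp
 next
  assume m: "\<forall>w\<in>Sp E 0. g' 0 *v (u 0 *v w) = k 0 *v (g 0 *v w)"
  show "mor_eq n (g' oR u) (k oR g)"
   by (rule hom_eqI0[OF S(2) S'(3,7) hom_comp[OF S(2) S'(2,3) u S'(5)] hom_comp[OF S(2,3) S'(3) S(5) k]])
    (use m comp_vec[OF u S'(5) n0] comp_vec[OF S(5) k n0] in simp)
 qed
 show ?thesis unfolding ext_mor_def em_def using 1 2 by auto
qed

lemma em_cong: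
 assumes "em n N E f g E' f' g' h k" "0 < n" "rep_hom n E M g"
  and "!!x. x \<in> Sp N 0 ==> h x = h' x" "!!x. x \<in> Sp M 0 ==> k x = k' x"
 shows "em n N E f g E' f' g' h' k'"
proof -
 have "g 0 *v w \<in> Sp M 0" if "w \<in> Sp E 0" for w
  using hom_vec[OF assms(3,2) that] .
 thus ?thesis using assms(1,4,5) unfolding em_def by (metis (no_types, lifting))
qed

lemma em_trans:
 assumes n: "1 < n" and e: "eseq n N E M f g" and e': "eseq n N' E' M' f' g'" and e'': "eseq n N'' E'' M'' f'' g''"
  and 1: "em n N E f g E' f' g' h k" and 2: "em n N' E' f' g' E'' f'' g'' h' k'"
  and h: "!!x. x \<in> Sp N 0 ==> h x \<in> Sp N' 0"
 shows "em n N E f g E'' f'' g'' (\<lambda>x. h' (h x)) (\<lambda>x. k' (k x))"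
proof -
 have n0: "0 < n" using n by simp
 obtain u where u: "rep_hom n E E' u" "!!x. x \<in> Sp N 0 ==> u 0 *v (f 0 *v x) = f' 0 *v h x"
  "!!w. w \<in> Sp E 0 ==> g' 0 *v (u 0 *v w) = k (g 0 *v w)" using 1 unfolding em_def by blast
 obtain u' where u': "rep_hom n E' E'' u'" "!!x. x \<in> Sp N' 0 ==> u' 0 *v (f' 0 *v x) = f'' 0 *v h' x"
  "!!w. w \<in> Sp E' 0 ==> g'' 0 *v (u' 0 *v w) = k' (g' 0 *v w)" using 2 unfolding em_def by blast
 have "rep_hom n E E'' (u' oR u)" by (rule hom_comp[OF eseqD(2)[OF e] eseqD(2)[OF e'] eseqD(2)[OF e''] u(1) u'(1)])
 moreover have "(u' oR u) 0 *v w = u' 0 *v (u 0 *v w)" if "w \<in> Sp E 0" for w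
  by (rule comp_vec[OF u(1) u'(1) n0 that])
 moreover have "f 0 *v x \<in> Sp E 0" if "x \<in> Sp N 0" for x
  by (rule hom_vec[OF eseqD(4)[OF e] n0 that])
 moreover have "u 0 *v w \<in> Sp E' 0" if "w \<in> Sp E 0" for w
  by (rule hom_vec[OF u(1) n0 that])
 ultimately show ?thesis using u(2,3) u'(2,3) h unfolding em_def by (intro exI[of _ "u' oR u"]) auto
qed

text \<open>The five lemma, at vertex 0.\<close>

lemma em_sym:
 assumes n: "1 < n" and e: "E_exact n N E M f g" and e': "E_exact n N E' M f' g'"
  and 1: "em n N E f g E' f' g' (\<lambda>x. x) (\<lambda>x. x)"
 shows "em n N E' f' g' E f g (\<lambda>x. x) (\<lambda>x. x)"
proof -
 have n0: "0 < n" using n by simp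
 note S = seqD[OF E_exactD(4)[OF e]] and S' = seqD[OF E_exactD(4)[OF e']]
 obtain u where u: "rep_hom n E E' u" "!!x. x \<in> Sp N 0 ==> u 0 *v (f 0 *v x) = f' 0 *v x"
  "!!w. w \<in> Sp E 0 ==> g' 0 *v (u 0 *v w) = g 0 *v w" using 1 unfolding em_def by blast
 have "inj_mat (u 0)"
  unfolding inj_mat_def
 proof (intro ballI impI)
  fix w assume "w \<in> cvec (dim_col (u 0))" and "u 0 *v w = 0v (dim_row (u 0))"
  hence w: "w \<in> Sp E 0" and z: "u 0 *v w = 0v (vdim E' 0)" using hom_mat[OF u(1) n0] by auto
  have "g 0 *v w = 0v (vdim M 0)" using u(3)[OF w] z lin0[OF hom_lin[OF S'(5) n0]] by simp
  then obtain x where x: "x \<in> Sp N 0" "w = f 0 *v x" using S(8)[OF n0 w] by blast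
  have "x = 0v (vdim N 0)" using S'(6)[OF n0 x(1)] u(2)[OF x(1)] z x(2) by simp
  thus "w = 0v (dim_col (u 0))"
   using x(2) lin0[OF hom_lin[OF S(4) n0]] hom_mat[OF u(1) n0] by simp
 qed
 hence "iso_mor n E E' u"
  using inj_of_inj0[OF S(2) S'(2) F_Delta_mono[OF E_exactD(2)[OF e]] u(1)]
   short_exact_dim[OF E_exactD(4)[OF e]] short_exact_dim[OF E_exactD(4)[OF e']]
  by (intro iso_of_inj[OF S(2) S'(2) u(1)]) auto
 then obtain r where r: "iso_mor n E' E r" "!!x. x \<in> Sp E 0 ==> r 0 *v (u 0 *v x) = x"
  "!!y. y \<in> Sp E' 0 ==> u 0 *v (r 0 *v y) = y"
  using iso_inverse n0 by metis
 note rh = iso_hom[OF r(1)]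
 have "r 0 *v (f' 0 *v x) = f 0 *v x" if "x \<in> Sp N 0" for x
  using r(2)[OF hom_vec[OF S(4) n0 that]] u(2)[OF that] by simp
 moreover have "g 0 *v (r 0 *v w) = g' 0 *v w" if "w \<in> Sp E' 0" for w
  using u(3)[OF hom_vec[OF rh n0 that]] r(3)[OF that] by simp
 ultimately show ?thesis unfolding em_def using rh by blast
qed

section \<open>Diagonal, codiagonal and sums of morphisms\<close>

lemma mor_dsum_vec:
 assumes "rep_hom n X Y f" "rep_hom n X' Y' f'" "v < n" "x \<in> Sp X v" "x' \<in> Sp X' v"
 shows "mor_dsum f f' v *v (x @v x') = (f v *v x) @v (f' v *v x')"
 unfolding mor_dsum_def by (rule block_diag_vec[OF hom_mat[OF assms(1,3)] hom_mat[OF assms(2,3)] assms(4,5)])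

lemma mor_dsum_hom:
 assumes n: "1 < n" and X: "is_rep n X" and Y: "is_rep n Y" and X': "is_rep n X'" and Y': "is_rep n Y'"
  and f: "rep_hom n X Y f" and f': "rep_hom n X' Y' f'"
 shows "rep_hom n (X +R X') (Y +R Y') (mor_dsum f f')"
proof (rule rep_homI[OF dsum_rep[OF n X X'] dsum_rep[OF n Y Y']])
 fix v
 show "v < n ==> mor_dsum f f' v \<in> carrier_mat (vdim (Y +R Y') v) (vdim (X +R X') v)"
  unfolding mor_dsum_def using block_diag_carrier[OF hom_mat[OF f] hom_mat[OF f']] by simp
 fix w :: "complex vec" assume v: "Suc v < n"
 note v' = Suc_lessD[OF v] and D = mor_dsum_vec[OF f f']
 show "mor_dsum f f' v *v (amap (X +R X') (Suc v) *v w) = amap (Y +R Y') (Suc v) *v (mor_dsum f f' (Suc v) *v w)"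
  if w: "w \<in> Sp (X +R X') (Suc v)"
 proof -
  obtain x y where xy: "x \<in> Sp X (Suc v)" "y \<in> Sp X' (Suc v)" "w = x @v y"
   by (rule vec_splitE[OF w[unfolded vdim_dsum]])
  show ?thesis
   unfolding xy(3) dsum_a[OF X X' v xy(1,2)] D[OF v xy(1,2)] D[OF v' rep_act(1)[OF X v xy(1)] rep_act(1)[OF X' v xy(2)]]
    dsum_a[OF Y Y' v hom_vec[OF f v xy(1)] hom_vec[OF f' v xy(2)]] rep_hom_a[OF X Y f v xy(1)] rep_hom_a[OF X' Y' f' v xy(2)] ..
 qed
 show "mor_dsum f f' (Suc v) *v (bmap (X +R X') (Suc v) *v w) = bmap (Y +R Y') (Suc v) *v (mor_dsum f f' v *v w)"
  if w: "w \<in> Sp (X +R X') v"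
 proof -
  obtain x y where xy: "x \<in> Sp X v" "y \<in> Sp X' v" "w = x @v y"
   by (rule vec_splitE[OF w[unfolded vdim_dsum]])
  show ?thesis
   unfolding xy(3) dsum_b[OF X X' v xy(1,2)] D[OF v' xy(1,2)] D[OF v rep_act(2)[OF X v xy(1)] rep_act(2)[OF X' v xy(2)]]
    dsum_b[OF Y Y' v hom_vec[OF f v' xy(1)] hom_vec[OF f' v' xy(2)]] rep_hom_b[OF X Y f v xy(1)] rep_hom_b[OF X' Y' f' v xy(2)] ..
 qed
qed

lemma mor_diag_vec: "x \<in> Sp X v ==> mor_diag X v *v x = x @v x"
 unfolding mor_diag_def by (subst mat_mult_append[OF one_carrier_mat one_carrier_mat]) auto

lemma mor_diag_eq: "mor_diag X v = hpair X X X (mor_id X) (mor_id X) v"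
proof (rule mat_eq_vecI)
 show "mor_diag X v \<in> carrier_mat (vdim X v + vdim X v) (vdim X v)"
  unfolding mor_diag_def by (rule carrier_append_rows) auto
 fix x :: "complex vec" assume x: "x \<in> Sp X v"
 show "mor_diag X v *v x = hpair X X X (mor_id X) (mor_id X) v *v x"
  by (subst hpair_vec) (use x mor_diag_vec[OF x] mor_id_vec[OF x] in \<open>auto simp: mor_id_def\<close>)
qed (simp add: hpair_def)

lemma mor_codiag_vec:
 assumes x: "x \<in> Sp X v" and y: "y \<in> Sp X v"
 shows "mor_codiag X v *v (x @v y) = x + y"
proof -
 let ?d = "vdim X v"
 have A: "1\<^sub>m ?d @\<^sub>r (1\<^sub>m ?d :: complex mat) \<in> carrier_mat (?d + ?d) ?d" by (rule carrier_append_rows) auto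
 have dim: "dim_row (mor_codiag X v) = ?d" using carrier_matD(2)[OF A] by (simp add: mor_codiag_def)
 show ?thesis
 proof (rule eq_vecI)
 fix a assume "a < dim_vec (x + y)"
 hence a: "a < ?d" using y by simp
 have "col (1\<^sub>m ?d @\<^sub>r 1\<^sub>m ?d) a = unit_vec ?d a @v (unit_vec ?d a :: complex vec)"
  unfolding mult_unit_vec[OF A a, symmetric] by (subst mat_mult_append[OF one_carrier_mat one_carrier_mat]) auto
 hence "row (mor_codiag X v) a = unit_vec ?d a @v unit_vec ?d a"
  using a carrier_matD(2)[OF A] by (simp add: mor_codiag_def)
 moreover have "a < dim_row (mor_codiag X v)" using a dim by simp
 ultimately have "(mor_codiag X v *v (x @v y)) $ a = (unit_vec ?d a @v unit_vec ?d a) \<bullet> (x @v y)"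
  by (simp only: index_mult_mat_vec)
 also have "\<dots> = x $ a + y $ a"
  using scalar_prod_append[of "unit_vec ?d a" ?d "unit_vec ?d a" ?d x y] x y a by simp
 finally show "(mor_codiag X v *v (x @v y)) $ a = (x + y) $ a" using a y by simp
 qed (use y dim in simp)
qed

lemma rep_hom_cong: "rep_hom n X Y f ==> (!!v. v < n ==> f v = f' v) ==> rep_hom n X Y f'"
 unfolding rep_hom_def by fastforce

lemma mor_diag_hom: "1 < n ==> is_rep n X ==> rep_hom n X (X +R X) (mor_diag X)"
 by (rule rep_hom_cong[OF hpair_hom[OF _ _ _ _ rep_hom_id rep_hom_id]]) (auto simp: mor_diag_eq)

lemma mor_codiag_hom:
 assumes n: "1 < n" and X: "is_rep n X" shows "rep_hom n (X +R X) X (mor_codiag X)"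
proof (rule rep_hom_cong[OF hcopair_hom[OF n X X X rep_hom_id[OF X] rep_hom_id[OF X]]])
 fix v assume v: "v < n"
 show "hcopair X X X (mor_id X) (mor_id X) v = mor_codiag X v"
 proof (rule mat_eq_vecI)
  show "mor_codiag X v \<in> carrier_mat (vdim X v) (vdim X v + vdim X v)"
   unfolding mor_codiag_def by (rule transpose_carrier_mat[THEN iffD2]) (rule carrier_append_rows, auto)
  fix w :: "complex vec" assume w: "w \<in> cvec (vdim X v + vdim X v)"
  obtain x y where xy: "x \<in> Sp X v" "y \<in> Sp X v" "w = x @v y" by (rule vec_splitE[OF w])
  show "hcopair X X X (mor_id X) (mor_id X) v *v w = mor_codiag X v *v w"
   unfolding xy(3) mor_codiag_vec[OF xy(1,2)] hcopair_vec'[OF rep_hom_id[OF X] rep_hom_id[OF X] v xy(1,2)]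
    mor_id_vec[OF xy(1)] mor_id_vec[OF xy(2)] ..
 qed (simp add: hcopair_def)
qed

lemma a_mono_dsum:
 assumes X: "is_rep n X" and Y: "is_rep n Y" and mX: "a_mono n X" and mY: "a_mono n Y"
 shows "a_mono n (X +R Y)"
 unfolding a_mono_def inj_mat_def
proof (intro allI impI ballI)
 fix v w assume v: "Suc v < n" and w: "w \<in> cvec (dim_col (amap (X +R Y) (Suc v)))"
  and z: "amap (X +R Y) (Suc v) *v w = 0v (dim_row (amap (X +R Y) (Suc v)))"
 note cX = is_rep_carrier(1)[OF X v] and cY = is_rep_carrier(1)[OF Y v]
 have c: "amap (X +R Y) (Suc v) \<in> carrier_mat (vdim X v + vdim Y v) (vdim X (Suc v) + vdim Y (Suc v))"
  using block_diag_carrier[OF cX cY] by (simp add: dsum_def)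
 have w': "w \<in> cvec (vdim X (Suc v) + vdim Y (Suc v))" using w c by simp
 obtain x y where xy: "x \<in> Sp X (Suc v)" "y \<in> Sp Y (Suc v)" "w = x @v y" by (rule vec_splitE[OF w'])
 have "amap X (Suc v) *v x = 0v (vdim X v)" "amap Y (Suc v) *v y = 0v (vdim Y v)"
  using z c dsum_a[OF X Y v xy(1,2)] append_vec_zero_iff[OF rep_act(1)[OF X v xy(1)] rep_act(1)[OF Y v xy(2)]] xy(3) by auto
 hence "x = 0v (vdim X (Suc v))" "y = 0v (vdim Y (Suc v))"
  using mX mY v xy cX cY unfolding a_mono_def inj_mat_def by auto
 thus "w = 0v (dim_col (amap (X +R Y) (Suc v)))" using c xy(3) by (simp add: zero_append)
qed

lemma eseq_dsum:
 assumes n: "1 < n" and e: "eseq n N E M f g" and e': "eseq n N' E' M' f' g'"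
 shows "eseq n (N +R N') (E +R E') (M +R M') (mor_dsum f f') (mor_dsum g g')"
 using eseqD[OF e] eseqD[OF e'] unfolding eseq_def
 by (intro conjI dsum_rep mor_dsum_hom a_mono_dsum n) auto

section \<open>Cocycles from a potential\<close>

lemma vec_diff_telescope:
 "a \<in> cvec p ==> b \<in> cvec p ==> c \<in> cvec p ==> (a - b) + (b - c) = a - (c :: complex vec)"
 by (intro eq_vecI) auto

lemma linmap_minus:
 assumes F: "linmap q p F" and G: "linmap q p G" shows "linmap q p (\<lambda>x. F x - G x)"
proof -
 have "F (x + y) - G (x + y) = (F x - G x) + (F y - G y)" if "x \<in> cvec q" "y \<in> cvec q" for x y
  unfolding linD(2)[OF F that] linD(2)[OF G that]
  using linD(1)[OF F that(1)] linD(1)[OF F that(2)] linD(1)[OF G that(1)] linD(1)[OF G that(2)]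
  by (intro eq_vecI) (auto simp: algebra_simps)
 moreover have "F (c *s x) - G (c *s x) = c *s (F x - G x)" if "x \<in> cvec q" for c x
  unfolding linD(3)[OF F that] linD(3)[OF G that]
  using linD(1)[OF F that] linD(1)[OF G that] by (intro eq_vecI) (auto simp: algebra_simps)
 ultimately show ?thesis unfolding linmap_def using linD(1)[OF F] linD(1)[OF G] by auto
qed

text \<open>
A family \<open>\<theta> v\<close> of linear maps from the spaces of \<open>M\<close> to the space of
\<open>N\<close> at vertex 0 has a coboundary. Once its values lie in the flag of \<open>N\<close>, they lift to
a cocycle, and the cocycle identities hold because they hold after applying the injective maps \<open>inc
v\<close>. The extension is the direct sum at vertex 0, with its flag sheared by \<open>\<theta>\<close>.
\<close>

lemma cocycle_of_potential:
 assumes n: "1 < n" and N: "is_rep n N" and mN: "a_mono n N" and M: "is_rep n M"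
  and \<theta>: "!!v. v < n ==> linmap (vdim M v) (vdim N 0) (\<theta> v)"
  and \<theta>0: "!!y. y \<in> Sp M 0 ==> \<theta> 0 y = 0v (vdim N 0)"
  and top: "!!v y. n = Suc v ==> y \<in> Sp M v ==> tt N (\<theta> v y) = 0v (vdim N 0)"
  and down: "!!v y. Suc v < n ==> y \<in> Sp M (Suc v) ==> \<theta> (Suc v) y - \<theta> v (amap M (Suc v) *v y) \<in> isub N v"
  and up: "!!v y. Suc v < n ==> y \<in> Sp M v ==> tt N (\<theta> v y) - \<theta> (Suc v) (bmap M (Suc v) *v y) \<in> isub N (Suc v)"
 obtains al bt where "cocycle n N M al bt"
  "!!w. w \<in> Sp M 0 ==>
   amap N (Suc 0) *v (bt (Suc 0) *v w) + al (Suc 0) *v (bmap M (Suc 0) *v w) = 0v (vdim N 0)"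
  "!!v x y. v < n ==> x \<in> Sp N v ==> y \<in> Sp M v ==>
   inc (cext N M al bt) v (x @v y) = (inc N v x + \<theta> v y) @v inc M v y"
proof -
 have lift: "\<exists>A\<in>carrier_mat (vdim N u) q. \<forall>y\<in>cvec q. inc N u (A *v y) = F y"
  if u: "u < n" and F: "linmap q (vdim N 0) F" and im: "!!y. y \<in> cvec q ==> F y \<in> isub N u" for u q F
 proof -
  have "\<exists>x\<in>Sp N u. inc N u x = F y" if "y \<in> cvec q" for y
   using im[OF that] unfolding isub_def by auto
  then obtain G where G: "linmap q (vdim N u) G" "!!y. y \<in> cvec q ==> inc N u (G y) = F y"
   using linmap_lift[OF lin_inc[OF N u] inc_inj[OF N mN u] F] by blast
  show ?thesis using G mat_of_fun_mult[OF G(1)] by (intro bexI[of _ "mat_of_fun q (vdim N u) G"]) auto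
 qed
 note ltN = lin_tt[OF N n]
 have "\<forall>v. \<exists>A. Suc v < n --> A \<in> carrier_mat (vdim N v) (vdim M (Suc v)) \<and>
   (\<forall>y\<in>Sp M (Suc v). inc N v (A *v y) = \<theta> (Suc v) y - \<theta> v (amap M (Suc v) *v y))"
  using lift[OF Suc_lessD linmap_minus[OF \<theta> lin_comp[OF linmap_act(1)[OF M] \<theta>[OF Suc_lessD]]] down] by blast
 then obtain A where A: "!!v. Suc v < n ==> A v \<in> carrier_mat (vdim N v) (vdim M (Suc v))"
  "!!v y. Suc v < n ==> y \<in> Sp M (Suc v) ==> inc N v (A v *v y) = \<theta> (Suc v) y - \<theta> v (amap M (Suc v) *v y)" by metis
 have "\<forall>v. \<exists>B. Suc v < n --> B \<in> carrier_mat (vdim N (Suc v)) (vdim M v) \<and>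
   (\<forall>y\<in>Sp M v. inc N (Suc v) (B *v y) = tt N (\<theta> v y) - \<theta> (Suc v) (bmap M (Suc v) *v y))"
  using lift[OF _ linmap_minus[OF lin_comp[OF \<theta>[OF Suc_lessD] ltN] lin_comp[OF linmap_act(2)[OF M] \<theta>]] up] by blast
 then obtain B where B: "!!v. Suc v < n ==> B v \<in> carrier_mat (vdim N (Suc v)) (vdim M v)"
  "!!v y. Suc v < n ==> y \<in> Sp M v ==> inc N (Suc v) (B v *v y) = tt N (\<theta> v y) - \<theta> (Suc v) (bmap M (Suc v) *v y)" by metis
 have Av: "A v *v y \<in> Sp N v" if "Suc v < n" "y \<in> Sp M (Suc v)" for v y using A(1)[OF that(1)] that by auto
 have Bv: "B v *v y \<in> Sp N (Suc v)" if "Suc v < n" "y \<in> Sp M v" for v y using B(1)[OF that(1)] that by auto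
 have th: "\<theta> v y \<in> Sp N 0" "tt N (\<theta> v y) \<in> Sp N 0" if "v < n" "y \<in> Sp M v" for v y
  using linD(1)[OF \<theta>[OF that(1)] that(2)] linD(1)[OF ltN] by auto
 have ba: "inc N (Suc v) (bmap N (Suc v) *v (A v *v w) + B v *v (amap M (Suc v) *v w)) =
   tt N (\<theta> (Suc v) w) - \<theta> (Suc v) (bmap M (Suc v) *v (amap M (Suc v) *v w))"
  if v: "Suc v < n" and w: "w \<in> Sp M (Suc v)" for v w
 proof -
  note aw = rep_act(1)[OF M v w]
  show ?thesis
   unfolding linD(2)[OF lin_inc[OF N v] rep_act(2)[OF N v Av[OF v w]] Bv[OF v aw]] inc_b[OF N v Av[OF v w]]
    A(2)[OF v w] B(2)[OF v aw] linmap_diff[OF ltN th(1)[OF v w] th(1)[OF Suc_lessD[OF v] aw]]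
   by (rule vec_diff_telescope[OF th(2)[OF v w] th(2)[OF Suc_lessD[OF v] aw] th(1)[OF v rep_act(2)[OF M v aw]]])
 qed
 have ab: "inc N v (amap N (Suc v) *v (B v *v w) + A v *v (bmap M (Suc v) *v w)) =
   tt N (\<theta> v w) - \<theta> v (amap M (Suc v) *v (bmap M (Suc v) *v w))"
  if v: "Suc v < n" and w: "w \<in> Sp M v" for v w
 proof -
  note bw = rep_act(2)[OF M v w]
  show ?thesis
   unfolding linD(2)[OF lin_inc[OF N Suc_lessD[OF v]] rep_act(1)[OF N v Bv[OF v w]] Av[OF v bw]] inc.simps(2)[symmetric]
    A(2)[OF v bw] B(2)[OF v w]
   by (rule vec_diff_telescope[OF th(2)[OF Suc_lessD[OF v] w] th(1)[OF v bw] th(1)[OF Suc_lessD[OF v] rep_act(1)[OF M v bw]]])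
 qed
 define al where "al v = A (v - 1)" for v
 define bt where "bt v = B (v - 1)" for v
 have c: "cocycle n N M al bt"
  unfolding cocycle_def
 proof (intro conjI allI impI ballI)
  fix v
  show "Suc v < n ==> al (Suc v) \<in> carrier_mat (vdim N v) (vdim M (Suc v))"
   "Suc v < n ==> bt (Suc v) \<in> carrier_mat (vdim N (Suc v)) (vdim M v)" using A(1) B(1) by (auto simp: al_def bt_def)
  fix w :: "complex vec" assume w: "w \<in> Sp M (Suc v)"
  have c1: "bmap N (Suc v) *v (A v *v w) + B v *v (amap M (Suc v) *v w) \<in> Sp N (Suc v)" if v: "Suc v < n"
   using rep_act(2)[OF N v Av[OF v w]] Bv[OF v rep_act(1)[OF M v w]] by simp
  show "bmap N (Suc v) *v (al (Suc v) *v w) + bt (Suc v) *v (amap M (Suc v) *v w) = 0v (vdim N (Suc v))" if nv: "n = Suc (Suc v)"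
  proof -
   have v: "Suc v < n" using nv by simp
   have "inc N (Suc v) (bmap N (Suc v) *v (A v *v w) + B v *v (amap M (Suc v) *v w)) = 0v (vdim N 0)"
    unfolding ba[OF v w] rep_top_vec[OF M nv w] lin0[OF \<theta>[OF v]] top[OF nv w] by simp
   from inc_inj[OF N mN v c1[OF v] this] show ?thesis by (simp add: al_def bt_def)
  qed
  show "amap N (Suc (Suc v)) *v (bt (Suc (Suc v)) *v w) + al (Suc (Suc v)) *v (bmap M (Suc (Suc v)) *v w) =
    bmap N (Suc v) *v (al (Suc v) *v w) + bt (Suc v) *v (amap M (Suc v) *v w)" if v2: "Suc (Suc v) < n"
  proof -
   note v = Suc_lessD[OF v2]
   have c2: "amap N (Suc (Suc v)) *v (B (Suc v) *v w) + A (Suc v) *v (bmap M (Suc (Suc v)) *v w) \<in> Sp N (Suc v)"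
    using rep_act(1)[OF N v2 Bv[OF v2 w]] Av[OF v2 rep_act(2)[OF M v2 w]] by simp
   show ?thesis
    using inc_inject[OF N mN v c2 c1[OF v]] ba[OF v w] ab[OF v2 w] rep_comm_vec[OF M v2 w] by (simp add: al_def bt_def)
  qed
 qed
 have n1: "Suc 0 < n" and n0: "0 < n" using n by auto
 have 0: "amap N (Suc 0) *v (bt (Suc 0) *v w) + al (Suc 0) *v (bmap M (Suc 0) *v w) = 0v (vdim N 0)"
  if w: "w \<in> Sp M 0" for w
  using ab[OF n1 w] \<theta>0[OF w] \<theta>0[OF rep_act(1)[OF M n1 rep_act(2)[OF M n1 w]]] lin0[OF ltN] by (simp add: al_def bt_def)
 have "v < n ==> x \<in> Sp N v ==> y \<in> Sp M v ==>
   inc (cext N M al bt) v (x @v y) = (inc N v x + \<theta> v y) @v inc M v y" for v x y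
 proof (induction v arbitrary: x y)
  case 0
  thus ?case using \<theta>0 by simp
 next
  case (Suc v)
  note v = Suc.prems(1) and v' = Suc_lessD[OF Suc.prems(1)] and x = Suc.prems(2) and y = Suc.prems(3)
  note ax = rep_act(1)[OF N v x] and ay = rep_act(1)[OF M v y]
  note iax = linD(1)[OF lin_inc[OF N v'] ax]
  have Ay: "al (Suc v) *v y \<in> Sp N v" using Av[OF v y] by (simp add: al_def)
  have "inc N v (amap N (Suc v) *v x + al (Suc v) *v y) + \<theta> v (amap M (Suc v) *v y) = inc N (Suc v) x + \<theta> (Suc v) y"
   using linD(2)[OF lin_inc[OF N v'] ax Ay] A(2)[OF v y] vec_diff_cancel[OF iax th(1)[OF v y] th(1)[OF v' ay]]
   by (simp add: al_def)
  thus ?case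
   using Suc.IH[OF v' add_carrier_vec[OF ax Ay] ay] cext_a[OF N M c v x y] by simp
 qed
 thus ?thesis using that[OF c 0] by blast
qed



section \<open>One dimensional vector spaces\<close>

text \<open>
The vectors of the extension group are classes of extensions; \<open>cls\<close> enumerates them by a scalar and
is linear.
\<close>

lemma has_dim_one:
 fixes V :: "(complex, 'a) module" and cls :: "complex => 'a"
 assumes car: "carrier V = range cls" and inj: "inj cls" and z: "\<zero>\<^bsub>V\<^esub> = cls 0"
  and add: "!!a b. cls a \<oplus>\<^bsub>V\<^esub> cls b = cls (a + b)" and sm: "!!c a. c \<odot>\<^bsub>V\<^esub> cls a = cls (c * a)"
 shows "has_dim V 1"
proof -
 have ab: "abelian_group V"
 proof (rule abelian_groupI)
  fix x assume "x \<in> carrier V"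
  then obtain a where "x = cls a" using car by auto
  thus "\<exists>y\<in>carrier V. y \<oplus>\<^bsub>V\<^esub> x = \<zero>\<^bsub>V\<^esub>" by (intro bexI[of _ "cls (- a)"]) (auto simp: add z car)
 qed (auto simp: car z add algebra_simps)
 have cr: "cring (class_ring :: complex ring)" and fr: "field (class_ring :: complex ring)"
  using class_field by (auto intro: field.axioms domain.axioms simp: field_def domain_def)
 have mod: "module class_ring V"
  by (rule moduleI[OF cr ab]) (auto simp: car sm add class_ring_simps algebra_simps)
 interpret vectorspace class_ring V by (rule vectorspace.intro[OF mod fr])
 have lc: "lincomb a {cls 1} = cls (a (cls 1))" for a
  unfolding lincomb_def by (subst finsum_insert) (auto simp: car sm z add)
 have g1: "gen_set {cls 1}"
  unfolding span_def
 proof (intro equalityI subsetI)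
  fix x assume "x \<in> {lincomb a A |a A. finite A \<and> A \<subseteq> {cls 1} \<and> a \<in> A \<rightarrow> carrier class_ring}"
  then obtain a A where x: "x = lincomb a A" and "A \<subseteq> {cls 1}" by blast
  hence "A = {} \<or> A = {cls 1}" by blast
  thus "x \<in> carrier V" using x lc[of a] car z by (auto simp: lincomb_def)
 next
  fix x assume "x \<in> carrier V"
  then obtain a where "x = cls a" using car by auto
  hence "x = lincomb (\<lambda>_. a) {cls 1}" using lc by simp
  thus "x \<in> {lincomb a A |a A. finite A \<and> A \<subseteq> {cls 1} \<and> a \<in> A \<rightarrow> carrier class_ring}"
   by (auto simp: class_ring_simps intro!: exI[of _ "\<lambda>_. a"] exI[of _ "{cls 1}"])
 qed
 have fd: "fin_dim" unfolding fin_dim_def using g1 car by (intro exI[of _ "{cls 1}"]) auto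
 have "dim = 1"
  unfolding dim_def
 proof (rule Least_equality)
  show "\<exists>A. finite A \<and> card A = 1 \<and> A \<subseteq> carrier V \<and> gen_set A"
   using g1 car by (intro exI[of _ "{cls 1}"]) auto
  fix y assume "\<exists>A. finite A \<and> card A = y \<and> A \<subseteq> carrier V \<and> gen_set A"
  then obtain A where A: "finite A" "card A = y" "gen_set A" by blast
  show "1 \<le> y"
  proof (rule ccontr)
   assume "\<not> 1 \<le> y"
   hence "card A = 0" using A(2) by simp
   hence "A = {}" using A(1) by simp
   hence "carrier V \<subseteq> {cls 0}" using A(3) z unfolding span_def by (auto simp: lincomb_def)
   hence "cls 1 = cls 0" using car by auto
   thus False using inj by (auto dest: injD)
  qed
 qed
 thus ?thesis unfolding has_dim_def using vectorspace.intro[OF mod fr] fd by simp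
qed

section \<open>The extension group\<close>

lemma zero_smult_vec: "x \<in> cvec p ==> 0 *s x = (0v p :: complex vec)"
 by (intro eq_vecI) auto

lemma hom_lin0: "rep_hom n X Y f ==> 0 < n ==> linmap (vdim X 0) (vdim Y 0) (\<lambda>x. f 0 *v x)"
 by (rule hom_lin)

lemma mor_smult_id_vec: "x \<in> Sp X v ==> mor_smult c (mor_id X) v *v x = c *s x"
 by (auto simp: mor_smult_def mor_id_def intro!: eq_vecI)

context interlaced
begin

lemma ext_inv_iff:
 assumes e: "eseq n N E M f g"
 shows "ext_inv (E, f, g) c \<longleftrightarrow> (\<exists>w\<in>isub E i. g 0 *v w = eb n I (dd I i - 1) \<and> (tt E ^^ dd I i) w = c *s (f 0 *v eb n J 0))"
proof -
 note S = eseqD[OF e]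
 have "g i *v z = topM \<longleftrightarrow> g 0 *v inc E i z = eb n I (dd I i - 1)" if z: "z \<in> Sp E i" for z
  using hom_inc[OF S(2,3,5) i_n z] inc_topM inc_inject[OF rM mM i_n hom_vec[OF S(5) i_n z] topM_carrier] by auto
 thus ?thesis unfolding ext_inv_def isub_def by auto
qed

lemma f_eb_inj:
 assumes f: "rep_hom n N E f" and fi: "!!x. x \<in> Sp N 0 ==> f 0 *v x = 0v (vdim E 0) ==> x = 0v (vdim N 0)"
  and eq: "c *s (f 0 *v eb n J 0) = c' *s (f 0 *v eb n J 0)"
 shows "c = c'"
proof -
 note lf = hom_lin0[OF f n0]
 have e: "eb n J 0 \<in> Sp N 0" using eb_carrier[OF n J] vN[OF n0] by simp
 have "f 0 *v ((c - c') *s eb n J 0) = (c - c') *s (f 0 *v eb n J 0)" by (rule linD(3)[OF lf e])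
 also have "\<dots> = c *s (f 0 *v eb n J 0) + (-1) *s (c' *s (f 0 *v eb n J 0))"
  using linD(1)[OF lf e] by (intro eq_vecI) (auto simp del: index_mult_mat_vec simp: algebra_simps)
 also have "\<dots> = 0v (vdim E 0)" unfolding eq by (rule vec_minus_self) (use linD(1)[OF lf e] in simp)
 finally have "(c - c') *s eb n J 0 = 0v (vdim N 0)" using fi[of "(c - c') *s eb n J 0"] e by simp
 hence "c - c' = 0" using es_smult_zero[OF n J, of "c - c'"] dJ0 vN[OF n0] by (simp add: es_def eb_def)
 thus ?thesis by simp
qed

text \<open>
The two vectors differ by an element of the flag of \<open>N\<close> at \<open>i\<close>, and \<open>t^d\<close>
kills it.
\<close>

lemma two_lifts:
 assumes e: "short_exact n N E X f g" and mX: "a_mono n X"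
  and w: "w \<in> isub E i" "w' \<in> isub E i" and g: "g 0 *v w = g 0 *v w'"
 shows "(tt E ^^ dd I i) w = (tt E ^^ dd I i) w'"
proof -
 note S = seqD[OF e]
 have wc: "w \<in> Sp E 0" "w' \<in> Sp E 0" using w isub_sub[OF S(2) i_n] by auto
 note lT = linmap_funpow[OF lin_tt[OF S(2) n], of "dd I i"]
 have "g 0 *v (w - w') = 0v (vdim X 0)"
  using linmap_diff[OF hom_lin0[OF S(5) n0] wc] g hom_vec[OF S(5) n0 wc(2)] by simp
 then obtain x where x: "x \<in> isub N i" "w - w' = f 0 *v x"
  using isub_ker[OF e mX i_n isub_diff[OF S(2) i_n w]] by blast
 have xc: "x \<in> Sp N 0" using x(1) isub_sub[OF rN i_n] by blast
 have "dd J i = dd I i" using dJ[OF i_n] ijk by simp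
 hence "(tt N ^^ dd I i) x = 0v (vdim N 0)" using tt_low[OF n J, of x "dd I i"] x(1) isub_low[OF n J i_n] vN[OF n0] by simp
 hence "(tt E ^^ dd I i) (w - w') = 0v (vdim E 0)"
  using hom_tt_pow[OF S(1,2) n S(4) xc, of "dd I i"] x(2) lin0[OF hom_lin0[OF S(4) n0]] by simp
 thus ?thesis
  using linmap_diff[OF lT wc] by (intro vec_diff_zero[OF linD(1)[OF lT wc(1)] linD(1)[OF lT wc(2)]]) simp
qed

lemma inv_unique:
 assumes e: "E_exact n N E M f g" and "ext_inv (E, f, g) c" "ext_inv (E, f, g) c'"
 shows "c = c'"
proof -
 note S = seqD[OF E_exactD(4)[OF e]]
 obtain w w' where w: "w \<in> isub E i" "g 0 *v w = eb n I (dd I i - 1)" "(tt E ^^ dd I i) w = c *s (f 0 *v eb n J 0)"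
  and w': "w' \<in> isub E i" "g 0 *v w' = eb n I (dd I i - 1)" "(tt E ^^ dd I i) w' = c' *s (f 0 *v eb n J 0)"
  using assms(2,3) unfolding ext_inv_iff[OF exact_eseq[OF e]] by blast
 show ?thesis
  by (rule f_eb_inj[OF S(4) S(6)[OF n0]]) (use two_lifts[OF E_exactD(4)[OF e] mM w(1) w'(1)] w w' in auto)
qed

lemma inv_exists: "E_exact n N E M f g ==> \<exists>c. ext_inv (E, f, g) c"
 using normal_form by metis

text \<open>A morphism of extensions carries lifts of the generator to lifts of the generator.\<close>

lemma inv_push:
 assumes e: "E_exact n N E M f g" and e': "E_exact n N E' M f' g'" and m: "em n N E f g E' f' g' (\<lambda>x. l *s x) (\<lambda>x. x)"
  and c: "ext_inv (E, f, g) c"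
 shows "ext_inv (E', f', g') (l * c)"
proof -
 note S = seqD[OF E_exactD(4)[OF e]] and S' = seqD[OF E_exactD(4)[OF e']]
 obtain u where u: "rep_hom n E E' u" "!!x. x \<in> Sp N 0 ==> u 0 *v (f 0 *v x) = f' 0 *v (l *s x)"
  "!!w. w \<in> Sp E 0 ==> g' 0 *v (u 0 *v w) = g 0 *v w" using m unfolding em_def by blast
 obtain w where w: "w \<in> isub E i" "g 0 *v w = eb n I (dd I i - 1)" "(tt E ^^ dd I i) w = c *s (f 0 *v eb n J 0)"
  using c unfolding ext_inv_iff[OF exact_eseq[OF e]] by blast
 have wc: "w \<in> Sp E 0" using w isub_sub[OF S(2) i_n] by auto
 have eJ: "eb n J 0 \<in> Sp N 0" using eb_carrier[OF n J] vN[OF n0] by simp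
 have "(tt E' ^^ dd I i) (u 0 *v w) = u 0 *v (c *s (f 0 *v eb n J 0))"
  using hom_tt_pow[OF S(2) S'(2) n u(1) wc, of "dd I i"] w(3) by simp
 also have "\<dots> = c *s (f' 0 *v (l *s eb n J 0))"
  using linD(3)[OF hom_lin0[OF u(1) n0] hom_vec[OF S(4) n0 eJ], of c] u(2)[OF eJ] by simp
 also have "\<dots> = (l * c) *s (f' 0 *v eb n J 0)"
  using linD(3)[OF hom_lin0[OF S'(4) n0] eJ, of l] by (simp add: smult_smult_assoc mult.commute)
 finally show ?thesis
  unfolding ext_inv_iff[OF exact_eseq[OF e']]
  using isub_hom[OF S(2) S'(2) u(1) i_n w(1)] u(3)[OF wc] w(2) by (intro bexI[of _ "u 0 *v w"]) auto
qed

text \<open>With \<open>c = 0\<close> the section of the normal form respects the flags.\<close>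

lemma inv_zero_section:
 assumes e: "E_exact n N E M f g" and c: "ext_inv (E, f, g) 0"
 obtains u where "rep_hom n M E u" "mor_eq n (g oR u) (mor_id M)"
proof -
 note S = seqD[OF E_exactD(4)[OF e]] and mE = F_Delta_mono[OF E_exactD(2)[OF e]]
 obtain c' s \<sigma> where nf: "ext_inv (E, f, g) c'" "linmap m (vdim E 0) s"
  "!!x. x \<in> cvec m ==> g 0 *v s x = x" "!!x. x \<in> cvec m ==> s (tt M x) = tt E (s x)"
  "!!v. v < n ==> linmap (vdim M v) (vdim E v) (\<sigma> v)"
  "!!v x. v < n ==> x \<in> Sp M v ==>
   inc E v (\<sigma> v x) = s (inc M v x) + (chi v * c') *s (f 0 *v Sh n I J (inc M v x))"
  using normal_form[OF e] by blast
 have c0: "c' = 0" by (rule inv_unique[OF e nf(1) c])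
 have im: "\<exists>y\<in>Sp E v. inc E v y = s (inc M v x)" if v: "v < n" and x: "x \<in> Sp M v" for v x
 proof -
  have ix: "inc M v x \<in> cvec m" using linD(1)[OF lin_inc[OF rM v] x] vM[OF n0] by simp
  have "f 0 *v Sh n I J (inc M v x) \<in> Sp E 0"
   using hom_vec[OF S(4) n0] linD(1)[OF Sh_linmap[OF n I J] ix] vN[OF n0] by simp
  hence "inc E v (\<sigma> v x) = s (inc M v x)" using nf(6)[OF v x] linD(1)[OF nf(2) ix] c0 zero_smult_vec by simp
  thus ?thesis using linD(1)[OF nf(5)[OF v] x] by blast
 qed
 obtain u where u: "rep_hom n M E u" "!!x. x \<in> Sp M 0 ==> u 0 *v x = s x"
  using hom_extend[OF rM S(2) mE n nf(2)[folded vM[OF n0]] nf(4)[folded vM[OF n0]] im] by blast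
 have "mor_eq n (g oR u) (mor_id M)"
 proof (rule hom_eqI0[OF rM rM mM hom_comp[OF rM S(2) rM u(1) S(5)] rep_hom_id[OF rM]])
  fix x :: "complex vec" assume x: "x \<in> Sp M 0"
  show "(g oR u) 0 *v x = mor_id M 0 *v x"
   using comp_vec[OF u(1) S(5) n0 x] u(2)[OF x] nf(3)[of x] x vM[OF n0] mor_id_vec[OF x] by simp
 qed
 thus ?thesis using that u(1) by blast
qed

lemma section_inv_zero:
 assumes e: "E_exact n N E M f g" and u: "rep_hom n M E u" "mor_eq n (g oR u) (mor_id M)"
 shows "ext_inv (E, f, g) 0"
proof -
 note S = seqD[OF E_exactD(4)[OF e]]
 let ?t = "eb n I (dd I i - 1)"
 have t: "?t \<in> Sp M 0" using eb_carrier[OF n I] vM[OF n0] by simp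
 have tM: "?t \<in> isub M i" using topM_carrier inc_topM by (auto intro: isubI)
 have "(tt M ^^ dd I i) ?t = 0v (vdim M 0)"
  using tt_low[OF n I, of ?t "dd I i"] eb_low[OF n I, of "dd I i - 1" "dd I i"] d_pos d_le[of i] vM[OF n0] by simp
 hence "(tt E ^^ dd I i) (u 0 *v ?t) = 0v (vdim E 0)"
  using hom_tt_pow[OF rM S(2) n u(1) t, of "dd I i"] lin0[OF hom_lin0[OF u(1) n0]] by simp
 moreover have "0 *s (f 0 *v eb n J 0) = 0v (vdim E 0)"
  using hom_vec[OF S(4) n0, of "eb n J 0"] eb_carrier[OF n J, of 0] vN[OF n0] zero_smult_vec by simp
 moreover have "g 0 *v (u 0 *v ?t) = ?t"
  using comp_vec[OF u(1) S(5) n0 t] eq_vec[OF u(2) n0, of ?t] mor_id_vec[OF t] by simp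
 ultimately show ?thesis
  unfolding ext_inv_iff[OF exact_eseq[OF e]] using isub_hom[OF rM S(2) u(1) i_n tM] by (intro bexI[of _ "u 0 *v ?t"]) auto
qed

text \<open>In coordinates \<open>Sh\<close> is the shift.\<close>

lemma Sh_PP:
 assumes u: "u \<in> cvec m"
 shows "Sh n I J (PP n I 0 *v u) = PP n J 0 *v vec (Suc m) (case_nat 0 (\<lambda>a. u $ a))"
proof -
 have "mat (dd J 0) m (\<lambda>(a, b). if a = Suc b then 1 else 0) *v u = vec (Suc m) (case_nat 0 (\<lambda>a. u $ a))"
 proof (rule eq_vecI)
  fix a assume "a < dim_vec (vec (Suc m) (case_nat 0 (\<lambda>a. u $ a)))"
  hence a: "a < Suc m" by simp
  have "(mat (dd J 0) m (\<lambda>(a, b). if a = Suc b then 1 else 0) *v u) $ a = (\<Sum>b<m. (if a = Suc b then 1 else 0) * u $ b)"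
   using a u by (simp add: dJ0 scalar_prod_def lessThan_atLeast0)
  also have "\<dots> = case_nat 0 (\<lambda>a. u $ a) a" using a by (cases a) (auto simp: if_distrib[of "\<lambda>x. x * _"] cong: if_cong)
  finally show "(mat (dd J 0) m (\<lambda>(a, b). if a = Suc b then 1 else 0) *v u) $ a = vec (Suc m) (case_nat 0 (\<lambda>a. u $ a)) $ a"
   using a by simp
 qed (simp add: dJ0)
 thus ?thesis unfolding Sh_def QQ_PP[OF n I n0 u] by simp
qed

lemma tt_PP: "K \<subseteq> {1..n} ==> u \<in> cvec (dd K 0) ==> tt (M_mod n K) (PP n K 0 *v u) = PP n K 0 *v tt (Nmod K) u"
 using hom_tt[OF Nmod_rep[OF n] M_rep[OF n] n iso_hom[OF PP_iso[OF n]]] by simp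

lemma tt_pred_low: assumes K: "K \<subseteq> {1..n}" and x: "x \<in> low n K q" shows "tt (M_mod n K) x \<in> low n K (q - 1)"
proof -
 obtain u where u: "u \<in> cvec (dd K 0)" "\<forall>r<dd K 0. q \<le> r --> u $ r = 0" "x = PP n K 0 *v u"
  using x unfolding low_def by blast
 have "\<forall>r<dd K 0. q - 1 \<le> r --> tt (Nmod K) u $ r = 0" using Nmod_tt[OF n K u(1)] u(2) by auto
 thus ?thesis
  unfolding low_def u(3) tt_PP[OF K u(1)] using Nmod_tt_carrier[OF n K u(1), of 1] by auto
qed

lemma Sh_low: assumes x: "x \<in> low n I q" shows "Sh n I J x \<in> low n J (Suc q)"
proof -
 obtain u where u: "u \<in> cvec m" "\<forall>r<m. q \<le> r --> u $ r = 0" "x = PP n I 0 *v u"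
  using x unfolding low_def by blast
 have "\<forall>r<dd J 0. Suc q \<le> r --> vec (Suc m) (case_nat 0 (\<lambda>a. u $ a)) $ r = 0"
  using u(2) by (auto simp: dJ0 split: nat.split)
 thus ?thesis unfolding low_def u(3) Sh_PP[OF u(1)] by (auto simp: dJ0 intro!: exI[of _ "vec (Suc m) (case_nat 0 (\<lambda>a. u $ a))"])
qed

lemma Sh_tt: assumes x: "x \<in> low n I q" shows "tt N (Sh n I J x) - Sh n I J (tt M x) \<in> low n J 1"
proof -
 obtain u where u: "u \<in> cvec m" "x = PP n I 0 *v u" using x unfolding low_def by blast
 let ?s = "\<lambda>u. vec (Suc m) (case_nat 0 (\<lambda>a. u $ a)) :: complex vec"
 note tu = Nmod_tt_carrier[OF n I u(1), of 1, simplified]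
 have s: "?s u \<in> cvec (dd J 0)" "?s (tt (Nmod I) u) \<in> cvec (dd J 0)" by (auto simp: dJ0)
 note ts = Nmod_tt_carrier[OF n J s(1), of 1, simplified]
 have "tt N (Sh n I J x) - Sh n I J (tt M x) = PP n J 0 *v (tt (Nmod J) (?s u) - ?s (tt (Nmod I) u))"
  unfolding u(2) tt_PP[OF I u(1)] Sh_PP[OF u(1)] Sh_PP[OF tu] tt_PP[OF J s(1)]
  using linmap_diff[OF linmap_mat[OF PP_carrier[OF n J n0]] ts s(2)] by simp
 moreover have "(tt (Nmod J) (?s u) - ?s (tt (Nmod I) u)) $ r = 0" if "r < dd J 0" "1 \<le> r" for r
  using that Nmod_tt[OF n J s(1) that(1)] Nmod_tt[OF n I u(1), of "r - 1"] by (cases r) (auto simp: dJ0)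
 ultimately show ?thesis unfolding low_def using ts s(2) minus_carrier_vec by blast
qed

text \<open>
 The cocycle of the generator of the extension group: its potential is \<open>Sh\<close> at the vertices from \<open>i\<close> to
 \<open>j - 1\<close> and zero at the others. The conditions on its coboundary have content only where \<open>chi\<close> jumps
 and, between these vertices, because of the commutator of \<open>Sh\<close> and \<open>t\<close>.
\<close>

lemma coc_exists:
 obtains al bt where "cocycle n N M al bt"
  "!!w. w \<in> Sp M 0 ==>
   amap N (Suc 0) *v (bt (Suc 0) *v w) + al (Suc 0) *v (bmap M (Suc 0) *v w) = 0v (vdim N 0)"
  "!!v x y. v < n ==> x \<in> Sp N v ==> y \<in> Sp M v ==>
   inc (cext N M al bt) v (x @v y) = (inc N v x + chi v *s Sh n I J (inc M v y)) @v inc M v y"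
proof (rule cocycle_of_potential[OF n rN mN rM, of "\<lambda>v y. chi v *s Sh n I J (inc M v y)"])
 have low: "inc M v y \<in> low n I (dd I v)" if "v < n" "y \<in> Sp M v" for v y
  using isub_low[OF n I that(1)] isubI[OF that(2) refl] by simp
 have car: "Sh n I J x \<in> Sp N 0" if "x \<in> low n I q" for x q
  using Sh_low[OF that] low_sub[OF n J] vN[OF n0] by auto
 have lSh: "linmap (vdim M 0) (vdim N 0) (Sh n I J)" using Sh_linmap[OF n I J] vM[OF n0] vN[OF n0] by simp
 have chi0: "chi v *s x = 0v (vdim N 0)" if "\<not> (i \<le> v \<and> v < j)" "x \<in> Sp N 0" for v x
  using that(1) zero_smult_vec[OF that(2)] by (auto simp: chi_def)
 have chi1: "chi v *s x = x" if "i \<le> v" "v < j" for v x using that by (simp add: chi_def)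
 have zero: "0v (vdim N 0) - 0v (vdim N 0) \<in> isub N v" if "v < n" for v
  using lin0[OF lin_inc[OF rN that]] by (intro isubI[of "0v (vdim N v)"]) auto
 have neg: "0v (vdim N 0) - x \<in> isub N v" if "v < n" "x \<in> isub N v" for v x
 proof -
  have "0v (vdim N 0) - x = (-1) *s x" using isub_sub[OF rN that(1)] that(2) by (intro eq_vecI) auto
  thus ?thesis using isub_smult[OF rN that] by simp
 qed
 have pos: "x - 0v (vdim N 0) \<in> isub N v" if "v < n" "x \<in> isub N v" for v x
 proof -
  have "x - 0v (vdim N 0) = x" using isub_sub[OF rN that(1)] that(2) by (intro eq_vecI) auto
  thus ?thesis using that by simp
 qed
 have inN: "x \<in> isub N v" if "v < n" "x \<in> low n J q" "q \<le> dd J v" for v x q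
  using that low_mono[of q "dd J v"] isub_low[OF n J that(1)] by auto
 have dI: "dd I (Suc v) \<le> dd I v" "dd I v \<le> Suc (dd I (Suc v))" and dJ': "dd J (Suc v) \<le> dd J v" "dd J v \<le> Suc (dd J (Suc v))" for v
  using dd_Suc_le[OF fI, of v] dd_le_Suc[OF fI, of v] dd_Suc_le[of J v] dd_le_Suc[of J v] J finite_subset by blast+
 have jd: "Suc (dd I j) \<le> dd I (j - 1)"
 proof -
  have "j - 1 < n" "j < n" "i \<le> j - 1" "j - 1 < j" using ijk by auto
  thus ?thesis using dJ'(1)[of "j - 1"] dJ[of "j - 1"] dJ[of j] ijk by simp
 qed
 have jp: "0 < dd I v" if "v < j" for v
 proof -
  have "v \<le> j - 1" using that by simp
  from dd_antimono[OF fI this] show ?thesis using jd by simp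
 qed
 fix v
 show "linmap (vdim M v) (vdim N 0) (\<lambda>y. chi v *s Sh n I J (inc M v y))" if "v < n"
  by (rule linmap_smult[OF lin_comp[OF lin_inc[OF rM that] lSh]])
 fix y :: "complex vec"
 show "chi 0 *s Sh n I J (inc M 0 y) = 0v (vdim N 0)" if "y \<in> Sp M 0"
  by (rule chi0[OF _ car[OF low[OF n0 that]]]) (use ijk in simp)
 show "tt N (chi v *s Sh n I J (inc M v y)) = 0v (vdim N 0)" if "n = Suc v" "y \<in> Sp M v"
  using chi0[of v, OF _ car[OF low[OF _ that(2)]]] that(1) ijk lin0[OF lin_tt[OF rN n]] by simp
 show "chi (Suc v) *s Sh n I J (inc M (Suc v) y) - chi v *s Sh n I J (inc M v (amap M (Suc v) *v y)) \<in> isub N v"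
  if v: "Suc v < n" and y: "y \<in> Sp M (Suc v)"
 proof -
  let ?x = "Sh n I J (inc M (Suc v) y)"
  have v': "v < n" using v by simp
  note xl = Sh_low[OF low[OF v y]] and xc = car[OF low[OF v y]]
  have xN: "?x \<in> isub N v" if "Suc (dd I (Suc v)) \<le> dd J v" by (rule inN[OF v' xl that])
  consider "Suc v = i" | "Suc v = j" | "i \<le> v" "Suc v < j" | "Suc v < i" | "j < Suc v" by linarith
  hence "chi (Suc v) *s ?x - chi v *s ?x \<in> isub N v"
  proof cases
   case 1
   have "?x \<in> isub N v" by (rule xN) (use dJ[OF v'] 1 ijk dI(1)[of v] in auto)
   thus ?thesis using pos[OF v'] chi1[of "Suc v" ?x] chi0[of v, OF _ xc] 1 ijk by simp
  next
   case 2
   have "?x \<in> isub N v" by (rule xN) (use dJ[OF v'] 2 ijk jd in auto)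
   thus ?thesis using neg[OF v'] chi1[of v ?x] chi0[of "Suc v", OF _ xc] 2 ijk by simp
  next
   case 3
   have "?x - ?x = 0v (vdim N 0) - 0v (vdim N 0)" using xc by (intro eq_vecI) auto
   thus ?thesis using zero[OF v'] chi1[of v ?x] chi1[of "Suc v" ?x] 3 by simp
  qed (use zero[OF v'] chi0[of v, OF _ xc] chi0[of "Suc v", OF _ xc] in auto)
  thus ?thesis by simp
 qed
 show "tt N (chi v *s Sh n I J (inc M v y)) - chi (Suc v) *s Sh n I J (inc M (Suc v) (bmap M (Suc v) *v y)) \<in> isub N (Suc v)"
  if v: "Suc v < n" and y: "y \<in> Sp M v"
 proof -
  let ?x = "inc M v y"
  have v': "v < n" using v by simp
  note xl = low[OF v' y]
  note Sx = Sh_low[OF xl] and Sxc = car[OF xl] and tl = tt_pred_low[OF I xl]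
  note Stx = Sh_low[OF tl] and Stxc = car[OF tl]
  note tS = tt_pred_low[OF J Sx, simplified]
  have t0: "tt N (0v (vdim N 0)) = 0v (vdim N 0)" by (rule lin0[OF lin_tt[OF rN n]])
  consider "Suc v = i" | "Suc v = j" | "i \<le> v" "Suc v < j" | "Suc v < i" | "j < Suc v" by linarith
  hence "tt N (chi v *s Sh n I J ?x) - chi (Suc v) *s Sh n I J (tt M ?x) \<in> isub N (Suc v)"
  proof cases
   case 1
   have "Sh n I J (tt M ?x) \<in> isub N (Suc v)"
    by (rule inN[OF v Stx]) (use dJ[OF v'] dJ[OF v] 1 ijk dJ'(2)[of v] d_pos in auto)
   thus ?thesis using neg[OF v] chi1[of "Suc v"] chi0[of v, OF _ Sxc] t0 1 ijk by simp
  next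
   case 2
   have "tt N (Sh n I J ?x) \<in> isub N (Suc v)" by (rule inN[OF v tS]) (use dJ[OF v] 2 ijk dI(2)[of v] in auto)
   thus ?thesis using pos[OF v] chi1[of v] chi0[of "Suc v", OF _ Stxc] 2 ijk by simp
  next
   case 3
   have "tt N (Sh n I J ?x) - Sh n I J (tt M ?x) \<in> isub N (Suc v)"
    by (rule inN[OF v Sh_tt[OF xl]]) (use dJ[OF v] jp[OF 3(2)] in simp)
   thus ?thesis using chi1[of v] chi1[of "Suc v"] 3 by simp
  qed (use zero[OF v] chi0[of v, OF _ Sxc] chi0[of "Suc v", OF _ Stxc] t0 in auto)
  thus ?thesis unfolding inc_b[OF rM v y] .
 qed
qed (rule that)

end

text \<open>
The extension with invariant 1, as a cocycle. Pulling it back along \<open>X \<rightarrow> M\<close> gives all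
the extensions needed, those by scalars for \<open>X = M\<close> and those comparing Baer sums for \<open>X = M
\<oplus> M\<close>.
\<close>

locale interlaced_cocycle = interlaced +
 fixes al bt :: "nat => complex mat"
 assumes coc: "cocycle n N M al bt"
  and coc0: "!!w. w \<in> Sp M 0 ==>
   amap N (Suc 0) *v (bt (Suc 0) *v w) + al (Suc 0) *v (bmap M (Suc 0) *v w) = 0v (vdim N 0)"
  and inc_coc: "!!v x y. v < n ==> x \<in> Sp N v ==> y \<in> Sp M v ==>
   inc (cext N M al bt) v (x @v y) = (inc N v x + chi v *s Sh n I J (inc M v y)) @v inc M v y"
begin

definition pbk :: "rep => rmor => rep" where "pbk X kk = cext N X (coc_a al kk) (coc_b bt kk)"

lemma vdim_pbk [simp]: "vdim (pbk X kk) v = vdim N v + vdim X v"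
 by (simp add: pbk_def)

lemma n1: "Suc 0 < n" using n by simp

context
 fixes X :: rep and kk :: rmor
 assumes X: "F_Delta n X" and kk: "rep_hom n X M kk"
begin

lemma rX: "is_rep n X" by (rule F_Delta_rep[OF X])
lemma pbk_coc: "cocycle n N X (coc_a al kk) (coc_b bt kk)" by (rule cocycle_comp[OF coc rX rM kk])

lemma pbk_rep: "is_rep n (pbk X kk)" unfolding pbk_def by (rule cext_rep[OF n rN rX pbk_coc])

lemma pbk_coc0:
 assumes w: "w \<in> Sp X 0"
 shows "amap N (Suc 0) *v (coc_b bt kk (Suc 0) *v w) + coc_a al kk (Suc 0) *v (bmap X (Suc 0) *v w) = 0v (vdim N 0)"
 unfolding coc_vec(2)[OF coc kk n1 w] coc_vec(1)[OF coc kk n1 rep_act(2)[OF rX n1 w]] rep_hom_b[OF rX rM kk n1 w]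
 by (rule coc0[OF hom_vec[OF kk n0 w]])

lemma pbk_exact: "E_exact n N (pbk X kk) X (in1 N X) (pr2 N X)"
 unfolding pbk_def by (rule cext_E_exact[OF n FN X pbk_coc pbk_coc0])

lemma pbk_inc:
 assumes v: "v < n" and x: "x \<in> Sp N v" and y: "y \<in> Sp X v"
 shows "inc (pbk X kk) v (x @v y) = (inc N v x + chi v *s Sh n I J (kk 0 *v inc X v y)) @v inc X v y"
proof -
 note u = cext_map_hom[OF n rN rX rM coc kk]
 note rC = cext_rep[OF n rN rM coc]
 have xy: "x @v y \<in> Sp (pbk X kk) v" using x y by simp
 have "inc (pbk X kk) v (x @v y) \<in> cvec (vdim N 0 + vdim X 0)" using linD(1)[OF lin_inc[OF pbk_rep v] xy] by simp
 then obtain a b where ab: "a \<in> Sp N 0" "b \<in> Sp X 0" "inc (pbk X kk) v (x @v y) = a @v b" by (rule vec_splitE)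
 have b: "b = inc X v y"
  using hom_inc[OF pbk_rep rX pr2_hom[OF n rN rX pbk_coc, folded pbk_def] v xy] pr2_vec[OF x y] pr2_vec[OF ab(1,2)] ab(3) by simp
 have ky: "kk v *v y \<in> Sp M v" by (rule hom_vec[OF kk v y])
 have "a @v (kk 0 *v b) = inc (cext N M al bt) v (x @v (kk v *v y))"
  using hom_inc[OF pbk_rep rC u(1)[folded pbk_def] v xy] u(2)[OF v x y] u(2)[OF n0 ab(1,2)] ab(3) by simp
 hence "a = inc N v x + chi v *s Sh n I J (inc M v (kk v *v y))"
  unfolding inc_coc[OF v x ky] using append_vec_eq[OF ab(1)] linD(1)[OF lin_inc[OF rN v] x]
   linD(1)[OF Sh_linmap[OF n I J]] linD(1)[OF lin_inc[OF rM v] ky] vM[OF n0] vN[OF n0]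
  by (metis add_carrier_vec smult_carrier_vec)
 thus ?thesis using ab(3) b hom_inc[OF rX rM kk v y] by simp
qed

lemma pbk_tt:
 assumes x: "x \<in> Sp N 0" and y: "y \<in> Sp X 0"
 shows "tt (pbk X kk) (x @v y) = tt N x @v tt X y"
proof -
 note bx = rep_act(2)[OF rN n1 x] and bey = rep_act(2)[OF rX n1 y]
 have bty: "coc_b bt kk (Suc 0) *v y \<in> Sp N (Suc 0)"
  and aly: "coc_a al kk (Suc 0) *v (bmap X (Suc 0) *v y) \<in> Sp N 0"
  using cocycle_carrier[OF pbk_coc n1] y bey by auto
 have "amap N (Suc 0) *v (bmap N (Suc 0) *v x + coc_b bt kk (Suc 0) *v y) + coc_a al kk (Suc 0) *v (bmap X (Suc 0) *v y)
  = tt N x + (amap N (Suc 0) *v (coc_b bt kk (Suc 0) *v y) + coc_a al kk (Suc 0) *v (bmap X (Suc 0) *v y))"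
  unfolding linD(2)[OF linmap_act(1)[OF rN n1] bx bty] tt_def
  by (rule assoc_add_vec[OF rep_act(1)[OF rN n1 bx] rep_act(1)[OF rN n1 bty] aly])
 also have "\<dots> = tt N x" unfolding pbk_coc0[OF y] using linD(1)[OF lin_tt[OF rN n] x] by simp
 finally show ?thesis
  unfolding pbk_def tt_def cext_b[OF rN rX pbk_coc n1 x y] cext_a[OF rN rX pbk_coc n1 add_carrier_vec[OF bx bty] bey] by simp
qed

end

text \<open>
The morphism is built at vertex 0 from the section \<open>s\<close> of the normal form. Since both flags are
sheared by multiples of \<open>Sh\<close>, it respects them as soon as the scalars match.
\<close>

lemma pbk_to_ext:
 assumes X: "F_Delta n X" and kk: "rep_hom n X M kk" and h: "rep_hom n X M h"
  and e: "E_exact n N E M f g" and c: "ext_inv (E, f, g) c'"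
  and match: "!!x. x \<in> Sp X 0 ==> l *s (kk 0 *v x) = c' *s (h 0 *v x)"
 shows "em n N (pbk X kk) (in1 N X) (pr2 N X) E f g (\<lambda>x. l *s x) (\<lambda>x. h 0 *v x)"
proof -
 note S = seqD[OF E_exactD(4)[OF e]] and mE = F_Delta_mono[OF E_exactD(2)[OF e]] and rX = F_Delta_rep[OF X]
 obtain c s \<sigma> where nf: "ext_inv (E, f, g) c" "linmap m (vdim E 0) s"
  "!!x. x \<in> cvec m ==> g 0 *v s x = x" "!!x. x \<in> cvec m ==> s (tt M x) = tt E (s x)"
  "!!v. v < n ==> linmap (vdim M v) (vdim E v) (\<sigma> v)"
  "!!v x. v < n ==> x \<in> Sp M v ==>
   inc E v (\<sigma> v x) = s (inc M v x) + (chi v * c) *s (f 0 *v Sh n I J (inc M v x))"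
  using normal_form[OF e] by blast
 have cc: "c = c'" by (rule inv_unique[OF e nf(1) c])
 note lf = hom_lin0[OF S(4) n0] and lk = hom_lin0[OF kk n0] and lh = hom_lin0[OF h n0]
 note lg = hom_lin0[OF S(5) n0]
 note lSh = Sh_linmap[OF n I J]
 have ls: "linmap (vdim M 0) (vdim E 0) s" using nf(2) vM[OF n0] by simp
 define F where "F w = l *s (f 0 *v vec_first w (vdim N 0)) + s (h 0 *v vec_last w (vdim X 0))" for w
 have Fv: "F (x @v y) = l *s (f 0 *v x) + s (h 0 *v y)" if "x \<in> Sp N 0" "y \<in> Sp X 0" for x y
  using that by (simp add: F_def)
 have lF: "linmap (vdim (pbk X kk) 0) (vdim E 0) F"
  unfolding F_def vdim_pbk
  by (rule linmap_add[OF linmap_smult[OF lin_comp[OF linmap_first lf]] lin_comp[OF lin_comp[OF linmap_last lh] ls]])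
 have spl: "\<exists>x y. x \<in> Sp N v \<and> y \<in> Sp X v \<and> w = x @v y" if w: "w \<in> Sp (pbk X kk) v" for w :: "complex vec" and v
  using vec_splitE[OF w[unfolded vdim_pbk]] by blast
 have Ft: "F (tt (pbk X kk) w) = tt E (F w)" if w: "w \<in> Sp (pbk X kk) 0" for w :: "complex vec"
 proof -
  obtain x y where xy: "x \<in> Sp N 0" "y \<in> Sp X 0" "w = x @v y" using spl[OF w] by blast
  note tx = linD(1)[OF lin_tt[OF rN n] xy(1)] and ty = linD(1)[OF lin_tt[OF rX n] xy(2)]
  note hy = hom_vec[OF h n0 xy(2)] and fx = hom_vec[OF S(4) n0 xy(1)]
  have shy: "s (h 0 *v y) \<in> Sp E 0" by (rule linD(1)[OF ls hy])
  have "s (h 0 *v tt X y) = tt E (s (h 0 *v y))"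
   using hom_tt[OF rX rM n h xy(2)] nf(4)[of "h 0 *v y"] hy vM[OF n0] by simp
  thus ?thesis
   unfolding xy(3) pbk_tt[OF X kk xy(1,2)] Fv[OF tx ty] Fv[OF xy(1,2)]
   using hom_tt[OF rN S(2) n S(4) xy(1)] linD(2)[OF lin_tt[OF S(2) n], of "l *s (f 0 *v x)" "s (h 0 *v y)"]
    linD(3)[OF lin_tt[OF S(2) n] fx, of l] fx shy by simp
 qed
 have im: "\<exists>z\<in>Sp E v. inc E v z = F (inc (pbk X kk) v w)" if v: "v < n" and w: "w \<in> Sp (pbk X kk) v" for v and w :: "complex vec"
 proof -
  obtain x y where xy: "x \<in> Sp N v" "y \<in> Sp X v" "w = x @v y" using spl[OF w] by blast
  note ix = linD(1)[OF lin_inc[OF rN v] xy(1)] and iy = linD(1)[OF lin_inc[OF rX v] xy(2)]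
  note fx = hom_vec[OF S(4) v xy(1)] and hy = hom_vec[OF h v xy(2)]
  note \<sigma>y = linD(1)[OF nf(5)[OF v] hy]
  note ki = hom_vec[OF kk n0 iy] and hi = hom_vec[OF h n0 iy]
  have kS: "Sh n I J (kk 0 *v inc X v y) \<in> Sp N 0" and hS: "Sh n I J (h 0 *v inc X v y) \<in> Sp N 0"
   using linD(1)[OF lSh] ki hi vM[OF n0] vN[OF n0] by auto
  have m1: "l *s Sh n I J (kk 0 *v inc X v y) = c' *s Sh n I J (h 0 *v inc X v y)"
   using match[OF iy] linD(3)[OF lSh, of "kk 0 *v inc X v y" l] linD(3)[OF lSh, of "h 0 *v inc X v y" c'] ki hi vM[OF n0] by simp
  have m2: "l *s (f 0 *v (chi v *s Sh n I J (kk 0 *v inc X v y))) = (chi v * c') *s (f 0 *v Sh n I J (h 0 *v inc X v y))"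
  proof -
   have "l *s (f 0 *v (chi v *s Sh n I J (kk 0 *v inc X v y))) = chi v *s (f 0 *v (l *s Sh n I J (kk 0 *v inc X v y)))"
    unfolding linD(3)[OF lf kS] smult_smult_assoc by (simp add: ac_simps)
   also have "\<dots> = (chi v * c') *s (f 0 *v Sh n I J (h 0 *v inc X v y))"
    unfolding m1 linD(3)[OF lf hS] smult_smult_assoc ..
   finally show ?thesis .
  qed
  have fx0: "f 0 *v inc N v x \<in> Sp E 0" by (rule hom_vec[OF S(4) n0 ix])
  have fhS: "f 0 *v Sh n I J (h 0 *v inc X v y) \<in> Sp E 0" by (rule hom_vec[OF S(4) n0 hS])
  have shi: "s (h 0 *v inc X v y) \<in> Sp E 0" by (rule linD(1)[OF ls hi])
  have Sc: "chi v *s Sh n I J (kk 0 *v inc X v y) \<in> Sp N 0" using kS by simp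
  have "F (inc (pbk X kk) v w) = l *s (f 0 *v inc N v x) + (chi v * c') *s (f 0 *v Sh n I J (h 0 *v inc X v y)) + s (h 0 *v inc X v y)"
   unfolding xy(3) pbk_inc[OF X kk v xy(1,2)] Fv[OF add_carrier_vec[OF ix Sc] iy] linD(2)[OF lf ix Sc] m2[symmetric]
   using smult_add_distrib_vec[OF fx0 hom_vec[OF S(4) n0 Sc], of l] by simp
  also have "\<dots> = l *s (f 0 *v inc N v x) + (s (h 0 *v inc X v y) + (chi v * c') *s (f 0 *v Sh n I J (h 0 *v inc X v y)))"
   using fx0 fhS shi by (simp add: assoc_add_vec[of _ "vdim E 0"] comm_add_vec[of "s (h 0 *v inc X v y)" "vdim E 0"])
  also have "\<dots> = inc E v (l *s (f v *v x) + \<sigma> v (h v *v y))"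
   using linD(2)[OF lin_inc[OF S(2) v] _ \<sigma>y, of "l *s (f v *v x)"] linD(3)[OF lin_inc[OF S(2) v] fx, of l]
    hom_inc[OF rN S(2,4) v xy(1)] nf(6)[OF v hy] hom_inc[OF rX rM h v xy(2)] cc fx by simp
  finally show ?thesis using fx \<sigma>y by (intro bexI[of _ "l *s (f v *v x) + \<sigma> v (h v *v y)"]) auto
 qed
 obtain u where u: "rep_hom n (pbk X kk) E u" "!!w. w \<in> Sp (pbk X kk) 0 ==> u 0 *v w = F w"
  using hom_extend[OF pbk_rep[OF X kk] S(2) mE n lF Ft im] by blast
 show ?thesis
  unfolding em_def
 proof (intro exI[of _ u] conjI ballI u(1))
  fix w :: "complex vec"
  show "u 0 *v (in1 N X 0 *v w) = f 0 *v (l *s w)" if w: "w \<in> Sp N 0"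
  proof -
   have "u 0 *v (in1 N X 0 *v w) = F (w @v 0v (vdim X 0))" unfolding in1_vec[OF w] by (rule u(2)) (use w in simp)
   thus ?thesis
    using Fv[OF w zero_carrier_vec] lin0[OF lh] lin0[OF ls] linD(3)[OF lf w, of l] hom_vec[OF S(4) n0 w] by simp
  qed
  show "g 0 *v (u 0 *v w) = h 0 *v (pr2 N X 0 *v w)" if w: "w \<in> Sp (pbk X kk) 0"
  proof -
   obtain x y where xy: "x \<in> Sp N 0" "y \<in> Sp X 0" "w = x @v y" using spl[OF w] by blast
   note fx = hom_vec[OF S(4) n0 xy(1)] and hy = hom_vec[OF h n0 xy(2)]
   have "g 0 *v (l *s (f 0 *v x) + s (h 0 *v y)) = h 0 *v y"
    using linD(2)[OF lg _ linD(1)[OF ls hy], of "l *s (f 0 *v x)"] linD(3)[OF lg fx, of l] S(7)[OF n0 xy(1)]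
     nf(3)[of "h 0 *v y"] hy fx vM[OF n0] by simp
   thus ?thesis unfolding u(2)[OF w] unfolding xy(3) Fv[OF xy(1,2)] pr2_vec[OF xy(1,2)] .
  qed
 qed
qed

end



context interlaced_cocycle
begin

lemma pbk_mono: "F_Delta n X ==> rep_hom n X M kk ==> a_mono n (pbk X kk)"
 by (rule F_Delta_mono[OF E_exactD(2)[OF pbk_exact]])

lemma pbk_tt_pow:
 assumes X: "F_Delta n X" and kk: "rep_hom n X M kk" and x: "x \<in> Sp N 0" and y: "y \<in> Sp X 0"
 shows "(tt (pbk X kk) ^^ q) (x @v y) = (tt N ^^ q) x @v (tt X ^^ q) y"
proof (induction q)
 case (Suc q)
 show ?case
  using Suc pbk_tt[OF X kk linD(1)[OF linmap_funpow[OF lin_tt[OF rN n]] x] linD(1)[OF linmap_funpow[OF lin_tt[OF F_Delta_rep[OF X] n]] y]] by simp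
qed simp

lemma pbk_map:
 assumes X: "F_Delta n X" and kk: "rep_hom n X M kk" and X': "F_Delta n X'" and kk': "rep_hom n X' M kk'"
  and h: "rep_hom n X X' h" and fac: "!!x. x \<in> Sp X 0 ==> kk' 0 *v (h 0 *v x) = kk 0 *v x"
 obtains u where "rep_hom n (pbk X kk) (pbk X' kk') u"
  "!!x y. x \<in> Sp N 0 ==> y \<in> Sp X 0 ==> u 0 *v (x @v y) = x @v (h 0 *v y)"
proof -
 note rX = F_Delta_rep[OF X] and rX' = F_Delta_rep[OF X']
 define F where "F w = vec_first w (vdim N 0) @v (h 0 *v vec_last w (vdim X 0))" for w
 have Fv: "F (x @v y) = x @v (h 0 *v y)" if "x \<in> Sp N 0" "y \<in> Sp X 0" for x y
  using that by (simp add: F_def)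
 have lF: "linmap (vdim (pbk X kk) 0) (vdim (pbk X' kk') 0) F"
  unfolding F_def vdim_pbk by (rule linmap_append[OF linmap_first lin_comp[OF linmap_last hom_lin0[OF h n0]]])
 have Ft: "F (tt (pbk X kk) w) = tt (pbk X' kk') (F w)" if w: "w \<in> Sp (pbk X kk) 0" for w
 proof -
  obtain x y where xy: "x \<in> Sp N 0" "y \<in> Sp X 0" "w = x @v y"
   by (rule vec_splitE[OF w[unfolded vdim_pbk]])
  show ?thesis
   unfolding xy(3) pbk_tt[OF X kk xy(1,2)] Fv[OF xy(1,2)] pbk_tt[OF X' kk' xy(1) hom_vec[OF h n0 xy(2)]]
    Fv[OF linD(1)[OF lin_tt[OF rN n] xy(1)] linD(1)[OF lin_tt[OF rX n] xy(2)]] hom_tt[OF rX rX' n h xy(2)] ..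
 qed
 have im: "\<exists>z\<in>Sp (pbk X' kk') v. inc (pbk X' kk') v z = F (inc (pbk X kk) v w)"
  if v: "v < n" and w: "w \<in> Sp (pbk X kk) v" for v and w :: "complex vec"
 proof -
  obtain x y where xy: "x \<in> Sp N v" "y \<in> Sp X v" "w = x @v y"
   by (rule vec_splitE[OF w[unfolded vdim_pbk]])
  note ix = linD(1)[OF lin_inc[OF rN v] xy(1)] and iy = linD(1)[OF lin_inc[OF rX v] xy(2)]
  note hy = hom_vec[OF h v xy(2)]
  have S: "chi v *s Sh n I J (kk 0 *v inc X v y) \<in> Sp N 0"
   using linD(1)[OF Sh_linmap[OF n I J], of "kk 0 *v inc X v y"] hom_vec[OF kk n0 iy] vM[OF n0] vN[OF n0] by simp
  have "inc (pbk X' kk') v (x @v (h v *v y)) = F (inc (pbk X kk) v w)"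
   unfolding xy(3) pbk_inc[OF X kk v xy(1,2)] Fv[OF add_carrier_vec[OF ix S] iy] pbk_inc[OF X' kk' v xy(1) hy]
    hom_inc[OF rX rX' h v xy(2)] fac[OF iy] ..
  thus ?thesis using xy(1) hy by (intro bexI[of _ "x @v (h v *v y)"]) auto
 qed
 show ?thesis
  using hom_extend[OF pbk_rep[OF X kk] pbk_rep[OF X' kk'] pbk_mono[OF X' kk'] n lF Ft im] that Fv
  by (metis append_carrier_vec vdim_pbk)
qed

text \<open>
Multiplication by \<open>c\<close>; the pullback \<open>pb c\<close> along it represents the class with
invariant \<open>c\<close>.
\<close>

definition sc :: "complex => rmor" where "sc c = mor_smult c (mor_id M)"
definition pb :: "complex => rep" where "pb c = pbk M (sc c)"

lemma sc_hom: "rep_hom n M M (sc c)"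
 unfolding sc_def by (rule rep_hom_smult[OF rM rM rep_hom_id[OF rM]])

lemma sc_vec: "x \<in> Sp M v ==> sc c v *v x = c *s x"
 unfolding sc_def by (rule mor_smult_id_vec)

lemma pb_exact: "E_exact n N (pb c) M (in1 N M) (pr2 N M)"
 unfolding pb_def by (rule pbk_exact[OF FM sc_hom])

lemma pb_inv: "ext_inv (pb c, in1 N M, pr2 N M) c"
proof -
 let ?t = "eb n I (dd I i - 1)" and ?e = "eb n J (dd I i)"
 have t: "?t \<in> Sp M 0" and e: "?e \<in> Sp N 0" and e0: "eb n J 0 \<in> Sp N 0"
  using eb_carrier[OF n I] eb_carrier[OF n J] vM[OF n0] vN[OF n0] by auto
 have ce: "c *s ?e \<in> Sp N 0" using e by simp
 note lSh = Sh_linmap[OF n I J]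
 have d: "dd I i < dd J 0" "dd I i - 1 < m" "Suc (dd I i - 1) = dd I i" "\<not> dd I i \<le> dd I i - 1" using d_pos d_le[of i] dJ0 by auto
 have "inc (pb c) i (0v (vdim N i) @v topM) = (c *s ?e) @v ?t"
  unfolding pb_def pbk_inc[OF FM sc_hom i_n zero_carrier_vec topM_carrier] inc_topM sc_vec[OF t]
  using linD(3)[OF lSh, of ?t c] Sh_eb[OF n I J d(2)] d t e vM[OF n0] ijk lin0[OF lin_inc[OF rN i_n]]
  by (simp add: chi_def smult_smult_assoc)
 hence 1: "(c *s ?e) @v ?t \<in> isub (pb c) i"
  using topM_carrier by (intro isubI[of "0v (vdim N i) @v topM"]) (auto simp: pb_def)
 have 2: "(tt (pb c) ^^ dd I i) ((c *s ?e) @v ?t) = c *s (in1 N M 0 *v eb n J 0)"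
  unfolding in1_vec[OF e0] append_smult pb_def pbk_tt_pow[OF FM sc_hom ce t]
  using linD(3)[OF linmap_funpow[OF lin_tt[OF rN n]] e, of "dd I i" c] eb_tt_pow[OF n J d(1), of "dd I i"]
   eb_tt_pow[OF n I d(2), of "dd I i", unfolded if_not_P[OF d(4)]] vM[OF n0] by simp
 show ?thesis
  unfolding ext_inv_iff[OF exact_eseq[OF pb_exact]]
  using 1 2 pr2_vec[OF ce t] by blast
qed

lemma pb_push:
 assumes e: "E_exact n N E M f g" and c: "ext_inv (E, f, g) (l * a)"
 shows "em n N (pb a) (in1 N M) (pr2 N M) E f g (\<lambda>x. l *s x) (\<lambda>x. mor_id M 0 *v x)"
 unfolding pb_def
 by (rule pbk_to_ext[OF FM sc_hom rep_hom_id[OF rM] e c])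
  (use sc_vec mor_id_vec in \<open>simp add: smult_smult_assoc\<close>)

lemma em_iff_inv:
 assumes e: "E_exact n N E M f g" and e': "E_exact n N E' M f' g'" and c: "ext_inv (E, f, g) c"
 shows "em n N E f g E' f' g' (\<lambda>x. x) (\<lambda>x. x) \<longleftrightarrow> ext_inv (E', f', g') c"
proof
 assume "em n N E f g E' f' g' (\<lambda>x. x) (\<lambda>x. x)"
 hence "em n N E f g E' f' g' (\<lambda>x. 1 *s x) (\<lambda>x. x)" by simp
 thus "ext_inv (E', f', g') c" using inv_push[OF e e' _ c] by fastforce
next
 assume c': "ext_inv (E', f', g') c"
 have p: "em n N (pb c) (in1 N M) (pr2 N M) G p q (\<lambda>x. x) (\<lambda>x. x)"
  if "E_exact n N G M p q" "ext_inv (G, p, q) c" for G p q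
  by (rule em_cong[OF pb_push[OF that(1), of 1 c] n0 seqD(5)[OF E_exactD(4)[OF pb_exact]]]) (use that mor_id_vec in auto)
 show "em n N E f g E' f' g' (\<lambda>x. x) (\<lambda>x. x)"
  by (rule em_trans[OF n exact_eseq[OF e] exact_eseq[OF pb_exact] exact_eseq[OF e'] em_sym[OF n pb_exact e p[OF e c]] p[OF e' c']])
qed

definition cls :: "complex => extn set" where "cls c = {\<xi> \<in> extns n M N. ext_inv \<xi> c}"

lemma cls_iff: "(E, f, g) \<in> cls c \<longleftrightarrow> E_exact n N E M f g \<and> ext_inv (E, f, g) c"
 by (simp add: cls_def extns_def)

lemma pb_cls: "(pb c, in1 N M, pr2 N M) \<in> cls c"
 using pb_exact pb_inv by (simp add: cls_iff)

lemma ext_mor_id: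
 assumes e: "E_exact n N E M f g" and e': "E_exact n N E' M f' g'"
 shows "ext_mor n (E, f, g) (E', f', g') (mor_id N) (mor_id M) \<longleftrightarrow> em n N E f g E' f' g' (\<lambda>x. x) (\<lambda>x. x)"
 unfolding ext_mor_em[OF n exact_eseq[OF e] exact_eseq[OF e'] rep_hom_id[OF rN] rep_hom_id[OF rM]]
 using em_cong[OF _ n0 seqD(5)[OF E_exactD(4)[OF e]]] mor_id_vec by smt

lemma ext_class:
 assumes e: "E_exact n N E M f g" and c: "ext_inv (E, f, g) c"
 shows "ext_rel n M N `` {(E, f, g)} = cls c"
 using e ext_mor_id[OF e] em_iff_inv[OF e _ c] unfolding ext_rel_def cls_def extns_def by auto

lemma carrier_ext1: "carrier (ext1 n M N) = range cls"
proof (intro equalityI subsetI)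
 fix A assume "A \<in> carrier (ext1 n M N)"
 then obtain \<xi> where x: "\<xi> \<in> extns n M N" "A = ext_rel n M N `` {\<xi>}" by (auto simp: ext1_def quotient_def)
 obtain E f g where E: "\<xi> = (E, f, g)" by (cases \<xi>)
 have e: "E_exact n N E M f g" using x(1) E by (simp add: extns_def)
 thus "A \<in> range cls" using inv_exists[OF e] ext_class[OF e] x(2) E by auto
next
 fix A assume "A \<in> range cls"
 then obtain c where "A = ext_rel n M N `` {(pb c, in1 N M, pr2 N M)}" using ext_class[OF pb_exact pb_inv] by auto
 moreover have "(pb c, in1 N M, pr2 N M) \<in> extns n M N" using pb_exact by (simp add: extns_def)
 ultimately show "A \<in> carrier (ext1 n M N)" by (auto simp: ext1_def quotient_def)
qed

lemma inj_cls: "inj cls"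
proof (rule injI)
 fix a b assume "cls a = cls b"
 hence "(pb a, in1 N M, pr2 N M) \<in> cls b" using pb_cls by blast
 thus "a = b" using inv_unique[OF pb_exact pb_inv] by (simp add: cls_iff)
qed

lemma split_cls: "split_extns n M N = cls 0"
proof (rule Set.set_eqI)
 fix \<xi> :: extn
 obtain E f g where E: "\<xi> = (E, f, g)" by (cases \<xi>)
 have "(\<exists>s. rep_hom n M E s \<and> mor_eq n (g oR s) (mor_id M)) \<longleftrightarrow> ext_inv (E, f, g) 0" if e: "E_exact n N E M f g"
 proof
  assume "\<exists>s. rep_hom n M E s \<and> mor_eq n (g oR s) (mor_id M)"
  thus "ext_inv (E, f, g) 0" using section_inv_zero[OF e] by blast
 next
  assume "ext_inv (E, f, g) 0"
  thus "\<exists>s. rep_hom n M E s \<and> mor_eq n (g oR s) (mor_id M)"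
   by (rule inv_zero_section[OF e]) blast
 qed
 thus "\<xi> \<in> split_extns n M N \<longleftrightarrow> \<xi> \<in> cls 0"
  unfolding E cls_iff split_extns_def extns_def by auto
qed

lemma smult_cls: "smult (ext1 n M N) c (cls a) = cls (c * a)"
proof (rule Set.set_eqI)
 fix \<xi> :: extn
 obtain E f g where E: "\<xi> = (E, f, g)" by (cases \<xi>)
 have em: "ext_mor n (E', f', g') (E, f, g) (mor_smult c (mor_id N)) (mor_id M) \<longleftrightarrow>
   em n N E' f' g' E f g (\<lambda>x. c *s x) (\<lambda>x. x)" if e: "E_exact n N E M f g" and e': "E_exact n N E' M f' g'" for E' f' g'
  unfolding ext_mor_em[OF n exact_eseq[OF e'] exact_eseq[OF e] rep_hom_smult[OF rN rN rep_hom_id[OF rN]] rep_hom_id[OF rM]]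
  using em_cong[OF _ n0 seqD(5)[OF E_exactD(4)[OF e']]] mor_id_vec mor_smult_id_vec by smt
 show "\<xi> \<in> smult (ext1 n M N) c (cls a) \<longleftrightarrow> \<xi> \<in> cls (c * a)"
 proof
  assume "\<xi> \<in> smult (ext1 n M N) c (cls a)"
  then obtain E' f' g' where 1: "E_exact n N E M f g" "E_exact n N E' M f' g'" "ext_inv (E', f', g') a"
   "ext_mor n (E', f', g') (E, f, g) (mor_smult c (mor_id N)) (mor_id M)"
   by (auto simp: ext1_def E extns_def cls_def)
  show "\<xi> \<in> cls (c * a)"
   unfolding E cls_iff using 1 inv_push[OF 1(2,1) _ 1(3)] em[OF 1(1,2)] by blast
 next
  assume "\<xi> \<in> cls (c * a)"
  hence 1: "E_exact n N E M f g" "ext_inv (E, f, g) (c * a)" by (auto simp: E cls_iff)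
  have "em n N (pb a) (in1 N M) (pr2 N M) E f g (\<lambda>x. c *s x) (\<lambda>x. x)"
   by (rule em_cong[OF pb_push[OF 1] n0 seqD(5)[OF E_exactD(4)[OF pb_exact]]]) (use mor_id_vec in auto)
  hence "ext_mor n (pb a, in1 N M, pr2 N M) (E, f, g) (mor_smult c (mor_id N)) (mor_id M)"
   using em[OF 1(1) pb_exact] by blast
  thus "\<xi> \<in> smult (ext1 n M N) c (cls a)"
   using 1 pb_cls[of a] by (auto simp: ext1_def E extns_def)
 qed
qed

text \<open>
In the middle term of the auxiliary extension \<open>\<zeta>\<close> of \<open>M \<oplus> M\<close> the lifts
coming from the direct sum and from \<open>\<xi>\<close> cover the same vector, so by \<open>two_lifts\<close>
their images under \<open>t^d\<close> agree. One is \<open>a + b\<close>, the other \<open>c\<close> times the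
socle generator.
\<close>

lemma baer_inv:
 assumes e1: "E_exact n N E1 M f1 g1" and c1: "ext_inv (E1, f1, g1) a"
  and e2: "E_exact n N E2 M f2 g2" and c2: "ext_inv (E2, f2, g2) b"
  and e: "E_exact n N E M f g" and c: "ext_inv (E, f, g) c"
  and baer: "baer_sum n M N (E1, f1, g1) (E2, f2, g2) (E, f, g)"
 shows "c = a + b"
proof -
 note S1 = seqD[OF E_exactD(4)[OF e1]] and S2 = seqD[OF E_exactD(4)[OF e2]] and S = seqD[OF E_exactD(4)[OF e]]
 let ?d = "dd I i" and ?t = "eb n I (dd I i - 1)" and ?e = "eb n J 0"
 obtain G p q where z: "E_exact n N G (M +R M) p q"
  "ext_mor n (E1 +R E2, mor_dsum f1 f2, mor_dsum g1 g2) (G, p, q) (mor_codiag N) (mor_id (M +R M))"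
  "ext_mor n (E, f, g) (G, p, q) (mor_id N) (mor_diag M)"
  using baer by (auto simp: baer_sum_def extn_dsum_def extns_def)
 note SG = seqD[OF E_exactD(4)[OF z(1)]]
 note rE = dsum_rep[OF n S1(2) S2(2)]
 obtain u where u: "rep_hom n (E1 +R E2) G u"
  "!!x. x \<in> Sp (N +R N) 0 ==> u 0 *v (mor_dsum f1 f2 0 *v x) = p 0 *v (mor_codiag N 0 *v x)"
  "!!w. w \<in> Sp (E1 +R E2) 0 ==> q 0 *v (u 0 *v w) = mor_id (M +R M) 0 *v (mor_dsum g1 g2 0 *v w)"
  using z(2) unfolding ext_mor_em[OF n eseq_dsum[OF n exact_eseq[OF e1] exact_eseq[OF e2]] exact_eseq[OF z(1)]
   mor_codiag_hom[OF n rN] rep_hom_id[OF dsum_rep[OF n rM rM]]] em_def by blast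
 obtain r where r: "rep_hom n E G r" "!!x. x \<in> Sp N 0 ==> r 0 *v (f 0 *v x) = p 0 *v (mor_id N 0 *v x)"
  "!!w. w \<in> Sp E 0 ==> q 0 *v (r 0 *v w) = mor_diag M 0 *v (g 0 *v w)"
  using z(3) unfolding ext_mor_em[OF n exact_eseq[OF e] exact_eseq[OF z(1)] rep_hom_id[OF rN] mor_diag_hom[OF n rM]] em_def by blast
 obtain w1 where w1: "w1 \<in> isub E1 i" "g1 0 *v w1 = ?t" "(tt E1 ^^ ?d) w1 = a *s (f1 0 *v ?e)"
  using c1 unfolding ext_inv_iff[OF exact_eseq[OF e1]] by blast
 obtain w2 where w2: "w2 \<in> isub E2 i" "g2 0 *v w2 = ?t" "(tt E2 ^^ ?d) w2 = b *s (f2 0 *v ?e)"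
  using c2 unfolding ext_inv_iff[OF exact_eseq[OF e2]] by blast
 obtain w where w: "w \<in> isub E i" "g 0 *v w = ?t" "(tt E ^^ ?d) w = c *s (f 0 *v ?e)"
  using c unfolding ext_inv_iff[OF exact_eseq[OF e]] by blast
 have wc: "w1 \<in> Sp E1 0" "w2 \<in> Sp E2 0" "w \<in> Sp E 0"
  using w1(1) w2(1) w(1) isub_sub[OF S1(2) i_n] isub_sub[OF S2(2) i_n] isub_sub[OF S(2) i_n] by auto
 have ww: "w1 @v w2 \<in> Sp (E1 +R E2) 0" using wc by simp
 have t: "?t \<in> Sp M 0" and ee: "?e \<in> Sp N 0"
  using eb_carrier[OF n I] eb_carrier[OF n J] vM[OF n0] vN[OF n0] by auto
 have wi: "w1 @v w2 \<in> isub (E1 +R E2) i"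
 proof -
  obtain a1 a2 where "a1 \<in> Sp E1 i" "w1 = inc E1 i a1" "a2 \<in> Sp E2 i" "w2 = inc E2 i a2"
   using w1(1) w2(1) by (auto elim!: isubE)
  thus ?thesis using inc_dsum[OF S1(2) S2(2) i_n] by (intro isubI[of "a1 @v a2"]) auto
 qed
 have q1: "q 0 *v (u 0 *v (w1 @v w2)) = ?t @v ?t"
  using u(3)[OF ww] mor_dsum_vec[OF S1(5) S2(5) n0 wc(1,2)] w1(2) w2(2) t mor_id_vec[of "?t @v ?t" "M +R M" 0] by simp
 have q2: "q 0 *v (r 0 *v w) = ?t @v ?t" using r(3)[OF wc(3)] w(2) mor_diag_vec[OF t] by simp
 have "(tt G ^^ ?d) (u 0 *v (w1 @v w2)) = (tt G ^^ ?d) (r 0 *v w)"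
  by (rule two_lifts[OF E_exactD(4)[OF z(1)] F_Delta_mono[OF E_exactD(3)[OF z(1)]]
   isub_hom[OF rE SG(2) u(1) i_n wi] isub_hom[OF S(2) SG(2) r(1) i_n w(1)]]) (simp only: q1 q2)
 moreover have "(tt G ^^ ?d) (u 0 *v (w1 @v w2)) = (a + b) *s (p 0 *v ?e)"
 proof -
  have ae: "a *s ?e \<in> Sp N 0" "b *s ?e \<in> Sp N 0" using ee by auto
  have "(tt G ^^ ?d) (u 0 *v (w1 @v w2)) = u 0 *v ((tt E1 ^^ ?d) w1 @v (tt E2 ^^ ?d) w2)"
   using hom_tt_pow[OF rE SG(2) n u(1) ww] tt_dsum_pow[OF S1(2) S2(2) n wc(1,2)] by simp
  also have "\<dots> = u 0 *v (mor_dsum f1 f2 0 *v ((a *s ?e) @v (b *s ?e)))"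
   unfolding mor_dsum_vec[OF S1(4) S2(4) n0 ae] w1(3) w2(3)
   using linD(3)[OF hom_lin0[OF S1(4) n0] ee] linD(3)[OF hom_lin0[OF S2(4) n0] ee] by simp
  also have "\<dots> = p 0 *v (a *s ?e + b *s ?e)"
   using u(2)[of "(a *s ?e) @v (b *s ?e)"] mor_codiag_vec[OF ae] ae by simp
  also have "\<dots> = (a + b) *s (p 0 *v ?e)"
   using linD(3)[OF hom_lin0[OF SG(4) n0] ee, of "a + b"] by (simp add: add_smult_distrib_vec)
  finally show ?thesis .
 qed
 moreover have "(tt G ^^ ?d) (r 0 *v w) = c *s (p 0 *v ?e)"
  using hom_tt_pow[OF S(2) SG(2) n r(1) wc(3), of ?d] w(3) linD(3)[OF hom_lin0[OF r(1) n0] hom_vec[OF S(4) n0 ee], of c]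
   r(2)[OF ee] mor_id_vec[OF ee] by simp
 ultimately show ?thesis by (intro f_eb_inj[OF SG(4) SG(6)[OF n0]]) auto
qed

text \<open>
The auxiliary extension is the pullback along \<open>(a, b) : M \<oplus> M \<rightarrow> M\<close>, which
restricts to \<open>a\<close> and \<open>b\<close> on the summands and to \<open>a + b\<close> on the diagonal.
\<close>

lemma baer_exists:
 assumes e: "E_exact n N E M f g" and c: "ext_inv (E, f, g) (a + b)"
 shows "baer_sum n M N (pb a, in1 N M, pr2 N M) (pb b, in1 N M, pr2 N M) (E, f, g)"
proof -
 note rMM = dsum_rep[OF n rM rM] and FMM = F_Delta_dsum[OF n FM FM]
 define kz where "kz = hcopair M M M (sc a) (sc b)"
 have hz: "rep_hom n (M +R M) M kz" unfolding kz_def by (rule hcopair_hom[OF n rM rM rM sc_hom sc_hom])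
 have kzv: "kz 0 *v (x @v y) = a *s x + b *s y" if "x \<in> Sp M 0" "y \<in> Sp M 0" for x y
  unfolding kz_def using hcopair_vec'[OF sc_hom sc_hom n0 that] sc_vec that by simp
 let ?G = "pbk (M +R M) kz" and ?p = "in1 N (M +R M)" and ?q = "pr2 N (M +R M)"
 note eG = pbk_exact[OF FMM hz] and rG = pbk_rep[OF FMM hz]
 let ?z = "0v (vdim M 0) :: complex vec"
 have z: "?z \<in> Sp M 0" by simp
 obtain u1 where u1: "rep_hom n (pb a) ?G u1"
  "!!x y. x \<in> Sp N 0 ==> y \<in> Sp M 0 ==> u1 0 *v (x @v y) = x @v (y @v ?z)"
 proof (rule pbk_map[OF FM sc_hom[of a] FMM hz dsum_in1[OF n rM rM]])
  show "kz 0 *v (in1 M M 0 *v x) = sc a 0 *v x" if "x \<in> Sp M 0" for x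
   using that by (simp add: in1_vec kzv sc_vec)
 qed (use that in \<open>simp add: pb_def in1_vec\<close>)
 obtain u2 where u2: "rep_hom n (pb b) ?G u2"
  "!!x y. x \<in> Sp N 0 ==> y \<in> Sp M 0 ==> u2 0 *v (x @v y) = x @v (?z @v y)"
 proof (rule pbk_map[OF FM sc_hom[of b] FMM hz dsum_in2[OF n rM rM]])
  show "kz 0 *v (in2 M M 0 *v x) = sc b 0 *v x" if "x \<in> Sp M 0" for x
   using that by (simp add: in2_vec kzv sc_vec)
 qed (use that in \<open>simp add: pb_def in2_vec\<close>)
 obtain u3 where u3: "rep_hom n (pb (a + b)) ?G u3"
  "!!x y. x \<in> Sp N 0 ==> y \<in> Sp M 0 ==> u3 0 *v (x @v y) = x @v (y @v y)"
 proof (rule pbk_map[OF FM sc_hom[of "a + b"] FMM hz mor_diag_hom[OF n rM]])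
  show "kz 0 *v (mor_diag M 0 *v x) = sc (a + b) 0 *v x" if "x \<in> Sp M 0" for x
   using that by (simp add: mor_diag_vec kzv sc_vec add_smult_distrib_vec)
 qed (use that in \<open>simp add: pb_def mor_diag_vec\<close>)
 note SP = seqD[OF E_exactD(4)[OF pb_exact]]
 define u where "u = hcopair (pb a) (pb b) ?G u1 u2"
 have hu: "rep_hom n (pb a +R pb b) ?G u" unfolding u_def by (rule hcopair_hom[OF n SP(2) SP(2) rG u1(1) u2(1)])
 have uv: "u 0 *v ((x @v y) @v (x' @v y')) = (x + x') @v (y @v y')"
  if x: "x \<in> Sp N 0" "x' \<in> Sp N 0" and y: "y \<in> Sp M 0" "y' \<in> Sp M 0" for x y x' y'
 proof -
  have "u 0 *v ((x @v y) @v (x' @v y')) = (x @v (y @v ?z)) + (x' @v (?z @v y'))"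
   unfolding u_def
   using hcopair_vec'[OF u1(1) u2(1) n0, of "x @v y" "x' @v y'"] u1(2)[OF x(1) y(1)] u2(2)[OF x(2) y(2)] x y
   by (simp add: pb_def)
  also have "\<dots> = (x + x') @v ((y @v ?z) + (?z @v y'))" by (rule append_add[of _ "vdim N 0" _ _ "vdim M 0 + vdim M 0"]) (use x y in auto)
  also have "(y @v ?z) + (?z @v y') = y @v y'" using append_add[OF y(1) z z y(2)] y by simp
  finally show ?thesis .
 qed
 have 1: "ext_mor n (pb a +R pb b, mor_dsum (in1 N M) (in1 N M), mor_dsum (pr2 N M) (pr2 N M)) (?G, ?p, ?q) (mor_codiag N) (mor_id (M +R M))"
  unfolding ext_mor_em[OF n eseq_dsum[OF n exact_eseq[OF pb_exact] exact_eseq[OF pb_exact]] exact_eseq[OF eG]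
   mor_codiag_hom[OF n rN] rep_hom_id[OF rMM]] em_def
 proof (intro exI[of _ u] conjI ballI hu)
  fix x :: "complex vec" assume x: "x \<in> Sp (N +R N) 0"
  obtain x1 x2 where xx: "x1 \<in> Sp N 0" "x2 \<in> Sp N 0" "x = x1 @v x2"
   by (rule vec_splitE[OF x[unfolded vdim_dsum]])
  have sp: "0v (vdim M 0 + vdim M 0) = ?z @v ?z" by (simp add: zero_append)
  show "u 0 *v (mor_dsum (in1 N M) (in1 N M) 0 *v x) = ?p 0 *v (mor_codiag N 0 *v x)"
   unfolding xx(3) mor_dsum_vec[OF SP(4) SP(4) n0 xx(1,2)] mor_codiag_vec[OF xx(1,2)] in1_vec[OF xx(1)] in1_vec[OF xx(2)]
    uv[OF xx(1,2) z z] in1_vec[OF add_carrier_vec[OF xx(1,2)]] vdim_dsum sp ..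
 next
  fix w :: "complex vec" assume w: "w \<in> cvec (vdim (pb a +R pb b) 0)"
  obtain w1 w2 where ww: "w1 \<in> Sp (pb a) 0" "w2 \<in> Sp (pb b) 0" "w = w1 @v w2"
   by (rule vec_splitE[OF w[unfolded vdim_dsum]])
  obtain x y where xy: "x \<in> Sp N 0" "y \<in> Sp M 0" "w1 = x @v y"
   by (rule vec_splitE[OF ww(1)[unfolded pb_def vdim_pbk]])
  obtain x' y' where xy': "x' \<in> Sp N 0" "y' \<in> Sp M 0" "w2 = x' @v y'"
   by (rule vec_splitE[OF ww(2)[unfolded pb_def vdim_pbk]])
  have yy: "y @v y' \<in> Sp (M +R M) 0" using xy xy' by simp
  show "?q 0 *v (u 0 *v w) = mor_id (M +R M) 0 *v (mor_dsum (pr2 N M) (pr2 N M) 0 *v w)"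
   unfolding ww(3) mor_dsum_vec[OF SP(5) SP(5) n0 ww(1,2)]
   unfolding xy(3) xy'(3) pr2_vec[OF xy(1,2)] pr2_vec[OF xy'(1,2)] uv[OF xy(1) xy'(1) xy(2) xy'(2)]
    mor_id_vec[OF yy] pr2_vec[OF add_carrier_vec[OF xy(1) xy'(1)] yy] ..
 qed
 have "em n N (pb (a + b)) (in1 N M) (pr2 N M) ?G ?p ?q (\<lambda>x. x) (\<lambda>x. mor_diag M 0 *v x)"
  unfolding em_def
 proof (intro exI[of _ u3] conjI ballI u3(1))
  fix x :: "complex vec"
  show "u3 0 *v (in1 N M 0 *v x) = ?p 0 *v x" if x: "x \<in> Sp N 0"
   using in1_vec[OF x] u3(2)[OF x z] by (simp add: zero_append)
  show "?q 0 *v (u3 0 *v x) = mor_diag M 0 *v (pr2 N M 0 *v x)" if w: "x \<in> cvec (vdim (pb (a + b)) 0)"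
  proof -
   obtain y y' where xy: "y \<in> Sp N 0" "y' \<in> Sp M 0" "x = y @v y'"
    by (rule vec_splitE[OF w[unfolded pb_def vdim_pbk]])
   have yy: "y' @v y' \<in> Sp (M +R M) 0" using xy by simp
   show ?thesis unfolding xy(3) u3(2)[OF xy(1,2)] pr2_vec[OF xy(1,2)] pr2_vec[OF xy(1) yy] mor_diag_vec[OF xy(2)] ..
  qed
 qed
 moreover have "em n N E f g (pb (a + b)) (in1 N M) (pr2 N M) (\<lambda>x. x) (\<lambda>x. x)"
  using em_iff_inv[OF e pb_exact c] pb_inv by blast
 ultimately have "em n N E f g ?G ?p ?q (\<lambda>x. x) (\<lambda>x. mor_diag M 0 *v x)"
  using em_trans[OF n exact_eseq[OF e] exact_eseq[OF pb_exact] exact_eseq[OF eG]] by blast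
 hence 2: "ext_mor n (E, f, g) (?G, ?p, ?q) (mor_id N) (mor_diag M)"
  unfolding ext_mor_em[OF n exact_eseq[OF e] exact_eseq[OF eG] rep_hom_id[OF rN] mor_diag_hom[OF n rM]]
  by (rule em_cong[OF _ n0 seqD(5)[OF E_exactD(4)[OF e]]]) (use mor_id_vec in auto)
 show ?thesis
  unfolding baer_sum_def extn_dsum_def extns_def using eG 1 2 by (intro bexI[of _ "(?G, ?p, ?q)"]) auto
qed

lemma add_cls: "add (ext1 n M N) (cls a) (cls b) = cls (a + b)"
proof (rule Set.set_eqI)
 fix \<xi> :: extn
 obtain E f g where E: "\<xi> = (E, f, g)" by (cases \<xi>)
 show "\<xi> \<in> add (ext1 n M N) (cls a) (cls b) \<longleftrightarrow> \<xi> \<in> cls (a + b)"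
 proof
  assume "\<xi> \<in> add (ext1 n M N) (cls a) (cls b)"
  then obtain E1 f1 g1 E2 f2 g2 where 1: "E_exact n N E M f g" "(E1, f1, g1) \<in> cls a" "(E2, f2, g2) \<in> cls b"
   "baer_sum n M N (E1, f1, g1) (E2, f2, g2) (E, f, g)"
   by (auto simp: ext1_def E extns_def)
  obtain c where c: "ext_inv (E, f, g) c" using inv_exists[OF 1(1)] by blast
  have "c = a + b" by (rule baer_inv[OF _ _ _ _ 1(1) c 1(4)]) (use 1(2,3) in \<open>auto simp: cls_iff\<close>)
  thus "\<xi> \<in> cls (a + b)" using 1(1) c by (simp add: E cls_iff)
 next
  assume "\<xi> \<in> cls (a + b)"
  hence 1: "E_exact n N E M f g" "ext_inv (E, f, g) (a + b)" by (auto simp: E cls_iff)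
  have "\<exists>\<xi>1\<in>cls a. \<exists>\<xi>2\<in>cls b. baer_sum n M N \<xi>1 \<xi>2 \<xi>"
   unfolding E using baer_exists[OF 1] by (rule bexI[OF bexI[OF _ pb_cls] pb_cls])
  moreover have "\<xi> \<in> extns n M N" using 1(1) by (simp add: E extns_def)
  ultimately show "\<xi> \<in> add (ext1 n M N) (cls a) (cls b)" by (simp add: ext1_def)
 qed
qed

lemma has_dim_ext1: "has_dim (ext1 n M N) 1"
 by (rule has_dim_one[OF carrier_ext1 inj_cls _ add_cls smult_cls]) (simp add: ext1_def split_cls)

end

lemma (in interlaced) ext1_dim_one: "has_dim (ext1 n M N) 1"
proof (rule coc_exists)
 fix al bt :: "nat => complex mat"
 assume "cocycle n N M al bt"
  "!!w. w \<in> Sp M 0 ==>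
   amap N (Suc 0) *v (bt (Suc 0) *v w) + al (Suc 0) *v (bmap M (Suc 0) *v w) = 0v (vdim N 0)"
  "!!v x y. v < n ==> x \<in> Sp N v ==> y \<in> Sp M v ==>
   inc (cext N M al bt) v (x @v y) = (inc N v x + chi v *s Sh n I J (inc M v y)) @v inc M v y"
 hence "interlaced_cocycle n i j k I J al bt"
  by (intro interlaced_cocycle.intro interlaced_axioms interlaced_cocycle_axioms.intro)
 thus ?thesis by (rule interlaced_cocycle.has_dim_ext1)
qed

text \<open>As \<open>L\<close> avoids three elements of \<open>[n]\<close>, \<open>|Lj| \<le> n - 2\<close>.\<close>

lemma ext1_exchange_dim_one:
 assumes n: "1 < n" and L: "L \<subseteq> {1..n}" and ijk: "{i, j, k} \<subseteq> {1..n}" "i < j" "j < k" "L \<inter> {i, j, k} = {}"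
 shows "has_dim (ext1 n (M_mod n (L \<union> {j})) (M_mod n (L \<union> {i, k}))) 1"
proof -
 note D = dd_L[OF n L ijk] and sb = subs[OF n L ijk] and fL = fL[OF n L ijk]
 have "card (L \<union> {i, j, k}) \<le> n" using card_mono[of "{1..n}" "L \<union> {i, j, k}"] L ijk by simp
 hence cL: "card L + 3 \<le> n" using card_Un_disjoint[of L "{i, j, k}"] fL ijk by simp
 have "dd L 0 \<le> card L" unfolding dd_def by (intro card_mono) (use fL in auto)
 hence "interlaced n i j k (L \<union> {j}) (L \<union> {i, k})"
  using n sb ijk cL \<open>dd L 0 \<le> card L\<close> unfolding interlaced_def D by (simp del: Un_insert_right)
 thus ?thesis by (rule interlaced.ext1_dim_one)
qed



section \<open>Direct sums and summands\<close>

lemma mor_eqI: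
 assumes "rep_hom n X Y f" "rep_hom n X Y g"
  and "!!v x :: complex vec. v < n ==> x \<in> Sp X v ==> f v *v x = g v *v x"
 shows "mor_eq n f g"
 unfolding mor_eq_def using mat_eq_vecI[OF hom_mat[OF assms(1)] hom_mat[OF assms(2)]] assms(3) by blast

lemma rep_isoI:
 assumes X: "is_rep n X" and Y: "is_rep n Y" and f: "rep_hom n X Y f" and g: "rep_hom n Y X g"
  and gf: "!!v x :: complex vec. v < n ==> x \<in> Sp X v ==> g v *v (f v *v x) = x"
  and fg: "!!v y :: complex vec. v < n ==> y \<in> Sp Y v ==> f v *v (g v *v y) = y"
 shows "rep_iso n X Y"
proof -
 have "mor_eq n (g oR f) (mor_id X)"
  by (rule mor_eqI[OF hom_comp[OF X Y X f g] rep_hom_id[OF X]]) (simp add: comp_vec[OF f g] gf mor_id_vec)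
 moreover have "mor_eq n (f oR g) (mor_id Y)"
  by (rule mor_eqI[OF hom_comp[OF Y X Y g f] rep_hom_id[OF Y]]) (simp add: comp_vec[OF g f] fg mor_id_vec)
 ultimately show ?thesis unfolding rep_iso_def iso_mor_def using f g by blast
qed

lemma rep_iso_refl: "is_rep n X ==> rep_iso n X X"
 unfolding rep_iso_def using iso_id by blast

lemma rep_iso_sym: "rep_iso n X Y ==> rep_iso n Y X"
 unfolding rep_iso_def using iso_inverse by metis

lemma rep_iso_trans:
 "is_rep n X ==> is_rep n Y ==> is_rep n Z ==> rep_iso n X Y ==> rep_iso n Y Z ==> rep_iso n X Z"
 unfolding rep_iso_def using iso_comp by blast

lemma rep_isoE:
 assumes "rep_iso n X Y"
 obtains f g where "rep_hom n X Y f" "rep_hom n Y X g"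
  "!!v x :: complex vec. v < n ==> x \<in> Sp X v ==> g v *v (f v *v x) = x"
  "!!v y :: complex vec. v < n ==> y \<in> Sp Y v ==> f v *v (g v *v y) = y"
proof -
 obtain f where f: "iso_mor n X Y f" using assms unfolding rep_iso_def by blast
 obtain g where g: "iso_mor n Y X g" "!!v x. v < n ==> x \<in> Sp X v ==> g v *v (f v *v x) = x"
  "!!v y. v < n ==> y \<in> Sp Y v ==> f v *v (g v *v y) = y" using iso_inverse[OF f] by blast
 show ?thesis by (rule that[OF iso_hom[OF f] iso_hom[OF g(1)] g(2,3)])
qed

lemma dsum_vecE:
 assumes "(w :: complex vec) \<in> Sp (X +R Y) v"
 obtains x y where "x \<in> Sp X v" "y \<in> Sp Y v" "w = x @v y"
 by (rule vec_splitE[OF assms[unfolded vdim_dsum]])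

lemma dsum_cong:
 assumes n: "1 < n" and r: "is_rep n X" "is_rep n Y" "is_rep n X'" "is_rep n Y'" and "rep_iso n X X'" "rep_iso n Y Y'"
 shows "rep_iso n (X +R Y) (X' +R Y')"
proof -
 obtain f g where f: "rep_hom n X X' f" "rep_hom n X' X g"
  "!!v x. v < n ==> x \<in> Sp X v ==> g v *v (f v *v x) = x"
  "!!v y. v < n ==> y \<in> Sp X' v ==> f v *v (g v *v y) = y" using rep_isoE[OF assms(6)] by blast
 obtain f' g' where f': "rep_hom n Y Y' f'" "rep_hom n Y' Y g'"
  "!!v x. v < n ==> x \<in> Sp Y v ==> g' v *v (f' v *v x) = x"
  "!!v y. v < n ==> y \<in> Sp Y' v ==> f' v *v (g' v *v y) = y" using rep_isoE[OF assms(7)] by blast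
 show ?thesis
  by (rule rep_isoI[OF dsum_rep[OF n r(1,2)] dsum_rep[OF n r(3,4)] mor_dsum_hom[OF n r(1,3,2,4) f(1) f'(1)] mor_dsum_hom[OF n r(3,1,4,2) f(2) f'(2)]];
   erule dsum_vecE)
   (simp_all add: mor_dsum_vec[OF f(1) f'(1)] mor_dsum_vec[OF f(2) f'(2)] f(3,4) f'(3,4)
    hom_vec[OF f(1)] hom_vec[OF f(2)] hom_vec[OF f'(1)] hom_vec[OF f'(2)])
qed

text \<open>The morphism \<open>(x, y, z) \<mapsto> (y, x, z)\<close>.\<close>

definition rearrange :: "rep => rep => rep => rmor" where
 "rearrange X Y Z = hpair (X +R Y +R Z) Y (X +R Z) (pr1 Y Z oR pr2 X (Y +R Z))
   (hpair (X +R Y +R Z) X Z (pr1 X (Y +R Z)) (pr2 Y Z oR pr2 X (Y +R Z)))"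

lemma rearrange:
 assumes n: "1 < n" and r: "is_rep n X" "is_rep n Y" "is_rep n Z"
 shows "rep_hom n (X +R Y +R Z) (Y +R X +R Z) (rearrange X Y Z)"
  "v < n ==> x \<in> Sp X v ==> y \<in> Sp Y v ==> z \<in> Sp Z v ==>
   rearrange X Y Z v *v (x @v (y @v z)) = y @v (x @v z)"
proof -
 note YZ = dsum_rep[OF n r(2,3)] and XZ = dsum_rep[OF n r(1,3)]
 note XYZ = dsum_rep[OF n r(1) YZ]
 note p = dsum_pr1[OF n r(1) YZ] dsum_pr2[OF n r(1) YZ] dsum_pr1[OF n r(2,3)] dsum_pr2[OF n r(2,3)]
 note c = hom_comp[OF XYZ YZ r(2) p(2,3)] hom_comp[OF XYZ YZ r(3) p(2,4)]
 note h = hpair_hom[OF n XYZ r(1,3) p(1) c(2)]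
 show "rep_hom n (X +R Y +R Z) (Y +R X +R Z) (rearrange X Y Z)"
  unfolding rearrange_def by (rule hpair_hom[OF n XYZ r(2) XZ c(1) h])
 assume v: "v < n" and x: "x \<in> Sp X v" "y \<in> Sp Y v" "z \<in> Sp Z v"
 have yz: "y @v z \<in> Sp (Y +R Z) v" using x by simp
 hence w: "x @v (y @v z) \<in> cvec (vdim (X +R Y +R Z) v)" using x by simp
 show "rearrange X Y Z v *v (x @v (y @v z)) = y @v (x @v z)"
  unfolding rearrange_def hpair_vec'[OF c(1) h v w] hpair_vec'[OF p(1) c(2) v w] comp_vec[OF p(2,3) v w] comp_vec[OF p(2,4) v w]
   pr2_vec[OF x(1) yz] pr1_vec[OF x(1) yz] pr2_vec[OF x(2,3)] pr1_vec[OF x(2,3)] ..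
qed

lemma dsum_swap:
 assumes n: "1 < n" and r: "is_rep n X" "is_rep n Y" "is_rep n Z"
 shows "rep_iso n (X +R Y +R Z) (Y +R X +R Z)"
 by (rule rep_isoI[OF dsum_rep[OF n r(1) dsum_rep[OF n r(2,3)]] dsum_rep[OF n r(2) dsum_rep[OF n r(1,3)]]
   rearrange(1)[OF n r] rearrange(1)[OF n r(2,1,3)]]; (erule dsum_vecE)+)
  (simp_all add: rearrange(2)[OF n r] rearrange(2)[OF n r(2,1,3)])

lemma append_vec_assoc: "(x @v y) @v z = x @v (y @v (z :: complex vec))"
 by (intro eq_vecI) (auto simp: diff_diff_left)

lemma dsum_assoc:
 assumes n: "1 < n" and r: "is_rep n X" "is_rep n Y" "is_rep n Z"
 shows "rep_iso n ((X +R Y) +R Z) (X +R Y +R Z)"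
proof -
 note XY = dsum_rep[OF n r(1,2)] and YZ = dsum_rep[OF n r(2,3)]
 note A = dsum_rep[OF n XY r(3)] and B = dsum_rep[OF n r(1) YZ]
 let ?f = "mor_id ((X +R Y) +R Z)"
 have a: "amap ((X +R Y) +R Z) (Suc v) *v w = amap (X +R Y +R Z) (Suc v) *v w"
  if v: "Suc v < n" and w: "w \<in> cvec (vdim ((X +R Y) +R Z) (Suc v))" for v w
 proof -
  obtain xy z where 1: "xy \<in> Sp (X +R Y) (Suc v)" "z \<in> Sp Z (Suc v)" "w = xy @v z" by (rule dsum_vecE[OF w])
  obtain x y where 2: "x \<in> Sp X (Suc v)" "y \<in> Sp Y (Suc v)" "xy = x @v y" by (rule dsum_vecE[OF 1(1)])
  have yz: "y @v z \<in> Sp (Y +R Z) (Suc v)" using 1 2 by simp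
  show ?thesis
   unfolding 1(3) dsum_a[OF XY r(3) v 1(1,2)] unfolding 2(3) dsum_a[OF r(1,2) v 2(1,2)] append_vec_assoc
    dsum_a[OF r(1) YZ v 2(1) yz] dsum_a[OF r(2,3) v 2(2) 1(2)] ..
 qed
 have b: "bmap ((X +R Y) +R Z) (Suc v) *v w = bmap (X +R Y +R Z) (Suc v) *v w"
  if v: "Suc v < n" and w: "w \<in> cvec (vdim ((X +R Y) +R Z) v)" for v w
 proof -
  obtain xy z where 1: "xy \<in> Sp (X +R Y) v" "z \<in> Sp Z v" "w = xy @v z" by (rule dsum_vecE[OF w])
  obtain x y where 2: "x \<in> Sp X v" "y \<in> Sp Y v" "xy = x @v y" by (rule dsum_vecE[OF 1(1)])
  have yz: "y @v z \<in> Sp (Y +R Z) v" using 1 2 by simp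
  show ?thesis
   unfolding 1(3) dsum_b[OF XY r(3) v 1(1,2)] unfolding 2(3) dsum_b[OF r(1,2) v 2(1,2)] append_vec_assoc
    dsum_b[OF r(1) YZ v 2(1) yz] dsum_b[OF r(2,3) v 2(2) 1(2)] ..
 qed
 have id: "?f v *v w = w" if "w \<in> cvec (vdim ((X +R Y) +R Z) v)" for v w by (rule mor_id_vec[OF that])
 have "rep_hom n ((X +R Y) +R Z) (X +R Y +R Z) ?f"
 proof (rule rep_homI[OF A B])
  fix v and w :: "complex vec" assume v: "Suc v < n"
  show "?f v *v (amap ((X +R Y) +R Z) (Suc v) *v w) = amap (X +R Y +R Z) (Suc v) *v (?f (Suc v) *v w)"
   if w: "w \<in> cvec (vdim ((X +R Y) +R Z) (Suc v))"
   unfolding id[OF w] id[OF rep_act(1)[OF A v w]] by (rule a[OF v w])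
  show "?f (Suc v) *v (bmap ((X +R Y) +R Z) (Suc v) *v w) = bmap (X +R Y +R Z) (Suc v) *v (?f v *v w)"
   if w: "w \<in> cvec (vdim ((X +R Y) +R Z) v)"
   unfolding id[OF w] id[OF rep_act(2)[OF A v w]] by (rule b[OF v w])
 qed (simp add: mor_id_def add.assoc)
 hence "iso_mor n ((X +R Y) +R Z) (X +R Y +R Z) ?f"
  by (rule iso_of_inj[OF A B]) (use iso_inj[OF iso_id[OF A]] in auto)
 thus ?thesis unfolding rep_iso_def by blast
qed

lemma zero_rep: "1 < n ==> is_rep n zero_rep"
 by (rule is_repI) (auto simp: zero_rep_def)

lemma vdim_zero_rep [simp]: "vdim zero_rep v = 0"
 by (simp add: zero_rep_def)

lemma dsum_zero:
 assumes n: "1 < n" and X: "is_rep n X"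
 shows "rep_iso n (zero_rep +R X) X"
proof -
 note Z = zero_rep[OF n]
 show ?thesis
 proof (rule rep_isoI[OF dsum_rep[OF n Z X] X dsum_pr2[OF n Z X] dsum_in2[OF n Z X]])
  fix v and w :: "complex vec"
  assume w: "w \<in> Sp (zero_rep +R X) v"
  obtain x y where xy: "x \<in> Sp zero_rep v" "y \<in> Sp X v" "w = x @v y" by (rule dsum_vecE[OF w])
  have "x = 0v (vdim zero_rep v)" using xy(1) by (intro eq_vecI) auto
  thus "in2 zero_rep X v *v (pr2 zero_rep X v *v w) = w" unfolding xy(3) pr2_vec[OF xy(1,2)] in2_vec[OF xy(2)] by simp
 next
  fix v and y :: "complex vec" assume y: "y \<in> Sp X v"
  show "pr2 zero_rep X v *v (in2 zero_rep X v *v y) = y" unfolding in2_vec[OF y] by (rule pr2_vec[OF zero_carrier_vec y])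
 qed
qed

lemma dsum_list_simps [simp]: "dsum_list [] = zero_rep" "dsum_list (X # Xs) = X +R dsum_list Xs"
 by (simp_all add: dsum_list_def)

lemma dsum_list_rep: "1 < n ==> (!!X. X \<in> set Xs ==> is_rep n X) ==> is_rep n (dsum_list Xs)"
 by (induction Xs) (auto intro: dsum_rep zero_rep)

lemma dsum_list_append:
 assumes n: "1 < n"
 shows "(!!X. X \<in> set (Xs @ Ys) ==> is_rep n X) ==> rep_iso n (dsum_list (Xs @ Ys)) (dsum_list Xs +R dsum_list Ys)"
proof (induction Xs)
 case Nil
 hence "is_rep n (dsum_list Ys)" using dsum_list_rep[OF n] by auto
 thus ?case using rep_iso_sym[OF dsum_zero[OF n]] by simp
next
 case (Cons X Xs)
 have r: "is_rep n X" "is_rep n (dsum_list Xs)" "is_rep n (dsum_list Ys)" "is_rep n (dsum_list (Xs @ Ys))"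
  using Cons.prems by (auto intro!: dsum_list_rep[OF n])
 note rr = dsum_rep[OF n r(2,3)]
 have "rep_iso n (X +R dsum_list (Xs @ Ys)) (X +R dsum_list Xs +R dsum_list Ys)"
  by (rule dsum_cong[OF n r(1,4) r(1) rr rep_iso_refl[OF r(1)] Cons.IH]) (use Cons.prems in auto)
 thus ?case
  using rep_iso_trans[OF dsum_rep[OF n r(1,4)] dsum_rep[OF n r(1) rr] dsum_rep[OF n dsum_rep[OF n r(1,2)] r(3)]]
   rep_iso_sym[OF dsum_assoc[OF n r(1,2,3)]] by simp
qed

lemma dsum_list_split:
 assumes n: "1 < n"
 shows "(!!Y. Y \<in> set (Xs @ X # Ys) ==> is_rep n Y) ==> rep_iso n (dsum_list (Xs @ X # Ys)) (X +R dsum_list (Xs @ Ys))"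
proof (induction Xs)
 case Nil
 thus ?case using rep_iso_refl[OF dsum_list_rep[OF n, of "X # Ys"]] by simp
next
 case (Cons Y Xs)
 have r: "is_rep n Y" "is_rep n X" "is_rep n (dsum_list (Xs @ Ys))" "is_rep n (dsum_list (Xs @ X # Ys))"
  using Cons.prems by (auto intro!: dsum_list_rep[OF n])
 have "rep_iso n (Y +R dsum_list (Xs @ X # Ys)) (Y +R X +R dsum_list (Xs @ Ys))"
  by (rule dsum_cong[OF n r(1,4) r(1) dsum_rep[OF n r(2,3)] rep_iso_refl[OF r(1)] Cons.IH]) (use Cons.prems in auto)
 thus ?case
  using rep_iso_trans[OF dsum_rep[OF n r(1,4)] dsum_rep[OF n r(1) dsum_rep[OF n r(2,3)]] dsum_rep[OF n r(2) dsum_rep[OF n r(1,3)]]]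
   dsum_swap[OF n r(1,2,3)] by simp
qed

lemma summand_trans:
 assumes n: "1 < n" and T: "is_rep n T" and X: "is_summand n X T" and W: "is_rep n W"
 shows "is_summand n X (T +R W)"
proof -
 obtain Y where Y: "is_rep n X" "is_rep n Y" "rep_iso n T (X +R Y)" using X unfolding is_summand_def by blast
 note XY = dsum_rep[OF n Y(1,2)]
 have "rep_iso n (T +R W) (X +R Y +R W)"
  by (rule rep_iso_trans[OF dsum_rep[OF n T W] dsum_rep[OF n XY W] dsum_rep[OF n Y(1) dsum_rep[OF n Y(2) W]]
   dsum_cong[OF n T W XY W Y(3) rep_iso_refl[OF W]] dsum_assoc[OF n Y(1,2) W]])
 thus ?thesis unfolding is_summand_def using Y(1) dsum_rep[OF n Y(2) W] by blast
qed

lemma in_add_summand: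
 assumes n: "1 < n" and T: "is_rep n T" and X: "is_summand n X T"
 shows "in_add n T X"
 unfolding in_add_def using summand_trans[OF n T X zero_rep[OF n]] by (intro exI[of _ 1]) simp

lemma in_add_dsum:
 assumes n: "1 < n" and T: "is_rep n T" and X: "in_add n T X" and X': "in_add n T X'"
 shows "in_add n T (X +R X')"
proof -
 obtain p q where p: "is_summand n X (dsum_list (replicate p T))" and q: "is_summand n X' (dsum_list (replicate q T))"
  using X X' unfolding in_add_def by blast
 let ?P = "dsum_list (replicate p T)" and ?Q = "dsum_list (replicate q T)" and ?R = "dsum_list (replicate (p + q) T)"
 obtain Y where Y: "is_rep n X" "is_rep n Y" "rep_iso n ?P (X +R Y)" using p unfolding is_summand_def by blast
 obtain Y' where Y': "is_rep n X'" "is_rep n Y'" "rep_iso n ?Q (X' +R Y')" using q unfolding is_summand_def by blast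
 have r: "is_rep n ?P" "is_rep n ?Q" "is_rep n ?R" using T by (auto intro!: dsum_list_rep[OF n])
 note r2 = dsum_rep[OF n r(1,2)] and XY = dsum_rep[OF n Y(1,2)] and XY' = dsum_rep[OF n Y'(1,2)] and YY = dsum_rep[OF n Y(2) Y'(2)]
 note XX = dsum_rep[OF n Y(1) Y'(1)]
 note a1 = dsum_rep[OF n XY XY'] and a2 = dsum_rep[OF n Y(1) dsum_rep[OF n Y(2) XY']]
  and a3 = dsum_rep[OF n Y(1) dsum_rep[OF n Y'(1) YY]] and a4 = dsum_rep[OF n XX YY]
 have 1: "rep_iso n ?R (?P +R ?Q)" unfolding replicate_add by (rule dsum_list_append[OF n]) (use T in auto)
 have 2: "rep_iso n (?P +R ?Q) ((X +R Y) +R (X' +R Y'))" by (rule dsum_cong[OF n r(1,2) XY XY' Y(3) Y'(3)])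
 have 3: "rep_iso n ((X +R Y) +R (X' +R Y')) (X +R Y +R X' +R Y')" by (rule dsum_assoc[OF n Y(1,2) XY'])
 have 4: "rep_iso n (X +R Y +R X' +R Y') (X +R X' +R Y +R Y')"
  by (rule dsum_cong[OF n Y(1) dsum_rep[OF n Y(2) XY'] Y(1) dsum_rep[OF n Y'(1) YY] rep_iso_refl[OF Y(1)] dsum_swap[OF n Y(2) Y'(1,2)]])
 have 5: "rep_iso n (X +R X' +R Y +R Y') ((X +R X') +R (Y +R Y'))"
  by (rule rep_iso_sym[OF dsum_assoc[OF n Y(1) Y'(1) YY]])
 have "rep_iso n ?R ((X +R X') +R (Y +R Y'))"
  by (rule rep_iso_trans[OF r(3) r2 a4 1 rep_iso_trans[OF r2 a1 a4 2 rep_iso_trans[OF a1 a2 a4 3 rep_iso_trans[OF a2 a3 a4 4 5]]]])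
 thus ?thesis unfolding in_add_def is_summand_def using XX YY by blast
qed

lemma summand_retract:
 assumes n: "1 < n" and X: "is_summand n X T" and T: "is_rep n T"
 obtains i p where "rep_hom n X T i" "rep_hom n T X p"
  "!!v x :: complex vec. v < n ==> x \<in> Sp X v ==> p v *v (i v *v x) = x"
proof -
 obtain Y where Y: "is_rep n X" "is_rep n Y" "rep_iso n T (X +R Y)" using X unfolding is_summand_def by blast
 note XY = dsum_rep[OF n Y(1,2)]
 obtain f g where f: "rep_hom n T (X +R Y) f" "rep_hom n (X +R Y) T g"
  "!!v x. v < n ==> x \<in> Sp T v ==> g v *v (f v *v x) = x"
  "!!v y. v < n ==> y \<in> Sp (X +R Y) v ==> f v *v (g v *v y) = y" using rep_isoE[OF Y(3)] by blast
 note i1 = dsum_in1[OF n Y(1,2)] and p1 = dsum_pr1[OF n Y(1,2)]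
 note hi = hom_comp[OF Y(1) XY T i1 f(2)] and hp = hom_comp[OF T XY Y(1) f(1) p1]
 have "(pr1 X Y oR f) v *v ((g oR in1 X Y) v *v x) = x" if v: "v < n" and x: "x \<in> Sp X v" for v x
  unfolding comp_vec[OF f(1) p1 v hom_vec[OF hi v x]]
  unfolding comp_vec[OF i1 f(2) v x]
  unfolding f(4)[OF v hom_vec[OF i1 v x]]
  unfolding in1_vec[OF x] by (rule pr1_vec[OF x]) simp
 thus ?thesis by (rule that[OF hi hp])
qed

text \<open>
To establish a property on \<open>add T\<close> it suffices to treat \<open>T\<close>, finite direct sums and
summands.
\<close>

lemma in_add_induct:
 assumes n: "1 < n" and X: "in_add n T X" and T: "is_rep n T" "P T" and zero: "P zero_rep"
  and sum: "!!X Y. is_rep n X ==> is_rep n Y ==> P X ==> P Y ==> P (X +R Y)"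
  and ret: "!!X T. is_rep n X ==> is_rep n T ==> is_summand n X T ==> P T ==> P X"
 shows "P X"
proof -
 obtain p where p: "is_summand n X (dsum_list (replicate p T))" using X unfolding in_add_def by blast
 have "is_rep n (dsum_list (replicate p T)) \<and> P (dsum_list (replicate p T))"
  by (induction p) (auto intro: sum zero T zero_rep[OF n] dsum_rep[OF n])
 thus ?thesis using ret p unfolding is_summand_def by blast
qed

section \<open>Factorization through approximations\<close>

definition lifts :: "nat => rep => rep => rmor => rep => bool" where
 "lifts n E Z g X \<longleftrightarrow> (\<forall>h. rep_hom n X Z h --> (\<exists>u. rep_hom n X E u \<and> mor_eq n (g oR u) h))"

definition extends :: "nat => rep => rep => rmor => rep => bool" where
 "extends n A F g X \<longleftrightarrow> (\<forall>h. rep_hom n A X h --> (\<exists>u. rep_hom n F X u \<and> mor_eq n (u oR g) h))"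

lemma vec0_eq: "x \<in> cvec 0 ==> y \<in> cvec 0 ==> x = (y :: complex vec)"
 by (intro eq_vecI) auto

lemma lifts_closed:
 assumes n: "1 < n" and E: "is_rep n E" and Z: "is_rep n Z" and g: "rep_hom n E Z g"
 shows lifts_zero: "lifts n E Z g zero_rep"
  and lifts_dsum: "is_rep n X ==> is_rep n Y ==> lifts n E Z g X ==> lifts n E Z g Y ==> lifts n E Z g (X +R Y)"
  and lifts_summand: "is_rep n X ==> is_rep n T ==> is_summand n X T ==> lifts n E Z g T ==> lifts n E Z g X"
proof -
 note lin = lin0[OF hom_lin]
 show "lifts n E Z g zero_rep"
  unfolding lifts_def
 proof (intro allI impI exI conjI)
  fix h assume h: "rep_hom n zero_rep Z h"
  show u: "rep_hom n zero_rep E (zmor zero_rep E)" by (rule zmor_hom[OF zero_rep[OF n] E])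
  show "mor_eq n (g oR zmor zero_rep E) h"
  proof (rule mor_eqI[OF hom_comp[OF zero_rep[OF n] E Z u g] h])
   fix v and x :: "complex vec" assume v: "v < n" and x: "x \<in> Sp zero_rep v"
   have "x = 0v (vdim zero_rep v)" using x by (intro vec0_eq) auto
   thus "(g oR zmor zero_rep E) v *v x = h v *v x"
    using lin[OF h v] lin[OF hom_comp[OF zero_rep[OF n] E Z u g] v] by simp
  qed
 qed
 assume X: "is_rep n X"
 show "lifts n E Z g (X +R Y)" if Y: "is_rep n Y" and LX: "lifts n E Z g X" and LY: "lifts n E Z g Y"
  unfolding lifts_def
 proof (intro allI impI)
  fix h assume h: "rep_hom n (X +R Y) Z h"
  obtain h1 h2 where hh: "rep_hom n X Z h1" "rep_hom n Y Z h2"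
   "!!v x y. v < n ==> x \<in> Sp X v ==> y \<in> Sp Y v ==>
    h v *v (x @v y) = h1 v *v x + h2 v *v y" using dsum_hom_out[OF n X Y Z h] by blast
  obtain u1 where u1: "rep_hom n X E u1" "mor_eq n (g oR u1) h1" using LX hh(1) unfolding lifts_def by blast
  obtain u2 where u2: "rep_hom n Y E u2" "mor_eq n (g oR u2) h2" using LY hh(2) unfolding lifts_def by blast
  note u = hcopair_hom[OF n X Y E u1(1) u2(1)]
  have "mor_eq n (g oR hcopair X Y E u1 u2) h"
  proof (rule mor_eqI[OF hom_comp[OF dsum_rep[OF n X Y] E Z u g] h])
   fix v and w :: "complex vec" assume v: "v < n" and w: "w \<in> Sp (X +R Y) v"
   obtain x y where xy: "x \<in> Sp X v" "y \<in> Sp Y v" "w = x @v y" by (rule dsum_vecE[OF w])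
   note ux = hom_vec[OF u1(1) v xy(1)] and uy = hom_vec[OF u2(1) v xy(2)]
   have "g v *v (u1 v *v x) = h1 v *v x" "g v *v (u2 v *v y) = h2 v *v y"
    using eq_vec[OF u1(2) v] comp_vec[OF u1(1) g v xy(1)] eq_vec[OF u2(2) v] comp_vec[OF u2(1) g v xy(2)] by auto
   thus "(g oR hcopair X Y E u1 u2) v *v w = h v *v w"
    unfolding comp_vec[OF u g v w] unfolding xy(3) hcopair_vec'[OF u1(1) u2(1) v xy(1,2)] hh(3)[OF v xy(1,2)]
     linD(2)[OF hom_lin[OF g v] ux uy] by simp
  qed
  thus "\<exists>u. rep_hom n (X +R Y) E u \<and> mor_eq n (g oR u) h" using u by blast
 qed
 show "lifts n E Z g X" if T: "is_rep n T" and s: "is_summand n X T" and LT: "lifts n E Z g T"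
  unfolding lifts_def
 proof (intro allI impI)
  fix h assume h: "rep_hom n X Z h"
  obtain i p where r: "rep_hom n X T i" "rep_hom n T X p"
   "!!v x. v < n ==> x \<in> Sp X v ==> p v *v (i v *v x) = x" using summand_retract[OF n s T] by blast
  obtain u where u: "rep_hom n T E u" "mor_eq n (g oR u) (h oR p)"
   using LT hom_comp[OF T X Z r(2) h] unfolding lifts_def by blast
  note ui = hom_comp[OF X T E r(1) u(1)]
  have "mor_eq n (g oR (u oR i)) h"
  proof (rule mor_eqI[OF hom_comp[OF X E Z ui g] h])
   fix v and x :: "complex vec" assume v: "v < n" and x: "x \<in> Sp X v"
   note ix = hom_vec[OF r(1) v x]
   show "(g oR (u oR i)) v *v x = h v *v x"
    unfolding comp_vec[OF ui g v x] comp_vec[OF r(1) u(1) v x]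
    using eq_vec[OF u(2) v, of "i v *v x"] comp_vec[OF u(1) g v ix] comp_vec[OF r(2) h v ix] r(3)[OF v x] by simp
  qed
  thus "\<exists>u. rep_hom n X E u \<and> mor_eq n (g oR u) h" using ui by blast
 qed
qed

lemma extends_closed:
 assumes n: "1 < n" and A: "is_rep n A" and F: "is_rep n F" and g: "rep_hom n A F g"
 shows extends_zero: "extends n A F g zero_rep"
  and extends_dsum: "is_rep n X ==> is_rep n Y ==> extends n A F g X ==> extends n A F g Y ==> extends n A F g (X +R Y)"
  and extends_summand: "is_rep n X ==> is_rep n T ==> is_summand n X T ==> extends n A F g T ==> extends n A F g X"
proof -
 show "extends n A F g zero_rep"
  unfolding extends_def
 proof (intro allI impI exI conjI)
  fix h assume h: "rep_hom n A zero_rep h"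
  show u: "rep_hom n F zero_rep (zmor F zero_rep)" by (rule zmor_hom[OF F zero_rep[OF n]])
  note ug = hom_comp[OF A F zero_rep[OF n] g u]
  show "mor_eq n (zmor F zero_rep oR g) h"
   by (rule mor_eqI[OF ug h], rule vec0_eq) (use hom_vec[OF ug] hom_vec[OF h] in auto)
 qed
 assume X: "is_rep n X"
 show "extends n A F g (X +R Y)" if Y: "is_rep n Y" and LX: "extends n A F g X" and LY: "extends n A F g Y"
  unfolding extends_def
 proof (intro allI impI)
  fix h assume h: "rep_hom n A (X +R Y) h"
  obtain h1 h2 where hh: "rep_hom n A X h1" "rep_hom n A Y h2"
   "!!v x. v < n ==> x \<in> Sp A v ==> h v *v x = (h1 v *v x) @v (h2 v *v x)"
   using dsum_hom_in[OF n A X Y h] by blast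
  obtain u1 where u1: "rep_hom n F X u1" "mor_eq n (u1 oR g) h1" using LX hh(1) unfolding extends_def by blast
  obtain u2 where u2: "rep_hom n F Y u2" "mor_eq n (u2 oR g) h2" using LY hh(2) unfolding extends_def by blast
  note u = hpair_hom[OF n F X Y u1(1) u2(1)]
  have "mor_eq n (hpair F X Y u1 u2 oR g) h"
  proof (rule mor_eqI[OF hom_comp[OF A F dsum_rep[OF n X Y] g u] h])
   fix v and x :: "complex vec" assume v: "v < n" and x: "x \<in> Sp A v"
   show "(hpair F X Y u1 u2 oR g) v *v x = h v *v x"
    unfolding comp_vec[OF g u v x] hpair_vec'[OF u1(1) u2(1) v hom_vec[OF g v x]] hh(3)[OF v x]
    using eq_vec[OF u1(2) v, of x] comp_vec[OF g u1(1) v x] eq_vec[OF u2(2) v, of x] comp_vec[OF g u2(1) v x] by simp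
  qed
  thus "\<exists>u. rep_hom n F (X +R Y) u \<and> mor_eq n (u oR g) h" using u by blast
 qed
 show "extends n A F g X" if T: "is_rep n T" and s: "is_summand n X T" and LT: "extends n A F g T"
  unfolding extends_def
 proof (intro allI impI)
  fix h assume h: "rep_hom n A X h"
  obtain i p where r: "rep_hom n X T i" "rep_hom n T X p"
   "!!v x. v < n ==> x \<in> Sp X v ==> p v *v (i v *v x) = x" using summand_retract[OF n s T] by blast
  obtain u where u: "rep_hom n F T u" "mor_eq n (u oR g) (i oR h)"
   using LT hom_comp[OF A X T h r(1)] unfolding extends_def by blast
  note pu = hom_comp[OF F T X u(1) r(2)]
  have "mor_eq n ((p oR u) oR g) h"
  proof (rule mor_eqI[OF hom_comp[OF A F X g pu] h])
   fix v and x :: "complex vec" assume v: "v < n" and x: "x \<in> Sp A v"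
   show "((p oR u) oR g) v *v x = h v *v x"
    unfolding comp_vec[OF g pu v x] comp_vec[OF u(1) r(2) v hom_vec[OF g v x]]
    using eq_vec[OF u(2) v, of x] comp_vec[OF g u(1) v x] comp_vec[OF h r(1) v x] r(3)[OF v hom_vec[OF h v x]] by simp
  qed
  thus "\<exists>u. rep_hom n F X u \<and> mor_eq n (u oR g) h" using pu by blast
 qed
qed

section \<open>Indecomposability and Krull-Schmidt for the submodules\<close>

text \<open>
A nonzero submodule of \<open>M_I\<close> contains its socle: move a nonzero vector to vertex 0 and apply
\<open>t\<close> until just before it vanishes.
\<close>

lemma sub_socle:
 assumes n: "1 < n" and I: "I \<subseteq> {1..n}" and A: "is_rep n A" and f: "rep_hom n A (M_mod n I) f"
  and inj: "!!v x. v < n ==> x \<in> Sp A v ==> f v *v x = 0v (vdim (M_mod n I) v) ==> x = 0v (vdim A v)"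
  and nz: "\<not> is_zero_rep n A"
 obtains x c where "x \<in> Sp A 0" "x \<noteq> 0v (vdim A 0)" "f 0 *v x = c *s es n I"
proof -
 have n0: "0 < n" using n by simp
 note rM = M_rep[OF n I] and mM = M_mono[OF n I] and vM = M_vdim[OF n I n0]
 obtain v where v: "v < n" "vdim A v \<noteq> 0" using nz unfolding is_zero_rep_def by blast
 let ?a = "unit_vec (vdim A v) 0 :: complex vec"
 have a: "?a \<in> Sp A v" "?a \<noteq> 0v (vdim A v)" using v(2) by auto
 have "inc A v ?a \<noteq> 0v (vdim A 0)"
 proof
  assume z: "inc A v ?a = 0v (vdim A 0)"
  have "inc (M_mod n I) v (f v *v ?a) = 0v (vdim (M_mod n I) 0)"
   using hom_inc[OF A rM f v(1) a(1)] z lin0[OF hom_lin[OF f n0]] by simp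
  hence "f v *v ?a = 0v (vdim (M_mod n I) v)" by (rule inc_inj[OF rM mM v(1) hom_vec[OF f v(1) a(1)]])
  thus False using inj[OF v(1) a(1)] a(2) by blast
 qed
 then obtain k where k: "(tt A ^^ k) (inc A v ?a) \<in> Sp A 0" "(tt A ^^ k) (inc A v ?a) \<noteq> 0v (vdim A 0)"
  "tt A ((tt A ^^ k) (inc A v ?a)) = 0v (vdim A 0)"
  using socle_power[OF A n linD(1)[OF lin_inc[OF A v(1)] a(1)]] by blast
 have "tt (M_mod n I) (f 0 *v (tt A ^^ k) (inc A v ?a)) = 0v (dd I 0)"
  unfolding hom_tt[OF A rM n f k(1)] k(3) using lin0[OF hom_lin[OF f n0]] vM by simp
 then obtain c where "f 0 *v (tt A ^^ k) (inc A v ?a) = c *s es n I"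
  using socle_es[OF n I hom_vec[OF f n0 k(1), unfolded vM]] by blast
 thus ?thesis by (rule that[OF k(1,2)])
qed

text \<open>Two nonzero summands would both contain the socle, which is simple.\<close>

lemma M_indecomposable:
 assumes n: "1 < n" and I: "I \<subseteq> {1..n}" and p: "0 < dd I 0"
 shows "indecomposable n (M_mod n I)"
 unfolding indecomposable_def
proof (intro conjI allI impI)
 have n0: "0 < n" using n by simp
 note rM = M_rep[OF n I] and vM = M_vdim[OF n I n0]
 show "is_rep n (M_mod n I)" by (rule rM)
 show "\<not> is_zero_rep n (M_mod n I)" using p vM n0 unfolding is_zero_rep_def by auto
 fix A B assume "is_rep n A \<and> is_rep n B \<and> rep_iso n (M_mod n I) (A +R B)"
 hence AB: "is_rep n A" "is_rep n B" and iso: "rep_iso n (M_mod n I) (A +R B)" by auto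
 note rAB = dsum_rep[OF n AB]
 obtain f g where f: "rep_hom n (M_mod n I) (A +R B) f" "rep_hom n (A +R B) (M_mod n I) g"
  "!!v x. v < n ==> x \<in> Sp (M_mod n I) v ==> g v *v (f v *v x) = x"
  "!!v y. v < n ==> y \<in> Sp (A +R B) v ==> f v *v (g v *v y) = y" using rep_isoE[OF iso] by blast
 note i1 = dsum_in1[OF n AB] and i2 = dsum_in2[OF n AB]
 note j1 = hom_comp[OF AB(1) rAB rM i1 f(2)] and j2 = hom_comp[OF AB(2) rAB rM i2 f(2)]
 have b1: "f v *v ((g oR in1 A B) v *v x) = x @v 0v (vdim B v)" if "v < n" "x \<in> Sp A v" for v x
  unfolding comp_vec[OF i1 f(2) that] f(4)[OF that(1) hom_vec[OF i1 that]] by (rule in1_vec[OF that(2)])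
 have b2: "f v *v ((g oR in2 A B) v *v x) = 0v (vdim A v) @v x" if "v < n" "x \<in> Sp B v" for v x
  unfolding comp_vec[OF i2 f(2) that] f(4)[OF that(1) hom_vec[OF i2 that]] by (rule in2_vec[OF that(2)])
 note fz = lin0[OF hom_lin[OF f(1)], unfolded vdim_dsum]
 have inj1: "x = 0v (vdim A v)" if v: "v < n" and x: "x \<in> Sp A v" and z: "(g oR in1 A B) v *v x = 0v (vdim (M_mod n I) v)" for v x
  using b1[OF v x] fz[OF v] append_vec_zero_iff[OF x zero_carrier_vec, of "vdim B v"] unfolding z by simp
 have inj2: "x = 0v (vdim B v)" if v: "v < n" and x: "x \<in> Sp B v" and z: "(g oR in2 A B) v *v x = 0v (vdim (M_mod n I) v)" for v x
  using b2[OF v x] fz[OF v] append_vec_zero_iff[OF zero_carrier_vec x, of "vdim A v"] unfolding z by simp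
 show "is_zero_rep n A \<or> is_zero_rep n B"
 proof (rule ccontr)
  assume "\<not> (is_zero_rep n A \<or> is_zero_rep n B)"
  hence nz: "\<not> is_zero_rep n A" "\<not> is_zero_rep n B" by auto
  obtain x c where x: "x \<in> Sp A 0" "x \<noteq> 0v (vdim A 0)" "(g oR in1 A B) 0 *v x = c *s es n I"
   using sub_socle[OF n I AB(1) j1 inj1 nz(1)] by blast
  obtain y d where y: "y \<in> Sp B 0" "y \<noteq> 0v (vdim B 0)" "(g oR in2 A B) 0 *v y = d *s es n I"
   using sub_socle[OF n I AB(2) j2 inj2 nz(2)] by blast
  have e: "es n I \<in> Sp (M_mod n I) 0" using es_carrier[OF n I] vM by simp
  have "d \<noteq> 0" using inj2[OF n0 y(1)] y(2,3) zero_smult_vec[OF e] by auto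
  note lf = linD(3)[OF hom_lin0[OF f(1) n0]]
  have "d *s (c *s es n I) = c *s (d *s es n I)" by (simp add: smult_smult_assoc mult.commute)
  hence "d *s (f 0 *v (c *s es n I)) = c *s (f 0 *v (d *s es n I))"
   using lf[of "c *s es n I" d] lf[of "d *s es n I" c] e by simp
  hence "(d *s x) @v 0v (vdim B 0) = 0v (vdim A 0) @v (c *s y)"
   using b1[OF n0 x(1)] b2[OF n0 y(1)] x(3) y(3) append_smult by simp
  hence "d *s x = 0v (vdim A 0)" using append_vec_eq[of "d *s x" "vdim A 0" "0v (vdim A 0)"] x(1) by simp
  hence "(1 / d) *s (d *s x) = 0v (vdim A 0)" by simp
  thus False using x(2) \<open>d \<noteq> 0\<close> by (simp add: smult_smult_assoc)
 qed
qed

text \<open>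
On the socle a composite \<open>M_I \<rightarrow> M_K \<rightarrow> M_I\<close> acts by the product of the
constant coefficients. If it is nonzero, then \<open>dd I = dd K\<close>, so \<open>I = K\<close>.
\<close>

lemma through_others:
 assumes n: "1 < n" and I: "I \<subseteq> {1..n}" and p: "0 < dd I 0"
 shows "I \<notin> set Ks ==> (!!K. K \<in> set Ks ==> K \<subseteq> {1..n}) ==> rep_hom n (M_mod n I) (dsum_list (map (M_mod n) Ks)) i ==>
  rep_hom n (dsum_list (map (M_mod n) Ks)) (M_mod n I) q ==> q 0 *v (i 0 *v es n I) = 0v (dd I 0)"
proof (induction Ks arbitrary: i q)
 have n0: "0 < n" using n by simp
 note rM = M_rep[OF n I] and vM = M_vdim[OF n I n0]
 have e: "es n I \<in> Sp (M_mod n I) 0" using es_carrier[OF n I] vM by simp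
 {
  case Nil
  have "i 0 *v es n I = 0v (vdim zero_rep 0)" using hom_vec[OF Nil(3) n0 e] by (intro vec0_eq) auto
  thus ?case using lin0[OF hom_lin0[OF Nil(4) n0]] vM by simp
 next
  case (Cons K Ks)
  let ?R = "dsum_list (map (M_mod n) Ks)"
  have K: "K \<subseteq> {1..n}" "I \<noteq> K" using Cons.prems(1,2) by auto
  note rK = M_rep[OF n K(1)]
  have rR: "is_rep n ?R" by (rule dsum_list_rep[OF n]) (use Cons.prems(2) M_rep[OF n] in auto)
  obtain i1 i2 where i: "rep_hom n (M_mod n I) (M_mod n K) i1" "rep_hom n (M_mod n I) ?R i2"
   "!!v x. v < n ==> x \<in> Sp (M_mod n I) v ==> i v *v x = (i1 v *v x) @v (i2 v *v x)"
   using dsum_hom_in[OF n rM rK rR Cons.prems(3)[simplified]] by blast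
  obtain q1 q2 where q: "rep_hom n (M_mod n K) (M_mod n I) q1" "rep_hom n ?R (M_mod n I) q2"
   "!!v x y. v < n ==> x \<in> Sp (M_mod n K) v ==> y \<in> Sp ?R v ==>
    q v *v (x @v y) = q1 v *v x + q2 v *v y"
   using dsum_hom_out[OF n rK rR rM Cons.prems(4)[simplified]] by blast
  have 2: "q2 0 *v (i2 0 *v es n I) = 0v (dd I 0)" by (rule Cons.IH[OF _ _ i(2) q(2)]) (use Cons.prems in auto)
  have 1: "q1 0 *v (i1 0 *v es n I) = 0v (dd I 0)"
  proof (cases "dd K 0 = 0")
   case True
   have "i1 0 *v es n I = 0v (vdim (M_mod n K) 0)" using hom_vec[OF i(1) n0 e] M_vdim[OF n K(1) n0] True by (intro vec0_eq) auto
   thus ?thesis using lin0[OF hom_lin0[OF q(1) n0]] vM by simp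
  next
   case False
   hence pK: "0 < dd K 0" by simp
   obtain c where c: "okc n I K c" "mor_eq n i1 (hm n I K c)" using hom_coef[OF n I K(1) i(1)] by blast
   obtain d where d: "okc n K I d" "mor_eq n q1 (hm n K I d)" using hom_coef[OF n K(1) I q(1)] by blast
   have eK: "es n K \<in> Sp (M_mod n K) 0" using es_carrier[OF n K(1)] M_vdim[OF n K(1) n0] by simp
   have v: "q1 0 *v (i1 0 *v es n I) = c 0 *s (d 0 *s es n I)"
    using eq_vec[OF c(2) n0] eq_vec[OF d(2) n0] hm_es[OF n I K(1) p pK, of c] hm_es[OF n K(1) I pK p, of d]
     linD(3)[OF hom_lin0[OF q(1) n0] eK, of "c 0"] by simp
   have "c 0 = 0 \<or> d 0 = 0"
   proof (rule ccontr)
    assume "\<not> (c 0 = 0 \<or> d 0 = 0)"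
    hence "dd I v = dd K v" if "v < n" for v using c(1) d(1) that unfolding okc_def by (metis add.right_neutral le_antisym)
    thus False using dd_determines[OF I K(1)] K(2) by blast
   qed
   thus ?thesis unfolding v using zero_smult_vec[OF e[unfolded vM]] zero_smult_vec[of "d 0 *s es n I" "dd I 0"] e vM by auto
  qed
  show ?case
   unfolding i(3)[OF n0 e] q(3)[OF n0 hom_vec[OF i(1) n0 e] hom_vec[OF i(2) n0 e]] 1 2 by simp
 }
qed

lemma T_coll_list:
 assumes n: "1 < n" and S: "!!K. K \<in> S ==> K \<subseteq> {1..n}"
 obtains xs where "distinct xs" "set xs = S" "T_coll n S = dsum_list (map (M_mod n) xs)"
proof -
 have "finite S" using S by (intro finite_subset[of S "Pow {1..n}"]) auto
 hence "\<exists>xs. distinct xs \<and> set xs = S" using finite_distinct_list by blast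
 from someI_ex[OF this] show ?thesis
  using that unfolding T_coll_def dsum_set_def by blast
qed

text \<open>Otherwise the identity of \<open>M_I\<close> would kill the socle.\<close>

lemma summand_T_coll:
 assumes n: "1 < n" and S: "!!K. K \<in> S ==> K \<subseteq> {1..n}" and I: "I \<subseteq> {1..n}" "0 < dd I 0"
  and s: "is_summand n (M_mod n I) (T_coll n S)"
 shows "I \<in> S"
proof (rule ccontr)
 assume nI: "I \<notin> S"
 have n0: "0 < n" using n by simp
 obtain xs where xs: "set xs = S" "T_coll n S = dsum_list (map (M_mod n) xs)" using T_coll_list[OF n S] by blast
 have rT: "is_rep n (T_coll n S)" unfolding xs(2) by (rule dsum_list_rep[OF n]) (use xs(1) S M_rep[OF n] in auto)
 have e: "es n I \<in> Sp (M_mod n I) 0" using es_carrier[OF n I(1)] M_vdim[OF n I(1) n0] by simp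
 obtain i p where r: "rep_hom n (M_mod n I) (T_coll n S) i" "rep_hom n (T_coll n S) (M_mod n I) p"
  "!!v x. v < n ==> x \<in> Sp (M_mod n I) v ==> p v *v (i v *v x) = x" using summand_retract[OF n s rT] by blast
 have "p 0 *v (i 0 *v es n I) = 0v (dd I 0)"
  by (rule through_others[OF n I _ _ r(1)[unfolded xs(2)] r(2)[unfolded xs(2)]]) (use xs(1) nI S in auto)
 hence "1 *s es n I = 0v (dd I 0)" using r(3)[OF n0 e] by simp
 thus False using es_smult_zero[OF n I, of 1] by simp
qed

lemma T_coll_complement:
 assumes n: "1 < n" and S: "!!K. K \<in> S ==> K \<subseteq> {1..n}" and I: "I \<in> S"
 obtains Ks where "set Ks = S - {I}" "rep_iso n (T_coll n S) (M_mod n I +R dsum_list (map (M_mod n) Ks))"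
proof -
 obtain xs where xs: "distinct xs" "set xs = S" "T_coll n S = dsum_list (map (M_mod n) xs)" using T_coll_list[OF n S] by blast
 obtain ys zs where yz: "xs = ys @ I # zs" using I xs(2) by (metis split_list)
 have rr: "is_rep n (M_mod n K)" if "K \<in> S" for K using M_rep[OF n S[OF that]] .
 have "set (ys @ zs) = S - {I}" using xs(1,2) yz by auto
 moreover have "rep_iso n (T_coll n S) (M_mod n I +R dsum_list (map (M_mod n) (ys @ zs)))"
  unfolding xs(3) yz map_append list.map by (rule dsum_list_split[OF n]) (use rr xs(2) yz in auto)
 ultimately show ?thesis by (rule that)
qed

lemma dsum_list_summand:
 assumes n: "1 < n" and r: "!!Y. Y \<in> set Xs ==> is_rep n Y" and X: "X \<in> set Xs"
 shows "is_summand n X (dsum_list Xs)"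
proof -
 obtain us vs where uv: "Xs = us @ X # vs" using X by (metis split_list)
 have "rep_iso n (dsum_list Xs) (X +R dsum_list (us @ vs))" unfolding uv by (rule dsum_list_split[OF n]) (use r uv in auto)
 moreover have "is_rep n (dsum_list (us @ vs))" by (rule dsum_list_rep[OF n]) (use r uv in auto)
 ultimately show ?thesis unfolding is_summand_def using r[OF X] by blast
qed

lemma dsum_list_induct:
 assumes n: "1 < n" and z: "P zero_rep" and s: "!!X Y. is_rep n X ==> is_rep n Y ==> P X ==> P Y ==> P (X +R Y)"
 shows "(!!X. X \<in> set Xs ==> is_rep n X \<and> P X) ==> P (dsum_list Xs)"
 by (induction Xs) (auto intro!: z s dsum_list_rep[OF n])



section \<open>The category F_Delta(J)\<close>

lemma dd_initial: "v \<le> p ==> dd {1..p} v = p - v" "p \<le> v ==> dd {1..p} v = 0"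
proof -
 have "{x \<in> {1..p}. v < x} = {Suc v..p}" by auto
 thus "v \<le> p ==> dd {1..p} v = p - v" "p \<le> v ==> dd {1..p} v = 0" by (simp_all add: dd_def)
qed

lemma dd_0_le: "finite I ==> dd I 0 \<le> dd I v + v"
proof (induction v)
 case (Suc v)
 thus ?case using dd_le_Suc[of I v] by simp
qed simp

text \<open>
The subspace of vertex \<open>v\<close> has dimension \<open>p - v\<close> and is therefore \<open>t^v\<close>
times the whole space.
\<close>

lemma T_mod_generated:
 assumes n: "1 < n" and p: "p \<le> n" and v: "v < n" and y: "y \<in> cvec (vdim (M_mod n {1..p}) v)"
 shows "\<exists>x\<in>cvec (vdim (M_mod n {1..p}) 0). path_act (M_mod n {1..p}) x v 0 = y"
proof -
 let ?I = "{1..p}" and ?T = "M_mod n {1..p}"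
 have I: "?I \<subseteq> {1..n}" and n0: "0 < n" using p n by auto
 note rT = M_rep[OF n I] and mT = M_mono[OF n I] and vT = M_vdim[OF n I n0]
 have "inc ?T v y \<in> isub ?T v" by (rule isubI[OF y refl])
 then obtain u where u: "u \<in> cvec (dd ?I 0)" "\<forall>r<dd ?I 0. dd ?I v \<le> r --> u $ r = 0" "inc ?T v y = PP n ?I 0 *v u"
  unfolding isub_low[OF n I v] low_def by blast
 define x' where "x' = vec (dd ?I 0) (\<lambda>r. if v \<le> r then u $ (r - v) else 0)"
 have x': "x' \<in> cvec (dd ?I 0)" by (simp add: x'_def)
 have d': "dd ?I v + v = dd ?I 0 \<or> dd ?I v = 0" using dd_initial[of v p] dd_initial(2)[of p v] dd_initial[of 0 p] by (cases "v \<le> p") auto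
 have "(tt (Nmod ?I) ^^ v) x' = u"
 proof (rule eq_vecI)
  show "dim_vec ((tt (Nmod ?I) ^^ v) x') = dim_vec u" using Nmod_tt_carrier[OF n I x'] u(1) by auto
  fix a assume "a < dim_vec u"
  hence a: "a < dd ?I 0" using u(1) by simp
  show "(tt (Nmod ?I) ^^ v) x' $ a = u $ a"
  proof (cases "a + v < dd ?I 0")
   case False
   hence "dd ?I v \<le> a" using d' by auto
   thus ?thesis unfolding Nmod_tt_pow[OF n I x' a] using False u(2) a by simp
  next
   case True
   thus ?thesis unfolding Nmod_tt_pow[OF n I x' a] by (simp add: x'_def)
  qed
 qed
 hence t: "(tt ?T ^^ v) (PP n ?I 0 *v x') = inc ?T v y"
  using hom_tt_pow[OF Nmod_rep[OF n I] rT n iso_hom[OF PP_iso[OF n I]], of x' v] x' u(3) by simp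
 have Px: "PP n ?I 0 *v x' \<in> Sp ?T 0" using PP_vec[OF n I n0 x'] vT by simp
 note pc = linD(1)[OF linmap_path_act[OF rT v] Px]
 have "path_act ?T (PP n ?I 0 *v x') v 0 = y"
  by (rule inc_inject[OF rT mT v pc y]) (simp only: inc_path_act[OF rT n Px v] t)
 thus ?thesis using Px by blast
qed

text \<open>
The submodule generated at vertex 0 is \<open>T_p\<close>, \<open>p = |I|\<close>: the identity of the space at
vertex 0 is a morphism \<open>T_p \<rightarrow> M_I\<close>, and \<open>T_p\<close> is generated at vertex 0.
\<close>

lemma M_mod_F_DeltaJ:
 assumes n: "1 < n" and J: "J \<subseteq> {1..n - 1}" and I: "I \<subseteq> {1..n}" and c: "card I \<in> J"
 shows "F_DeltaJ n J (M_mod n I)"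
proof -
 let ?p = "card I" and ?T = "M_mod n {1..card I}" and ?f = "hm n {1..card I} I (delta 0)"
 have n0: "0 < n" using n by simp
 have p: "?p \<le> n" "0 < ?p" using subsetD[OF J c] by auto
 have T: "{1..?p} \<subseteq> {1..n}" using p by auto
 have fI: "finite I" using I finite_subset by blast
 have d0: "dd {1..?p} 0 = dd I 0" using dd_0[OF T] dd_0[OF I] by simp
 have dp: "0 < dd I 0" using dd_0[OF I] p by simp
 note rT = M_rep[OF n T] and rM = M_rep[OF n I] and mT = M_mono[OF n T] and vT = M_vdim[OF n T n0] and vM = M_vdim[OF n I n0]
 have "dd {1..?p} v \<le> dd I v" for v
  using dd_0_le[OF fI, of v] dd_initial[of v ?p] dd_initial(2)[of ?p v] dd_0[OF I] by (cases "v \<le> ?p") auto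
 hence "okc n {1..?p} I (delta 0)" by (auto simp: okc_def delta_def split: if_splits intro: trans_le_add1)
 note f = hm_hom[OF n T I this]
 have inj0: "inj_mat (?f 0)"
 proof (rule inj_of_socle[OF rT rM n f])
  fix w :: "complex vec" assume w: "w \<in> Sp ?T 0" "tt ?T w = 0v (vdim ?T 0)" "?f 0 *v w = 0v (vdim (M_mod n I) 0)"
  obtain a where a: "w = a *s es n {1..?p}" using socle_es[OF n T w(1,2)[unfolded vT]] by blast
  have e: "es n {1..?p} \<in> Sp ?T 0" using es_carrier[OF n T] vT by simp
  have "a *s es n I = 0v (dd I 0)"
   using w(3) linD(3)[OF hom_lin0[OF f n0] e, of a] hm_es[OF n T I _ dp, of "delta 0"] d0 dp vM
   by (simp add: a delta_def)
  hence "a = 0" by (rule es_smult_zero[OF n I dp])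
  thus "w = 0v (vdim ?T 0)" using a zero_smult_vec[OF e] by simp
 qed
 have inj: "inj_mat (?f v)" if "v < n" for v by (rule inj_of_inj0[OF rT rM mT f inj0 that])
 have mono: "mono_mor n ?T ?f"
  unfolding mono_mor_def using inj inj_mat_iff[OF hom_mat[OF f]] by blast
 have surj0: "\<exists>x\<in>Sp ?T 0. ?f 0 *v x = y" if "y \<in> Sp (M_mod n I) 0" for y
 proof -
  have "?f 0 \<in> carrier_mat (dd I 0) (dd I 0)" using hom_mat[OF f n0] vT vM d0 by simp
  from inj_square_surj[OF this inj0] that show ?thesis using vT vM d0 by metis
 qed
 have img: "(\<lambda>x. ?f v *v x) ` vspace ?T v = eta n (M_mod n I) v" if v: "v < n" for v
 proof (intro equalityI subsetI)
  fix w assume "w \<in> (\<lambda>x. ?f v *v x) ` vspace ?T v"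
  then obtain y where y: "y \<in> Sp ?T v" "w = ?f v *v y" by (auto simp: vspace_def)
  obtain x where x: "x \<in> Sp ?T 0" "path_act ?T x v 0 = y" using T_mod_generated[OF n p(1) v y(1)] by blast
  hence "w = path_act (M_mod n I) (?f 0 *v x) v 0" using hom_path_act[OF rT rM n f v x(1)] y(2) by simp
  thus "w \<in> eta n (M_mod n I) v" unfolding eta_iff[OF rM n v] using hom_vec[OF f n0 x(1)] by blast
 next
  fix w assume "w \<in> eta n (M_mod n I) v"
  then obtain y where y: "y \<in> Sp (M_mod n I) 0" "w = path_act (M_mod n I) y v 0" unfolding eta_iff[OF rM n v] by blast
  obtain x where x: "x \<in> Sp ?T 0" "?f 0 *v x = y" using surj0[OF y(1)] by blast
  have "w = ?f v *v path_act ?T x v 0" using hom_path_act[OF rT rM n f v x(1)] x(2) y(2) by simp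
  thus "w \<in> (\<lambda>x. ?f v *v x) ` vspace ?T v" unfolding vspace_def using linD(1)[OF linmap_path_act[OF rT v] x(1)] by blast
 qed
 have fJ: "finite J" using J finite_subset by blast
 have rTj: "is_rep n (T_mod n j)" if "j \<in> J" for j unfolding T_mod_def using that J by (intro M_rep[OF n]) auto
 have "\<exists>xs. distinct xs \<and> set xs = J" using finite_distinct_list[OF fJ] by blast
 from someI_ex[OF this] obtain xs where xs: "set xs = J" "dsum_set (T_mod n) J = dsum_list (map (T_mod n) xs)"
  unfolding dsum_set_def by blast
 have "is_summand n (T_mod n ?p) (dsum_set (T_mod n) J)"
  unfolding xs(2) by (rule dsum_list_summand[OF n]) (use xs(1) rTj c in auto)
 hence "in_add n (dsum_set (T_mod n) J) ?T"
  using in_add_summand[OF n, of "dsum_set (T_mod n) J"] dsum_list_rep[OF n, of "map (T_mod n) xs"] xs rTj by (auto simp: T_mod_def)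
 thus ?thesis
  unfolding F_DeltaJ_def using M_mod_F_Delta[OF n I] rT f mono img by blast
qed

lemma path_act_dsum:
 assumes n: "1 < n" and X: "is_rep n X" and Y: "is_rep n Y" and x: "x \<in> Sp X 0" and y: "y \<in> Sp Y 0"
 shows "v < n ==> path_act (X +R Y) (x @v y) v 0 = path_act X x v 0 @v path_act Y y v 0"
proof (induction v)
 case (Suc v)
 note v = Suc_lessD[OF Suc.prems]
 show ?case
  using Suc.IH[OF v] dsum_b[OF X Y Suc.prems linD(1)[OF linmap_path_act[OF X v] x] linD(1)[OF linmap_path_act[OF Y v] y]] by simp
qed simp

lemma F_DeltaJ_dsum:
 assumes n: "1 < n" and J: "J \<subseteq> {1..n - 1}" and X: "F_DeltaJ n J X" and Y: "F_DeltaJ n J Y"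
 shows "F_DeltaJ n J (X +R Y)"
proof -
 let ?T = "dsum_set (T_mod n) J"
 obtain X' f where f: "F_Delta n X" "is_rep n X'" "rep_hom n X' X f" "mono_mor n X' f"
  "!!v. v < n ==> (\<lambda>x. f v *v x) ` vspace X' v = eta n X v" "in_add n ?T X'" using X unfolding F_DeltaJ_def by blast
 obtain Y' g where g: "F_Delta n Y" "is_rep n Y'" "rep_hom n Y' Y g" "mono_mor n Y' g"
  "!!v. v < n ==> (\<lambda>x. g v *v x) ` vspace Y' v = eta n Y v" "in_add n ?T Y'" using Y unfolding F_DeltaJ_def by blast
 note rX = F_Delta_rep[OF f(1)] and rY = F_Delta_rep[OF g(1)]
 have rT: "is_rep n ?T"
 proof -
  have "\<exists>xs. distinct xs \<and> set xs = J" using finite_distinct_list[OF finite_subset[OF J finite_atLeastAtMost]] by blast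
  from someI_ex[OF this] show ?thesis
   unfolding dsum_set_def by (intro dsum_list_rep[OF n]) (use subsetD[OF J] in \<open>fastforce simp: T_mod_def intro!: M_rep[OF n]\<close>)
 qed
 note h = mor_dsum_hom[OF n f(2) rX g(2) rY f(3) g(3)]
 have mono: "mono_mor n (X' +R Y') (mor_dsum f g)"
  unfolding mono_mor_def
 proof (intro allI impI inj_onI)
  fix v and w w' :: "complex vec" assume v: "v < n" and w: "w \<in> Sp (X' +R Y') v" "w' \<in> Sp (X' +R Y') v"
   and eq: "mor_dsum f g v *v w = mor_dsum f g v *v w'"
  obtain x y where xy: "x \<in> Sp X' v" "y \<in> Sp Y' v" "w = x @v y" by (rule dsum_vecE[OF w(1)])
  obtain x' y' where xy': "x' \<in> Sp X' v" "y' \<in> Sp Y' v" "w' = x' @v y'" by (rule dsum_vecE[OF w(2)])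
  have "f v *v x = f v *v x' \<and> g v *v y = g v *v y'"
   using eq mor_dsum_vec[OF f(3) g(3) v xy(1,2)] mor_dsum_vec[OF f(3) g(3) v xy'(1,2)] xy(3) xy'(3)
    append_vec_eq[OF hom_vec[OF f(3) v xy(1)] hom_vec[OF f(3) v xy'(1)]] by simp
  thus "w = w'" using f(4) g(4) v xy xy' unfolding mono_mor_def by (auto dest: inj_onD)
 qed
 have img: "(\<lambda>x. mor_dsum f g v *v x) ` vspace (X' +R Y') v = eta n (X +R Y) v" if v: "v < n" for v
 proof -
  have "(\<lambda>x. mor_dsum f g v *v x) ` vspace (X' +R Y') v = {a @v b |a b. a \<in> eta n X v \<and> b \<in> eta n Y v}"
  proof (intro equalityI subsetI)
   fix w assume "w \<in> (\<lambda>x. mor_dsum f g v *v x) ` vspace (X' +R Y') v"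
   then obtain z where z: "z \<in> Sp (X' +R Y') v" "w = mor_dsum f g v *v z" by (auto simp: vspace_def)
   obtain x y where xy: "x \<in> Sp X' v" "y \<in> Sp Y' v" "z = x @v y" by (rule dsum_vecE[OF z(1)])
   have "w = (f v *v x) @v (g v *v y)" using z(2) xy(3) mor_dsum_vec[OF f(3) g(3) v xy(1,2)] by simp
   thus "w \<in> {a @v b |a b. a \<in> eta n X v \<and> b \<in> eta n Y v}"
    using f(5)[OF v] g(5)[OF v] xy unfolding vspace_def by blast
  next
   fix w assume "w \<in> {a @v b |a b. a \<in> eta n X v \<and> b \<in> eta n Y v}"
   then obtain x y where xy: "x \<in> Sp X' v" "y \<in> Sp Y' v" "w = (f v *v x) @v (g v *v y)"
    unfolding f(5)[OF v, symmetric] g(5)[OF v, symmetric] vspace_def by blast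
   hence "w = mor_dsum f g v *v (x @v y)" "x @v y \<in> vspace (X' +R Y') v"
    using mor_dsum_vec[OF f(3) g(3) v xy(1,2)] by (auto simp: vspace_def)
   thus "w \<in> (\<lambda>x. mor_dsum f g v *v x) ` vspace (X' +R Y') v" by blast
  qed
  also have "\<dots> = eta n (X +R Y) v"
  proof (intro equalityI subsetI)
   fix w assume "w \<in> {a @v b |a b. a \<in> eta n X v \<and> b \<in> eta n Y v}"
   then obtain x y where xy: "x \<in> Sp X 0" "y \<in> Sp Y 0" "w = path_act X x v 0 @v path_act Y y v 0"
    unfolding eta_iff[OF rX n v] eta_iff[OF rY n v] by blast
   have "w = path_act (X +R Y) (x @v y) v 0" using path_act_dsum[OF n rX rY xy(1,2) v] xy(3) by simp
   moreover have "x @v y \<in> Sp (X +R Y) 0" using xy by simp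
   ultimately show "w \<in> eta n (X +R Y) v" unfolding eta_iff[OF dsum_rep[OF n rX rY] n v] by blast
  next
   fix w assume "w \<in> eta n (X +R Y) v"
   then obtain z where z: "z \<in> Sp (X +R Y) 0" "w = path_act (X +R Y) z v 0"
    unfolding eta_iff[OF dsum_rep[OF n rX rY] n v] by blast
   obtain x y where xy: "x \<in> Sp X 0" "y \<in> Sp Y 0" "z = x @v y" by (rule dsum_vecE[OF z(1)])
   have "w = path_act X x v 0 @v path_act Y y v 0" using path_act_dsum[OF n rX rY xy(1,2) v] xy(3) z(2) by simp
   thus "w \<in> {a @v b |a b. a \<in> eta n X v \<and> b \<in> eta n Y v}"
    unfolding eta_iff[OF rX n v] eta_iff[OF rY n v] using xy(1,2) by blast
  qed
  finally show ?thesis .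
 qed
 show ?thesis
  unfolding F_DeltaJ_def
  using F_Delta_dsum[OF n f(1) g(1)] dsum_rep[OF n f(2) g(2)] h mono img in_add_dsum[OF n rT f(6) g(6)] by blast
qed

section \<open>Mutation\<close>

text \<open>
The first sequence ends and the second one begins in the module to be mutated. What is assumed of
\<open>K\<close> are the hypotheses of the lifting criteria \<open>factor_right\<close> and
\<open>factor_left\<close>.
\<close>

lemma exchange_mutation:
 assumes X: "exchange n A B C Z s" and Y: "exchange n Z B' C' A s'"
  and J: "J \<subseteq> {1..n - 1}" and S: "!!K. K \<in> S ==> K \<subseteq> {1..n}" and SJ: "!!K. K \<in> S ==> card K \<in> J" and AJ: "card A \<in> J"
  and T: "cluster_tilting n J (T_coll n S)" and Z: "Z \<in> S" and mem: "B \<in> S - {Z}" "C \<in> S - {Z}" "B' \<in> S - {Z}" "C' \<in> S - {Z}"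
  and right: "!!K t. K \<in> S - {Z} ==> \<forall>v<n. dd K v \<le> dd Z v + t ==>
    (\<forall>v<n. dd K v \<le> dd B v + t) \<or> (s \<le> t \<and> (\<forall>v<n. dd K v \<le> dd C v + (t - s)))"
  and left: "!!K t. K \<in> S - {Z} ==> \<forall>v<n. dd Z v \<le> dd K v + t ==>
    (\<forall>v<n. dd C' v \<le> dd K v + t) \<or> (s' \<le> t \<and> (\<forall>v<n. dd B' v \<le> dd K v + (t - s')))"
 shows "mutation_sequences n J (T_coll n S) (M_mod n Z) (M_mod n A) (M_mod n B +R M_mod n C) (exchange.ff n A B C s) (exchange.gg n B C Z s)
   (M_mod n B' +R M_mod n C') (exchange.ff n Z B' C' s') (exchange.gg n B' C' A s')"
proof -
 interpret X: exchange n A B C Z s by (rule X)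
 interpret Y: exchange n Z B' C' A s' by (rule Y)
 note n = X.n
 have n0: "0 < n" using n by simp
 note rZ = M_rep[OF n X.Z] and rA = M_rep[OF n X.A] and rB = M_rep[OF n X.B] and rC = M_rep[OF n X.C]
  and rB' = M_rep[OF n Y.B] and rC' = M_rep[OF n Y.C]
 note E = dsum_rep[OF n rB rC] and F = dsum_rep[OF n rB' rC']
 have posA: "0 < dd A 0" using X.posA by simp
 have FJ: "F_DeltaJ n J (M_mod n K)" if "K \<in> S" for K by (rule M_mod_F_DeltaJ[OF n J S[OF that] SJ[OF that]])
 have FA: "F_DeltaJ n J (M_mod n A)" by (rule M_mod_F_DeltaJ[OF n J X.A AJ])
 have FE: "F_DeltaJ n J (M_mod n B +R M_mod n C)" by (rule F_DeltaJ_dsum[OF n J FJ FJ]) (use mem in auto)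
 have np: "\<not> projectiveJ n J (M_mod n Z)"
 proof
  assume "projectiveJ n J (M_mod n Z)"
  then obtain u where "rep_hom n (M_mod n Z) (M_mod n B +R M_mod n C) u" "mor_eq n (X.gg oR u) (mor_id (M_mod n Z))"
   unfolding projectiveJ_def using FA FE FJ[OF Z] X.exchange_exact rep_hom_id[OF rZ] by blast
  thus False using X.nonsplit by blast
 qed
 obtain Ks where Ks: "set Ks = S - {Z}" "rep_iso n (T_coll n S) (M_mod n Z +R dsum_list (map (M_mod n) Ks))"
  using T_coll_complement[OF n S Z] by blast
 let ?U = "dsum_list (map (M_mod n) Ks)"
 have rK: "is_rep n (M_mod n K)" if "K \<in> S - {Z}" for K using M_rep[OF n S] that by blast
 have rU: "is_rep n ?U" by (rule dsum_list_rep[OF n]) (use Ks(1) rK in auto)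
 have addU: "in_add n ?U (M_mod n K)" if "K \<in> S - {Z}" for K
  by (rule in_add_summand[OF n rU dsum_list_summand[OF n]]) (use Ks(1) rK that in auto)
 have lift: "lifts n (M_mod n B +R M_mod n C) (M_mod n Z) X.gg (M_mod n K)" if K: "K \<in> S - {Z}" for K
  unfolding lifts_def
 proof (intro allI impI)
  fix h assume h: "rep_hom n (M_mod n K) (M_mod n Z) h"
  have KS: "K \<subseteq> {1..n}" using K S by blast
  show "\<exists>u. rep_hom n (M_mod n K) (M_mod n B +R M_mod n C) u \<and> mor_eq n (X.gg oR u) h"
   by (rule X.factor_right[OF KS right[OF K] h]) blast+
 qed
 have ext: "extends n (M_mod n Z) (M_mod n B' +R M_mod n C') Y.ff (M_mod n K)" if K: "K \<in> S - {Z}" for K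
  unfolding extends_def
 proof (intro allI impI)
  fix h assume h: "rep_hom n (M_mod n Z) (M_mod n K) h"
  have KS: "K \<subseteq> {1..n}" using K S by blast
  show "\<exists>u. rep_hom n (M_mod n B' +R M_mod n C') (M_mod n K) u \<and> mor_eq n (u oR Y.ff) h"
   by (rule Y.factor_left[OF KS left[OF K] h]) blast+
 qed
 note lc = lifts_closed[OF n E rZ X.gg_hom] and ec = extends_closed[OF n rZ F Y.ff_hom]
 have liftU: "lifts n (M_mod n B +R M_mod n C) (M_mod n Z) X.gg ?U"
  by (rule dsum_list_induct[OF n lc(1,2)]) (use lift rK Ks(1) in auto)
 have extU: "extends n (M_mod n Z) (M_mod n B' +R M_mod n C') Y.ff ?U"
  by (rule dsum_list_induct[OF n ec(1,2)]) (use ext rK Ks(1) in auto)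
 have liftX: "lifts n (M_mod n B +R M_mod n C) (M_mod n Z) X.gg W" if "in_add n ?U W" for W
  by (rule in_add_induct[where P = "lifts n (M_mod n B +R M_mod n C) (M_mod n Z) X.gg", OF n that rU liftU lc])
 have extX: "extends n (M_mod n Z) (M_mod n B' +R M_mod n C') Y.ff W" if "in_add n ?U W" for W
  by (rule in_add_induct[where P = "extends n (M_mod n Z) (M_mod n B' +R M_mod n C') Y.ff", OF n that rU extU ec])
 have "right_min_approx n ?U (M_mod n B +R M_mod n C) (M_mod n Z) X.gg"
  unfolding right_min_approx_def
  using in_add_dsum[OF n rU addU[OF mem(1)] addU[OF mem(2)]] X.gg_hom liftX X.gg_right_minimal unfolding lifts_def by blast
 moreover have "left_min_approx n ?U (M_mod n B' +R M_mod n C') (M_mod n Z) Y.ff"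
  unfolding left_min_approx_def
  using in_add_dsum[OF n rU addU[OF mem(3)] addU[OF mem(4)]] Y.ff_hom extX Y.ff_left_minimal unfolding extends_def by blast
 ultimately show ?thesis
  unfolding mutation_sequences_def
  using T M_indecomposable[OF n X.Z X.posZ] np FA M_indecomposable[OF n X.A posA] X.exchange_exact Y.exchange_exact rU Ks(2) by blast
qed

theorem proposition12p6:
  fixes n i j k :: nat and L :: "nat set"
  assumes "n > 1"
    and "L \<subseteq> {1..n}" and "{i, j, k} \<subseteq> {1..n}" and "i < j" and "j < k"
    and "L \<inter> {i, j, k} = {}"
  shows
    "has_dim (ext1 n (M_mod n (L \<union> {j})) (M_mod n (L \<union> {i, k}))) 1 \<and>
     (\<exists>f f' g g'.
        E_exact n (M_mod n (L \<union> {i, k}))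
                  (M_mod n (L \<union> {i}) \<oplus>\<^sub>R M_mod n (L \<union> {j, k}))
                  (M_mod n (L \<union> {j})) f f' \<and>
        E_exact n (M_mod n (L \<union> {j}))
                  (M_mod n (L \<union> {i, j}) \<oplus>\<^sub>R M_mod n (L \<union> {k}))
                  (M_mod n (L \<union> {i, k})) g g' \<and>
        (\<forall>J S. J \<subseteq> {1..n - 1} \<and> (\<exists>p q. J = {p..q}) \<and> max_ws_collection n J S \<and>
               cluster_tilting n J (T_coll n S) \<and>
               is_summand n (M_mod n (L \<union> {i})) (T_coll n S) \<and>
               is_summand n (M_mod n (L \<union> {k})) (T_coll n S) \<and>
               is_summand n (M_mod n (L \<union> {i, j})) (T_coll n S) \<and>
               is_summand n (M_mod n (L \<union> {j, k})) (T_coll n S) \<longrightarrow>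
           (is_summand n (M_mod n (L \<union> {j})) (T_coll n S) \<longrightarrow>
              mutation_sequences n J (T_coll n S) (M_mod n (L \<union> {j})) (M_mod n (L \<union> {i, k}))
                (M_mod n (L \<union> {i}) \<oplus>\<^sub>R M_mod n (L \<union> {j, k})) f f'
                (M_mod n (L \<union> {i, j}) \<oplus>\<^sub>R M_mod n (L \<union> {k})) g g') \<and>
           (is_summand n (M_mod n (L \<union> {i, k})) (T_coll n S) \<longrightarrow>
              mutation_sequences n J (T_coll n S) (M_mod n (L \<union> {i, k})) (M_mod n (L \<union> {j}))
                (M_mod n (L \<union> {i, j}) \<oplus>\<^sub>R M_mod n (L \<union> {k})) g g'
                (M_mod n (L \<union> {i}) \<oplus>\<^sub>R M_mod n (L \<union> {j, k})) f f')))"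
proof (intro conjI exI allI impI; (elim conjE)?)
 let ?Li = "L \<union> {i}" and ?Lj = "L \<union> {j}" and ?Lk = "L \<union> {k}" and ?Lij = "L \<union> {i, j}" and ?Lik = "L \<union> {i, k}" and ?Ljk = "L \<union> {j, k}"
 note n = assms(1) and L = assms(2) and ijk = assms(3-6)
 note Xj = exchange_j[OF n L ijk] and Xik = exchange_ik[OF n L ijk] and sb = subs[OF n L ijk]
 show "has_dim (ext1 n (M_mod n ?Lj) (M_mod n ?Lik)) 1"
  by (rule ext1_exchange_dim_one[OF n L ijk])
 show "E_exact n (M_mod n ?Lik) (M_mod n ?Li +R M_mod n ?Ljk) (M_mod n ?Lj)
   (exchange.ff n ?Lik ?Li ?Ljk 1) (exchange.gg n ?Li ?Ljk ?Lj 1)"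
  by (rule exchange.exchange_exact[OF Xj])
 show "E_exact n (M_mod n ?Lj) (M_mod n ?Lij +R M_mod n ?Lk) (M_mod n ?Lik)
   (exchange.ff n ?Lj ?Lij ?Lk 0) (exchange.gg n ?Lij ?Lk ?Lik 0)"
  by (rule exchange.exchange_exact[OF Xik])
 fix J S
 assume J: "J \<subseteq> {1..n - 1}" and max: "max_ws_collection n J S" and T: "cluster_tilting n J (T_coll n S)"
  and s: "is_summand n (M_mod n ?Li) (T_coll n S)" "is_summand n (M_mod n ?Lk) (T_coll n S)"
   "is_summand n (M_mod n ?Lij) (T_coll n S)" "is_summand n (M_mod n ?Ljk) (T_coll n S)"
 have S: "K \<subseteq> {1..n}" and SJ: "card K \<in> J" if "K \<in> S" for K
  using max that unfolding max_ws_collection_def ws_collection_def by auto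
 have ws: "weakly_separated K K'" if "K \<in> S" "K' \<in> S" for K K'
  using max that unfolding max_ws_collection_def ws_collection_def by blast
 have fL: "finite L" using L finite_subset by blast
 have inS: "K \<in> S" if "is_summand n (M_mod n K) (T_coll n S)" "K \<subseteq> {1..n}" "K \<noteq> {}" for K
 proof (rule summand_T_coll[OF n S that(2) _ that(1)])
  show "0 < dd K 0" using that dd_0[OF that(2)] finite_subset[OF that(2)] by (simp add: card_gt_0_iff)
 qed
 have m: "?Li \<in> S" "?Lk \<in> S" "?Lij \<in> S" "?Ljk \<in> S"
  using inS[OF s(1) sb(1)] inS[OF s(2) sb(3)] inS[OF s(3) sb(4)] inS[OF s(4) sb(6)] by auto
 have "card ?Lj = card ?Li" "card ?Lik = card ?Lij" using ijk fL by auto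
 hence cJ: "card ?Lj \<in> J" "card ?Lik \<in> J" using SJ[OF m(1)] SJ[OF m(3)] by auto
 have wsK: "weakly_separated K ?Li" "weakly_separated K ?Lk" "weakly_separated K ?Lij" "weakly_separated K ?Ljk"
  if "K \<in> S" for K using ws[OF that] m by auto
 have ne: "x \<noteq> y" if "z \<in> x - y \<or> z \<in> y - x" for x y :: "nat set" and z using that by blast
 have dist: "?Li \<noteq> ?Lj" "?Lk \<noteq> ?Lj" "?Lij \<noteq> ?Lj" "?Ljk \<noteq> ?Lj"
  "?Li \<noteq> ?Lik" "?Lk \<noteq> ?Lik" "?Lij \<noteq> ?Lik" "?Ljk \<noteq> ?Lik"
  by (rule ne[of i] ne[of k] ne[of i] ne[of k] ne[of k] ne[of i] ne[of j] ne[of j], use ijk in force)+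
 show "mutation_sequences n J (T_coll n S) (M_mod n ?Lj) (M_mod n ?Lik)
   (M_mod n ?Li +R M_mod n ?Ljk)
   (exchange.ff n ?Lik ?Li ?Ljk 1) (exchange.gg n ?Li ?Ljk ?Lj 1)
   (M_mod n ?Lij +R M_mod n ?Lk)
   (exchange.ff n ?Lj ?Lij ?Lk 0) (exchange.gg n ?Lij ?Lk ?Lik 0)"
  if sj: "is_summand n (M_mod n ?Lj) (T_coll n S)"
 proof (rule exchange_mutation[OF Xj Xik J S SJ cJ(2) T])
  show jS: "?Lj \<in> S" using inS[OF sj sb(2)] by simp
  show "?Li \<in> S - {?Lj}" "?Ljk \<in> S - {?Lj}" "?Lij \<in> S - {?Lj}" "?Lk \<in> S - {?Lj}"
   using m dist by auto
  fix K t assume K: "K \<in> S - {?Lj}"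
  hence KS: "K \<in> S" "K \<noteq> ?Lj" by auto
  show "\<forall>v<n. dd K v \<le> dd ?Lj v + t ==>
    (\<forall>v<n. dd K v \<le> dd ?Li v + t) \<or> (1 \<le> t \<and> (\<forall>v<n. dd K v \<le> dd ?Ljk v + (t - 1)))"
   by (rule right_cond_j[OF n L ijk S[OF KS(1)] wsK[OF KS(1)] ws[OF KS(1) jS] KS(2)])
  show "\<forall>v<n. dd ?Lj v \<le> dd K v + t ==>
    (\<forall>v<n. dd ?Lk v \<le> dd K v + t) \<or> (0 \<le> t \<and> (\<forall>v<n. dd ?Lij v \<le> dd K v + (t - 0)))"
   by (rule left_cond_j[OF n L ijk S[OF KS(1)] wsK[OF KS(1)] ws[OF KS(1) jS] KS(2)])
 qed
 show "mutation_sequences n J (T_coll n S) (M_mod n ?Lik) (M_mod n ?Lj)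
   (M_mod n ?Lij +R M_mod n ?Lk)
   (exchange.ff n ?Lj ?Lij ?Lk 0) (exchange.gg n ?Lij ?Lk ?Lik 0)
   (M_mod n ?Li +R M_mod n ?Ljk)
   (exchange.ff n ?Lik ?Li ?Ljk 1) (exchange.gg n ?Li ?Ljk ?Lj 1)"
  if sik: "is_summand n (M_mod n ?Lik) (T_coll n S)"
 proof (rule exchange_mutation[OF Xik Xj J S SJ cJ(1) T])
  show ikS: "?Lik \<in> S" using inS[OF sik sb(5)] by simp
  show "?Lij \<in> S - {?Lik}" "?Lk \<in> S - {?Lik}" "?Li \<in> S - {?Lik}" "?Ljk \<in> S - {?Lik}"
   using m dist by auto
  fix K t assume K: "K \<in> S - {?Lik}"
  hence KS: "K \<in> S" "K \<noteq> ?Lik" by auto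
  show "\<forall>v<n. dd K v \<le> dd ?Lik v + t ==>
    (\<forall>v<n. dd K v \<le> dd ?Lij v + t) \<or> (0 \<le> t \<and> (\<forall>v<n. dd K v \<le> dd ?Lk v + (t - 0)))"
   by (rule right_cond_ik[OF n L ijk S[OF KS(1)] wsK[OF KS(1)] ws[OF KS(1) ikS] KS(2)])
  show "\<forall>v<n. dd ?Lik v \<le> dd K v + t ==>
    (\<forall>v<n. dd ?Ljk v \<le> dd K v + t) \<or> (1 \<le> t \<and> (\<forall>v<n. dd ?Li v \<le> dd K v + (t - 1)))"
   by (rule left_cond_ik[OF n L ijk S[OF KS(1)] wsK[OF KS(1)] ws[OF KS(1) ikS] KS(2)])
 qed
qed

end
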